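(* Let $\sigma>0$ and let $U$ be a (non-empty) compact, connected and $T_\bullet$-invariant subset of $U[\rho,\sigma]$ such that the dynamical system $(T_\bullet,U)$ is chain recurrent. Then for every proximate order $\rho(r)\to\rho$ there exists $u\in SH(\rho(r))$ such that $$\mathbf{Fr}[u,\rho(r),V_\bullet,\mathbb R^m]=U.$$
   Context: Fix $m\ge 2$ and $0<\rho<\infty$. A proximate order (with respect to $\rho$) is a function $\rho(r)\ge 0$ on $(0,\infty)$ with continuous derivative such that $\rho(r)\to\rho$ and $r\log r\,\rho'(r)\to 0$ as $r\to\infty$. Let $\{V_t:t>0\}$ be a one-parameter group of rotations of $\mathbb R^m$, continuous in $t$ ($V_{t_1}V_{t_2}=V_{t_1t_2}$, $V_1=I$), and $P_t:=tV_t$. $U[\rho,\sigma]$ is the set of functions $v$ subharmonic in $\mathbb R^m$ with $v(0)=0$ and $\max_{|x|=r}v(x)\le\sigma r^\rho$ for all $r\ge0$, with the (metrizable) topology of $\mathcal D'(\mathbb R^m)$; $(T_tv)(x):=e^{-\rho t}v(P_{e^t}x)$, $t\in\mathbb R$. $U$ is $T_\bullet$-invariant if $T_tU=U$ for all $t$. Let $d$ be any metric on $U$ inducing the $\mathcal D'$-topology. $(T_\bullet,U)$ is chain recurrent if for every $w\in U$, every $\varepsilon>0$ and $s>0$ there is a finite sequence $w_0=w,w_1,\dots,w_n=w$ in $U$ ($n\ge1$) such that for each $j<n$ there is $t_j\ge s$ with $d(T_{t_j}w_j,w_{j+1})<\varepsilon$. $SH(\rho(r))$ is the set of subharmonic functions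 $u\not\equiv-\infty$ in $\mathbb R^m$ with $\limsup_{r\to\infty}r^{-\rho(r)}\max_{|x|=r}u(x)<\infty$. $\mathbf{Fr}[u,\rho(r),V_\bullet,\mathbb R^m]$ is the set of all subharmonic $v$ such that $u_{t_k}\to v$ in $\mathcal D'(\mathbb R^m)$ for some $t_k\to\infty$, where $u_t(x):=t^{-\rho(t)}u(P_tx)$. *)

theory Defs
  imports "HOL-Analysis.Analysis"
begin

section \<open>Subharmonic functions\<close>

text \<open>Lebesgue integral of an extended-real function over a ball, as the integral of the positive
  part minus that of the negative part (\<^term>\<open>e2ennreal\<close> truncates negative values to 0).  For an upper
  semicontinuous function without the value \<open>\<infinity>\<close> the first part is finite, so the difference is
  well defined and lies in \<open>[-\<infinity>,\<infinity>)\<close>.\<close>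

definition ball_mean :: "(real^'m \<Rightarrow> ereal) \<Rightarrow> real^'m \<Rightarrow> real \<Rightarrow> ereal" where
  "ball_mean u x r =
     (enn2ereal (\<integral>\<^sup>+ y \<in> ball x r. e2ennreal (u y) \<partial>lborel)
        - enn2ereal (\<integral>\<^sup>+ y \<in> ball x r. e2ennreal (- u y) \<partial>lborel))
      / ereal (measure lborel (ball x r))"

text \<open>Upper semicontinuous functions with values in \<open>[-\<infinity>,\<infinity>)\<close> that satisfy the sub-mean-value inequality
  on all balls.  The constant \<open>-\<infinity>\<close> is not excluded here.\<close>

definition subharmonic :: "(real^'m \<Rightarrow> ereal) \<Rightarrow> bool" where
  "subharmonic u \<longleftrightarrow>
     (\<forall>x. u x < \<infinity>) \<and>
     (\<forall>c. open {x. u x < c}) \<and>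
     (\<forall>x. \<forall>r>0. u x \<le> ball_mean u x r)"

definition sh_functions :: "(real^'m \<Rightarrow> ereal) set" where
  "sh_functions = {u. subharmonic u \<and> (\<exists>x. u x \<noteq> -\<infinity>)}"

text \<open>The supremum is attained for upper semicontinuous \<^term>\<open>u\<close>.\<close>

definition max_on_sphere :: "(real^'m \<Rightarrow> ereal) \<Rightarrow> real \<Rightarrow> ereal" where
  "max_on_sphere u r = (SUP x \<in> sphere 0 r. u x)"


section \<open>The topology of distributions\<close>

primrec continuously_differentiable :: "nat \<Rightarrow> (real^'m \<Rightarrow> real) \<Rightarrow> bool" where
  "continuously_differentiable 0 f \<longleftrightarrow> continuous_on UNIV f"
| "continuously_differentiable (Suc k) f \<longleftrightarrow>
     (\<forall>x. f differentiable (at x)) \<and>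
     (\<forall>h. continuously_differentiable k (\<lambda>x. frechet_derivative f (at x) h))"

definition test_functions :: "(real^'m \<Rightarrow> real) set" where
  "test_functions =
     {\<phi>. (\<forall>k. continuously_differentiable k \<phi>) \<and> compact (closure {x. \<phi> x \<noteq> 0})}"

text \<open>A subharmonic function \<open>v \<noteq> -\<infinity>\<close> is locally integrable and finite almost everywhere, so the
  junk value \<^term>\<open>real_of_ereal (-\<infinity>) = 0\<close> does not matter.\<close>

definition pairing :: "(real^'m \<Rightarrow> ereal) \<Rightarrow> (real^'m \<Rightarrow> real) \<Rightarrow> real" where
  "pairing v \<phi> = (LINT x|lborel. real_of_ereal (v x) * \<phi> x)"

text \<open>The topology induced by the (weak) topology of \<open>\<D>'\<close> on the subharmonic functions, i.e. the
  coarsest one that makes all pairings with test functions continuous.\<close>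

definition distr_topology :: "(real^'m \<Rightarrow> ereal) topology" where
  "distr_topology =
     pullback_topology sh_functions (\<lambda>v. \<lambda>\<phi>\<in>test_functions. pairing v \<phi>)
       (product_topology (\<lambda>\<phi>. euclideanreal) test_functions)"


section \<open>Proximate orders, rotations and scalings\<close>

definition proximate_order :: "real \<Rightarrow> (real \<Rightarrow> real) \<Rightarrow> bool" where
  "proximate_order \<rho> p \<longleftrightarrow>
     (\<forall>r>0. 0 \<le> p r) \<and>
     (p \<longlongrightarrow> \<rho>) at_top \<and>
     (\<exists>p'. (\<forall>r>0. (p has_real_derivative p' r) (at r)) \<and>
           continuous_on {0<..} p' \<and>
           ((\<lambda>r. r * ln r * p' r) \<longlongrightarrow> 0) at_top)"

text \<open>Only the values of \<^term>\<open>V\<close> at positive arguments are relevant.\<close>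

definition rotation_group :: "(real \<Rightarrow> real^'m^'m) \<Rightarrow> bool" where
  "rotation_group V \<longleftrightarrow>
     (\<forall>t>0. rotation_matrix (V t)) \<and>
     (\<forall>t1>0. \<forall>t2>0. V t1 ** V t2 = V (t1 * t2)) \<and>
     V 1 = mat 1 \<and>
     continuous_on {0<..} V"

definition P_map :: "(real \<Rightarrow> real^'m^'m) \<Rightarrow> real \<Rightarrow> real^'m \<Rightarrow> real^'m" where
  "P_map V t x = t *\<^sub>R (V t *v x)"


section \<open>The dynamical system and limit sets\<close>

definition U_class :: "real \<Rightarrow> real \<Rightarrow> (real^'m \<Rightarrow> ereal) set" where
  "U_class \<rho> \<sigma> =
     {v. subharmonic v \<and> v 0 = 0 \<and> (\<forall>r\<ge>0. max_on_sphere v r \<le> ereal (\<sigma> * r powr \<rho>))}"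

definition T_map ::
    "real \<Rightarrow> (real \<Rightarrow> real^'m^'m) \<Rightarrow> real \<Rightarrow> (real^'m \<Rightarrow> ereal) \<Rightarrow> real^'m \<Rightarrow> ereal" where
  "T_map \<rho> V t v = (\<lambda>x. ereal (exp (- \<rho> * t)) * v (P_map V (exp t) x))"

definition T_invariant :: "(real \<Rightarrow> 'a \<Rightarrow> 'a) \<Rightarrow> 'a set \<Rightarrow> bool" where
  "T_invariant T U \<longleftrightarrow> (\<forall>t. T t ` U = U)"

definition chain_recurrent ::
    "('a \<Rightarrow> 'a \<Rightarrow> real) \<Rightarrow> (real \<Rightarrow> 'a \<Rightarrow> 'a) \<Rightarrow> 'a set \<Rightarrow> bool" where
  "chain_recurrent d T U \<longleftrightarrow>
     (\<forall>w\<in>U. \<forall>\<epsilon>>0. \<forall>s>0. \<exists>n::nat. \<exists>c::nat \<Rightarrow> 'a.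
        n \<ge> 1 \<and> c 0 = w \<and> c n = w \<and> (\<forall>j\<le>n. c j \<in> U) \<and>
        (\<forall>j<n. \<exists>t\<ge>s. d (T t (c j)) (c (Suc j)) < \<epsilon>))"

definition SH :: "(real \<Rightarrow> real) \<Rightarrow> (real^'m \<Rightarrow> ereal) set" where
  "SH p = {u \<in> sh_functions.
     Limsup at_top (\<lambda>r. ereal (r powr (- p r)) * max_on_sphere u r) < \<infinity>}"

definition rescale ::
    "(real \<Rightarrow> real) \<Rightarrow> (real \<Rightarrow> real^'m^'m) \<Rightarrow> (real^'m \<Rightarrow> ereal) \<Rightarrow> real \<Rightarrow> real^'m \<Rightarrow> ereal" where
  "rescale p V u t = (\<lambda>x. ereal (t powr (- p t)) * u (P_map V t x))"

definition Fr ::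
    "(real^'m \<Rightarrow> ereal) \<Rightarrow> (real \<Rightarrow> real) \<Rightarrow> (real \<Rightarrow> real^'m^'m) \<Rightarrow> (real^'m \<Rightarrow> ereal) set" where
  "Fr u p V =
     {v \<in> sh_functions. \<exists>t :: nat \<Rightarrow> real.
        (\<forall>k. 0 < t k) \<and> filterlim t at_top sequentially \<and>
        limitin distr_topology (\<lambda>k. rescale p V u (t k)) v sequentially}"

end

theory Submission
  imports Defs
begin

text \<open>Chain recurrence and connectedness turn \<open>U\<close> into a chain transitive system, so there is a pseudo-orbit
  \<open>y\<^sub>0, y\<^sub>1, \<dots>\<close> in \<open>U\<close> with \<open>d (T\<^sub>1 y\<^sub>k) y\<^sub>k\<^sub>+\<^sub>1 \<rightarrow> 0\<close> that comes back near every orbit of \<open>U\<close>.  Let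
  \<open>H s = e\<^bsup>s p(e\<^sup>s)\<^esup>\<close>.  Each \<open>y\<^sub>k\<close> is smoothed by a kernel of relative radius \<open>\<mu>\<^sub>k \<rightarrow> 0\<close>, cut off to an annulus of bounded
  ratio, moved to the scale \<open>e\<^sup>k\<close> and multiplied by \<open>H k\<close>; \<open>u\<close> is the sum of these patches and a radial
  corrector.  The kernel is homogeneous, so its Laplacian in one variable is dual to a Laplacian in the
  other one, and smoothing preserves subharmonicity.  Consecutive patches nearly agree, since \<open>U\<close> is compact and
  \<open>H (k + 1) / H k \<rightarrow> e\<^sup>\<rho>\<close>; hence gluing them costs a negative Laplacian of size \<open>o(H k) / |x|\<^sup>2\<close> only, which a radial
  function of growth \<open>o(H (log |x|))\<close> compensates.  The rescalings of \<open>u\<close> by \<open>e\<^bsup>k + \<theta>\<^esup>\<close> are then asymptotic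
  to \<open>T\<^sub>\<theta> y\<^sub>k\<close>, whose cluster set is \<open>U\<close>.\<close>

section \<open>Lebesgue measure and similarities\<close>

text \<open>The obstacle is a conflict over the smoothing radius. The metric \<open>d\<close> sees
  only distributions, whereas gluing two patches multiplies their difference, and its gradient, by
  derivatives of a cutoff. Closeness in \<open>d\<close> controls this only after smoothing, with
  constants that blow up as the radius tends to 0. But the radius has to tend to 0, since the limit
  set must consist of the functions in \<open>U\<close> themselves and not of their averages. So the
  radius becomes a second coordinate of the pseudo-orbit: during stage n it moves from 1/(n+2) to
  1/(n+3), and the tolerance for the steps of that stage is chosen, by compactness, for radii
  bounded below by 1/(n+3). A stage is also prolonged until the growth of \<open>H\<close> over a
  unit step is accurate enough for the next tolerance. The corrector is built from cubes of the
  excess of ln |x| over a threshold: these are C2, have a Laplacian of at least 1/|x|^2 one unit of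
  ln |x| further out, and grow only like powers of ln |x|, which the exponential growth of
  \<open>H\<close> absorbs because \<rho> > 0.\<close>

lemma distr_lborel_translate: "distr lborel borel (\<lambda>x. c + x) = (lborel :: 'a::euclidean_space measure)"
  using lborel_affine[of 1 c] by (simp add: density_1)

lemma nn_integral_lborel_translate:
  fixes f :: "'a::euclidean_space \<Rightarrow> ennreal"
  assumes [measurable]: "f \<in> borel_measurable borel"
  shows "(\<integral>\<^sup>+x. f (x + c) \<partial>lborel) = (\<integral>\<^sup>+x. f x \<partial>lborel)"
proof -
  have "(\<integral>\<^sup>+x. f x \<partial>lborel) = (\<integral>\<^sup>+x. f x \<partial>distr lborel borel (\<lambda>x. c + x))"
    by (simp add: distr_lborel_translate)
  also have "\<dots> = (\<integral>\<^sup>+x. f (c + x) \<partial>lborel)" by (rule nn_integral_distr) auto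
  finally show ?thesis by (simp add: add.commute)
qed

lemma nn_integral_lborel_uminus:
  fixes f :: "'a::euclidean_space \<Rightarrow> ennreal"
  assumes [measurable]: "f \<in> borel_measurable borel"
  shows "(\<integral>\<^sup>+x. f (c - x) \<partial>lborel) = (\<integral>\<^sup>+x. f x \<partial>lborel)"
proof -
  have "lborel = distr lborel borel (\<lambda>x::'a. c + (-1) *\<^sub>R x)"
    using lborel_affine[of "-1" c] by (simp add: density_1)
  then have "(\<integral>\<^sup>+x. f x \<partial>lborel) = (\<integral>\<^sup>+x. f x \<partial>distr lborel borel (\<lambda>x::'a. c + (-1) *\<^sub>R x))"
    by simp
  also have "\<dots> = (\<integral>\<^sup>+x. f (c + (-1) *\<^sub>R x) \<partial>lborel)"
    by (rule nn_integral_distr) auto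
  finally show ?thesis by simp
qed

text \<open>A translation-invariant Borel measure is proportional to Lebesgue measure, by Fubini; the factor
  for the image measure under an isometry is found by measuring the unit ball.\<close>

lemma distr_lborel_orthogonal:
  fixes f :: "'a::euclidean_space \<Rightarrow> 'a"
  assumes f: "orthogonal_transformation f"
  shows "distr lborel borel f = lborel"
proof -
  let ?M = "distr lborel borel f"
  have lin: "linear f" and nf: "\<And>x. norm (f x) = norm x"
    using f by (auto simp: orthogonal_transformation_linear orthogonal_transformation_norm)
  have [measurable]: "f \<in> borel_measurable borel"
    by (intro borel_measurable_continuous_onI linear_continuous_on)
       (use lin linear_conv_bounded_linear in auto)
  have surj: "surj f" using f by (rule orthogonal_transformation_surj)
  define g where "g = inv f"
  have fg: "f (g x) = x" for x using surj unfolding g_def by (rule surj_f_inv_f)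
  have Minv: "(\<integral>\<^sup>+x. h (x + c) \<partial>?M) = (\<integral>\<^sup>+x. h x \<partial>?M)"
    if [measurable]: "h \<in> borel_measurable borel" for h and c :: 'a
  proof -
    have "(\<integral>\<^sup>+x. h (x + c) \<partial>?M) = (\<integral>\<^sup>+x. h (f x + c) \<partial>lborel)"
      by (rule nn_integral_distr) auto
    also have "\<dots> = (\<integral>\<^sup>+x. h (f (x + g c)) \<partial>lborel)"
      using lin by (simp add: linear_add fg)
    also have "\<dots> = (\<integral>\<^sup>+x. h (f x) \<partial>lborel)"
      by (rule nn_integral_lborel_translate[of "\<lambda>x. h (f x)"]) auto
    also have "\<dots> = (\<integral>\<^sup>+x. h x \<partial>?M)"
      by (rule nn_integral_distr[symmetric]) auto
    finally show ?thesis .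
  qed
  \<comment> \<open>Fubini requires a sigma-finite image measure. The preimage under
    \<open>f\<close> of a centred ball is the ball itself, so centred balls have finite
    measure.\<close>
  have sf: "sigma_finite_measure ?M"
  proof (rule sigma_finite_measure.intro, intro exI conjI)
    show "countable (range (\<lambda>n::nat. ball (0::'a) n))" by auto
    show "range (\<lambda>n::nat. ball 0 n) \<subseteq> sets ?M" by auto
    show "\<Union> (range (\<lambda>n::nat. ball (0::'a) n)) = space ?M"
      by (auto simp: reals_Archimedean2)
    show "\<forall>a\<in>range (\<lambda>n::nat. ball 0 n). emeasure ?M a \<noteq> \<infinity>"
    proof
      fix a :: "'a set" assume "a \<in> range (\<lambda>n::nat. ball 0 n)"
      then obtain n :: nat where a: "a = ball 0 n" by auto
      have "f -` ball 0 (real n) = ball 0 n" by (auto simp: nf)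
      then show "emeasure ?M a \<noteq> \<infinity>"
        unfolding a using emeasure_lborel_ball_finite[of 0 "real n"]
        by (subst emeasure_distr) (auto simp: less_top)
    qed
  qed
  interpret M: sigma_finite_measure ?M by (rule sf)
  interpret P: pair_sigma_finite ?M lborel ..
  \<comment> \<open>Both sides are the integral of \<open>?i A x * ?i B (y + x)\<close> over all
    pairs. Integrating in y first uses the translation invariance of Lebesgue measure; integrating
    in x first uses that of \<open>?M\<close> and then, after a second exchange, the reflection of
    y.\<close>
  have key: "emeasure ?M A * emeasure lborel B = emeasure ?M B * emeasure lborel A"
    if [measurable]: "A \<in> sets borel" "B \<in> sets borel" for A B
  proof -
    let ?i = "indicator :: 'a set \<Rightarrow> 'a \<Rightarrow> ennreal"
    have "emeasure ?M A * emeasure lborel B = (\<integral>\<^sup>+x. ?i A x * (\<integral>\<^sup>+y. ?i B y \<partial>lborel) \<partial>?M)"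
      by (simp add: nn_integral_multc)
    also have "\<dots> = (\<integral>\<^sup>+x. (\<integral>\<^sup>+y. ?i A x * ?i B (y + x) \<partial>lborel) \<partial>?M)"
    proof (rule nn_integral_cong)
      fix x :: 'a
      show "?i A x * (\<integral>\<^sup>+y. ?i B y \<partial>lborel) = (\<integral>\<^sup>+y. ?i A x * ?i B (y + x) \<partial>lborel)"
        using nn_integral_lborel_translate[of "?i B" x] by (simp add: nn_integral_cmult)
    qed
    also have "\<dots> = (\<integral>\<^sup>+y. (\<integral>\<^sup>+x. ?i A x * ?i B (y + x) \<partial>?M) \<partial>lborel)"
      by (rule P.Fubini'[symmetric]) measurable
    also have "\<dots> = (\<integral>\<^sup>+y. (\<integral>\<^sup>+x. ?i A (x - y) * ?i B x \<partial>?M) \<partial>lborel)"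
    proof (rule nn_integral_cong)
      fix y :: 'a
      show "(\<integral>\<^sup>+x. ?i A x * ?i B (y + x) \<partial>?M) = (\<integral>\<^sup>+x. ?i A (x - y) * ?i B x \<partial>?M)"
        using Minv[of "\<lambda>x. ?i A (x - y) * ?i B x" y] by (simp add: add.commute)
    qed
    also have "\<dots> = (\<integral>\<^sup>+x. (\<integral>\<^sup>+y. ?i A (x - y) * ?i B x \<partial>lborel) \<partial>?M)"
      by (rule P.Fubini') measurable
    also have "\<dots> = (\<integral>\<^sup>+x. (\<integral>\<^sup>+y. ?i A y \<partial>lborel) * ?i B x \<partial>?M)"
    proof (rule nn_integral_cong)
      fix x :: 'a
      show "(\<integral>\<^sup>+y. ?i A (x - y) * ?i B x \<partial>lborel) = (\<integral>\<^sup>+y. ?i A y \<partial>lborel) * ?i B x"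
        using nn_integral_lborel_uminus[of "?i A" x] by (simp add: nn_integral_multc)
    qed
    also have "\<dots> = emeasure ?M B * emeasure lborel A"
      by (simp add: nn_integral_multc mult.commute)
    finally show ?thesis .
  qed
  show ?thesis
  proof (rule measure_eqI)
    fix A assume "A \<in> sets ?M"
    then have A: "A \<in> sets borel" by simp
    let ?B = "ball 0 1 :: 'a set"
    have "f -` ?B = ?B" by (auto simp: nf)
    then have MB: "emeasure ?M ?B = emeasure lborel ?B" by (subst emeasure_distr) auto
    have "emeasure lborel ?B \<noteq> 0"
      using content_ball_pos[of 1 "0::'a"] by (auto simp: measure_def)
    moreover have "emeasure lborel ?B < \<infinity>" by (rule emeasure_lborel_ball_finite)
    ultimately show "emeasure ?M A = emeasure lborel A"
      using key[OF A, of ?B] MB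
      by (auto simp add: mult.commute[of "emeasure ?M A"] ennreal_mult_cancel_left)
  qed simp
qed

lemma integral_lborel_similarity:
  fixes f :: "'a::euclidean_space \<Rightarrow> real" and g :: "'a \<Rightarrow> 'a"
  assumes g: "orthogonal_transformation g" and c: "0 < c"
    and f [measurable]: "f \<in> borel_measurable borel"
  shows "(LINT x|lborel. f (c *\<^sub>R g x)) = (LINT x|lborel. f x) / c ^ DIM('a)"
    and "integrable lborel (\<lambda>x. f (c *\<^sub>R g x)) \<longleftrightarrow> integrable lborel f"
proof -
  have lin: "linear g" using g by (simp add: orthogonal_transformation_linear)
  have [measurable]: "g \<in> borel_measurable borel"
    by (intro borel_measurable_continuous_onI linear_continuous_on)
       (use lin linear_conv_bounded_linear in auto)
  have 1: "(LINT x|lborel. f (c *\<^sub>R g x)) = (LINT x|lborel. f (c *\<^sub>R x))"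
    using integral_distr[of g lborel borel "\<lambda>x. f (c *\<^sub>R x)"] by (simp add: distr_lborel_orthogonal[OF g])
  have 2: "integrable lborel (\<lambda>x. f (c *\<^sub>R g x)) \<longleftrightarrow> integrable lborel (\<lambda>x. f (c *\<^sub>R x))"
    using integrable_distr_eq[of g lborel borel "\<lambda>x. f (c *\<^sub>R x)"] by (simp add: distr_lborel_orthogonal[OF g])
  have l: "lborel = density (distr lborel borel (\<lambda>x::'a. c *\<^sub>R x)) (\<lambda>_. ennreal (c ^ DIM('a)))"
    using lborel_affine[of c "0::'a"] c by (simp add: ennreal_power)
  have "(LINT x|lborel. f x) = (LINT x|density (distr lborel borel (\<lambda>x::'a. c *\<^sub>R x)) (\<lambda>_. ennreal (c ^ DIM('a))). f x)"
    using l by simp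
  also have "\<dots> = c ^ DIM('a) * (LINT x|lborel. f (c *\<^sub>R x))"
    using c by (subst integral_real_density) (auto simp: integral_distr)
  finally show "(LINT x|lborel. f (c *\<^sub>R g x)) = (LINT x|lborel. f x) / c ^ DIM('a)"
    using c 1 by simp
  have "integrable lborel f \<longleftrightarrow> integrable (density (distr lborel borel (\<lambda>x::'a. c *\<^sub>R x)) (\<lambda>_. ennreal (c ^ DIM('a)))) f"
    using l by simp
  also have "\<dots> \<longleftrightarrow> integrable lborel (\<lambda>x. f (c *\<^sub>R x))"
    using c by (subst integrable_real_density) (auto simp: integrable_distr_eq)
  finally show "integrable lborel (\<lambda>x. f (c *\<^sub>R g x)) \<longleftrightarrow> integrable lborel f"
    using 2 by simp
qed

lemma integral_lborel_translate:
  fixes f :: "'a::euclidean_space \<Rightarrow> real"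
  assumes [measurable]: "f \<in> borel_measurable borel"
  shows "(LINT x|lborel. f (x + c)) = (LINT x|lborel. f x)"
    and "integrable lborel (\<lambda>x. f (x + c)) \<longleftrightarrow> integrable lborel f"
  using integral_distr[of "\<lambda>x. c + x" lborel borel f] integrable_distr_eq[of "\<lambda>x. c + x" lborel borel f]
  by (simp_all only: distr_lborel_translate) (auto simp: add.commute)

lemma integrable_bounded_on_cball:
  fixes f :: "'a::euclidean_space \<Rightarrow> real"
  assumes "f \<in> borel_measurable borel" and "\<And>x. x \<in> cball a R \<Longrightarrow> \<bar>f x\<bar> \<le> B"
    and "\<And>x. x \<notin> cball a R \<Longrightarrow> f x = 0"
  shows "integrable lborel f"
proof -
  have "integrable lborel (\<lambda>x. indicator (cball a R) x *\<^sub>R f x)"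
    by (rule integrableI_bounded_set_indicator[where B = B])
       (use assms emeasure_bounded_finite[of "cball a R"] in auto)
  moreover have "(\<lambda>x. indicator (cball a R) x *\<^sub>R f x) = f"
    using assms(3) by (force simp: indicator_def)
  ultimately show ?thesis by simp
qed

section \<open>The Laplacian of twice differentiable functions\<close>

text \<open>\<open>l\<close> is the trace of the Hessian \<open>G\<close>. Computations involve only
  the gradient and the Laplacian, so the Hessian stays existentially quantified, while
  \<open>D\<close> is kept explicit because the Leibniz and chain rules for Laplacians contain
  it.\<close>

definition C2_on ::
    "'a::euclidean_space set \<Rightarrow> ('a \<Rightarrow> real) \<Rightarrow> ('a \<Rightarrow> 'a) \<Rightarrow> ('a \<Rightarrow> real) \<Rightarrow> bool" where
  "C2_on S f D l \<longleftrightarrow> open S \<and> (\<forall>x\<in>S. (f has_derivative (\<lambda>h. D x \<bullet> h)) (at x)) \<and>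
     (\<exists>G. (\<forall>x\<in>S. (D has_derivative G x) (at x)) \<and> (\<forall>h. continuous_on S (\<lambda>x. G x h)) \<and>
          (\<forall>x\<in>S. (\<Sum>i\<in>Basis. G x i \<bullet> i) = l x))"

lemma C2_on_imp:
  assumes "C2_on S f D l"
  shows "continuous_on S f" "continuous_on S D" "continuous_on S l"
proof -
  obtain G where G: "\<And>x. x \<in> S \<Longrightarrow> (D has_derivative G x) (at x)" "\<And>h. continuous_on S (\<lambda>x. G x h)"
    "\<And>x. x \<in> S \<Longrightarrow> (\<Sum>i\<in>Basis. G x i \<bullet> i) = l x"
    and f: "\<And>x. x \<in> S \<Longrightarrow> (f has_derivative (\<lambda>h. D x \<bullet> h)) (at x)"
    using assms unfolding C2_on_def by blast
  show "continuous_on S f" using f has_derivative_continuous continuous_at_imp_continuous_on by blast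
  show "continuous_on S D" using G(1) has_derivative_continuous continuous_at_imp_continuous_on by blast
  have "continuous_on S (\<lambda>x. \<Sum>i\<in>Basis. G x i \<bullet> i)" by (intro continuous_intros G(2))
  then show "continuous_on S l" using G(3) by (simp cong: continuous_on_cong)
qed

text \<open>Uniqueness of derivatives makes the two Hessians agree on the overlap, so the pasted one
  is continuous on each of the two open sets.\<close>

lemma C2_on_Un: "C2_on (S \<union> T) f D l" if S: "C2_on S f D l" and T: "C2_on T f D l"
proof -
  obtain G where G: "\<And>x. x \<in> S \<Longrightarrow> (D has_derivative G x) (at x)" "\<And>h. continuous_on S (\<lambda>x. G x h)"
    "\<And>x. x \<in> S \<Longrightarrow> (\<Sum>i\<in>Basis. G x i \<bullet> i) = l x"
    and f: "\<And>x. x \<in> S \<Longrightarrow> (f has_derivative (\<lambda>h. D x \<bullet> h)) (at x)" and oS: "open S"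
    using S unfolding C2_on_def by blast
  obtain G' where G': "\<And>x. x \<in> T \<Longrightarrow> (D has_derivative G' x) (at x)" "\<And>h. continuous_on T (\<lambda>x. G' x h)"
    "\<And>x. x \<in> T \<Longrightarrow> (\<Sum>i\<in>Basis. G' x i \<bullet> i) = l x"
    and f': "\<And>x. x \<in> T \<Longrightarrow> (f has_derivative (\<lambda>h. D x \<bullet> h)) (at x)" and oT: "open T"
    using T unfolding C2_on_def by blast
  define H where "H x = (if x \<in> S then G x else G' x)" for x
  have HT: "H x = G' x" if "x \<in> T" for x
    using G(1) G'(1) that has_derivative_unique unfolding H_def by metis
  have "continuous_on S (\<lambda>x. H x h)" for h using G(2)[of h] by (simp add: H_def cong: continuous_on_cong)
  moreover have "continuous_on T (\<lambda>x. H x h)" for h using G'(2)[of h] by (simp add: HT cong: continuous_on_cong)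
  ultimately have "continuous_on (S \<union> T) (\<lambda>x. H x h)" for h using oS oT by (intro continuous_on_open_Un)
  then show ?thesis unfolding C2_on_def
    using oS oT f f' G(1,3) G'(1,3) HT by (intro conjI open_Un exI[of _ H]) (auto simp: H_def)
qed

lemma C2_on_cong:
  assumes "C2_on S f D l" "\<And>x. x \<in> S \<Longrightarrow> f x = f' x" "\<And>x. x \<in> S \<Longrightarrow> D x = D' x" "\<And>x. x \<in> S \<Longrightarrow> l x = l' x"
  shows "C2_on S f' D' l'"
proof -
  obtain G where G: "\<And>x. x \<in> S \<Longrightarrow> (D has_derivative G x) (at x)" "\<And>h. continuous_on S (\<lambda>x. G x h)"
    "\<And>x. x \<in> S \<Longrightarrow> (\<Sum>i\<in>Basis. G x i \<bullet> i) = l x"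
    and f: "\<And>x. x \<in> S \<Longrightarrow> (f has_derivative (\<lambda>h. D x \<bullet> h)) (at x)" and oS: "open S"
    using assms(1) unfolding C2_on_def by blast
  have "(f' has_derivative (\<lambda>h. D' x \<bullet> h)) (at x)" if "x \<in> S" for x
    using has_derivative_transform_within_open[OF f[OF that] oS that] assms(2,3) that by auto
  moreover have "(D' has_derivative G x) (at x)" if "x \<in> S" for x
    using has_derivative_transform_within_open[OF G(1)[OF that] oS that] assms(3) by auto
  ultimately show ?thesis using oS G assms(4) unfolding C2_on_def
    by (intro conjI exI[of _ G]) auto
qed

lemma C2_on_const: "open S \<Longrightarrow> C2_on S (\<lambda>x. c) (\<lambda>x. 0) (\<lambda>x. 0)"
  unfolding C2_on_def by (auto intro!: exI[of _ "\<lambda>x h. 0"] simp: inner_zero_left[abs_def])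

lemma C2_on_dist_sq:
  fixes z :: "'a::euclidean_space"
  shows "open S \<Longrightarrow> C2_on S (\<lambda>x. (norm (x - z))\<^sup>2) (\<lambda>x. 2 *\<^sub>R (x - z)) (\<lambda>x. 2 * real DIM('a))"
  unfolding C2_on_def power2_norm_eq_inner
  by (auto intro!: exI[of _ "\<lambda>x h. 2 *\<^sub>R h"] derivative_eq_intros simp: algebra_simps inner_commute inner_Basis)

lemma C2_on_add:
  assumes "C2_on S f Df lf" "C2_on S g Dg lg"
  shows "C2_on S (\<lambda>x. f x + g x) (\<lambda>x. Df x + Dg x) (\<lambda>x. lf x + lg x)"
proof -
  obtain F where F: "\<And>x. x \<in> S \<Longrightarrow> (Df has_derivative F x) (at x)" "\<And>h. continuous_on S (\<lambda>x. F x h)"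
    "\<And>x. x \<in> S \<Longrightarrow> (\<Sum>i\<in>Basis. F x i \<bullet> i) = lf x"
    and f: "\<And>x. x \<in> S \<Longrightarrow> (f has_derivative (\<lambda>h. Df x \<bullet> h)) (at x)" and oS: "open S"
    using assms(1) unfolding C2_on_def by blast
  obtain G where G: "\<And>x. x \<in> S \<Longrightarrow> (Dg has_derivative G x) (at x)" "\<And>h. continuous_on S (\<lambda>x. G x h)"
    "\<And>x. x \<in> S \<Longrightarrow> (\<Sum>i\<in>Basis. G x i \<bullet> i) = lg x"
    and g: "\<And>x. x \<in> S \<Longrightarrow> (g has_derivative (\<lambda>h. Dg x \<bullet> h)) (at x)"
    using assms(2) unfolding C2_on_def by blast
  show ?thesis unfolding C2_on_def
    using oS F(3) G(3)
    by (intro conjI ballI allI exI[of _ "\<lambda>x h. F x h + G x h"] has_derivative_add F G continuous_intros)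
       (auto intro!: derivative_eq_intros f g simp: inner_add_left sum.distrib)
qed

lemma C2_on_mult:
  assumes "C2_on S f Df lf" "C2_on S g Dg lg"
  shows "C2_on S (\<lambda>x. f x * g x) (\<lambda>x. f x *\<^sub>R Dg x + g x *\<^sub>R Df x)
           (\<lambda>x. f x * lg x + g x * lf x + 2 * (Df x \<bullet> Dg x))"
proof -
  obtain F where F: "\<And>x. x \<in> S \<Longrightarrow> (Df has_derivative F x) (at x)" "\<And>h. continuous_on S (\<lambda>x. F x h)"
    "\<And>x. x \<in> S \<Longrightarrow> (\<Sum>i\<in>Basis. F x i \<bullet> i) = lf x"
    and f: "\<And>x. x \<in> S \<Longrightarrow> (f has_derivative (\<lambda>h. Df x \<bullet> h)) (at x)" and oS: "open S"
    using assms(1) unfolding C2_on_def by blast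
  obtain G where G: "\<And>x. x \<in> S \<Longrightarrow> (Dg has_derivative G x) (at x)" "\<And>h. continuous_on S (\<lambda>x. G x h)"
    "\<And>x. x \<in> S \<Longrightarrow> (\<Sum>i\<in>Basis. G x i \<bullet> i) = lg x"
    and g: "\<And>x. x \<in> S \<Longrightarrow> (g has_derivative (\<lambda>h. Dg x \<bullet> h)) (at x)"
    using assms(2) unfolding C2_on_def by blast
  let ?H = "\<lambda>x h. (f x *\<^sub>R G x h + (Df x \<bullet> h) *\<^sub>R Dg x) + (g x *\<^sub>R F x h + (Dg x \<bullet> h) *\<^sub>R Df x)"
  have "(\<Sum>i\<in>Basis. ?H x i \<bullet> i) = f x * lg x + g x * lf x + 2 * (Df x \<bullet> Dg x)" if "x \<in> S" for x
  proof -
    have "(\<Sum>i\<in>Basis. ?H x i \<bullet> i) = f x * (\<Sum>i\<in>Basis. G x i \<bullet> i) + g x * (\<Sum>i\<in>Basis. F x i \<bullet> i)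
        + 2 * (\<Sum>i\<in>Basis. (Df x \<bullet> i) * (Dg x \<bullet> i))"
      by (simp add: inner_add_left sum.distrib sum_distrib_left algebra_simps)
    then show ?thesis using F(3) G(3) that by (simp add: euclidean_inner[of "Df x" "Dg x"])
  qed
  then show ?thesis unfolding C2_on_def
    using oS C2_on_imp[OF assms(1)] C2_on_imp[OF assms(2)]
    by (intro conjI ballI allI exI[of _ ?H] continuous_intros F G)
       (auto intro!: derivative_eq_intros f g F(1) G(1) simp: algebra_simps)
qed

lemma C2_on_compose:
  assumes "C2_on S f D l"
    and h: "\<And>x. x \<in> S \<Longrightarrow> (h has_real_derivative h' (f x)) (at (f x))"
    and h': "\<And>x. x \<in> S \<Longrightarrow> (h' has_real_derivative h'' (f x)) (at (f x))"
    and h'': "continuous_on (f ` S) h''"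
  shows "C2_on S (\<lambda>x. h (f x)) (\<lambda>x. h' (f x) *\<^sub>R D x)
           (\<lambda>x. h' (f x) * l x + h'' (f x) * (D x \<bullet> D x))"
proof -
  obtain G where G: "\<And>x. x \<in> S \<Longrightarrow> (D has_derivative G x) (at x)" "\<And>h. continuous_on S (\<lambda>x. G x h)"
    "\<And>x. x \<in> S \<Longrightarrow> (\<Sum>i\<in>Basis. G x i \<bullet> i) = l x"
    and f: "\<And>x. x \<in> S \<Longrightarrow> (f has_derivative (\<lambda>h. D x \<bullet> h)) (at x)" and oS: "open S"
    using assms(1) unfolding C2_on_def by blast
  have hf: "((\<lambda>x. h (f x)) has_derivative (\<lambda>k. (h' (f x) *\<^sub>R D x) \<bullet> k)) (at x)" if "x \<in> S" for x
    using has_derivative_compose[OF f[OF that], of h "\<lambda>k. h' (f x) * k"] h[OF that]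
    by (simp add: has_field_derivative_def)
  have hf': "((\<lambda>x. h' (f x)) has_derivative (\<lambda>k. h'' (f x) * (D x \<bullet> k))) (at x)" if "x \<in> S" for x
    using has_derivative_compose[OF f[OF that], of h' "\<lambda>k. h'' (f x) * k"] h'[OF that]
    by (simp add: has_field_derivative_def)
  let ?H = "\<lambda>x k. h' (f x) *\<^sub>R G x k + (h'' (f x) * (D x \<bullet> k)) *\<^sub>R D x"
  have tr: "(\<Sum>i\<in>Basis. ?H x i \<bullet> i) = h' (f x) * l x + h'' (f x) * (D x \<bullet> D x)" if "x \<in> S" for x
  proof -
    have "(\<Sum>i\<in>Basis. ?H x i \<bullet> i) = h' (f x) * (\<Sum>i\<in>Basis. G x i \<bullet> i)
        + h'' (f x) * (\<Sum>i\<in>Basis. (D x \<bullet> i) * (D x \<bullet> i))"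
      by (simp add: inner_add_left sum.distrib sum_distrib_left algebra_simps)
    then show ?thesis using G(3) that by (simp add: euclidean_inner[of "D x" "D x"])
  qed
  have cf: "continuous_on S f" "continuous_on S D" using C2_on_imp[OF assms(1)] by auto
  have c1: "continuous_on S (\<lambda>x. h' (f x))"
    using hf' has_derivative_continuous continuous_at_imp_continuous_on by blast
  have c2: "continuous_on S (\<lambda>x. h'' (f x))"
    by (rule continuous_on_compose2[OF h'' cf(1)]) auto
  show ?thesis unfolding C2_on_def
    using oS tr cf c1 c2
    by (intro conjI ballI allI exI[of _ ?H] continuous_intros G hf)
       (auto intro!: derivative_eq_intros hf' G(1) simp: algebra_simps)
qed

section \<open>The mean value identity\<close>

text \<open>Each difference quotient has integral 0 by translation invariance, and the Lipschitz
  bound together with the bounded support dominates them. The derivative is required almost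
  everywhere only, because the weight to which this is applied has a corner along the unit
  sphere.\<close>

lemma integral_difference_quotient_limit_eq_0:
  fixes F :: "'a::euclidean_space \<Rightarrow> real"
  assumes F [measurable]: "F \<in> borel_measurable borel" and F' [measurable]: "F' \<in> borel_measurable borel"
    and int: "integrable lborel F"
    and supp: "\<And>y. y \<notin> cball 0 R \<Longrightarrow> F y = 0"
    and i: "norm i = 1"
    and Lip: "\<And>y h. 0 < h \<Longrightarrow> h \<le> 1 \<Longrightarrow> \<bar>F (y + h *\<^sub>R i) - F y\<bar> \<le> L * h"
    and lim: "AE y in lborel. ((\<lambda>t. F (y + t *\<^sub>R i)) has_real_derivative F' y) (at 0)"
  shows "integral\<^sup>L lborel F' = 0"
proof -
  define h where "h n = 1 / real (Suc n)" for n
  have h: "0 < h n" "h n \<le> 1" for n by (auto simp: h_def field_simps)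
  have h0: "h \<longlonglongrightarrow> 0" unfolding h_def
    using LIMSEQ_inverse_real_of_nat by (simp add: inverse_eq_divide)
  define s where "s n y = (F (y + h n *\<^sub>R i) - F y) / h n" for n y
  have ms [measurable]: "s n \<in> borel_measurable borel" for n unfolding s_def by measurable
  have int0: "integral\<^sup>L lborel (s n) = 0" for n
    using integral_lborel_translate[OF F, of "h n *\<^sub>R i"] int unfolding s_def by simp
  have "(\<lambda>n. integral\<^sup>L lborel (s n)) \<longlonglongrightarrow> integral\<^sup>L lborel F'"
  proof (rule integral_dominated_convergence)
    show "integrable lborel (\<lambda>y. L * indicator (cball 0 (R + 1)) y :: real)"
      by (rule integrable_bounded_on_cball[of _ 0 "R + 1" "\<bar>L\<bar>"]) (auto simp: indicator_def)
    show "AE y in lborel. (\<lambda>n. s n y) \<longlonglongrightarrow> F' y"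
      using lim
    proof eventually_elim
      fix y assume "((\<lambda>t. F (y + t *\<^sub>R i)) has_real_derivative F' y) (at 0)"
      then have "((\<lambda>t. (F (y + t *\<^sub>R i) - F y) / t) \<longlongrightarrow> F' y) (at 0)"
        by (simp add: has_field_derivative_iff)
      moreover have "filterlim h (at 0) sequentially"
        using h0 h(1) by (simp add: filterlim_at less_imp_neq[symmetric] order_less_imp_not_eq2)
      ultimately show "(\<lambda>n. s n y) \<longlonglongrightarrow> F' y"
        unfolding s_def by (rule filterlim_compose)
    qed
    show "AE y in lborel. norm (s n y) \<le> L * indicator (cball 0 (R + 1)) y" for n
    proof (rule AE_I2)
      fix y :: 'a
      show "norm (s n y) \<le> L * indicator (cball 0 (R + 1)) y"
      proof (cases "y \<in> cball 0 (R + 1)")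
        case True
        then show ?thesis using Lip[of "h n" y] h[of n] by (simp add: s_def field_simps)
      next
        case False
        then have "norm y > R + 1" by simp
        moreover have "norm y \<le> norm (y + h n *\<^sub>R i) + h n"
          using norm_triangle_ineq4[of "y + h n *\<^sub>R i" "h n *\<^sub>R i"] i h[of n] by simp
        ultimately have "norm (y + h n *\<^sub>R i) > R" "norm y > R" using h(2)[of n] by auto
        then show ?thesis using False by (simp add: s_def supp)
      qed
    qed
  qed auto
  then show ?thesis by (simp add: int0 LIMSEQ_const_iff)
qed

lemma AE_norm_neq: "AE y in (lborel :: 'a::euclidean_space measure). norm y \<noteq> r"
proof -
  have "sphere (0::'a) r \<in> null_sets lborel"
    using negligible_sphere[of "0::'a" r] closed_sphere[of "0::'a" r]
    by (simp add: negligible_iff_null_sets null_sets_completion_iff)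
  then show ?thesis
    by (intro AE_I'[of "sphere 0 r"]) auto
qed

text \<open>Integration by parts against the weight \<open>max 0 (1 - |y|\<^sup>2)\<close>, whose gradient is \<open>-2y\<close> in the unit
  ball.\<close>

lemma C2_ball_parts:
  fixes f :: "'a::euclidean_space \<Rightarrow> real"
  assumes "C2_on UNIV f D l"
  shows "(LINT y|lborel. indicator (ball 0 1) y * (D (x + r *\<^sub>R y) \<bullet> y)) =
         (LINT y|lborel. indicator (ball 0 1) y * (r * (1 - (norm y)\<^sup>2) / 2 * l (x + r *\<^sub>R y)))"
proof -
  obtain G where G: "\<And>x. (D has_derivative G x) (at x)" "\<And>h. continuous_on UNIV (\<lambda>x. G x h)"
    "\<And>x. (\<Sum>i\<in>Basis. G x i \<bullet> i) = l x"
    using assms unfolding C2_on_def by blast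
  have cD: "continuous_on UNIV D" and cl: "continuous_on UNIV l" using C2_on_imp[OF assms] by auto
  have cD': "continuous_on S (\<lambda>y. D (x + r *\<^sub>R y))" for S
    by (rule continuous_on_compose2[OF cD]) (auto intro!: continuous_intros)
  have cG': "continuous_on S (\<lambda>y. G (x + r *\<^sub>R y) h)" for S h
    by (rule continuous_on_compose2[OF G(2)]) (auto intro!: continuous_intros)
  have cl': "continuous_on S (\<lambda>y. l (x + r *\<^sub>R y))" for S
    by (rule continuous_on_compose2[OF cl]) (auto intro!: continuous_intros)
  have [measurable]: "(\<lambda>y. D (x + r *\<^sub>R y)) \<in> borel_measurable borel"
    "(\<lambda>y. G (x + r *\<^sub>R y) h) \<in> borel_measurable borel"
    "(\<lambda>y. l (x + r *\<^sub>R y)) \<in> borel_measurable borel" for h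
    by (intro borel_measurable_continuous_onI cD' cG' cl')+
  define w :: "'a \<Rightarrow> real" where "w y = max 0 (1 - (norm y)\<^sup>2)" for y
  have wB: "w y = indicator (ball 0 1) y * (1 - (norm y)\<^sup>2)" for y
  proof (cases "norm y < 1")
    case True
    then have "(norm y)\<^sup>2 \<le> 1" by (intro power_le_one) auto
    with True show ?thesis by (simp add: w_def)
  next
    case False
    then have "(norm y)\<^sup>2 \<ge> 1" by (intro one_le_power) auto
    with False show ?thesis by (simp add: w_def)
  qed
  define F where "F i y = (D (x + r *\<^sub>R y) \<bullet> i) * w y" for i y
  \<comment> \<open>\<open>F' i\<close> is the i-th partial derivative of \<open>F i\<close> off the
    unit sphere; the indicator carries the derivative of the weight.\<close>
  define F' where "F' i y = r * (G (x + r *\<^sub>R y) i \<bullet> i) * w y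
      + (D (x + r *\<^sub>R y) \<bullet> i) * (indicator (ball 0 1) y * (-2 * (y \<bullet> i)))" for i y
  have bd: "\<exists>M. \<forall>y\<in>cball 0 3. \<bar>h y\<bar> \<le> M" if "continuous_on (cball 0 3) h" for h :: "'a \<Rightarrow> real"
  proof -
    have "compact (h ` cball 0 3)" by (rule compact_continuous_image[OF that]) simp
    then obtain M where "\<forall>z\<in>h ` cball 0 3. norm z \<le> M" by (meson bounded_iff compact_imp_bounded)
    then show ?thesis by auto
  qed
  have mw [measurable]: "w \<in> borel_measurable borel" unfolding w_def by measurable
  have mF [measurable]: "F i \<in> borel_measurable borel" "F' i \<in> borel_measurable borel" for i
    unfolding F_def[abs_def] F'_def[abs_def]
    by (measurable, auto intro!: borel_measurable_continuous_onI continuous_intros)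
  have w01: "0 \<le> w y" "w y \<le> 1" for y by (auto simp: w_def)
  have w0: "w y = 0" if "1 \<le> norm y" for y using that by (simp add: wB)
  have intF': "integrable lborel (F' i)" and intF: "integrable lborel (F i)" and zero: "integral\<^sup>L lborel (F' i) = 0"
    if i: "i \<in> Basis" for i
  proof -
    obtain M1 where M1: "\<And>y. y \<in> cball 0 3 \<Longrightarrow> \<bar>D (x + r *\<^sub>R y) \<bullet> i\<bar> \<le> M1"
      using bd[OF continuous_on_inner[OF cD' continuous_on_const]] by blast
    obtain M2 where M2: "\<And>y. y \<in> cball 0 3 \<Longrightarrow> \<bar>G (x + r *\<^sub>R y) i \<bullet> i\<bar> \<le> M2"
      using bd[OF continuous_on_inner[OF cG' continuous_on_const]] by blast
    have M0: "0 \<le> M1" "0 \<le> M2" using M1[of 0] M2[of 0] by auto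
    show iF: "integrable lborel (F i)"
    proof (rule integrable_bounded_on_cball[where a = 0 and R = 3 and B = "M1 * 1"])
      show "\<bar>F i y\<bar> \<le> M1 * 1" if "y \<in> cball 0 3" for y
        unfolding F_def abs_mult using M1[OF that] w01[of y] M0 by (intro mult_mono) auto
    qed (auto simp: F_def w0)
    show "integrable lborel (F' i)"
    proof (rule integrable_bounded_on_cball[where a = 0 and R = 1 and B = "\<bar>r\<bar> * M2 * 1 + M1 * 2"])
      fix y :: 'a assume y: "y \<in> cball 0 1"
      have "\<bar>y \<bullet> i\<bar> \<le> 1" using Basis_le_norm[OF i, of y] y by simp
      then have 2: "\<bar>indicator (ball 0 1) y * (-2 * (y \<bullet> i))\<bar> \<le> 2" by (auto simp: indicator_def abs_mult)
      have y3: "y \<in> cball 0 3" using y by simp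
      have "\<bar>r * (G (x + r *\<^sub>R y) i \<bullet> i) * w y\<bar> \<le> \<bar>r\<bar> * M2 * 1"
        unfolding abs_mult using M2[OF y3] w01[of y] M0 by (intro mult_mono) auto
      moreover have "\<bar>(D (x + r *\<^sub>R y) \<bullet> i) * (indicator (ball 0 1) y * (-2 * (y \<bullet> i)))\<bar> \<le> M1 * 2"
        unfolding abs_mult[of "D (x + r *\<^sub>R y) \<bullet> i"] using M1[OF y3] 2 M0 by (intro mult_mono) auto
      ultimately show "\<bar>F' i y\<bar> \<le> \<bar>r\<bar> * M2 * 1 + M1 * 2"
        unfolding F'_def by linarith
    qed (auto simp: F'_def wB not_le)
    have GL: "G z (c *\<^sub>R i) = c *\<^sub>R G z i" for z c
      using has_derivative_linear[OF G(1)] by (simp add: linear_cmul)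
    have Dlip: "\<bar>D (x + r *\<^sub>R (y + h *\<^sub>R i)) \<bullet> i - D (x + r *\<^sub>R y) \<bullet> i\<bar> \<le> \<bar>r\<bar> * M2 * h"
      if y: "norm y \<le> 2" and h: "0 < h" "h \<le> 1" for y h
    proof -
      let ?g = "\<lambda>t. D (x + r *\<^sub>R (y + t *\<^sub>R i)) \<bullet> i"
      have der: "(?g has_real_derivative r * (G (x + r *\<^sub>R (y + t *\<^sub>R i)) i \<bullet> i)) (at t)" for t
      proof -
        have "((\<lambda>t. D (x + r *\<^sub>R (y + t *\<^sub>R i))) has_derivative (\<lambda>s. G (x + r *\<^sub>R (y + t *\<^sub>R i)) ((r * s) *\<^sub>R i))) (at t)"
          by (rule has_derivative_compose[OF _ G(1)]) (auto intro!: derivative_eq_intros)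
        then have "(?g has_derivative (\<lambda>s. G (x + r *\<^sub>R (y + t *\<^sub>R i)) ((r * s) *\<^sub>R i) \<bullet> i)) (at t)"
          by (auto intro!: derivative_eq_intros)
        then show ?thesis unfolding has_field_derivative_def
          by (rule has_derivative_eq_rhs) (simp add: GL fun_eq_iff)
      qed
      obtain z where z: "0 < z" "z < h" "?g h - ?g 0 = (h - 0) * (r * (G (x + r *\<^sub>R (y + z *\<^sub>R i)) i \<bullet> i))"
        using MVT2[of 0 h ?g "\<lambda>t. r * (G (x + r *\<^sub>R (y + t *\<^sub>R i)) i \<bullet> i)"] der h by blast
      have "norm (y + z *\<^sub>R i) \<le> 3" using norm_triangle_ineq[of y "z *\<^sub>R i"] y z h i by simp
      then have "\<bar>G (x + r *\<^sub>R (y + z *\<^sub>R i)) i \<bullet> i\<bar> \<le> M2" by (intro M2) simp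
      then have "\<bar>?g h - ?g 0\<bar> \<le> h * (\<bar>r\<bar> * M2)"
        using z h by (simp add: abs_mult mult_left_mono)
      then show ?thesis by (simp add: mult_ac)
    qed
    \<comment> \<open>For \<open>norm y > 2\<close> neither y nor its translate by
      \<open>h \<le> 1\<close> meets the open unit ball, so \<open>F i\<close> vanishes at both.
      Otherwise both points stay in \<open>cball 0 3\<close>, where the bounds \<open>M1\<close> and
      \<open>M2\<close> hold.\<close>
    have Lip: "\<bar>F i (y + h *\<^sub>R i) - F i y\<bar> \<le> (\<bar>r\<bar> * M2 + 5 * M1) * h" if h: "0 < h" "h \<le> 1" for y h
    proof (cases "norm y \<le> 2")
      case True
      let ?y = "y + h *\<^sub>R i"
      have n: "norm ?y \<le> 3" using norm_triangle_ineq[of y "h *\<^sub>R i"] True h i by simp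
      have "(norm ?y)\<^sup>2 - (norm y)\<^sup>2 = 2 * h * (y \<bullet> i) + h\<^sup>2"
        unfolding power2_norm_eq_inner using i by (simp add: algebra_simps inner_commute power2_eq_square inner_Basis)
      moreover have "\<bar>y \<bullet> i\<bar> \<le> 2" using Basis_le_norm[OF i, of y] True by simp
      then have "\<bar>2 * h * (y \<bullet> i)\<bar> \<le> 4 * h" using h by (simp add: abs_mult)
      moreover have "h\<^sup>2 \<le> h" using h by (simp add: power2_eq_square mult_left_le)
      moreover have "0 \<le> h\<^sup>2" by simp
      ultimately have "\<bar>(norm ?y)\<^sup>2 - (norm y)\<^sup>2\<bar> \<le> 5 * h" by linarith
      then have wl: "\<bar>w ?y - w y\<bar> \<le> 5 * h" unfolding w_def by linarith
      have "F i ?y - F i y = (D (x + r *\<^sub>R ?y) \<bullet> i - D (x + r *\<^sub>R y) \<bullet> i) * w y + (D (x + r *\<^sub>R ?y) \<bullet> i) * (w ?y - w y)"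
        by (simp add: F_def algebra_simps)
      also have "\<bar>\<dots>\<bar> \<le> \<bar>(D (x + r *\<^sub>R ?y) \<bullet> i - D (x + r *\<^sub>R y) \<bullet> i) * w y\<bar> + \<bar>(D (x + r *\<^sub>R ?y) \<bullet> i) * (w ?y - w y)\<bar>"
        by (rule abs_triangle_ineq)
      also have "\<dots> \<le> \<bar>r\<bar> * M2 * h * 1 + M1 * (5 * h)"
        unfolding abs_mult using Dlip[OF True h] M1[of ?y] wl w01[of y] n M0 h
        by (intro add_mono mult_mono) (auto simp: mem_cball_0)
      finally show ?thesis by (simp add: algebra_simps)
    next
      case False
      have "norm y \<le> norm (y + h *\<^sub>R i) + h" using norm_triangle_ineq4[of "y + h *\<^sub>R i" "h *\<^sub>R i"] h i by simp
      then have "norm (y + h *\<^sub>R i) \<ge> 1" "norm y \<ge> 1" using False h by auto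
      then show ?thesis using M0 h by (simp add: F_def w0)
    qed
    show "integral\<^sup>L lborel (F' i) = 0"
    proof (rule integral_difference_quotient_limit_eq_0[where i = i and R = 1 and F = "F i"])
      show "AE y in lborel. ((\<lambda>t. F i (y + t *\<^sub>R i)) has_real_derivative F' i y) (at 0)"
        using AE_norm_neq[of 1]
      proof eventually_elim
        fix y :: 'a assume y1: "norm y \<noteq> 1"
        have dw: "((\<lambda>t. w (y + t *\<^sub>R i)) has_real_derivative indicator (ball 0 1) y * (-2 * (y \<bullet> i))) (at 0)"
        proof (cases "norm y < 1")
          case True
          have op: "open {t. norm (y + t *\<^sub>R i) < 1}" by (intro open_Collect_less continuous_intros)
          have "((\<lambda>t. 1 - (norm (y + t *\<^sub>R i))\<^sup>2) has_real_derivative (-2 * (y \<bullet> i))) (at 0)"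
            unfolding power2_norm_eq_inner has_field_derivative_def
            by (auto intro!: derivative_eq_intros simp: algebra_simps inner_commute)
          then have "((\<lambda>t. w (y + t *\<^sub>R i)) has_real_derivative (-2 * (y \<bullet> i))) (at 0)"
            by (rule has_field_derivative_transform_within_open[OF _ op]) (use True in \<open>auto simp: wB\<close>)
          then show ?thesis using True by simp
        next
          case False
          have op: "open {t. norm (y + t *\<^sub>R i) > 1}" by (intro open_Collect_less continuous_intros)
          have "((\<lambda>t. w (y + t *\<^sub>R i)) has_real_derivative 0) (at 0)"
            by (rule has_field_derivative_transform_within_open[OF DERIV_const op]) (use False y1 in \<open>auto simp: w0\<close>)
          then show ?thesis using False by simp
        qed
        have "((\<lambda>t. D (x + r *\<^sub>R (y + t *\<^sub>R i))) has_derivative (\<lambda>s. G (x + r *\<^sub>R (y + 0 *\<^sub>R i)) ((r * s) *\<^sub>R i))) (at 0)"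
          by (rule has_derivative_compose[OF _ G(1)]) (auto intro!: derivative_eq_intros)
        then have "((\<lambda>t. D (x + r *\<^sub>R (y + t *\<^sub>R i)) \<bullet> i) has_derivative (\<lambda>s. G (x + r *\<^sub>R y) ((r * s) *\<^sub>R i) \<bullet> i)) (at 0)"
          by (auto intro!: derivative_eq_intros)
        then have dD: "((\<lambda>t. D (x + r *\<^sub>R (y + t *\<^sub>R i)) \<bullet> i) has_real_derivative r * (G (x + r *\<^sub>R y) i \<bullet> i)) (at 0)"
          unfolding has_field_derivative_def by (rule has_derivative_eq_rhs) (simp add: GL fun_eq_iff)
        show "((\<lambda>t. F i (y + t *\<^sub>R i)) has_real_derivative F' i y) (at 0)"
          unfolding F_def F'_def using DERIV_mult[OF dD dw] by (simp add: mult_ac add.commute)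
      qed
    qed (use iF Lip i in \<open>auto simp: F_def F'_def w0\<close>)
  qed
  \<comment> \<open>Summing over the basis turns the Hessian entries into \<open>l\<close> and the
    derivatives of the weight into the radial derivative of f, so the integral of the sum is twice
    the difference of the two sides.\<close>
  have sum: "(\<Sum>i\<in>Basis. F' i y) = 2 * (indicator (ball 0 1) y * (r * (1 - (norm y)\<^sup>2) / 2 * l (x + r *\<^sub>R y)))
     - 2 * (indicator (ball 0 1) y * (D (x + r *\<^sub>R y) \<bullet> y))" for y
  proof -
    have "(\<Sum>i\<in>Basis. F' i y) = r * w y * (\<Sum>i\<in>Basis. G (x + r *\<^sub>R y) i \<bullet> i)
       - 2 * indicator (ball 0 1) y * (\<Sum>i\<in>Basis. (D (x + r *\<^sub>R y) \<bullet> i) * (y \<bullet> i))"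
      unfolding F'_def sum.distrib
      by (simp add: sum_distrib_left sum_negf mult_ac)
    then show ?thesis by (simp add: G(3) euclidean_inner[of "D (x + r *\<^sub>R y)" y] wB mult_ac)
  qed
  have [measurable]: "(\<lambda>y. D (x + r *\<^sub>R y) \<bullet> y) \<in> borel_measurable borel"
    by (intro borel_measurable_continuous_onI continuous_on_inner[OF cD' continuous_on_id])
  obtain M1 where M1: "\<And>y. y \<in> cball 0 3 \<Longrightarrow> \<bar>D (x + r *\<^sub>R y) \<bullet> y\<bar> \<le> M1"
    using bd[OF continuous_on_inner[OF cD' continuous_on_id]] by blast
  have i1: "integrable lborel (\<lambda>y. indicator (ball 0 1) y * (D (x + r *\<^sub>R y) \<bullet> y))"
  proof (rule integrable_bounded_on_cball[where a = 0 and R = 1 and B = M1])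
    fix y :: 'a assume "y \<in> cball 0 1"
    then show "\<bar>indicator (ball 0 1) y * (D (x + r *\<^sub>R y) \<bullet> y)\<bar> \<le> M1"
      using M1[of y] M1[of 0] by (auto simp: indicator_def)
  qed (auto intro!: borel_measurable_times borel_measurable_indicator)
  have "continuous_on (cball 0 3) (\<lambda>y. r * (1 - (norm y)\<^sup>2) / 2 * l (x + r *\<^sub>R y))"
    by (intro continuous_intros cl') auto
  then obtain M2 where M2: "\<And>y. y \<in> cball 0 3 \<Longrightarrow> \<bar>r * (1 - (norm y)\<^sup>2) / 2 * l (x + r *\<^sub>R y)\<bar> \<le> M2"
    using bd by blast
  have i2: "integrable lborel (\<lambda>y. indicator (ball 0 1) y * (r * (1 - (norm y)\<^sup>2) / 2 * l (x + r *\<^sub>R y)))"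
  proof (rule integrable_bounded_on_cball[where a = 0 and R = 1 and B = M2])
    fix y :: 'a assume "y \<in> cball 0 1"
    then show "\<bar>indicator (ball 0 1) y * (r * (1 - (norm y)\<^sup>2) / 2 * l (x + r *\<^sub>R y))\<bar> \<le> M2"
      using M2[of y] M2[of 0] by (auto simp: indicator_def)
  next
    show "(\<lambda>y. indicator (ball 0 1) y * (r * (1 - (norm y)\<^sup>2) / 2 * l (x + r *\<^sub>R y))) \<in> borel_measurable borel"
      by (intro borel_measurable_times borel_measurable_indicator borel_measurable_continuous_onI
           continuous_intros cl') auto
  qed auto
  have "0 = (\<Sum>i\<in>Basis. integral\<^sup>L lborel (F' i))" using zero by simp
  also have "\<dots> = (LINT y|lborel. (\<Sum>i\<in>Basis. F' i y))"
    using intF' by (rule Bochner_Integration.integral_sum[symmetric])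
  also have "\<dots> = 2 * (LINT y|lborel. indicator (ball 0 1) y * (r * (1 - (norm y)\<^sup>2) / 2 * l (x + r *\<^sub>R y)))
     - 2 * (LINT y|lborel. indicator (ball 0 1) y * (D (x + r *\<^sub>R y) \<bullet> y))"
    unfolding sum
    by (subst Bochner_Integration.integral_diff[OF integrable_mult_right[OF i2] integrable_mult_right[OF i1]])
       (simp only: integral_mult_right_zero)
  finally show ?thesis by simp
qed

lemma continuous_bounded_on_cball:
  fixes h :: "'a::euclidean_space \<Rightarrow> real"
  assumes "continuous_on (cball a R) h"
  obtains M where "0 \<le> M" "\<And>y. y \<in> cball a R \<Longrightarrow> \<bar>h y\<bar> \<le> M"
proof -
  have "compact (h ` cball a R)" by (rule compact_continuous_image[OF assms]) simp
  then obtain M where "\<forall>z\<in>h ` cball a R. norm z \<le> M" by (meson bounded_iff compact_imp_bounded)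
  then have "\<bar>h y\<bar> \<le> max 0 M" if "y \<in> cball a R" for y
    using that by (auto simp: le_max_iff_disj)
  then show ?thesis using that[of "max 0 M"] by simp
qed

text \<open>The double integral is the ball mean of \<open>l\<close> against a positive Green kernel, so the following is
  the distributional equation \<open>\<Delta> f = l\<close> in a form that passes to integrals over parameters.\<close>

definition weak_laplacian :: "('a::euclidean_space \<Rightarrow> real) \<Rightarrow> ('a \<Rightarrow> real) \<Rightarrow> bool" where
  "weak_laplacian f l \<longleftrightarrow> continuous_on UNIV f \<and> continuous_on UNIV l \<and>
     (\<forall>x. \<forall>r>0. (LINT y|lborel. indicator (ball 0 1) y * f (x + r *\<^sub>R y)) =
        f x * measure lborel (ball (0::'a) 1) +
        (LINT p|lborel. (indicator ({0..r} \<times> ball 0 1) p * (fst p * (1 - (norm (snd p))\<^sup>2) / 2))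
            * l (x + fst p *\<^sub>R snd p)))"

text \<open>The kernel of the second integral in \<open>weak_laplacian\<close>. Its factor s (1 -
  |y|^2) / 2 is what \<open>C2_ball_parts\<close> leaves at radius s. Keeping the pair (s, y)
  instead of the point s y means that the Green kernel of the ball appears before its push-forward
  and stays bounded.\<close>

definition green_weight :: "real \<Rightarrow> real \<times> 'a::euclidean_space \<Rightarrow> real" where
  "green_weight r p = indicator ({0..r} \<times> ball 0 1) p * (fst p * (1 - (norm (snd p))\<^sup>2) / 2)"

lemma green_weight_measurable [measurable]:
  "green_weight r \<in> borel_measurable (borel :: (real \<times> 'a::euclidean_space) measure)"
proof -
  have 1: "{0..r} \<times> ball (0::'a) 1 \<in> sets borel"
    by (metis atLeastAtMost_borel borel_prod borel_open open_ball pair_measureI)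
  have 2: "(\<lambda>p::real \<times> 'a. fst p * (1 - (norm (snd p))\<^sup>2) / 2) \<in> borel_measurable borel"
    by (intro borel_measurable_continuous_onI continuous_intros) auto
  show ?thesis unfolding green_weight_def[abs_def]
    by (intro borel_measurable_times borel_measurable_indicator 1 2)
qed

lemma green_weight_nonneg: "0 \<le> green_weight r p"
  using power_le_one[of "norm (snd p)" 2] by (auto simp: green_weight_def indicator_def)

lemma green_weight_le: "green_weight r (p :: real \<times> 'a::euclidean_space) \<le> \<bar>r\<bar>"
proof (cases "p \<in> {0..r} \<times> ball 0 1")
  case True
  then have 1: "0 \<le> fst p" "fst p \<le> r" "(norm (snd p))\<^sup>2 \<le> 1"
    using power_le_one[of "norm (snd p)" 2] by auto
  have "fst p * (1 - (norm (snd p))\<^sup>2) \<le> r * 1" using 1 by (intro mult_mono) auto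
  then show ?thesis using True 1 by (simp add: green_weight_def)
qed (simp add: green_weight_def)

lemma green_weight_eq_0:
  assumes "p \<notin> cball 0 (\<bar>r\<bar> + 1)"
  shows "green_weight r (p :: real \<times> 'a::euclidean_space) = 0"
proof -
  have "p \<notin> {0..r} \<times> ball 0 1"
  proof
    assume "p \<in> {0..r} \<times> ball 0 1"
    then have "\<bar>fst p\<bar> \<le> \<bar>r\<bar>" "norm (snd p) \<le> 1" by auto
    then have "norm p \<le> \<bar>r\<bar> + 1"
      using sqrt_sum_squares_le_sum_abs[of "norm (fst p)" "norm (snd p)"] by (simp add: norm_prod_def)
    then show False using assms by simp
  qed
  then show ?thesis by (simp add: green_weight_def)
qed

lemma weak_laplacian_alt:
  "weak_laplacian f (l :: 'a::euclidean_space \<Rightarrow> real) \<longleftrightarrow> continuous_on UNIV f \<and> continuous_on UNIV l \<and>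
     (\<forall>x. \<forall>r>0. (LINT y|lborel. indicator (ball 0 1) y * f (x + r *\<^sub>R y)) =
        f x * measure lborel (ball (0::'a) 1) +
        (LINT p|lborel. green_weight r p * l (x + fst p *\<^sub>R snd p)))"
  unfolding weak_laplacian_def green_weight_def ..

lemma integrable_ball_continuous:
  fixes f :: "'a::euclidean_space \<Rightarrow> real"
  assumes "continuous_on UNIV f"
  shows "integrable lborel (\<lambda>y. indicator (ball 0 1) y * f (x + r *\<^sub>R y))"
proof -
  have c: "continuous_on S (\<lambda>y. f (x + r *\<^sub>R y))" for S
    by (rule continuous_on_compose2[OF assms]) (auto intro!: continuous_intros)
  obtain M where M: "0 \<le> M" "\<And>y. y \<in> cball 0 1 \<Longrightarrow> \<bar>f (x + r *\<^sub>R y)\<bar> \<le> M"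
    using continuous_bounded_on_cball[OF c] by metis
  show ?thesis
  proof (rule integrable_bounded_on_cball[where a = 0 and R = 1 and B = M])
    show "(\<lambda>y. indicator (ball 0 1) y * f (x + r *\<^sub>R y)) \<in> borel_measurable borel"
      by (intro borel_measurable_times borel_measurable_indicator borel_measurable_continuous_onI[OF c]) auto
  qed (use M in \<open>auto simp: indicator_def\<close>)
qed

lemma integrable_green_continuous:
  fixes l :: "'a::euclidean_space \<Rightarrow> real"
  assumes "continuous_on UNIV l"
  shows "integrable lborel (\<lambda>p. green_weight r p * l (x + fst p *\<^sub>R snd p))"
proof -
  have c: "continuous_on S (\<lambda>p. l (x + fst p *\<^sub>R snd p))" for S
    by (rule continuous_on_compose2[OF assms]) (auto intro!: continuous_intros)
  obtain M where M: "0 \<le> M" "\<And>p. p \<in> cball 0 (\<bar>r\<bar> + 1) \<Longrightarrow> \<bar>l (x + fst p *\<^sub>R snd p)\<bar> \<le> M"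
    using continuous_bounded_on_cball[OF c] by metis
  show ?thesis
  proof (rule integrable_bounded_on_cball[where a = 0 and R = "\<bar>r\<bar> + 1" and B = "\<bar>r\<bar> * M"])
    show "(\<lambda>p. green_weight r p * l (x + fst p *\<^sub>R snd p)) \<in> borel_measurable borel"
      by (intro borel_measurable_times borel_measurable_continuous_onI[OF c] green_weight_measurable)
    show "\<bar>green_weight r p * l (x + fst p *\<^sub>R snd p)\<bar> \<le> \<bar>r\<bar> * M" if "p \<in> cball 0 (\<bar>r\<bar> + 1)" for p
      unfolding abs_mult using M that green_weight_le[of r p] green_weight_nonneg[of r p]
      by (intro mult_mono) auto
  qed (simp add: green_weight_eq_0)
qed

text \<open>The increment of f along each radius is the integral of its radial derivative. After
  exchanging the integrals, the ball integral at a fixed s is rewritten by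
  \<open>C2_ball_parts\<close>.\<close>

lemma C2_on_imp_weak_laplacian:
  fixes f :: "'a::euclidean_space \<Rightarrow> real"
  assumes "C2_on UNIV f D l"
  shows "weak_laplacian f l"
  unfolding weak_laplacian_alt
proof (intro conjI allI impI)
  show cf: "continuous_on UNIV f" and cl: "continuous_on UNIV l" using C2_on_imp[OF assms] by auto
  have cD: "continuous_on UNIV D" using C2_on_imp[OF assms] by auto
  fix x :: 'a and r :: real assume r: "0 < r"
  have df: "(f has_derivative (\<lambda>h. D x \<bullet> h)) (at x)" for x using assms unfolding C2_on_def by blast
  have cD': "continuous_on S (\<lambda>p. D (x + fst p *\<^sub>R snd p) \<bullet> snd p)" for S :: "(real \<times> 'a) set"
    by (intro continuous_intros continuous_on_compose2[OF cD]) auto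
  have ftc: "(LINT s|lborel. indicator {0..r} s *\<^sub>R (D (x + s *\<^sub>R y) \<bullet> y)) = f (x + r *\<^sub>R y) - f (x + 0 *\<^sub>R y)" for y
  proof (rule integral_FTC_Icc)
    show "continuous_on {0..r} (\<lambda>s. D (x + s *\<^sub>R y) \<bullet> y)"
      by (intro continuous_intros continuous_on_compose2[OF cD]) auto
    fix s :: real
    have "((\<lambda>s. f (x + s *\<^sub>R y)) has_derivative (\<lambda>h. D (x + s *\<^sub>R y) \<bullet> (h *\<^sub>R y))) (at s within {0..r})"
      by (rule has_derivative_compose[OF _ df]) (auto intro!: derivative_eq_intros)
    then show "((\<lambda>s. f (x + s *\<^sub>R y)) has_vector_derivative D (x + s *\<^sub>R y) \<bullet> y) (at s within {0..r})"
      by (simp add: has_vector_derivative_def)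
  qed (use r in auto)
  let ?F = "\<lambda>p. indicator ({0..r} \<times> ball 0 1) p * (D (x + fst p *\<^sub>R snd p) \<bullet> snd p)"
  have ind: "indicator ({0..r} \<times> ball (0::'a) 1) (s, y) = (indicator {0..r} s * indicator (ball 0 1) y :: real)" for s y
    by (auto simp: indicator_def)
  have iF: "integrable lborel ?F"
  proof -
    obtain M where M: "0 \<le> M" "\<And>p. p \<in> cball 0 (r + 1) \<Longrightarrow> \<bar>D (x + fst p *\<^sub>R snd p) \<bullet> snd p\<bar> \<le> M"
      using continuous_bounded_on_cball[OF cD'] by metis
    have sub: "p \<in> cball 0 (r + 1)" if p: "p \<in> {0..r} \<times> ball (0::'a) 1" for p
    proof -
      have "\<bar>fst p\<bar> \<le> r" "norm (snd p) \<le> 1" using p r by auto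
      then show ?thesis
        using sqrt_sum_squares_le_sum_abs[of "norm (fst p)" "norm (snd p)"] by (simp add: norm_prod_def)
    qed
    have "{0..r} \<times> ball (0::'a) 1 \<in> sets borel"
      by (metis atLeastAtMost_borel borel_prod borel_open open_ball pair_measureI)
    then show ?thesis
      using M sub by (intro integrable_bounded_on_cball[where a = 0 and R = "r + 1" and B = M]
         borel_measurable_times borel_measurable_continuous_onI[OF cD'] borel_measurable_indicator)
        (auto simp: indicator_def)
  qed
  then have iF': "integrable (lborel \<Otimes>\<^sub>M lborel) ?F" by (simp add: lborel_prod)
  let ?G = "\<lambda>p. green_weight r p * l (x + fst p *\<^sub>R snd p)"
  have iG': "integrable (lborel \<Otimes>\<^sub>M lborel) ?G" using integrable_green_continuous[OF cl] by (simp add: lborel_prod)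
  have s1: "(LINT y|lborel. indicator (ball 0 1) y * (f (x + r *\<^sub>R y) - f x)) =
      (LINT y|lborel. LINT s|lborel. ?F (s, y))"
    unfolding ind using ftc by (intro Bochner_Integration.integral_cong refl) (simp add: mult_ac)
  have s2: "(LINT y|lborel. LINT s|lborel. ?F (s, y)) = (LINT s|lborel. LINT y|lborel. ?F (s, y))"
    using lborel_pair.Fubini_integral[of "\<lambda>s y. ?F (s, y)"] iF' by (simp add: case_prod_unfold)
  have s3: "(LINT s|lborel. LINT y|lborel. ?F (s, y)) = (LINT s|lborel. LINT y|lborel. ?G (s, y))"
  proof (rule Bochner_Integration.integral_cong[OF refl])
    fix s :: real
    have "(LINT y|lborel. ?F (s, y)) = indicator {0..r} s * (LINT y|lborel. indicator (ball 0 1) y * (D (x + s *\<^sub>R y) \<bullet> y))"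
      unfolding ind by (simp add: mult.assoc)
    also have "\<dots> = indicator {0..r} s * (LINT y|lborel. indicator (ball 0 1) y * (s * (1 - (norm y)\<^sup>2) / 2 * l (x + s *\<^sub>R y)))"
      by (simp add: C2_ball_parts[OF assms])
    also have "\<dots> = (LINT y|lborel. ?G (s, y))"
      unfolding green_weight_def ind by (simp add: mult.assoc)
    finally show "(LINT y|lborel. ?F (s, y)) = (LINT y|lborel. ?G (s, y))" .
  qed
  have s4: "(LINT s|lborel. LINT y|lborel. ?G (s, y)) = integral\<^sup>L lborel ?G"
    using lborel_pair.integral_fst'[OF iG'] by (simp add: lborel_prod)
  have "(LINT y|lborel. indicator (ball 0 1) y * (f (x + r *\<^sub>R y) - f x)) = integral\<^sup>L lborel ?G"
    using s1 s2 s3 s4 by simp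
  moreover have "(LINT y|lborel. indicator (ball 0 1) y * (f (x + r *\<^sub>R y) - f x)) =
      (LINT y|lborel. indicator (ball 0 1) y * f (x + r *\<^sub>R y)) - (LINT y|lborel. indicator (ball (0::'a) 1) y * f x)"
    using integrable_ball_continuous[OF cf, of x r] integrable_ball_continuous[of "\<lambda>_. f x" x r]
    by (simp add: algebra_simps)
  moreover have "(LINT y|lborel. indicator (ball (0::'a) 1) y * f x) = f x * measure lborel (ball (0::'a) 1)" by simp
  ultimately show "(LINT y|lborel. indicator (ball 0 1) y * f (x + r *\<^sub>R y)) =
       f x * measure lborel (ball (0::'a) 1) + (LINT p|lborel. green_weight r p * l (x + fst p *\<^sub>R snd p))"
    by linarith
qed

lemma weak_laplacian_add:
  assumes "weak_laplacian f l" "weak_laplacian g k"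
  shows "weak_laplacian (\<lambda>x. f x + g x) (\<lambda>x. l x + k x)"
proof -
  have c: "continuous_on UNIV f" "continuous_on UNIV g" "continuous_on UNIV l" "continuous_on UNIV k"
    using assms by (auto simp: weak_laplacian_def)
  then show ?thesis
    using assms integrable_ball_continuous[OF c(1)] integrable_ball_continuous[OF c(2)]
      integrable_green_continuous[OF c(3)] integrable_green_continuous[OF c(4)]
    unfolding weak_laplacian_alt
    by (auto simp: distrib_left distrib_right intro!: continuous_intros)
qed

lemma weak_laplacian_cmult:
  "weak_laplacian f l \<Longrightarrow> weak_laplacian (\<lambda>x. c * f x) (\<lambda>x. c * l x)"
  unfolding weak_laplacian_alt
  by (auto simp: mult.left_commute[of _ c] distrib_left intro!: continuous_intros)

lemma weak_laplacian_sum: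
  assumes "\<And>j. j \<in> J \<Longrightarrow> weak_laplacian (f j) (l j)"
  shows "weak_laplacian (\<lambda>x. \<Sum>j\<in>J. f j x) (\<lambda>x. \<Sum>j\<in>J. l j x)"
proof (cases "finite J")
  case True
  then show ?thesis using assms
  proof (induction J)
    case (insert j J)
    then have "weak_laplacian (\<lambda>x. f j x + (\<Sum>j\<in>J. f j x)) (\<lambda>x. l j x + (\<Sum>j\<in>J. l j x))"
      by (intro weak_laplacian_add) auto
    then show ?case using insert by simp
  qed (simp add: weak_laplacian_def)
qed (simp add: weak_laplacian_def)

text \<open>The identity at x with radius r involves the functions only in the ball about the origin
  of radius \<open>norm x + r + 1\<close>. This admits infinite sums that are finite on every
  ball.\<close>

lemma weak_laplacian_local:
  assumes "\<And>R. \<exists>f' l'. weak_laplacian f' l' \<and> (\<forall>x\<in>ball 0 R. f x = f' x \<and> l x = l' x)"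
  shows "weak_laplacian f l"
  unfolding weak_laplacian_alt
proof (intro conjI allI impI)
  have "continuous_on (\<Union>R\<in>UNIV. ball 0 R) f \<and> continuous_on (\<Union>R\<in>UNIV. ball 0 R) l"
  proof (intro conjI continuous_on_open_UN open_ball)
    fix R :: real
    obtain f' l' where fl: "weak_laplacian f' l'" "\<forall>x\<in>ball 0 R. f x = f' x \<and> l x = l' x"
      using assms by blast
    then have "continuous_on (ball 0 R) f'" "continuous_on (ball 0 R) l'"
      unfolding weak_laplacian_def by (auto intro: continuous_on_subset)
    with fl(2) show "continuous_on (ball 0 R) f" "continuous_on (ball 0 R) l"
      using continuous_on_cong[of "ball 0 R" "ball 0 R" f f'] continuous_on_cong[of "ball 0 R" "ball 0 R" l l'] by auto
  qed
  moreover have "(\<Union>R\<in>UNIV. ball (0::'a) R) = UNIV" using gt_ex by (auto simp: mem_ball_0)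
  ultimately show "continuous_on UNIV f" "continuous_on UNIV l" by simp_all
  fix x :: 'a and r :: real assume r: "0 < r"
  define R where "R = norm x + r + 1"
  obtain f' l' where wl: "weak_laplacian f' l'" and fl: "\<And>x. x \<in> ball 0 R \<Longrightarrow> f x = f' x" "\<And>x. x \<in> ball 0 R \<Longrightarrow> l x = l' x"
    using assms by blast
  have inR: "x + s *\<^sub>R y \<in> ball 0 R" if "0 \<le> s" "s \<le> r" "norm y < 1" for s y
  proof -
    have "norm (s *\<^sub>R y) \<le> r * 1" using that r mult_mono[of s r "norm y" 1] by simp
    then show ?thesis using norm_triangle_ineq[of x "s *\<^sub>R y"] by (simp add: R_def)
  qed
  have "(LINT y|lborel. indicator (ball 0 1) y * f (x + r *\<^sub>R y)) = (LINT y|lborel. indicator (ball 0 1) y * f' (x + r *\<^sub>R y))"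
    using inR r fl by (intro Bochner_Integration.integral_cong refl) (auto simp: indicator_def)
  moreover have "(LINT p|lborel. green_weight r p * l (x + fst p *\<^sub>R snd p)) = (LINT p|lborel. green_weight r p * l' (x + fst p *\<^sub>R snd p))"
    using inR r fl by (intro Bochner_Integration.integral_cong refl) (auto simp: green_weight_def indicator_def)
  moreover have "f x = f' x" using r by (intro fl) (simp add: R_def)
  ultimately show "(LINT y|lborel. indicator (ball 0 1) y * f (x + r *\<^sub>R y)) =
       f x * measure lborel (ball (0::'a) 1) + (LINT p|lborel. green_weight r p * l (x + fst p *\<^sub>R snd p))"
    using wl r unfolding weak_laplacian_alt by simp
qed

section \<open>Superpositions of kernels and their weak Laplacians\<close>

lemma integrable_lborel_prod_times:
  fixes f :: "'a::euclidean_space \<Rightarrow> real" and g :: "'b::euclidean_space \<Rightarrow> real"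
  assumes f: "integrable lborel f" and g: "integrable lborel g"
  shows "integrable (lborel \<Otimes>\<^sub>M lborel) (\<lambda>p. f (fst p) * g (snd p))"
proof -
  have [measurable]: "f \<in> borel_measurable borel" "g \<in> borel_measurable borel" using f g by auto
  show ?thesis
    by (rule lborel_pair.Fubini_integrable) (use f g in \<open>auto simp: abs_mult\<close>)
qed

text \<open>The weight w is only locally integrable and K has bounded support only in its second
  argument; the bounded support of c confines \<open>v p\<close> to a compact set, which gives an
  integrable majorant.\<close>

lemma Fubini_kernel:
  fixes c :: "'b::euclidean_space \<Rightarrow> real" and v :: "'b \<Rightarrow> 'a::euclidean_space"
    and w :: "'c::euclidean_space \<Rightarrow> real" and K :: "'a \<Rightarrow> 'c \<Rightarrow> real"
  assumes c [measurable]: "c \<in> borel_measurable borel" and cB: "\<And>p. \<bar>c p\<bar> \<le> B" and c0: "\<And>p. p \<notin> cball 0 R \<Longrightarrow> c p = 0"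
    and v: "continuous_on UNIV v"
    and K: "continuous_on UNIV (\<lambda>p. K (fst p) (snd p))" and K0: "\<And>x z. z \<notin> cball 0 S \<Longrightarrow> K x z = 0"
    and w [measurable]: "w \<in> borel_measurable borel" and iw: "integrable lborel (\<lambda>z. indicator (cball 0 S) z * w z)"
  shows "(LINT p|lborel. c p * (LINT z|lborel. w z * K (v p) z)) = (LINT z|lborel. w z * (LINT p|lborel. c p * K (v p) z))"
proof -
  have cK: "continuous_on T (\<lambda>q. K (v (fst q)) (snd q))" for T
    by (rule continuous_on_compose2[OF K, of _ "\<lambda>q. (v (fst q), snd q)", simplified])
       (auto intro!: continuous_intros continuous_on_compose2[OF v])
  then have mK [measurable]: "(\<lambda>q. K (v (fst q)) (snd q)) \<in> borel_measurable (borel \<Otimes>\<^sub>M borel)"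
    unfolding borel_prod by (rule borel_measurable_continuous_onI)
  have "compact ((\<lambda>q. K (v (fst q)) (snd q)) ` (cball 0 R \<times> cball 0 S))"
    by (intro compact_continuous_image cK compact_Times compact_cball)
  then obtain M where M: "\<forall>z\<in>(\<lambda>q. K (v (fst q)) (snd q)) ` (cball 0 R \<times> cball 0 S). norm z \<le> M"
    by (meson bounded_iff compact_imp_bounded)
  have B0: "0 \<le> B" using cB[of 0] by simp
  let ?M = "max 0 M"
  have i1: "integrable lborel (\<lambda>p::'b. B * ?M * indicator (cball 0 R) p)"
    using B0 by (intro integrable_bounded_on_cball[of _ 0 R "B * ?M"]) (auto simp: indicator_def)
  have i2: "integrable lborel (\<lambda>z. \<bar>indicator (cball 0 S) z * w z\<bar>)" using iw by (rule integrable_abs)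
  have "integrable (lborel \<Otimes>\<^sub>M lborel) (\<lambda>q. c (fst q) * (w (snd q) * K (v (fst q)) (snd q)))"
  proof (rule Bochner_Integration.integrable_bound[OF integrable_lborel_prod_times[OF i1 i2]])
    show "(\<lambda>q. c (fst q) * (w (snd q) * K (v (fst q)) (snd q))) \<in> borel_measurable (lborel \<Otimes>\<^sub>M lborel)"
      by measurable
    show "AE q in lborel \<Otimes>\<^sub>M lborel. norm (c (fst q) * (w (snd q) * K (v (fst q)) (snd q)))
        \<le> norm (B * ?M * indicator (cball 0 R) (fst q) * \<bar>indicator (cball 0 S) (snd q) * w (snd q)\<bar>)"
    proof (rule AE_I2)
      fix q :: "'b \<times> 'c"
      show "norm (c (fst q) * (w (snd q) * K (v (fst q)) (snd q)))
        \<le> norm (B * ?M * indicator (cball 0 R) (fst q) * \<bar>indicator (cball 0 S) (snd q) * w (snd q)\<bar>)"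
      proof (cases "fst q \<in> cball 0 R \<and> snd q \<in> cball 0 S")
        case True
        then have "\<bar>K (v (fst q)) (snd q)\<bar> \<le> ?M" using M by (force simp: mem_Times_iff)
        then have "\<bar>c (fst q)\<bar> * (\<bar>w (snd q)\<bar> * \<bar>K (v (fst q)) (snd q)\<bar>) \<le> B * (\<bar>w (snd q)\<bar> * ?M)"
          using cB[of "fst q"] B0 by (intro mult_mono) auto
        then show ?thesis using True B0 by (simp add: abs_mult mult_ac)
      next
        case False
        then have "c (fst q) = 0 \<or> K (v (fst q)) (snd q) = 0" using c0 K0 by blast
        then show ?thesis by auto
      qed
    qed
  qed
  then have i: "integrable (lborel \<Otimes>\<^sub>M lborel) (\<lambda>(p, z). c p * (w z * K (v p) z))"
    by (simp add: case_prod_unfold)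
  have "(LINT p|lborel. c p * (LINT z|lborel. w z * K (v p) z)) = (LINT p|lborel. LINT z|lborel. c p * (w z * K (v p) z))"
    by simp
  also have "\<dots> = (LINT z|lborel. LINT p|lborel. c p * (w z * K (v p) z))"
    using lborel_pair.Fubini_integral[OF i] by simp
  also have "\<dots> = (LINT z|lborel. w z * (LINT p|lborel. c p * K (v p) z))"
    by (simp add: mult.left_commute[of "c _"])
  finally show ?thesis .
qed

lemma kernel_slice_bound:
  fixes K :: "'a::euclidean_space \<Rightarrow> 'c::euclidean_space \<Rightarrow> real"
  assumes "continuous_on UNIV (\<lambda>p. K (fst p) (snd p))"
  obtains M where "0 \<le> M" "\<And>x z. x \<in> cball 0 R \<Longrightarrow> z \<in> cball 0 S \<Longrightarrow> \<bar>K x z\<bar> \<le> M"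
proof -
  have "compact ((\<lambda>q. K (fst q) (snd q)) ` (cball 0 R \<times> cball 0 S))"
    using assms by (intro compact_continuous_image compact_Times compact_cball) (auto intro: continuous_on_subset)
  then obtain M where M: "\<forall>z\<in>(\<lambda>q. K (fst q) (snd q)) ` (cball 0 R \<times> cball 0 S). norm z \<le> M"
    by (meson bounded_iff compact_imp_bounded)
  have "\<bar>K x z\<bar> \<le> max 0 M" if "x \<in> cball 0 R" "z \<in> cball 0 S" for x z
    using M[rule_format, OF imageI[of "(x, z)"]] that by simp
  then show ?thesis using that[of "max 0 M"] by simp
qed

lemma continuous_kernel_integral:
  fixes K :: "'a::euclidean_space \<Rightarrow> 'c::euclidean_space \<Rightarrow> real"
  assumes K: "continuous_on UNIV (\<lambda>p. K (fst p) (snd p))" and K0: "\<And>x z. z \<notin> cball 0 S \<Longrightarrow> K x z = 0"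
    and w [measurable]: "w \<in> borel_measurable borel" and iw: "integrable lborel (\<lambda>z. indicator (cball 0 S) z * w z)"
  shows "continuous_on UNIV (\<lambda>x. LINT z|lborel. w z * K x z)"
  unfolding continuous_on_sequentially
proof (intro ballI allI impI, elim conjE)
  fix X :: "nat \<Rightarrow> 'a" and a assume X: "X \<longlonglongrightarrow> a"
  then obtain R where R: "\<And>n. X n \<in> cball 0 R"
    using convergent_imp_bounded[of X] by (auto simp: bounded_iff convergent_def)
  obtain M where M: "0 \<le> M" "\<And>x z. x \<in> cball 0 R \<Longrightarrow> z \<in> cball 0 S \<Longrightarrow> \<bar>K x z\<bar> \<le> M"
    using kernel_slice_bound[OF K] by blast
  have cKx: "continuous_on UNIV (K x)" for x
    by (rule continuous_on_compose2[OF K, of _ "\<lambda>z. (x, z)", simplified]) (auto intro!: continuous_intros)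
  have mK [measurable]: "K x \<in> borel_measurable borel" for x
    by (rule borel_measurable_continuous_onI[OF cKx])
  have "(\<lambda>n. LINT z|lborel. w z * K (X n) z) \<longlonglongrightarrow> (LINT z|lborel. w z * K a z)"
  proof (rule integral_dominated_convergence[where w = "\<lambda>z. \<bar>indicator (cball 0 S) z * w z\<bar> * M"])
    show "AE z in lborel. (\<lambda>n. w z * K (X n) z) \<longlonglongrightarrow> w z * K a z"
    proof (rule AE_I2, intro tendsto_intros)
      fix z
      have "isCont (\<lambda>x. K x z) a"
        using continuous_on_compose2[OF K, of UNIV "\<lambda>x. (x, z)", simplified]
        by (simp add: continuous_on_eq_continuous_at continuous_intros)
      then show "(\<lambda>n. K (X n) z) \<longlonglongrightarrow> K a z" using X by (rule isCont_tendsto_compose)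
    qed
    show "AE z in lborel. norm (w z * K (X n) z) \<le> \<bar>indicator (cball 0 S) z * w z\<bar> * M" for n
    proof (rule AE_I2)
      fix z show "norm (w z * K (X n) z) \<le> \<bar>indicator (cball 0 S) z * w z\<bar> * M"
        using M(2)[OF R[of n], of z] K0[of z "X n"] by (cases "z \<in> cball 0 S") (auto simp: abs_mult mult_left_mono)
    qed
  qed (use iw in auto)
  then show "((\<lambda>x. LINT z|lborel. w z * K x z) \<circ> X) \<longlonglongrightarrow> (LINT z|lborel. w z * K a z)"
    by (simp add: o_def)
qed

text \<open>The identity defining \<open>weak_laplacian\<close> is linear, so it may be integrated
  in z against any locally integrable weight, of either sign; the bounded support in z makes Fubini
  applicable.\<close>

lemma weak_laplacian_superposition:
  fixes K L :: "'a::euclidean_space \<Rightarrow> 'c::euclidean_space \<Rightarrow> real"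
  assumes K: "continuous_on UNIV (\<lambda>p. K (fst p) (snd p))" and K0: "\<And>x z. z \<notin> cball 0 S \<Longrightarrow> K x z = 0"
    and L: "continuous_on UNIV (\<lambda>p. L (fst p) (snd p))" and L0: "\<And>x z. z \<notin> cball 0 S \<Longrightarrow> L x z = 0"
    and w: "w \<in> borel_measurable borel" "integrable lborel (\<lambda>z. indicator (cball 0 S) z * w z)"
    and KL: "\<And>z. weak_laplacian (\<lambda>x. K x z) (\<lambda>x. L x z)"
  shows "weak_laplacian (\<lambda>x. LINT z|lborel. w z * K x z) (\<lambda>x. LINT z|lborel. w z * L x z)"
  unfolding weak_laplacian_alt
proof (intro conjI allI impI continuous_kernel_integral[OF K K0 w] continuous_kernel_integral[OF L L0 w])
  fix x :: 'a and r :: real assume r: "0 < r"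
  have c1: "continuous_on UNIV (\<lambda>y. x + r *\<^sub>R y)" by (intro continuous_intros)
  have c2: "continuous_on UNIV (\<lambda>p. x + fst p *\<^sub>R snd p)" by (intro continuous_intros)
  let ?i = "indicator (ball 0 1) :: 'a \<Rightarrow> real"
  let ?G = "\<lambda>z. LINT p|lborel. green_weight r p * L (x + fst p *\<^sub>R snd p) z"
  let ?G' = "\<lambda>z. LINT p|lborel. green_weight r p * L (x + fst p *\<^sub>R snd p) z * indicator (cball 0 (\<bar>r\<bar> + 1)) p"
  have "(LINT y|lborel. ?i y * (LINT z|lborel. w z * K (x + r *\<^sub>R y) z))
      = (LINT z|lborel. w z * (LINT y|lborel. ?i y * K (x + r *\<^sub>R y) z))"
    by (rule Fubini_kernel[where B = 1 and R = 1 and S = S, OF _ _ _ c1 K K0 w]) (auto simp: indicator_def)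
  also have "\<dots> = (LINT z|lborel. w z * K x z * measure lborel (ball (0::'a) 1) +
        w z * ?G z)"
    using KL r unfolding weak_laplacian_alt by (simp add: distrib_left mult.assoc)
  also have "\<dots> = (LINT z|lborel. w z * K x z * measure lborel (ball (0::'a) 1)) +
        (LINT z|lborel. w z * ?G z)"
  proof (rule Bochner_Integration.integral_add)
    have cont_int: "integrable lborel (\<lambda>z. w z * h z)" if h: "continuous_on UNIV h" "\<And>z. z \<notin> cball 0 S \<Longrightarrow> h z = 0" for h
    proof -
      obtain M where M: "0 \<le> M" "\<And>z. z \<in> cball 0 S \<Longrightarrow> \<bar>h z\<bar> \<le> M"
        using continuous_bounded_on_cball[OF continuous_on_subset[OF h(1)]] by blast
      have [measurable]: "h \<in> borel_measurable borel" by (rule borel_measurable_continuous_onI[OF h(1)])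
      note [measurable] = w(1)
      show ?thesis
      proof (rule Bochner_Integration.integrable_bound[where f = "\<lambda>z. M * (indicator (cball 0 S) z * w z)"])
        show "AE z in lborel. norm (w z * h z) \<le> norm (M * (indicator (cball 0 S) z * w z))"
        proof (rule AE_I2)
          fix z show "norm (w z * h z) \<le> norm (M * (indicator (cball 0 S) z * w z))"
            using M(2)[of z] M(1) h(2)[of z] by (cases "z \<in> cball 0 S") (auto simp: abs_mult mult_right_mono mult.commute[of "\<bar>w z\<bar>"])
        qed
      qed (use w in auto)
    qed
    have "continuous_on UNIV (\<lambda>z. K x z)"
      by (rule continuous_on_compose2[OF K, of _ "\<lambda>z. (x, z)", simplified]) (auto intro!: continuous_intros)
    then show "integrable lborel (\<lambda>z. w z * K x z * measure lborel (ball (0::'a) 1))"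
      using K0 by (intro integrable_mult_left cont_int) auto
    \<comment> \<open>Continuity in z is read off from the identity itself: the Green integral of L
      is the ball integral of K minus a multiple of the value at the centre, and both depend
      continuously on z.\<close>
    have "continuous_on UNIV (\<lambda>z. LINT p|lborel. green_weight r p * L (x + fst p *\<^sub>R snd p) z * indicator (cball 0 (\<bar>r\<bar> + 1)) p)"
    proof -
      define A where "A = (LINT y|lborel. ?i y)"
      have eq: "?G' z
          = (LINT y|lborel. ?i y * K (x + r *\<^sub>R y) z) - K x z * measure lborel (ball (0::'a) 1)" for z
      proof -
        have "?G' z
            = ?G z"
          using green_weight_eq_0[of _ r] by (intro Bochner_Integration.integral_cong refl) (auto simp: indicator_def)
        then show ?thesis using KL r unfolding weak_laplacian_alt by simp
      qed
      have cK: "continuous_on UNIV (\<lambda>q. K (x + r *\<^sub>R fst q) (snd q))"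
        by (rule continuous_on_compose2[OF K, of _ "\<lambda>q. (x + r *\<^sub>R fst q, snd q)", simplified])
           ((auto intro!: continuous_intros)?)
      \<comment> \<open>The factor \<open>max 0 (min 1 (2 - norm y))\<close> is 1 on the unit ball;
        it gives the kernel the bounded support in y that \<open>continuous_kernel_integral\<close>
        asks for.\<close>
      have "continuous_on UNIV (\<lambda>z. LINT y|lborel. ?i y * (K (x + r *\<^sub>R y) z * max 0 (min 1 (2 - norm y))))"
      proof (rule continuous_kernel_integral[where S = 2])
        show "continuous_on UNIV (\<lambda>p. K (x + r *\<^sub>R snd p) (fst p) * max 0 (min 1 (2 - norm (snd p))))"
          by (intro continuous_intros continuous_on_compose2[OF cK, of _ "\<lambda>p. (snd p, fst p)", simplified])
             ((auto intro!: continuous_intros)?)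
        show "integrable lborel (\<lambda>y. indicator (cball 0 2) y * ?i y)"
          by (rule integrable_bounded_on_cball[of _ 0 2 1]) (auto simp: indicator_def)
      qed (auto intro!: borel_measurable_indicator)
      moreover have "(LINT y|lborel. ?i y * (K (x + r *\<^sub>R y) z * max 0 (min 1 (2 - norm y)))) = (LINT y|lborel. ?i y * K (x + r *\<^sub>R y) z)" for z
        by (intro Bochner_Integration.integral_cong refl) (auto simp: indicator_def)
      ultimately show ?thesis unfolding eq
        by (intro continuous_intros \<open>continuous_on UNIV (\<lambda>z. K x z)\<close>) simp
    qed
    moreover have "?G' z
            = ?G z" for z
      using green_weight_eq_0[of _ r] by (intro Bochner_Integration.integral_cong refl) (auto simp: indicator_def)
    ultimately show "integrable lborel (\<lambda>z. w z * ?G z)"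
      using L0 by (intro cont_int) simp_all
  qed
  also have "(LINT z|lborel. w z * ?G z)
      = (LINT p|lborel. green_weight r p * (LINT z|lborel. w z * L (x + fst p *\<^sub>R snd p) z))"
    by (rule Fubini_kernel[where B = "\<bar>r\<bar>" and R = "\<bar>r\<bar> + 1" and S = S, OF _ _ _ c2 L L0 w, symmetric])
       (auto simp: green_weight_eq_0 green_weight_le green_weight_nonneg)
  finally show "(LINT y|lborel. ?i y * (LINT z|lborel. w z * K (x + r *\<^sub>R y) z)) =
      (LINT z|lborel. w z * K x z) * measure lborel (ball (0::'a) 1) +
      (LINT p|lborel. green_weight r p * (LINT z|lborel. w z * L (x + fst p *\<^sub>R snd p) z))"
    by simp
qed

section \<open>Subharmonic functions as real-valued functions\<close>

lemma pred_ball_cball [measurable]: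
  "Measurable.pred borel (\<lambda>x::'a::euclidean_space. x \<in> ball a r)"
  "Measurable.pred borel (\<lambda>x::'a::euclidean_space. x \<in> cball a r)"
  by (auto simp: pred_def simp del: mem_ball mem_cball)

lemma subharmonicD:
  assumes "subharmonic u"
  shows "u x < \<infinity>" "open {x. u x < c}" "0 < r \<Longrightarrow> u x \<le> ball_mean u x r"
  using assms unfolding subharmonic_def by simp_all

lemma sh_subharmonic: "u \<in> sh_functions \<Longrightarrow> subharmonic u"
  by (simp add: sh_functions_def)

lemma subharmonic_measurable:
  assumes "subharmonic u"
  shows "u \<in> borel_measurable borel"
  by (intro borel_measurableI_less) (auto intro: borel_open subharmonicD(2)[OF assms])

text \<open>By upper semicontinuity the sublevel sets at integer levels are open, and they cover the
  compact ball.\<close>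

lemma subharmonic_bounded_above:
  assumes "subharmonic u"
  obtains B :: real where "0 \<le> B" "\<And>y. y \<in> cball a R \<Longrightarrow> u y < ereal B"
proof -
  note op = subharmonicD(2)[OF assms]
  have "cball a R \<subseteq> (\<Union>n::nat. {x. u x < ereal (real n)})"
  proof
    fix x
    have "u x < \<infinity>" by (rule subharmonicD(1)[OF assms])
    then obtain c :: real where "u x \<le> ereal c" by (cases "u x") auto
    moreover obtain n :: nat where "c < real n" using reals_Archimedean2 by blast
    ultimately have "u x < ereal (real n)" by (simp add: le_less_trans)
    then show "x \<in> (\<Union>n::nat. {x. u x < ereal (real n)})" by auto
  qed
  from compactE_image[OF compact_cball op this] obtain F where
    F: "finite F" "cball a R \<subseteq> (\<Union>n\<in>F. {x. u x < ereal (real (n::nat))})" by metis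
  define N where "N = (if F = {} then 0 else Max F)"
  have "u y < ereal (real N)" if "y \<in> cball a R" for y
  proof -
    from subsetD[OF F(2) that] obtain n where n: "n \<in> F" "u y < ereal (real n)" by blast
    then have "real n \<le> real N" using F(1) by (auto simp: N_def)
    with n(2) show ?thesis by (meson ereal_less_eq(3) less_le_trans)
  qed
  then show ?thesis by (intro that[of "real N"]) auto
qed

lemma ennreal_finite_obtain:
  fixes x :: ennreal
  assumes "x < \<infinity>"
  obtains a where "0 \<le> a" "x = ennreal a"
  using assms by (cases x rule: ennreal_cases) auto

text \<open>If both parts are finite, the difference in \<open>ball_mean\<close> is a Bochner
  integral: u is finite almost everywhere on the ball, so the value 0 that
  \<open>real_of_ereal\<close> gives to \<open>-\<infinity>\<close> is invisible.\<close>

lemma ball_mean_eq: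
  fixes u :: "real^'m \<Rightarrow> ereal"
  assumes u: "u \<in> borel_measurable borel" "\<And>y. u y < \<infinity>"
    and fin: "(\<integral>\<^sup>+ y \<in> ball x r. e2ennreal (u y) \<partial>lborel) < \<infinity>"
             "(\<integral>\<^sup>+ y \<in> ball x r. e2ennreal (- u y) \<partial>lborel) < \<infinity>"
  shows "AE y in lborel. y \<in> ball x r \<longrightarrow> u y \<noteq> -\<infinity>"
    and "integrable lborel (\<lambda>y. indicator (ball x r) y * real_of_ereal (u y))"
    and "ball_mean u x r = ereal ((LINT y|lborel. indicator (ball x r) y * real_of_ereal (u y)) / measure lborel (ball x r))"
proof -
  note [measurable] = u(1)
  let ?f = "\<lambda>y. indicator (ball x r) y * real_of_ereal (u y)"
  have mb [measurable]: "ball x r \<in> sets borel" by auto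
  have "AE y in lborel. e2ennreal (- u y) * indicator (ball x r) y \<noteq> \<infinity>"
    by (rule nn_integral_PInf_AE) (use fin(2) in auto)
  then show AE: "AE y in lborel. y \<in> ball x r \<longrightarrow> u y \<noteq> -\<infinity>"
    by eventually_elim (auto simp: indicator_def)
  have P: "(\<integral>\<^sup>+ y. ennreal (?f y) \<partial>lborel) = (\<integral>\<^sup>+ y \<in> ball x r. e2ennreal (u y) \<partial>lborel)"
  proof (rule nn_integral_cong)
    fix y show "ennreal (?f y) = e2ennreal (u y) * indicator (ball x r) y"
      using u(2)[of y] by (cases "u y") (auto simp: indicator_def e2ennreal_neg)
  qed
  have N: "(\<integral>\<^sup>+ y. ennreal (- ?f y) \<partial>lborel) = (\<integral>\<^sup>+ y \<in> ball x r. e2ennreal (- u y) \<partial>lborel)"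
  proof (rule nn_integral_cong_AE)
    show "AE y in lborel. ennreal (- ?f y) = e2ennreal (- u y) * indicator (ball x r) y"
      using AE
    proof eventually_elim
      fix y assume "y \<in> ball x r \<longrightarrow> u y \<noteq> -\<infinity>"
      then show "ennreal (- ?f y) = e2ennreal (- u y) * indicator (ball x r) y"
        using u(2)[of y] by (cases "u y") (auto simp: indicator_def)
    qed
  qed
  have mf [measurable]: "?f \<in> borel_measurable lborel" by measurable
  show i: "integrable lborel ?f" unfolding real_integrable_def P N using fin mf by auto
  have "ereal (integral\<^sup>L lborel ?f) = enn2ereal (\<integral>\<^sup>+ y \<in> ball x r. e2ennreal (u y) \<partial>lborel)
        - enn2ereal (\<integral>\<^sup>+ y \<in> ball x r. e2ennreal (- u y) \<partial>lborel)"
  proof -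
    obtain a where a: "0 \<le> a" "(\<integral>\<^sup>+ y \<in> ball x r. e2ennreal (u y) \<partial>lborel) = ennreal a"
      using ennreal_finite_obtain[OF fin(1)] .
    obtain b where b: "0 \<le> b" "(\<integral>\<^sup>+ y \<in> ball x r. e2ennreal (- u y) \<partial>lborel) = ennreal b"
      using ennreal_finite_obtain[OF fin(2)] .
    show ?thesis using a(1) b(1) unfolding real_lebesgue_integral_def[OF i] P N a(2) b(2) by (simp add: enn2ereal_ennreal)
  qed
  then show "ball_mean u x r = ereal (integral\<^sup>L lborel ?f / measure lborel (ball x r))"
  proof (cases "measure lborel (ball x r) = 0")
    case False
    then show ?thesis
      unfolding ball_mean_def \<open>ereal (integral\<^sup>L lborel ?f) = _\<close>[symmetric] by simp
  next
    case True
    have "integral\<^sup>L lborel ?f = 0"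
    proof -
      have "r \<le> 0" using True content_ball_pos[of r x] by (metis less_irrefl not_le)
      then show ?thesis by (simp add: ball_empty)
    qed
    then show ?thesis
      unfolding ball_mean_def \<open>ereal (integral\<^sup>L lborel ?f) = _\<close>[symmetric] by (simp add: True zero_ereal_def[symmetric])
  qed
qed

text \<open>Local integrability. Were the negative part infinite on some ball, it would be infinite
  on a larger ball centred at a point where u is not \<open>-\<infinity>\<close>, and the
  sub-mean-value inequality would fail there.\<close>

lemma sh_finite_parts:
  fixes u :: "real^'m \<Rightarrow> ereal"
  assumes u: "u \<in> sh_functions"
  shows "(\<integral>\<^sup>+ y \<in> ball x r. e2ennreal (u y) \<partial>lborel) < \<infinity>"
    and "(\<integral>\<^sup>+ y \<in> ball x r. e2ennreal (- u y) \<partial>lborel) < \<infinity>"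
proof -
  have su: "subharmonic u" using u by (simp add: sh_functions_def)
  note [measurable] = subharmonic_measurable[OF su]
  obtain a where a: "u a \<noteq> -\<infinity>" using u by (auto simp: sh_functions_def)
  have pos: "(\<integral>\<^sup>+ y \<in> ball x r. e2ennreal (u y) \<partial>lborel) < \<infinity>" for x r
  proof -
    obtain B :: real where B: "0 \<le> B" "\<And>y. y \<in> cball x r \<Longrightarrow> u y < ereal B"
      using subharmonic_bounded_above[OF su] by blast
    have "(\<integral>\<^sup>+ y \<in> ball x r. e2ennreal (u y) \<partial>lborel) \<le> (\<integral>\<^sup>+ y. ennreal B * indicator (ball x r) y \<partial>lborel)"
    proof (rule nn_integral_mono)
      fix y show "e2ennreal (u y) * indicator (ball x r) y \<le> ennreal B * indicator (ball x r) y"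
        using B(2)[of y] e2ennreal_mono[of "u y" "ereal B"] by (auto simp: indicator_def)
    qed
    also have "\<dots> = ennreal B * emeasure lborel (ball x r)"
      by (simp add: nn_integral_cmult_indicator)
    also have "\<dots> < \<infinity>" using emeasure_lborel_ball_finite[of x r] by (simp add: ennreal_mult_less_top)
    finally show ?thesis .
  qed
  then show "(\<integral>\<^sup>+ y \<in> ball x r. e2ennreal (u y) \<partial>lborel) < \<infinity>" .
  define R where "R = dist a x + \<bar>r\<bar> + 1"
  have R: "0 < R" using zero_le_dist[of a x] unfolding R_def by linarith
  have sub: "ball x r \<subseteq> ball a R"
  proof
    fix y assume "y \<in> ball x r"
    then show "y \<in> ball a R" using dist_triangle[of a y x] by (simp add: R_def)
  qed
  have "(\<integral>\<^sup>+ y \<in> ball a R. e2ennreal (- u y) \<partial>lborel) < \<infinity>"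
  proof (rule ccontr)
    assume "\<not> ?thesis"
    then have inf: "(\<integral>\<^sup>+ y \<in> ball a R. e2ennreal (- u y) \<partial>lborel) = \<infinity>"
      unfolding infinity_ennreal_def not_less top_unique .
    obtain p where p: "0 \<le> p" "(\<integral>\<^sup>+ y \<in> ball a R. e2ennreal (u y) \<partial>lborel) = ennreal p"
      using ennreal_finite_obtain[OF pos[of a R]] .
    have "ball_mean u a R = -\<infinity>"
    proof -
      have "enn2ereal (\<infinity>::ennreal) = \<infinity>" by (simp add: top_ereal_def enn2ereal_top)
      then show ?thesis
        unfolding ball_mean_def inf p(2) using p(1) content_ball_pos[OF R, of a]
        by (simp add: enn2ereal_ennreal)
    qed
    moreover have "u a \<le> ball_mean u a R" by (rule subharmonicD(3)[OF su R])
    ultimately show False using a by simp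
  qed
  then show "(\<integral>\<^sup>+ y \<in> ball x r. e2ennreal (- u y) \<partial>lborel) < \<infinity>"
  proof (rule le_less_trans[rotated])
    show "(\<integral>\<^sup>+ y \<in> ball x r. e2ennreal (- u y) \<partial>lborel) \<le> (\<integral>\<^sup>+ y \<in> ball a R. e2ennreal (- u y) \<partial>lborel)"
      using sub by (intro nn_integral_mono) (auto simp: indicator_def)
  qed
qed

lemma sh_finite_less: "u \<in> sh_functions \<Longrightarrow> u y < \<infinity>"
  by (rule subharmonicD(1)[OF sh_subharmonic])

lemma sh_measurable: "u \<in> sh_functions \<Longrightarrow> u \<in> borel_measurable borel"
  by (simp add: sh_functions_def subharmonic_measurable)

lemma sh_real_measurable: "u \<in> sh_functions \<Longrightarrow> (\<lambda>y. real_of_ereal (u y)) \<in> borel_measurable borel"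
  by (rule borel_measurable_real_of_ereal) (rule sh_measurable)

lemma sh_AE_finite:
  fixes u :: "real^'m \<Rightarrow> ereal"
  assumes u: "u \<in> sh_functions"
  shows "AE y in lborel. ereal (real_of_ereal (u y)) = u y"
proof -
  have "AE y in lborel. \<forall>n::nat. y \<in> ball 0 (real n) \<longrightarrow> u y \<noteq> -\<infinity>"
    unfolding AE_all_countable
    by (intro allI ball_mean_eq(1)[OF sh_measurable[OF u] sh_finite_less[OF u] sh_finite_parts[OF u]])
  then show ?thesis
  proof eventually_elim
    fix y assume *: "\<forall>n::nat. y \<in> ball 0 (real n) \<longrightarrow> u y \<noteq> -\<infinity>"
    obtain n :: nat where "norm y < real n" using reals_Archimedean2 by blast
    then have "u y \<noteq> -\<infinity>" using *[rule_format, of n] by simp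
    then show "ereal (real_of_ereal (u y)) = u y" using sh_finite_less[OF u, of y] by (cases "u y") auto
  qed
qed

lemma sh_integrable_ball:
  fixes u :: "real^'m \<Rightarrow> ereal"
  assumes u: "u \<in> sh_functions"
  shows "integrable lborel (\<lambda>y. indicator (ball x r) y * real_of_ereal (u y))"
  by (rule ball_mean_eq(2)[OF sh_measurable[OF u] sh_finite_less[OF u] sh_finite_parts[OF u]])

lemma sh_integrable_cball:
  fixes u :: "real^'m \<Rightarrow> ereal"
  assumes u: "u \<in> sh_functions"
  shows "integrable lborel (\<lambda>y. indicator (cball x r) y * real_of_ereal (u y))"
proof (rule Bochner_Integration.integrable_bound[OF sh_integrable_ball[OF u, of x "r + 1"]])
  note [measurable] = sh_real_measurable[OF u]
  show "(\<lambda>y. indicator (cball x r) y * real_of_ereal (u y)) \<in> borel_measurable lborel" by measurable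
  show "AE y in lborel. norm (indicator (cball x r) y * real_of_ereal (u y)) \<le> norm (indicator (ball x (r + 1)) y * real_of_ereal (u y))"
  proof (rule AE_I2)
    fix y show "norm (indicator (cball x r) y * real_of_ereal (u y)) \<le> norm (indicator (ball x (r + 1)) y * real_of_ereal (u y))"
      by (cases "y \<in> cball x r") simp_all
  qed
qed

lemma sh_submean:
  fixes u :: "real^'m \<Rightarrow> ereal"
  assumes u: "u \<in> sh_functions" and r: "0 < r"
  shows "u x \<le> ereal ((LINT y|lborel. indicator (ball x r) y * real_of_ereal (u y)) / measure lborel (ball x r))"
proof -
  have "u x \<le> ball_mean u x r" by (rule subharmonicD(3)[OF sh_subharmonic[OF u] r])
  then show ?thesis
    using ball_mean_eq(3)[OF sh_measurable[OF u] sh_finite_less[OF u] sh_finite_parts[OF u], of x r] by simp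
qed

text \<open>The sub-mean-value inequality at 0 makes the integral of u nonnegative, and
  \<open>\<bar>u\<bar> \<le> 2 * B - u\<close> wherever \<open>u \<le> B\<close>. Hence an upper
  bound alone controls L1 norms, uniformly over \<open>U\<close> and over the rescalings of the
  constructed function.\<close>

lemma sh_L1_bound:
  fixes u :: "real^'m \<Rightarrow> ereal"
  assumes u: "u \<in> sh_functions" and u0: "u 0 = 0" and r: "0 < r"
    and B: "0 \<le> B" "\<And>y. y \<in> ball 0 r \<Longrightarrow> real_of_ereal (u y) \<le> B"
  shows "(LINT y|lborel. indicator (ball 0 r) y * \<bar>real_of_ereal (u y)\<bar>) \<le> 2 * B * measure lborel (ball (0::real^'m) r)"
proof -
  define f where "f y = real_of_ereal (u y)" for y
  let ?\<mu> = "measure lborel (ball (0::real^'m) r)"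
  have i: "integrable lborel (\<lambda>y. indicator (ball 0 r) y * f y)"
    unfolding f_def by (rule sh_integrable_ball[OF u])
  have ind: "integrable lborel (\<lambda>y. indicator (ball (0::real^'m) r) y :: real)"
    by (rule integrable_bounded_on_cball[of _ 0 r 1]) (auto simp: indicator_def)
  have "0 \<le> (LINT y|lborel. indicator (ball 0 r) y * f y) / ?\<mu>"
    using sh_submean[OF u r, of 0] unfolding u0 f_def[symmetric] by simp
  moreover have "0 < ?\<mu>" by (rule content_ball_pos[OF r])
  ultimately have nn: "0 \<le> (LINT y|lborel. indicator (ball 0 r) y * f y)"
    by (metis divide_neg_pos not_le)
  have "(LINT y|lborel. indicator (ball 0 r) y * \<bar>f y\<bar>) \<le> (LINT y|lborel. 2 * B * indicator (ball 0 r) y - indicator (ball 0 r) y * f y)"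
  proof (rule integral_mono)
    show "integrable lborel (\<lambda>y. indicator (ball 0 r) y * \<bar>f y\<bar>)" using integrable_abs[OF i] by (simp add: abs_mult)
    show "integrable lborel (\<lambda>y. 2 * B * indicator (ball 0 r) y - indicator (ball 0 r) y * f y)" using i ind by simp
    fix y :: "real^'m"
    show "indicator (ball 0 r) y * \<bar>f y\<bar> \<le> 2 * B * indicator (ball 0 r) y - indicator (ball 0 r) y * f y"
    proof (cases "y \<in> ball 0 r")
      case True
      have "\<bar>f y\<bar> \<le> 2 * B - f y" using B(1) B(2)[OF True, folded f_def] by linarith
      then show ?thesis using True by simp
    qed simp
  qed
  also have "\<dots> = 2 * B * ?\<mu> - (LINT y|lborel. indicator (ball 0 r) y * f y)"
    by (subst Bochner_Integration.integral_diff[OF integrable_mult_right[OF ind] i]) simp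
  finally show ?thesis using nn unfolding f_def by linarith
qed

text \<open>Near x upper semicontinuity keeps v below \<open>c + e\<close>, hence also its mean over
  a small ball; that mean equals the mean of u, which dominates \<open>u x\<close>.\<close>

lemma sh_le_if_ball_integrals_eq:
  fixes u v :: "real^'m \<Rightarrow> ereal"
  assumes u: "u \<in> sh_functions" and v: "v \<in> sh_functions"
    and eq: "\<And>x r. 0 < r \<Longrightarrow> (LINT y|lborel. indicator (ball x r) y * real_of_ereal (u y)) =
      (LINT y|lborel. indicator (ball x r) y * real_of_ereal (v y))"
  shows "u x \<le> v x"
proof (rule ereal_le_real)
  fix c :: real assume vc: "v x \<le> ereal c"
  define f where "f y = real_of_ereal (u y)" for y
  define g where "g y = real_of_ereal (v y)" for y
  show "u x \<le> ereal c"
  proof (rule ereal_le_epsilon2)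
    fix e :: real assume e: "0 < e"
    have op: "open {y. v y < ereal (c + e)}" by (rule subharmonicD(2)[OF sh_subharmonic[OF v]])
    have "ereal c < ereal (c + e)" using e by simp
    with vc have "v x < ereal (c + e)" by (rule le_less_trans)
    then have "x \<in> {y. v y < ereal (c + e)}" by (rule CollectI)
    with op obtain r where r: "0 < r" "ball x r \<subseteq> {y. v y < ereal (c + e)}"
      by (rule openE)
    let ?\<mu> = "measure lborel (ball x r)"
    have "(LINT y|lborel. indicator (ball x r) y * f y) = (LINT y|lborel. indicator (ball x r) y * g y)"
      unfolding f_def g_def by (rule eq[OF r(1)])
    also have "\<dots> \<le> (LINT y|lborel. (c + e) * indicator (ball x r) y)"
    proof (rule integral_mono_AE)
      show "integrable lborel (\<lambda>y. indicator (ball x r) y * g y)"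
        unfolding g_def by (rule sh_integrable_ball[OF v])
      show "integrable lborel (\<lambda>y. (c + e) * indicator (ball x r) y)"
        by (rule integrable_bounded_on_cball[of _ x r "\<bar>c + e\<bar>"]) (auto simp: indicator_def)
      show "AE y in lborel. indicator (ball x r) y * g y \<le> (c + e) * indicator (ball x r) y"
        using sh_AE_finite[OF v, folded g_def]
      proof eventually_elim
        fix y assume *: "ereal (g y) = v y"
        show "indicator (ball x r) y * g y \<le> (c + e) * indicator (ball x r) y"
        proof (cases "y \<in> ball x r")
          case True
          from subsetD[OF r(2) True] have "v y < ereal (c + e)" by (rule CollectD)
          then have "g y < c + e" unfolding *[symmetric] by (simp only: less_ereal.simps)
          then show ?thesis using True by simp
        qed simp
      qed
    qed
    also have "\<dots> = (c + e) * ?\<mu>" by simp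
    finally have *: "(LINT y|lborel. indicator (ball x r) y * f y) \<le> (c + e) * ?\<mu>" .
    have "0 < ?\<mu>" by (rule content_ball_pos[OF r(1)])
    with * have "(LINT y|lborel. indicator (ball x r) y * f y) / ?\<mu> \<le> c + e"
      by (simp only: pos_divide_le_eq)
    then have "ereal ((LINT y|lborel. indicator (ball x r) y * f y) / ?\<mu>) \<le> ereal (c + e)"
      by (simp only: ereal_less_eq)
    with sh_submean[OF u r(1), of x, folded f_def] have "u x \<le> ereal (c + e)" by (rule order_trans)
    then show "u x \<le> ereal c + ereal e" by simp
  qed
qed

lemma sh_eq_if_ball_integrals_eq:
  fixes u v :: "real^'m \<Rightarrow> ereal"
  assumes "u \<in> sh_functions" "v \<in> sh_functions"
    and "\<And>x r. 0 < r \<Longrightarrow> (LINT y|lborel. indicator (ball x r) y * real_of_ereal (u y)) =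
      (LINT y|lborel. indicator (ball x r) y * real_of_ereal (v y))"
  shows "u = v"
proof (rule ext, rule antisym)
  fix x
  show "u x \<le> v x" by (rule sh_le_if_ball_integrals_eq[OF assms])
  show "v x \<le> u x" by (rule sh_le_if_ball_integrals_eq[OF assms(2,1) assms(3)[symmetric]])
qed

lemma integral_ball_rescale:
  fixes f :: "'a::euclidean_space \<Rightarrow> real"
  assumes f [measurable]: "f \<in> borel_measurable borel" and r: "0 < r"
  shows "(LINT y|lborel. indicator (ball x r) y * f y) = r ^ DIM('a) * (LINT y|lborel. indicator (ball 0 1) y * f (x + r *\<^sub>R y))"
proof -
  have "(LINT y|lborel. indicator (ball 0 1) y * f (x + r *\<^sub>R y)) = (LINT y|lborel. indicator (ball x r) (r *\<^sub>R y + x) * f (r *\<^sub>R y + x))"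
    using r by (intro Bochner_Integration.integral_cong refl)
      (auto simp: indicator_def dist_norm add.commute norm_minus_commute)
  also have "\<dots> = (LINT y|lborel. indicator (ball x r) (y + x) * f (y + x)) / r ^ DIM('a)"
    using integral_lborel_similarity(1)[OF orthogonal_transformation_id r, of "\<lambda>y. indicator (ball x r) (y + x) * f (y + x)"]
    by simp
  also have "(LINT y|lborel. indicator (ball x r) (y + x) * f (y + x)) = (LINT y|lborel. indicator (ball x r) y * f y)"
    using integral_lborel_translate(1)[of "\<lambda>y. indicator (ball x r) y * f y" x] by simp
  finally show ?thesis using r by simp
qed

lemma measure_ball_rescale:
  fixes x :: "'a::euclidean_space"
  shows "0 < r \<Longrightarrow> measure lborel (ball x r) = r ^ DIM('a) * measure lborel (ball (0::'a) 1)"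
  using integral_ball_rescale[of "\<lambda>_::'a. 1" r x] by simp

text \<open>The Green integral of a nonnegative function is nonnegative, so the identity becomes the
  sub-mean-value inequality.\<close>

lemma weak_laplacian_nonneg_imp_subharmonic:
  fixes f :: "real^'m \<Rightarrow> real"
  assumes wl: "weak_laplacian f l" and l: "\<And>x. 0 \<le> l x"
  shows "subharmonic (\<lambda>x. ereal (f x))"
  unfolding subharmonic_def
proof (intro conjI allI impI)
  have cf: "continuous_on UNIV f" using wl by (simp add: weak_laplacian_def)
  have [measurable]: "f \<in> borel_measurable borel" by (rule borel_measurable_continuous_onI[OF cf])
  show "ereal (f x) < \<infinity>" for x by simp
  show "open {x. ereal (f x) < c}" for c
  proof (cases c)
    case (real b)
    show ?thesis unfolding real less_ereal.simps by (intro open_Collect_less cf continuous_on_const)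
  next
    case PInf
    show ?thesis unfolding PInf less_ereal.simps by (simp only: UNIV_def[symmetric] open_UNIV)
  next
    case MInf
    show ?thesis unfolding MInf less_ereal.simps by (simp only: empty_def[symmetric] open_empty)
  qed
  fix x :: "real^'m" and r :: real assume r: "0 < r"
  have cc: "continuous_on (cball x r) f" by (rule continuous_on_subset[OF cf]) simp
  obtain M where M: "0 \<le> M" "\<And>y. y \<in> cball x r \<Longrightarrow> \<bar>f y\<bar> \<le> M"
    using continuous_bounded_on_cball[OF cc] by metis
  have fin: "(\<integral>\<^sup>+ y \<in> ball x r. e2ennreal (h y) \<partial>lborel) < \<infinity>" if "\<And>y. y \<in> ball x r \<Longrightarrow> h y \<le> ereal M" for h
  proof -
    have "(\<integral>\<^sup>+ y \<in> ball x r. e2ennreal (h y) \<partial>lborel) \<le> (\<integral>\<^sup>+ y. ennreal M * indicator (ball x r) y \<partial>lborel)"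
    proof (rule nn_integral_mono)
      fix y show "e2ennreal (h y) * indicator (ball x r) y \<le> ennreal M * indicator (ball x r) y"
        using that[of y] e2ennreal_mono[of "h y" "ereal M"] by (auto simp: indicator_def)
    qed
    also have "\<dots> = ennreal M * emeasure lborel (ball x r)" by (simp add: nn_integral_cmult_indicator)
    also have "\<dots> < \<infinity>" using emeasure_lborel_ball_finite[of x r] by (simp add: ennreal_mult_less_top)
    finally show ?thesis .
  qed
  have "ball_mean (\<lambda>x. ereal (f x)) x r = ereal ((LINT y|lborel. indicator (ball x r) y * real_of_ereal (ereal (f y))) / measure lborel (ball x r))"
  proof (intro ball_mean_eq(3) fin)
    fix y assume "y \<in> ball x r"
    then have "\<bar>f y\<bar> \<le> M" by (intro M(2)) simp
    then show "ereal (f y) \<le> ereal M" "- ereal (f y) \<le> ereal M" by auto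
  qed auto
  also have "\<dots> = ereal ((LINT y|lborel. indicator (ball 0 1) y * f (x + r *\<^sub>R y)) / measure lborel (ball (0::real^'m) 1))"
    using r integral_ball_rescale[of f r x] by (simp add: measure_ball_rescale[OF r, of x])
  finally have bm: "ball_mean (\<lambda>x. ereal (f x)) x r = \<dots>" .
  have "0 \<le> (LINT p|lborel. green_weight r p * l (x + fst p *\<^sub>R snd p))"
    using l by (intro integral_nonneg_AE) (auto simp: green_weight_nonneg)
  then have "f x * measure lborel (ball (0::real^'m) 1) \<le> (LINT y|lborel. indicator (ball 0 1) y * f (x + r *\<^sub>R y))"
    using wl r unfolding weak_laplacian_alt by simp
  then show "ereal (f x) \<le> ball_mean (\<lambda>x. ereal (f x)) x r"
    unfolding bm using content_ball_pos[of 1 "0::real^'m"] by (simp add: pos_le_divide_eq)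
qed

section \<open>Pairing subharmonic functions with weak Laplacians\<close>

lemma integrable_times_bounded:
  fixes w h :: "'a::euclidean_space \<Rightarrow> real"
  assumes w: "w \<in> borel_measurable borel" "integrable lborel (\<lambda>z. indicator (cball 0 S) z * w z)"
    and h: "h \<in> borel_measurable borel" "\<And>z. \<bar>h z\<bar> \<le> M" "\<And>z. z \<notin> cball 0 S \<Longrightarrow> h z = 0"
  shows "integrable lborel (\<lambda>z. w z * h z)"
    and "\<bar>LINT z|lborel. w z * h z\<bar> \<le> M * (LINT z|lborel. indicator (cball 0 S) z * \<bar>w z\<bar>)"
proof -
  note [measurable] = w(1) h(1)
  have le: "\<bar>w z * h z\<bar> \<le> M * (indicator (cball 0 S) z * \<bar>w z\<bar>)" for z
  proof (cases "z \<in> cball 0 S")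
    case True
    have "\<bar>h z\<bar> * \<bar>w z\<bar> \<le> M * \<bar>w z\<bar>" by (intro mult_right_mono h(2)) auto
    then show ?thesis using True by (simp add: abs_mult mult.commute)
  qed (simp add: h(3))
  have i: "integrable lborel (\<lambda>z. M * (indicator (cball 0 S) z * \<bar>w z\<bar>))"
    using integrable_abs[OF w(2)] by (simp add: abs_mult)
  show "integrable lborel (\<lambda>z. w z * h z)"
    by (rule Bochner_Integration.integrable_bound[OF i]) (use le in \<open>auto intro!: AE_I2 order_trans[OF _ abs_ge_self]\<close>)
  have "\<bar>LINT z|lborel. w z * h z\<bar> \<le> (LINT z|lborel. \<bar>w z * h z\<bar>)" by (rule integral_abs_bound)
  also have "\<dots> \<le> (LINT z|lborel. M * (indicator (cball 0 S) z * \<bar>w z\<bar>))"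
    by (intro integral_mono integrable_abs \<open>integrable lborel (\<lambda>z. w z * h z)\<close> i le)
  also have "\<dots> = M * (LINT z|lborel. indicator (cball 0 S) z * \<bar>w z\<bar>)" by simp
  finally show "\<bar>LINT z|lborel. w z * h z\<bar> \<le> M * (LINT z|lborel. indicator (cball 0 S) z * \<bar>w z\<bar>)" .
qed

lemma integral_green_weight_pos:
  assumes r: "0 < r"
  shows "0 < (LINT p|lborel. green_weight r (p :: real \<times> 'a::euclidean_space))"
proof -
  have i: "integrable lborel (green_weight r :: real \<times> 'a \<Rightarrow> real)"
    using integrable_green_continuous[of "\<lambda>_::'a. 1" r 0] by simp
  have "0 \<le> (LINT p|lborel. green_weight r (p :: real \<times> 'a))"
    by (rule integral_nonneg_AE) (simp add: green_weight_nonneg)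
  moreover have "(LINT p|lborel. green_weight r (p :: real \<times> 'a)) \<noteq> 0"
  proof
    assume "(LINT p|lborel. green_weight r (p :: real \<times> 'a)) = 0"
    then have AE: "AE p in lborel. green_weight r (p :: real \<times> 'a) = 0"
      using integral_nonneg_eq_0_iff_AE[OF i] by (simp add: green_weight_nonneg)
    let ?O = "{0<..<r} \<times> ball (0::'a) 1"
    have op: "open ?O" by (intro open_Times open_greaterThanLessThan open_ball)
    have pos: "green_weight r p \<noteq> 0" if p: "p \<in> ?O" for p
    proof -
      obtain s y where "p = (s, y)" by (cases p)
      with p have sy: "p = (s, y)" "0 < s" "s < r" "norm y < 1" by auto
      then have "(norm y)\<^sup>2 < 1" using power_strict_mono[of "norm y" 1 2] by simp
      then show ?thesis using sy by (simp add: green_weight_def)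
    qed
    have "AE p in lborel. p \<notin> ?O" using AE by eventually_elim (use pos in blast)
    then have "?O \<in> null_sets lborel"
      by (rule AE_iff_null_sets[THEN iffD2, rotated]) (simp add: borel_open[OF op])
    then have "negligible ?O" by (simp add: negligible_iff_null_sets null_sets_completionI)
    moreover have "?O \<noteq> {}" using r by (auto simp: intro!: exI[of _ "r / 2"])
    ultimately show False using open_not_negligible[OF op] by blast
  qed
  ultimately show ?thesis by linarith
qed

text \<open>The distributional Laplacian of w is a positive measure, derived from mean values alone.
  \<open>G r\<close> is, up to a factor, the excess of the ball mean of \<Phi> over \<Phi>.
  Averaging over balls is symmetric, so Fubini moves it onto w, whose excess is nonnegative. As r
  tends to 0, \<open>G r\<close> divided by the total Green weight tends to l uniformly.\<close>

lemma sh_integral_weak_laplacian_nonneg: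
  fixes w :: "real^'m \<Rightarrow> ereal"
  assumes w: "w \<in> sh_functions" and wl: "weak_laplacian \<Phi> l" and \<Phi>: "\<And>z. 0 \<le> \<Phi> z"
    and supp: "\<And>z. z \<notin> cball 0 S \<Longrightarrow> \<Phi> z = 0" "\<And>z. z \<notin> cball 0 S \<Longrightarrow> l z = 0"
  shows "0 \<le> (LINT z|lborel. real_of_ereal (w z) * l z)"
proof -
  define f where "f z = real_of_ereal (w z)" for z
  have mf [measurable]: "f \<in> borel_measurable borel"
    using sh_real_measurable[OF w] unfolding f_def[abs_def] .
  have if_c: "integrable lborel (\<lambda>z. indicator (cball 0 R) z * f z)" for R
    unfolding f_def by (rule sh_integrable_cball[OF w])
  have if_b: "integrable lborel (\<lambda>z. indicator (ball x R) z * f z)" for x R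
    unfolding f_def by (rule sh_integrable_ball[OF w])
  have c\<Phi>: "continuous_on UNIV \<Phi>" and cl: "continuous_on UNIV l" using wl by (auto simp: weak_laplacian_def)
  have [measurable]: "\<Phi> \<in> borel_measurable borel" "l \<in> borel_measurable borel"
    by (intro borel_measurable_continuous_onI c\<Phi> cl)+
  have bdd: "\<exists>M\<ge>0. \<forall>z. \<bar>h z\<bar> \<le> M" if h: "continuous_on UNIV h" "\<And>z. z \<notin> cball 0 S \<Longrightarrow> h z = 0" for h :: "real^'m \<Rightarrow> real"
  proof -
    obtain M where M: "0 \<le> M" "\<And>z. z \<in> cball 0 S \<Longrightarrow> \<bar>h z\<bar> \<le> M"
      using continuous_bounded_on_cball[OF continuous_on_subset[OF h(1) subset_UNIV]] by metis
    have "\<bar>h z\<bar> \<le> M" for z using M h(2)[of z] by (cases "z \<in> cball 0 S") auto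
    then show ?thesis using M(1) by blast
  qed
  obtain M1 where M1: "0 \<le> M1" "\<And>z. \<bar>\<Phi> z\<bar> \<le> M1" using bdd[OF c\<Phi> supp(1)] by blast
  obtain M2 where M2: "0 \<le> M2" "\<And>z. \<bar>l z\<bar> \<le> M2" using bdd[OF cl supp(2)] by blast
  have i\<Phi>: "integrable lborel \<Phi>"
    by (rule integrable_bounded_on_cball[of _ 0 S M1]) (use M1 supp(1) in auto)
  define \<beta> where "\<beta> = measure lborel (ball (0::real^'m) 1)"
  define G where "G r z = (LINT p|lborel. green_weight r p * l (z + fst p *\<^sub>R snd p))" for r z
  define C where "C = (LINT z|lborel. indicator (cball 0 (S + 1)) z * \<bar>f z\<bar>)"
  have if\<Phi>: "integrable lborel (\<lambda>z. f z * \<Phi> z)"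
    by (rule integrable_times_bounded(1)[of f S \<Phi> M1]) (use M1 supp(1) if_c in auto)
  have ifl: "integrable lborel (\<lambda>z. f z * l z)"
    by (rule integrable_times_bounded(1)[of f S l M2]) (use M2 supp(2) if_c in auto)
  have stepA: "0 \<le> (LINT z|lborel. f z * G r z)" and iG: "integrable lborel (\<lambda>z. f z * G r z)" if r: "0 < r" "r \<le> 1" for r
  proof -
    define m where "m = DIM(real^'m)"
    let ?A = "\<lambda>z. (LINT z'|lborel. indicator (ball z r) z' * \<Phi> z')"
    have rm: "0 < r ^ m" using r by simp
    have G_eq: "G r z = ?A z / r ^ m - \<Phi> z * \<beta>" for z
    proof -
      have "?A z = r ^ m * (LINT y|lborel. indicator (ball 0 1) y * \<Phi> (z + r *\<^sub>R y))"
        unfolding m_def by (rule integral_ball_rescale) (use r in auto)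
      moreover have "(LINT y|lborel. indicator (ball 0 1) y * \<Phi> (z + r *\<^sub>R y)) = \<Phi> z * \<beta> + G r z"
        using wl r(1) unfolding weak_laplacian_alt \<beta>_def G_def by blast
      ultimately show ?thesis using r(1) by simp
    qed
    let ?F = "\<lambda>q. f (fst q) * (indicator {q. dist (fst q) (snd q) < r} q * \<Phi> (snd q))"
    have op: "{q :: (real^'m) \<times> (real^'m). dist (fst q) (snd q) < r} \<in> sets (borel \<Otimes>\<^sub>M borel)"
      unfolding borel_prod by (intro borel_open open_Collect_less continuous_intros)
    have iF: "integrable (lborel \<Otimes>\<^sub>M lborel) ?F"
    proof (rule Bochner_Integration.integrable_bound[OF integrable_lborel_prod_times[OF if_c[of "S + 1"] i\<Phi>]])
      show "?F \<in> borel_measurable (lborel \<Otimes>\<^sub>M lborel)"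
        by (intro borel_measurable_times borel_measurable_indicator) (use op in \<open>auto simp: measurable_lborel1 cong: measurable_cong_sets\<close>)
      show "AE q in lborel \<Otimes>\<^sub>M lborel. norm (?F q) \<le> norm (indicator (cball 0 (S + 1)) (fst q) * f (fst q) * \<Phi> (snd q))"
      proof (rule AE_I2)
        fix q :: "(real^'m) \<times> (real^'m)"
        show "norm (?F q) \<le> norm (indicator (cball 0 (S + 1)) (fst q) * f (fst q) * \<Phi> (snd q))"
        proof (cases "dist (fst q) (snd q) < r \<and> snd q \<in> cball 0 S")
          case True
          then have "fst q \<in> cball 0 (S + 1)" using dist_triangle[of 0 "fst q" "snd q"] r
            by (simp add: dist_commute)
          then show ?thesis using True by (simp add: abs_mult)
        next
          case False
          then have 0: "indicator {q. dist (fst q) (snd q) < r} q * \<Phi> (snd q) = 0" using supp(1) by (auto simp: indicator_def)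
          show ?thesis unfolding 0 by simp
        qed
      qed
    qed
    then have iF': "integrable (lborel \<Otimes>\<^sub>M lborel) (\<lambda>(z, z'). ?F (z, z'))" by (simp add: case_prod_unfold)
    have ind: "indicator {q. dist (fst q) (snd q) < r} (z, z') = (indicator (ball z r) z' :: real)"
      "(indicator (ball z r) z' :: real) = indicator (ball z' r) z" for z z' :: "real^'m"
      by (auto simp: indicator_def dist_commute)
    have inner: "(LINT z'|lborel. ?F (z, z')) = f z * ?A z" for z
      by (simp add: ind(1))
    have "integrable lborel (\<lambda>z. LINT z'|lborel. ?F (z, z'))" using lborel_pair.integrable_fst'[OF iF] .
    then have ifA: "integrable lborel (\<lambda>z. f z * ?A z)" unfolding inner .
    have "(\<lambda>z. f z * G r z) = (\<lambda>z. f z * ?A z / r ^ m - f z * \<Phi> z * \<beta>)"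
      by (simp add: G_eq algebra_simps)
    then show "integrable lborel (\<lambda>z. f z * G r z)" using ifA if\<Phi> by simp
    have inner': "(LINT z|lborel. ?F (z, z')) = \<Phi> z' * (LINT z|lborel. indicator (ball z' r) z * f z)" for z'
    proof -
      have "(LINT z|lborel. ?F (z, z')) = (LINT z|lborel. \<Phi> z' * (indicator (ball z' r) z * f z))"
        by (intro Bochner_Integration.integral_cong refl) (simp add: ind)
      then show ?thesis by simp
    qed
    have "(LINT z|lborel. f z * ?A z) = (LINT z|lborel. LINT z'|lborel. ?F (z, z'))" unfolding inner ..
    also have "\<dots> = (LINT z'|lborel. LINT z|lborel. ?F (z, z'))"
      using lborel_pair.Fubini_integral[OF iF'] by simp
    also have "\<dots> = (LINT z'|lborel. \<Phi> z' * (LINT z|lborel. indicator (ball z' r) z * f z))" unfolding inner' ..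
    finally have eq: "(LINT z|lborel. f z * ?A z) = (LINT z'|lborel. \<Phi> z' * (LINT z|lborel. indicator (ball z' r) z * f z))" .
    have iR: "integrable lborel (\<lambda>z'. \<Phi> z' * (LINT z|lborel. indicator (ball z' r) z * f z))"
      using lborel_pair.integrable_snd[OF iF'] unfolding inner' .
    have "(LINT z|lborel. f z * \<Phi> z * \<beta> * r ^ m) \<le> (LINT z'|lborel. \<Phi> z' * (LINT z|lborel. indicator (ball z' r) z * f z))"
    proof (rule integral_mono_AE)
      show "AE z in lborel. f z * \<Phi> z * \<beta> * r ^ m \<le> \<Phi> z * (LINT y|lborel. indicator (ball z r) y * f y)"
        using sh_AE_finite[OF w, folded f_def]
      proof eventually_elim
        fix z assume *: "ereal (f z) = w z"
        let ?I = "LINT y|lborel. indicator (ball z r) y * f y"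
        have "ereal (f z) \<le> ereal (?I / measure lborel (ball z r))"
          unfolding * using sh_submean[OF w r(1), of z, folded f_def] .
        then have "f z \<le> ?I / measure lborel (ball z r)" by (simp only: ereal_less_eq)
        then have "f z * measure lborel (ball z r) \<le> ?I"
          by (simp only: pos_le_divide_eq[OF content_ball_pos[OF r(1)]])
        then have "f z * (r ^ m * \<beta>) \<le> ?I"
          unfolding measure_ball_rescale[OF r(1), of z] \<beta>_def m_def .
        from mult_left_mono[OF this \<Phi>[of z]] show "f z * \<Phi> z * \<beta> * r ^ m \<le> \<Phi> z * ?I" by (simp add: mult_ac)
      qed
    qed (use iR if\<Phi> in auto)
    then have "(LINT z|lborel. f z * \<Phi> z) * \<beta> * r ^ m \<le> (LINT z|lborel. f z * ?A z)" unfolding eq by simp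
    moreover have "(LINT z|lborel. f z * G r z) = (LINT z|lborel. f z * ?A z) / r ^ m - (LINT z|lborel. f z * \<Phi> z) * \<beta>"
      unfolding \<open>(\<lambda>z. f z * G r z) = _\<close> using ifA if\<Phi> by (subst Bochner_Integration.integral_diff) auto
    ultimately show "0 \<le> (LINT z|lborel. f z * G r z)" using rm by (simp add: pos_le_divide_eq)
  qed
  have C0: "0 \<le> C" unfolding C_def by (rule integral_nonneg_AE) simp
  \<comment> \<open>The mass \<kappa> of the Green weight divides out. What remains of the error is
    a bound \<omega> for the oscillation of l at scale r, times the mass C of f near the
    support.\<close>
  have lb: "- (\<omega> * C) \<le> (LINT z|lborel. f z * l z)" if \<omega>: "0 < \<omega>" for \<omega>
  proof -
    have "uniformly_continuous_on (cball 0 (S + 2)) l"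
      by (rule compact_uniformly_continuous[OF continuous_on_subset[OF cl subset_UNIV]]) simp
    then obtain \<delta> where \<delta>: "0 < \<delta>" "\<And>x y. x \<in> cball 0 (S + 2) \<Longrightarrow> y \<in> cball 0 (S + 2) \<Longrightarrow> dist y x < \<delta> \<Longrightarrow> dist (l y) (l x) < \<omega>"
      using \<omega> unfolding uniformly_continuous_on_def by blast
    define r where "r = min 1 (\<delta> / 2)"
    have r: "0 < r" "r \<le> 1" "r < \<delta>" using \<delta>(1) by (auto simp: r_def min_def)
    define \<kappa> where "\<kappa> = (LINT p|lborel. green_weight r (p :: real \<times> (real^'m)))"
    have \<kappa>: "0 < \<kappa>" unfolding \<kappa>_def by (rule integral_green_weight_pos[OF r(1)])
    have ig: "integrable lborel (green_weight r :: real \<times> (real^'m) \<Rightarrow> real)"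
      using integrable_green_continuous[of "\<lambda>_::real^'m. 1" r 0] by simp
    have near: "norm (fst p *\<^sub>R snd p) \<le> r" if "green_weight r p \<noteq> 0" for p :: "real \<times> (real^'m)"
    proof -
      have "p \<in> {0..r} \<times> ball 0 1" using that by (auto simp: green_weight_def indicator_def split: if_splits)
      then have "\<bar>fst p\<bar> * norm (snd p) \<le> r * 1" by (intro mult_mono) auto
      then show ?thesis by simp
    qed
    have Gl: "\<bar>G r z - \<kappa> * l z\<bar> \<le> \<kappa> * \<omega>" if z: "z \<in> cball 0 (S + 1)" for z
    proof -
      have "G r z - \<kappa> * l z = (LINT p|lborel. green_weight r p * (l (z + fst p *\<^sub>R snd p) - l z))"
        unfolding G_def \<kappa>_def using integrable_green_continuous[OF cl, of r z] ig
        by (simp add: right_diff_distrib)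
      also have "\<bar>\<dots>\<bar> \<le> (LINT p|lborel. green_weight r (p :: real \<times> (real^'m)) * \<omega>)"
      proof (rule order_trans[OF integral_abs_bound integral_mono])
        show "integrable lborel (\<lambda>p. \<bar>green_weight r p * (l (z + fst p *\<^sub>R snd p) - l z)\<bar>)"
          using integrable_green_continuous[OF cl, of r z] ig by (simp add: right_diff_distrib)
        show "integrable lborel (\<lambda>p::real \<times> (real^'m). green_weight r p * \<omega>)" using ig by simp
        fix p :: "real \<times> (real^'m)"
        show "\<bar>green_weight r p * (l (z + fst p *\<^sub>R snd p) - l z)\<bar> \<le> green_weight r p * \<omega>"
        proof (cases "green_weight r p = 0")
          case False
          let ?h = "fst p *\<^sub>R snd p"
          have "norm ?h \<le> r" using near[OF False] .
          moreover have z': "norm z \<le> S + 1" using z by simp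
          ultimately have "norm (z + ?h) \<le> S + 2" using norm_triangle_ineq[of z ?h] r(2) by linarith
          then have "z + ?h \<in> cball 0 (S + 2)" by simp
          moreover have "z \<in> cball 0 (S + 2)" using z' by simp
          moreover have "dist (z + ?h) z < \<delta>" using \<open>norm ?h \<le> r\<close> r(3) by (simp add: dist_norm)
          ultimately have "dist (l (z + ?h)) (l z) < \<omega>" by (intro \<delta>(2))
          then show ?thesis using green_weight_nonneg[of r p]
            by (simp add: abs_mult dist_norm mult_left_mono)
        qed simp
      qed
      also have "\<dots> = \<kappa> * \<omega>" unfolding \<kappa>_def by simp
      finally show ?thesis .
    qed
    have Gl0: "G r z - \<kappa> * l z = 0" if z: "z \<notin> cball 0 (S + 1)" for z
    proof -
      have "green_weight r p * l (z + fst p *\<^sub>R snd p) = 0" for p :: "real \<times> (real^'m)"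
      proof (cases "green_weight r p = 0")
        case False
        have "norm (fst p *\<^sub>R snd p) \<le> r" using near[OF False] .
        moreover have "norm z \<le> norm (z + fst p *\<^sub>R snd p) + norm (fst p *\<^sub>R snd p)"
          using norm_triangle_ineq4[of "z + fst p *\<^sub>R snd p" "fst p *\<^sub>R snd p"] by simp
        ultimately have "z + fst p *\<^sub>R snd p \<notin> cball 0 S" using z r(2) by simp
        then show ?thesis by (simp add: supp(2))
      qed simp
      moreover have "l z = 0" using z by (intro supp(2)) auto
      moreover from calculation(1) have "G r z = 0"
        unfolding G_def by (intro integral_eq_zero_AE AE_I2)
      ultimately show ?thesis by simp
    qed
    have Gl': "\<bar>G r z - \<kappa> * l z\<bar> \<le> \<kappa> * \<omega>" for z
      using Gl[of z] Gl0[of z] \<kappa> \<omega> by (cases "z \<in> cball 0 (S + 1)") auto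
    have mG: "(\<lambda>z. G r z - \<kappa> * l z) \<in> borel_measurable borel"
    proof -
      have S: "sets (borel \<Otimes>\<^sub>M lborel) = sets (borel :: ((real^'m) \<times> (real \<times> (real^'m))) measure)"
        by (subst borel_prod[symmetric]) (intro sets_pair_measure_cong; simp)
      have 1: "(\<lambda>q::(real^'m) \<times> (real \<times> (real^'m)). green_weight r (snd q)) \<in> borel_measurable borel"
        by (rule measurable_compose[OF borel_measurable_continuous_onI green_weight_measurable]) (intro continuous_intros)
      have 2: "(\<lambda>q::(real^'m) \<times> (real \<times> (real^'m)). l (fst q + fst (snd q) *\<^sub>R snd (snd q))) \<in> borel_measurable borel"
        by (intro borel_measurable_continuous_onI continuous_on_compose2[OF cl] continuous_intros) auto
      have [measurable]: "(\<lambda>q. green_weight r (snd q) * l (fst q + fst (snd q) *\<^sub>R snd (snd q))) \<in> borel_measurable (borel \<Otimes>\<^sub>M lborel)"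
        unfolding measurable_cong_sets[OF S refl] by (rule borel_measurable_times[OF 1 2])
      have "(\<lambda>z. LINT p|lborel. green_weight r p * l (z + fst p *\<^sub>R snd p)) \<in> borel_measurable borel"
        by (rule lborel.borel_measurable_lebesgue_integral[of "\<lambda>z p. green_weight r p * l (z + fst p *\<^sub>R snd p)"]) (simp add: case_prod_unfold)
      then have "(\<lambda>z. G r z) \<in> borel_measurable borel" unfolding G_def .
      then show ?thesis by simp
    qed
    have "\<bar>LINT z|lborel. f z * (G r z - \<kappa> * l z)\<bar> \<le> \<kappa> * \<omega> * C"
      unfolding C_def by (rule integrable_times_bounded(2)[OF mf if_c mG Gl' Gl0])
    moreover have "(LINT z|lborel. f z * (G r z - \<kappa> * l z)) = (LINT z|lborel. f z * G r z) - \<kappa> * (LINT z|lborel. f z * l z)"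
      using iG[OF r(1,2)] ifl by (simp add: right_diff_distrib mult.left_commute[of _ \<kappa>])
    ultimately have "- (\<kappa> * \<omega> * C) \<le> \<kappa> * (LINT z|lborel. f z * l z)" using stepA[OF r(1,2)] by linarith
    then have "\<kappa> * (- (\<omega> * C)) \<le> \<kappa> * (LINT z|lborel. f z * l z)" by simp
    then show ?thesis using \<kappa> by (simp only: mult_le_cancel_left_pos)
  qed
  have "0 \<le> (LINT z|lborel. f z * l z)"
  proof (rule ccontr)
    assume neg: "\<not> 0 \<le> (LINT z|lborel. f z * l z)"
    define I where "I = (LINT z|lborel. f z * l z)"
    have I: "0 < - I" using neg by (simp add: I_def)
    have "0 < - I / (2 * (C + 1))" using I C0 by (intro divide_pos_pos) auto
    from lb[OF this] have "- (- I / (2 * (C + 1)) * C) \<le> I" unfolding I_def .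
    moreover have "- I / (2 * (C + 1)) * C = - I / 2 * (C / (C + 1))" by simp
    moreover have "- I / 2 * (C / (C + 1)) \<le> - I / 2 * 1" using I C0 by (intro mult_left_mono) auto
    ultimately show False using I by linarith
  qed
  then show ?thesis unfolding f_def .
qed

section \<open>Density of test functions\<close>

text \<open>This family is closed under differentiation up to linear combinations, also across 0;
  one computation thus replaces the iterated derivatives of exp(-1/t).\<close>

definition bump_factor :: "nat \<Rightarrow> real \<Rightarrow> real" where
  "bump_factor j t = (if 0 < t then exp (- 1 / t) / t ^ j else 0)"

lemma bump_factor_tendsto_0: "(bump_factor j \<longlongrightarrow> 0) (at 0)"
proof -
  have "((\<lambda>t::real. inverse t ^ j / exp (inverse t)) \<longlongrightarrow> 0) (at_right 0)"
    using filterlim_compose[OF tendsto_power_div_exp_0 filterlim_inverse_at_top_right] .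
  then have "(bump_factor j \<longlongrightarrow> 0) (at_right 0)"
  proof (rule Lim_transform_eventually)
    show "\<forall>\<^sub>F t in at_right 0. inverse t ^ j / exp (inverse t) = bump_factor j t"
      by (rule eventually_at_right_less[THEN eventually_mono])
         (simp add: bump_factor_def exp_minus divide_simps power_inverse)
  qed
  moreover have "(bump_factor j \<longlongrightarrow> 0) (at_left 0)"
  proof (rule Lim_transform_eventually[OF tendsto_const])
    show "\<forall>\<^sub>F t in at_left 0. 0 = bump_factor j t"
      by (auto simp: bump_factor_def eventually_at_filter)
  qed
  ultimately show ?thesis by (simp add: filterlim_split_at)
qed

lemma bump_factor_has_derivative:
  "(bump_factor j has_real_derivative (- real j * bump_factor (Suc j) t + bump_factor (Suc (Suc j)) t)) (at t)"
proof -
  consider "t < 0" | "t = 0" | "0 < t" by linarith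
  then show ?thesis
  proof cases
    case 1
    have "((\<lambda>_. 0) has_real_derivative 0) (at t)" by simp
    then have "(bump_factor j has_real_derivative 0) (at t)"
      by (rule has_field_derivative_transform_within_open[of _ _ _ "{..<0}"]) (use 1 in \<open>auto simp: bump_factor_def\<close>)
    then show ?thesis using 1 by (simp add: bump_factor_def)
  next
    case 2
    have "((\<lambda>y. (bump_factor j y - bump_factor j 0) / (y - 0)) \<longlongrightarrow> 0) (at 0)"
    proof (rule Lim_transform_eventually[OF bump_factor_tendsto_0[of "Suc j"]])
      show "\<forall>\<^sub>F y in at 0. bump_factor (Suc j) y = (bump_factor j y - bump_factor j 0) / (y - 0)"
        by (auto simp: bump_factor_def eventually_at_filter)
    qed
    then show ?thesis using 2 by (simp add: has_field_derivative_iff bump_factor_def)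
  next
    case 3
    have eq: "bump_factor i s = exp (- inverse s) * inverse s ^ i" if "0 < s" for i s
      using that by (simp add: bump_factor_def divide_inverse power_inverse)
    have D1: "((\<lambda>s. exp (- inverse s)) has_real_derivative exp (- inverse t) * (inverse t * inverse t)) (at t)"
      using 3 by (auto intro!: derivative_eq_intros)
    have D2: "((\<lambda>s. inverse s ^ j) has_real_derivative real j * (- (inverse t * inverse t) * inverse t ^ (j - Suc 0))) (at t)"
      using 3 by (auto intro!: derivative_eq_intros)
    have "((\<lambda>s. exp (- inverse s) * inverse s ^ j) has_real_derivative (- real j * bump_factor (Suc j) t + bump_factor (Suc (Suc j)) t)) (at t)"
      by (rule DERIV_cong[OF DERIV_mult[OF D1 D2]]) (use 3 in \<open>cases j; simp add: eq algebra_simps\<close>)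
    then show ?thesis
      by (rule has_field_derivative_transform_within_open[of _ _ _ "{0<..}"]) (use 3 eq in auto)
  qed
qed

lemma real_polynomial_function_derivative:
  assumes "real_polynomial_function P"
  obtains P' where "\<And>x. (P has_derivative P' x) (at x)" "\<And>h. real_polynomial_function (\<lambda>x. P' x h)"
proof -
  have "\<exists>P'. (\<forall>x. (P has_derivative P' x) (at x)) \<and> (\<forall>h. real_polynomial_function (\<lambda>x. P' x h))"
    using assms
  proof induction
    case (linear f)
    then show ?case
      by (intro exI[of _ "\<lambda>x. f"]) (auto intro: bounded_linear_imp_has_derivative real_polynomial_function.intros(2))
  next
    case (const c)
    then show ?case
      by (intro exI[of _ "\<lambda>x h. 0"]) (auto intro: real_polynomial_function.intros(2))
  next
    case (add f g)
    then obtain f' g' where "\<And>x. (f has_derivative f' x) (at x)" "\<And>h. real_polynomial_function (\<lambda>x. f' x h)"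
      "\<And>x. (g has_derivative g' x) (at x)" "\<And>h. real_polynomial_function (\<lambda>x. g' x h)" by blast
    then show ?case
      by (intro exI[of _ "\<lambda>x h. f' x h + g' x h"]) (auto intro!: derivative_intros real_polynomial_function.intros(3))
  next
    case (mult f g)
    then obtain f' g' where *: "\<And>x. (f has_derivative f' x) (at x)" "\<And>h. real_polynomial_function (\<lambda>x. f' x h)"
      "\<And>x. (g has_derivative g' x) (at x)" "\<And>h. real_polynomial_function (\<lambda>x. g' x h)" by blast
    show ?case
      by (intro exI[of _ "\<lambda>x h. f x * g' x h + f' x h * g x"] conjI allI has_derivative_mult * 
           real_polynomial_function.intros(3) real_polynomial_function.intros(4) mult.hyps)
  qed
  then show ?thesis using that by blast
qed

text \<open>A class stable under directional derivatives, so that membership alone yields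
  differentiability of every order by induction. The polynomial factors are what the
  Stone-Weierstrass theorem supplies.\<close>

inductive bump_combination :: "real \<Rightarrow> (real^'m \<Rightarrow> real) \<Rightarrow> bool" for R where
  base: "real_polynomial_function P \<Longrightarrow> bump_combination R (\<lambda>x. P x * bump_factor j (R\<^sup>2 - (norm x)\<^sup>2))"
| add: "bump_combination R f \<Longrightarrow> bump_combination R g \<Longrightarrow> bump_combination R (\<lambda>x. f x + g x)"

lemma bump_combination_derivative:
  fixes f :: "real^'m \<Rightarrow> real"
  assumes "bump_combination R f"
  shows "\<exists>f'. (\<forall>x. (f has_derivative f' x) (at x)) \<and> (\<forall>h. bump_combination R (\<lambda>x. f' x h))"
  using assms
proof induction
  case (base P j)
  obtain P' where P': "\<And>x. (P has_derivative P' x) (at x)" "\<And>h. real_polynomial_function (\<lambda>x. P' x h)"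
    using real_polynomial_function_derivative[OF base] by blast
  let ?t = "\<lambda>x::real^'m. R\<^sup>2 - (norm x)\<^sup>2"
  let ?f' = "\<lambda>x h. P' x h * bump_factor j (?t x) + ((P x * (real j * 2) * (x \<bullet> h)) * bump_factor (Suc j) (?t x)
       + (P x * (- 2) * (x \<bullet> h)) * bump_factor (Suc (Suc j)) (?t x))"
  have dt: "(?t has_derivative (\<lambda>h. - 2 * (x \<bullet> h))) (at x)" for x
    unfolding power2_norm_eq_inner by (auto intro!: derivative_eq_intros simp: inner_commute)
  have db: "((\<lambda>x. bump_factor j (?t x)) has_derivative
       (\<lambda>h. (- real j * bump_factor (Suc j) (?t x) + bump_factor (Suc (Suc j)) (?t x)) * (- 2 * (x \<bullet> h)))) (at x)" for x
    using has_derivative_compose[OF dt, of "bump_factor j" "\<lambda>k. (- real j * bump_factor (Suc j) (?t x) + bump_factor (Suc (Suc j)) (?t x)) * k"]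
      bump_factor_has_derivative[of j "?t x"] by (simp add: has_field_derivative_def)
  have "((\<lambda>x. P x * bump_factor j (?t x)) has_derivative ?f' x) (at x)" for x
    by (rule has_derivative_eq_rhs[OF has_derivative_mult[OF P'(1) db]]) (auto simp: algebra_simps)
  moreover have "bump_combination R (\<lambda>x. ?f' x h)" for h
  proof -
    have lin: "real_polynomial_function (\<lambda>x::real^'m. x \<bullet> h)"
      by (intro real_polynomial_function.intros(1) bounded_linear_inner_left)
    show ?thesis
      by (intro bump_combination.intros P'(2) real_polynomial_function.intros(4) real_polynomial_function.intros(2) lin base)
  qed
  ultimately show ?case by (intro exI[of _ ?f']) blast
next
  case (add f g)
  then obtain f' g' where "\<And>x. (f has_derivative f' x) (at x)" "\<And>h. bump_combination R (\<lambda>x. f' x h)"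
      "\<And>x. (g has_derivative g' x) (at x)" "\<And>h. bump_combination R (\<lambda>x. g' x h)" by blast
  then show ?case
    by (intro exI[of _ "\<lambda>x h. f' x h + g' x h"]) (auto intro!: derivative_intros bump_combination.add)
qed

lemma bump_combination_continuously_differentiable:
  "bump_combination R f \<Longrightarrow> continuously_differentiable k f"
proof (induction k arbitrary: f)
  case 0
  obtain f' where "\<And>x. (f has_derivative f' x) (at x)" using bump_combination_derivative[OF 0] by blast
  then show ?case using has_derivative_continuous_on[of UNIV f f'] by (simp add: has_derivative_at_withinI)
next
  case (Suc k)
  obtain f' where f': "\<And>x. (f has_derivative f' x) (at x)" "\<And>h. bump_combination R (\<lambda>x. f' x h)"
    using bump_combination_derivative[OF Suc.prems] by blast
  have "frechet_derivative f (at x) = f' x" for x using frechet_derivative_at[OF f'(1)] by simp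
  then show ?case using f' Suc.IH unfolding continuously_differentiable.simps differentiable_def by auto
qed

lemma bump_combination_eq_0: "bump_combination R f \<Longrightarrow> 0 \<le> R \<Longrightarrow> R \<le> norm x \<Longrightarrow> f x = 0"
proof (induction rule: bump_combination.induct)
  case (base P j)
  then have "R\<^sup>2 \<le> (norm x)\<^sup>2" by (intro power_mono)
  then show ?case by (simp add: bump_factor_def)
qed simp

lemma bump_combination_test_function:
  assumes "bump_combination R f" "0 \<le> R"
  shows "f \<in> test_functions"
proof -
  have "{x. f x \<noteq> 0} \<subseteq> cball 0 R"
    using bump_combination_eq_0[OF assms] by (auto simp: not_le) (meson not_le less_imp_le linear)
  then have "closure {x. f x \<noteq> 0} \<subseteq> cball 0 R" by (rule closure_minimal) simp
  then have "bounded (closure {x. f x \<noteq> 0})" by (meson bounded_cball bounded_subset)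
  then show ?thesis unfolding test_functions_def
    using bump_combination_continuously_differentiable[OF assms(1)] by (simp add: compact_eq_bounded_closed)
qed

text \<open>Instead of mollifying \<psi>, the quotient of \<psi> by a smooth bump q is approximated
  by a polynomial P, and \<open>P * q\<close> is the test function.\<close>

lemma test_functions_dense:
  fixes \<psi> :: "real^'m \<Rightarrow> real"
  assumes \<psi>: "continuous_on UNIV \<psi>" and supp: "\<And>x. x \<notin> cball 0 S \<Longrightarrow> \<psi> x = 0" and S: "0 < S" and e: "0 < e"
  obtains \<phi> where "\<phi> \<in> test_functions" "\<And>x. \<bar>\<phi> x - \<psi> x\<bar> \<le> e" "\<And>x. x \<notin> cball 0 (S + 1) \<Longrightarrow> \<phi> x = 0"
    "continuous_on UNIV \<phi>"
proof -
  define R where "R = S + 1"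
  define q where "q x = bump_factor 0 (R\<^sup>2 - (norm x)\<^sup>2)" for x :: "real^'m"
  have q: "0 \<le> q x" "q x \<le> 1" for x by (auto simp: q_def bump_factor_def)
  have qpos: "0 < q x" if "norm x < R" for x
    using that power_strict_mono[of "norm x" R 2] by (simp add: q_def bump_factor_def)
  have cq: "continuous_on UNIV q"
    unfolding q_def by (rule continuous_on_compose2[of UNIV "bump_factor 0"])
      (auto intro!: continuous_intros DERIV_continuous_on[OF has_field_derivative_at_within[OF bump_factor_has_derivative]])
  \<comment> \<open>On the sphere of radius R both \<psi> and q vanish, and the quotient takes the
    default value 0. This is its continuous value, because \<psi> is already 0 outside
    \<open>cball 0 S\<close>.\<close>
  have "continuous_on (ball 0 R \<union> - cball 0 S) (\<lambda>x. \<psi> x / q x)"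
  proof (rule continuous_on_open_Un)
    show "continuous_on (ball 0 R) (\<lambda>x. \<psi> x / q x)"
      using qpos by (intro continuous_on_divide continuous_on_subset[OF \<psi>] continuous_on_subset[OF cq]) force+
    have "continuous_on (- cball 0 S) (\<lambda>x::real^'m. 0::real)" by simp
    then show "continuous_on (- cball 0 S) (\<lambda>x. \<psi> x / q x)"
      by (rule continuous_on_eq) (use supp in auto)
  qed auto
  moreover have "cball 0 R \<subseteq> ball 0 R \<union> - cball (0::real^'m) S" by (auto simp: R_def)
  ultimately have "continuous_on (cball 0 R) (\<lambda>x. \<psi> x / q x)" by (rule continuous_on_subset)
  then obtain P where P: "real_polynomial_function P" "\<And>x. x \<in> cball 0 R \<Longrightarrow> \<bar>\<psi> x / q x - P x\<bar> < e"
    using Stone_Weierstrass_real_polynomial_function[OF compact_cball _ e, of 0 R "\<lambda>x. \<psi> x / q x"] by blast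
  define \<phi> where "\<phi> x = P x * q x" for x
  have b: "bump_combination R \<phi>" unfolding \<phi>_def[abs_def] q_def by (rule bump_combination.base[OF P(1)])
  show ?thesis
  proof
    show "\<phi> \<in> test_functions" using b by (rule bump_combination_test_function) (use S in \<open>simp add: R_def\<close>)
    show "continuous_on UNIV \<phi>" using bump_combination_continuously_differentiable[OF b, of 0] by simp
    show "\<phi> x = 0" if "x \<notin> cball 0 (S + 1)" for x
      using that S by (intro bump_combination_eq_0[OF b]) (auto simp: R_def)
    show "\<bar>\<phi> x - \<psi> x\<bar> \<le> e" for x
    proof (cases "norm x < R")
      case True
      then have "\<bar>\<phi> x - \<psi> x\<bar> = q x * \<bar>\<psi> x / q x - P x\<bar>"
        using qpos[OF True] by (simp add: \<phi>_def abs_mult_pos' algebra_simps flip: abs_minus_commute)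
      also have "\<dots> \<le> 1 * e" using q P(2)[of x] True by (intro mult_mono) auto
      finally show ?thesis by simp
    next
      case False
      then have "\<psi> x = 0" by (intro supp) (simp add: R_def)
      moreover have "\<phi> x = 0" using False S by (intro bump_combination_eq_0[OF b]) (auto simp: R_def)
      ultimately show ?thesis using e by simp
    qed
  qed
qed

text \<open>Local L1 bounds extend convergence against test functions to continuous integrands of
  bounded support, and even to integrands that vary with n and converge uniformly: all of them are
  uniformly close to one test function.\<close>

lemma pairing_limit:
  fixes w :: "nat \<Rightarrow> real^'m \<Rightarrow> real" and w' :: "real^'m \<Rightarrow> real"
  assumes w: "\<And>n. w n \<in> borel_measurable borel" "\<And>n R. integrable lborel (\<lambda>z. indicator (cball 0 R) z * w n z)"
    and w': "w' \<in> borel_measurable borel" "\<And>R. integrable lborel (\<lambda>z. indicator (cball 0 R) z * w' z)"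
    and bd: "\<And>R. \<exists>C. \<forall>n. (LINT z|lborel. indicator (cball 0 R) z * \<bar>w n z\<bar>) \<le> C"
    and conv: "\<And>\<phi>. \<phi> \<in> test_functions \<Longrightarrow> (\<lambda>n. LINT z|lborel. w n z * \<phi> z) \<longlonglongrightarrow> (LINT z|lborel. w' z * \<phi> z)"
    and \<Psi>: "\<And>n. \<Psi> n \<in> borel_measurable borel" "\<And>n z. z \<notin> cball 0 S \<Longrightarrow> \<Psi> n z = 0"
    and \<Psi>': "continuous_on UNIV \<Psi>'" "\<And>z. z \<notin> cball 0 S \<Longrightarrow> \<Psi>' z = 0"
    and S: "0 < S"
    and unif: "\<And>e. 0 < e \<Longrightarrow> \<forall>\<^sub>F n in sequentially. \<forall>z. \<bar>\<Psi> n z - \<Psi>' z\<bar> \<le> e"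
  shows "(\<lambda>n. LINT z|lborel. w n z * \<Psi> n z) \<longlonglongrightarrow> (LINT z|lborel. w' z * \<Psi>' z)"
proof (rule tendstoI)
  fix e :: real assume e: "0 < e"
  let ?N = "\<lambda>f. (LINT z|lborel. indicator (cball 0 (S + 1)) z * \<bar>f z\<bar>)"
  obtain C0 where C0: "\<And>n. ?N (w n) \<le> C0" using bd[of "S + 1"] by blast
  define C where "C = max 1 (max C0 (?N w'))"
  have C: "1 \<le> C" "\<And>n. ?N (w n) \<le> C" "?N w' \<le> C" using C0 by (auto simp: C_def intro: max.coboundedI1 max.coboundedI2)
  \<comment> \<open>The replacement costs at most \<open>2 * \<delta> * C\<close> for
    \<open>w n\<close> and \<open>\<delta> * C\<close> for the limit, together three fifths of e;
    the convergence for the test function costs one more fifth.\<close>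
  define \<delta> where "\<delta> = e / (5 * C)"
  have \<delta>: "0 < \<delta>" using e C(1) by (simp add: \<delta>_def)
  have \<delta>C: "\<delta> * C = e / 5" using C(1) by (simp add: \<delta>_def)
  obtain \<phi> where \<phi>: "\<phi> \<in> test_functions" "\<And>x. \<bar>\<phi> x - \<Psi>' x\<bar> \<le> \<delta>" "\<And>x. x \<notin> cball 0 (S + 1) \<Longrightarrow> \<phi> x = 0" "continuous_on UNIV \<phi>"
    using test_functions_dense[OF \<Psi>'(1,2) S \<delta>] by metis
  have m\<phi>: "\<phi> \<in> borel_measurable borel" "\<Psi>' \<in> borel_measurable borel"
    by (intro borel_measurable_continuous_onI \<phi>(4) \<Psi>'(1))+
  have bnd: "\<exists>M. \<forall>z. \<bar>h z\<bar> \<le> M" if h: "continuous_on UNIV h" "\<And>z. z \<notin> cball 0 (S + 1) \<Longrightarrow> h z = 0" for h :: "real^'m \<Rightarrow> real"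
  proof -
    obtain M where M: "0 \<le> M" "\<And>z. z \<in> cball 0 (S + 1) \<Longrightarrow> \<bar>h z\<bar> \<le> M"
      using continuous_bounded_on_cball[OF continuous_on_subset[OF h(1) subset_UNIV]] by metis
    have "\<bar>h z\<bar> \<le> M" for z using M h(2)[of z] by (cases "z \<in> cball 0 (S + 1)") auto
    then show ?thesis by blast
  qed
  obtain M1 where M1: "\<And>z. \<bar>\<phi> z\<bar> \<le> M1" using bnd[OF \<phi>(4,3)] by blast
  have \<Psi>'0: "\<Psi>' z = 0" if "z \<notin> cball 0 (S + 1)" for z using that by (intro \<Psi>'(2)) auto
  have \<Psi>0: "\<Psi> n z = 0" if "z \<notin> cball 0 (S + 1)" for n z using that by (intro \<Psi>(2)) auto
  obtain M2 where M2: "\<And>z. \<bar>\<Psi>' z\<bar> \<le> M2" using bnd[OF \<Psi>'(1) \<Psi>'0] by blast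
  have ev1: "\<forall>\<^sub>F n in sequentially. dist (LINT z|lborel. w n z * \<phi> z) (LINT z|lborel. w' z * \<phi> z) < e / 5"
    using tendstoD[OF conv[OF \<phi>(1)], of "e / 5"] e by simp
  show "\<forall>\<^sub>F n in sequentially. dist (LINT z|lborel. w n z * \<Psi> n z) (LINT z|lborel. w' z * \<Psi>' z) < e"
    using ev1 unif[OF \<delta>]
  proof eventually_elim
    fix n assume 1: "dist (LINT z|lborel. w n z * \<phi> z) (LINT z|lborel. w' z * \<phi> z) < e / 5"
      and 2: "\<forall>z. \<bar>\<Psi> n z - \<Psi>' z\<bar> \<le> \<delta>"
    have 3: "\<bar>\<Psi> n z - \<phi> z\<bar> \<le> 2 * \<delta>" for z using 2[rule_format, of z] \<phi>(2)[of z] by linarith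
    have m3: "(\<lambda>z. \<Psi> n z - \<phi> z) \<in> borel_measurable borel" "(\<lambda>z. \<phi> z - \<Psi>' z) \<in> borel_measurable borel"
      by (intro borel_measurable_diff \<Psi>(1) m\<phi>)+
    have z3: "\<Psi> n z - \<phi> z = 0" "\<phi> z - \<Psi>' z = 0" if "z \<notin> cball 0 (S + 1)" for z
      by (simp_all only: \<Psi>0[OF that] \<phi>(3)[OF that] \<Psi>'0[OF that])
    note i = integrable_times_bounded(1)[OF w(1)[of n] w(2)[of "S + 1"] m3(1) 3 z3(1)]
    note a = integrable_times_bounded(2)[OF w(1)[of n] w(2)[of "S + 1"] m3(1) 3 z3(1)]
    have i2: "integrable lborel (\<lambda>z. w n z * \<phi> z)"
      by (rule integrable_times_bounded[OF w(1) w(2)[of "S + 1"] m\<phi>(1) M1 \<phi>(3)])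
    note i' = integrable_times_bounded(1)[OF w'(1) w'(2)[of "S + 1"] m3(2) \<phi>(2) z3(2)]
    note a' = integrable_times_bounded(2)[OF w'(1) w'(2)[of "S + 1"] m3(2) \<phi>(2) z3(2)]
    have i2': "integrable lborel (\<lambda>z. w' z * \<phi> z)"
      by (rule integrable_times_bounded[OF w'(1) w'(2)[of "S + 1"] m\<phi>(1) M1 \<phi>(3)])
    have "(LINT z|lborel. w n z * \<Psi> n z) = (LINT z|lborel. w n z * (\<Psi> n z - \<phi> z)) + (LINT z|lborel. w n z * \<phi> z)"
      using Bochner_Integration.integral_add[OF i i2] by (simp add: algebra_simps)
    moreover have "(LINT z|lborel. w' z * \<Psi>' z) = (LINT z|lborel. w' z * \<phi> z) - (LINT z|lborel. w' z * (\<phi> z - \<Psi>' z))"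
      using Bochner_Integration.integral_diff[OF i2' i'] by (simp add: algebra_simps)
    moreover have "2 * \<delta> * ?N (w n) \<le> 2 * (\<delta> * C)" using mult_left_mono[OF C(2)[of n], of "2 * \<delta>"] \<delta> by simp
    moreover have "\<delta> * ?N w' \<le> \<delta> * C" using C(3) \<delta> by (intro mult_left_mono) auto
    ultimately show "dist (LINT z|lborel. w n z * \<Psi> n z) (LINT z|lborel. w' z * \<Psi>' z) < e"
      using 1 a a' \<delta>C e unfolding dist_real_def by linarith
  qed
qed

lemma uniform_limit_compact_param:
  fixes F :: "'k::metric_space \<Rightarrow> 'a::euclidean_space \<Rightarrow> real"
  assumes K: "compact K" and F: "continuous_on (K \<times> UNIV) (\<lambda>p. F (fst p) (snd p))"
    and supp: "\<And>k z. k \<in> K \<Longrightarrow> z \<notin> cball 0 S \<Longrightarrow> F k z = 0"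
    and k: "\<And>n. k n \<in> K" "k \<longlonglongrightarrow> k'" and e: "0 < e"
  shows "\<forall>\<^sub>F n in sequentially. \<forall>z. \<bar>F (k n) z - F k' z\<bar> \<le> e"
proof -
  have k': "k' \<in> K" using K k closed_sequentially compact_imp_closed by blast
  have "uniformly_continuous_on (K \<times> cball 0 S) (\<lambda>p. F (fst p) (snd p))"
    by (intro compact_uniformly_continuous continuous_on_subset[OF F] compact_Times K) auto
  then obtain \<delta> where \<delta>: "0 < \<delta>" "\<And>p q. p \<in> K \<times> cball 0 S \<Longrightarrow> q \<in> K \<times> cball 0 S \<Longrightarrow> dist q p < \<delta> \<Longrightarrow>
      dist (F (fst q) (snd q)) (F (fst p) (snd p)) < e"
    using e unfolding uniformly_continuous_on_def by blast
  have "\<forall>\<^sub>F n in sequentially. dist (k n) k' < \<delta>" using tendstoD[OF k(2) \<delta>(1)] .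
  then show ?thesis
  proof eventually_elim
    fix n assume n: "dist (k n) k' < \<delta>"
    show "\<forall>z. \<bar>F (k n) z - F k' z\<bar> \<le> e"
    proof
      fix z
      show "\<bar>F (k n) z - F k' z\<bar> \<le> e"
      proof (cases "z \<in> cball 0 S")
        case True
        then show ?thesis
          using \<delta>(2)[of "(k', z)" "(k n, z)"] k' k(1)[of n] n by (simp add: dist_prod_def dist_real_def)
      qed (use supp k' k(1) e in simp)
    qed
  qed
qed

lemma sh_integrable_times:
  fixes u :: "real^'m \<Rightarrow> ereal"
  assumes "u \<in> sh_functions" "h \<in> borel_measurable borel" "\<And>z. \<bar>h z\<bar> \<le> M" "\<And>z. z \<notin> cball 0 S \<Longrightarrow> h z = 0"
  shows "integrable lborel (\<lambda>z. real_of_ereal (u z) * h z)"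
  by (rule integrable_times_bounded(1)[OF sh_real_measurable[OF assms(1)] sh_integrable_cball[OF assms(1)] assms(2-)])

text \<open>\<open>pairing_limit\<close> for constant sequences extends the equality to continuous
  tents; these increase to the indicator of a ball, and ball integrals determine a subharmonic
  function at every point. So a limit in \<open>Fr\<close> is identified as a function, not just
  almost everywhere.\<close>

lemma sh_eq_if_pairing_eq:
  fixes u v :: "real^'m \<Rightarrow> ereal"
  assumes u: "u \<in> sh_functions" and v: "v \<in> sh_functions"
    and eq: "\<And>\<phi>. \<phi> \<in> test_functions \<Longrightarrow> pairing u \<phi> = pairing v \<phi>"
  shows "u = v"
proof (rule sh_eq_if_ball_integrals_eq[OF u v])
  fix x :: "real^'m" and r :: real assume r: "0 < r"
  define f where "f y = real_of_ereal (u y)" for y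
  define g where "g y = real_of_ereal (v y)" for y
  have fg: "f \<in> borel_measurable borel" "g \<in> borel_measurable borel"
    "\<And>R. integrable lborel (\<lambda>z. indicator (cball 0 R) z * f z)" "\<And>R. integrable lborel (\<lambda>z. indicator (cball 0 R) z * g z)"
    unfolding f_def[abs_def] g_def[abs_def]
    by (rule sh_real_measurable[OF u] sh_real_measurable[OF v] sh_integrable_cball[OF u] sh_integrable_cball[OF v])+
  note [measurable] = fg(1,2)
  define \<psi> where "\<psi> n y = min 1 (real n * max 0 (r - dist x y))" for n y
  define S where "S = norm x + r"
  have S: "0 < S" using r by (simp add: S_def add_nonneg_pos)
  have c\<psi>: "continuous_on UNIV (\<psi> n)" for n unfolding \<psi>_def by (intro continuous_intros)
  then have [measurable]: "\<psi> n \<in> borel_measurable borel" for n by (rule borel_measurable_continuous_onI)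
  have \<psi>0: "\<psi> n y = 0" if "y \<notin> ball x r" for n y using that by (simp add: \<psi>_def)
  have sub: "y \<notin> ball x r" if "y \<notin> cball 0 S" for y
    using that dist_triangle[of 0 y x] by (auto simp: S_def)
  have \<psi>b: "0 \<le> \<psi> n y" "\<psi> n y \<le> 1" for n y by (auto simp: \<psi>_def)
  have same: "(LINT z|lborel. f z * \<psi> n z) = (LINT z|lborel. g z * \<psi> n z)" for n
  proof -
    have "(\<lambda>k::nat. LINT z|lborel. f z * \<psi> n z) \<longlonglongrightarrow> (LINT z|lborel. g z * \<psi> n z)"
    proof (rule pairing_limit[where S = S])
      show "(\<lambda>k::nat. LINT z|lborel. f z * \<phi> z) \<longlonglongrightarrow> (LINT z|lborel. g z * \<phi> z)" if "\<phi> \<in> test_functions" for \<phi>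
        using eq[OF that] unfolding pairing_def f_def g_def by simp
    qed (use fg S c\<psi> \<psi>0 sub in auto)
    then show ?thesis by (simp add: LIMSEQ_const_iff)
  qed
  have "(\<lambda>n. LINT z|lborel. h z * \<psi> n z) \<longlonglongrightarrow> (LINT z|lborel. indicator (ball x r) z * h z)"
    if [measurable]: "h \<in> borel_measurable borel" and ih: "\<And>R. integrable lborel (\<lambda>z. indicator (cball 0 R) z * h z)" for h
  proof (rule integral_dominated_convergence[where w = "\<lambda>z. \<bar>indicator (cball 0 S) z * h z\<bar>"])
    show "AE z in lborel. (\<lambda>n. h z * \<psi> n z) \<longlonglongrightarrow> indicator (ball x r) z * h z"
    proof (rule AE_I2)
      fix z
      show "(\<lambda>n. h z * \<psi> n z) \<longlonglongrightarrow> indicator (ball x r) z * h z"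
      proof (cases "z \<in> ball x r")
        case True
        then have p: "0 < r - dist x z" by simp
        obtain N :: nat where "1 / (r - dist x z) < real N" using reals_Archimedean2 by blast
        then have "\<psi> n z = 1" if "N \<le> n" for n
        proof -
          have "1 < real N * (r - dist x z)" using \<open>1 / (r - dist x z) < real N\<close> p by (simp add: pos_divide_less_eq)
          also have "\<dots> \<le> real n * (r - dist x z)" using that p by (intro mult_right_mono) auto
          finally show ?thesis using p by (simp add: \<psi>_def)
        qed
        then have "\<forall>\<^sub>F n in sequentially. h z * \<psi> n z = h z" unfolding eventually_sequentially by (intro exI[of _ N]) auto
        then show ?thesis using True by (simp add: tendsto_eventually)
      qed (simp add: \<psi>0)
    qed
    show "AE z in lborel. norm (h z * \<psi> n z) \<le> \<bar>indicator (cball 0 S) z * h z\<bar>" for n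
    proof (rule AE_I2)
      fix z show "norm (h z * \<psi> n z) \<le> \<bar>indicator (cball 0 S) z * h z\<bar>"
        using \<psi>b[of n z] \<psi>0[OF sub, of z n] by (cases "z \<in> cball 0 S") (auto simp: abs_mult mult_left_le)
    qed
  qed (use ih in auto)
  note lim = this
  have "(LINT z|lborel. indicator (ball x r) z * f z) = (LINT z|lborel. indicator (ball x r) z * g z)"
    using lim[OF fg(1,3)] unfolding same by (rule LIMSEQ_unique) (rule lim[OF fg(2,4)])
  then show "(LINT y|lborel. indicator (ball x r) y * real_of_ereal (u y)) = (LINT y|lborel. indicator (ball x r) y * real_of_ereal (v y))"
    unfolding f_def g_def .
qed

text \<open>The pullback topology lives on \<open>sh_functions\<close>, so a limit includes eventual
  membership besides the convergence of all pairings.\<close>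

lemma limitin_distr_topology:
  fixes f :: "'b \<Rightarrow> real^'m \<Rightarrow> ereal"
  shows "limitin distr_topology f v F \<longleftrightarrow> v \<in> sh_functions \<and> (\<forall>\<^sub>F n in F. f n \<in> sh_functions) \<and>
     (\<forall>\<phi>\<in>test_functions. ((\<lambda>n. pairing (f n) \<phi>) \<longlongrightarrow> pairing v \<phi>) F)"
proof -
  let ?T = "product_topology (\<lambda>\<phi>. euclideanreal) (test_functions :: (real^'m \<Rightarrow> real) set)"
  let ?p = "\<lambda>v::real^'m \<Rightarrow> ereal. \<lambda>\<phi>\<in>test_functions. pairing v \<phi>"
  have p_top: "?p v \<in> topspace ?T" for v by simp
  have ts: "topspace distr_topology = (sh_functions :: (real^'m \<Rightarrow> ereal) set)"
    unfolding distr_topology_def topspace_pullback_topology by auto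
  have op: "openin distr_topology S \<longleftrightarrow> (\<exists>W. openin ?T W \<and> S = ?p -` W \<inter> sh_functions)" for S
    unfolding distr_topology_def openin_pullback_topology ..
  have "limitin distr_topology f v F \<longleftrightarrow> v \<in> sh_functions \<and> (\<forall>\<^sub>F n in F. f n \<in> sh_functions) \<and> limitin ?T (\<lambda>n. ?p (f n)) (?p v) F"
  proof (intro iffI conjI)
    assume L: "limitin distr_topology f v F"
    show v: "v \<in> sh_functions" using L unfolding limitin_def ts by (rule conjunct1)
    show "\<forall>\<^sub>F n in F. f n \<in> sh_functions"
    proof -
      have "openin distr_topology (sh_functions :: (real^'m \<Rightarrow> ereal) set)"
        using openin_topspace[of "distr_topology :: (real^'m \<Rightarrow> ereal) topology"] unfolding ts .
      then show ?thesis using L v unfolding limitin_def by blast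
    qed
    show "limitin ?T (\<lambda>n. ?p (f n)) (?p v) F"
      unfolding limitin_def
    proof (intro conjI allI impI p_top, elim conjE)
      fix W assume W: "openin ?T W" "?p v \<in> W"
      then have "openin distr_topology (?p -` W \<inter> sh_functions)" "v \<in> ?p -` W \<inter> sh_functions"
        using op v by auto
      then have "\<forall>\<^sub>F n in F. f n \<in> ?p -` W \<inter> sh_functions" using L unfolding limitin_def by blast
      then show "\<forall>\<^sub>F n in F. ?p (f n) \<in> W" by eventually_elim simp
    qed
  next
    assume R: "v \<in> sh_functions \<and> (\<forall>\<^sub>F n in F. f n \<in> sh_functions) \<and> limitin ?T (\<lambda>n. ?p (f n)) (?p v) F"
    show "limitin distr_topology f v F"
      unfolding limitin_def ts
    proof (intro conjI allI impI, use R in blast, elim conjE)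
      fix S assume S: "openin distr_topology S" "v \<in> S"
      then obtain W where W: "openin ?T W" "S = ?p -` W \<inter> sh_functions" using op by blast
      then have "\<forall>\<^sub>F n in F. ?p (f n) \<in> W" using R S(2) unfolding limitin_def by blast
      moreover have "\<forall>\<^sub>F n in F. f n \<in> sh_functions" using R by blast
      ultimately show "\<forall>\<^sub>F n in F. f n \<in> S" unfolding W(2) by eventually_elim simp
    qed
  qed
  also have "limitin ?T (\<lambda>n. ?p (f n)) (?p v) F \<longleftrightarrow> (\<forall>\<phi>\<in>test_functions. ((\<lambda>n. pairing (f n) \<phi>) \<longlongrightarrow> pairing v \<phi>) F)"
    by (simp add: limitin_componentwise)
  finally show ?thesis .
qed

section \<open>The smoothing kernel\<close>

lemma C2_on_cmult:
  assumes "C2_on S f D l"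
  shows "C2_on S (\<lambda>x. c * f x) (\<lambda>x. c *\<^sub>R D x) (\<lambda>x. c * l x)"
proof -
  have "open S" using assms by (simp add: C2_on_def)
  from C2_on_mult[OF C2_on_const[OF this, of c] assms] show ?thesis by (rule C2_on_cong) simp_all
qed

text \<open>On the overlap f vanishes on an open set, hence so does its gradient, and the two pieces
  match.\<close>

lemma C2_on_extend_zero:
  assumes "C2_on S f D l" and T: "open T" and f0: "\<And>x. x \<in> T \<Longrightarrow> f x = 0" and l0: "\<And>x. x \<in> T \<Longrightarrow> l x = 0"
  obtains D' where "C2_on (S \<union> T) f D' l"
proof -
  define D' where "D' x = (if x \<in> T then 0 else D x)" for x
  have "D x = 0" if x: "x \<in> S" "x \<in> T" for x
  proof -
    have "(f has_derivative (\<lambda>h. 0)) (at x)"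
      by (rule has_derivative_transform_within_open[OF has_derivative_const[of 0] T x(2)]) (simp add: f0)
    moreover have "(f has_derivative (\<lambda>h. D x \<bullet> h)) (at x)" using assms(1) x(1) unfolding C2_on_def by blast
    ultimately have "(\<lambda>h. D x \<bullet> h) = (\<lambda>h. 0)" by (rule has_derivative_unique[rotated])
    from fun_cong[OF this, of "D x"] have "D x \<bullet> D x = 0" .
    then show ?thesis by simp
  qed
  then have "C2_on S f D' l" by (intro C2_on_cong[OF assms(1)]) (auto simp: D'_def)
  moreover have "C2_on T f D' l" by (rule C2_on_cong[OF C2_on_const[OF T, of 0]]) (auto simp: D'_def f0 l0)
  ultimately show ?thesis using C2_on_Un that by blast
qed

text \<open>Rotation invariance of the Laplacian: the Hessian is conjugated by an orthogonal map,
  whose inverse \<open>h\<close> is its adjoint, and so keeps its trace.\<close>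

lemma C2_on_similarity:
  fixes f :: "'a::euclidean_space \<Rightarrow> real" and g :: "'a \<Rightarrow> 'a"
  assumes f: "C2_on UNIV f D l" and g: "orthogonal_transformation g"
  obtains D' where "C2_on UNIV (\<lambda>x. f (c *\<^sub>R g x)) D' (\<lambda>x. c\<^sup>2 * l (c *\<^sub>R g x))"
proof -
  obtain G where G: "\<And>x. (D has_derivative G x) (at x)" "\<And>h. continuous_on UNIV (\<lambda>x. G x h)"
    "\<And>x. (\<Sum>i\<in>Basis. G x i \<bullet> i) = l x" and df: "\<And>x. (f has_derivative (\<lambda>h. D x \<bullet> h)) (at x)"
    using f unfolding C2_on_def by blast
  have lg: "linear g" using g by (simp add: orthogonal_transformation_linear)
  then have bg: "bounded_linear g" by (simp add: linear_conv_bounded_linear)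
  define h where "h = inv g"
  have gh: "g (h x) = x" "h (g x) = x" for x
    using orthogonal_transformation_surj[OF g] orthogonal_transformation_inj[OF g]
    unfolding h_def by (auto simp: surj_f_inv_f inv_f_f)
  have ip: "g x \<bullet> g y = x \<bullet> y" for x y using g by (simp add: orthogonal_transformation_def)
  have xg: "x \<bullet> g y = h x \<bullet> y" for x y using ip[of "h x" y] gh(1) by simp
  have gij: "g i \<bullet> j = h j \<bullet> i" for i j using xg[of j i] by (simp only: inner_commute[of "g i" j])
  have lh: "linear h"
  proof (rule linearI)
    fix x y :: 'a and r :: real
    have "h (x + y) = h (g (h x + h y))" by (simp only: linear_add[OF lg] gh)
    then show "h (x + y) = h x + h y" by (simp only: gh)
    have "h (r *\<^sub>R x) = h (g (r *\<^sub>R h x))" by (simp only: linear_cmul[OF lg] gh)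
    then show "h (r *\<^sub>R x) = r *\<^sub>R h x" by (simp only: gh)
  qed
  then have bh: "bounded_linear h" by (simp add: linear_conv_bounded_linear)
  have dg: "((\<lambda>x. c *\<^sub>R g x) has_derivative (\<lambda>k. c *\<^sub>R g k)) (at x)" for x
    by (intro has_derivative_scaleR_right bounded_linear_imp_has_derivative bg)
  let ?P = "\<lambda>x. c *\<^sub>R g x"
  let ?D = "\<lambda>x. c *\<^sub>R h (D (?P x))"
  have 1: "((\<lambda>x. f (?P x)) has_derivative (\<lambda>k. ?D x \<bullet> k)) (at x)" for x
    using has_derivative_compose[OF dg df] by (rule has_derivative_eq_rhs) (simp add: xg fun_eq_iff)
  have 2: "(?D has_derivative (\<lambda>k. c *\<^sub>R h (G (?P x) (c *\<^sub>R g k)))) (at x)" for x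
    by (intro has_derivative_scaleR_right bounded_linear.has_derivative[OF bh] has_derivative_compose[OF dg G(1)])
  have lG: "linear (G x)" for x using has_derivative_linear[OF G(1)] .
  have 3: "(\<Sum>i\<in>Basis. (c *\<^sub>R h (G y (c *\<^sub>R g i))) \<bullet> i) = c\<^sup>2 * l y" for y
  proof -
    have "(\<Sum>i\<in>Basis. (c *\<^sub>R h (G y (c *\<^sub>R g i))) \<bullet> i) = c\<^sup>2 * (\<Sum>i\<in>Basis. G y (g i) \<bullet> g i)"
      by (simp add: linear_cmul[OF lG] linear_cmul[OF lh] power2_eq_square sum_distrib_left mult.assoc xg[symmetric])
    \<comment> \<open>The trace does not depend on the orthonormal basis: expand \<open>g i\<close>
      in the standard basis and exchange the two sums.\<close>
    also have "(\<Sum>i\<in>Basis. G y (g i) \<bullet> g i) = (\<Sum>i\<in>Basis. \<Sum>j\<in>Basis. (g i \<bullet> j) * (G y j \<bullet> g i))"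
    proof (rule sum.cong[OF refl])
      fix i
      have "G y (g i) = G y (\<Sum>j\<in>Basis. (g i \<bullet> j) *\<^sub>R j)" by (simp add: euclidean_representation)
      also have "\<dots> = (\<Sum>j\<in>Basis. (g i \<bullet> j) *\<^sub>R G y j)" by (simp add: linear_sum[OF lG] linear_cmul[OF lG])
      finally show "G y (g i) \<bullet> g i = (\<Sum>j\<in>Basis. (g i \<bullet> j) * (G y j \<bullet> g i))" by (simp add: inner_sum_left)
    qed
    also have "\<dots> = (\<Sum>j\<in>Basis. \<Sum>i\<in>Basis. (g i \<bullet> j) * (G y j \<bullet> g i))" by (rule sum.swap)
    also have "\<dots> = (\<Sum>j\<in>Basis. G y j \<bullet> g (\<Sum>i\<in>Basis. (h j \<bullet> i) *\<^sub>R i))"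
      by (simp only: linear_sum[OF lg] linear_cmul[OF lg] inner_sum_right inner_scaleR_right gij)
    also have "\<dots> = l y" by (simp add: euclidean_representation gh G(3))
    finally show ?thesis .
  qed
  have 4: "continuous_on UNIV (\<lambda>x. c *\<^sub>R h (G (?P x) (c *\<^sub>R g k)))" for k
    by (intro continuous_intros linear_continuous_on_compose[OF _ lh] continuous_on_compose2[OF G(2)]
         continuous_on_scaleR linear_continuous_on bg) auto
  have "C2_on UNIV (\<lambda>x. f (?P x)) ?D (\<lambda>x. c\<^sup>2 * l (?P x))"
    unfolding C2_on_def using 1 2 3 4
    by (intro conjI ballI exI[of _ "\<lambda>x k. c *\<^sub>R h (G (?P x) (c *\<^sub>R g k))"] allI open_UNIV)
  then show ?thesis using that by blast
qed

section \<open>Profile and transition functions of one variable\<close>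

lemma max0_power_has_derivative:
  "((\<lambda>t::real. (max 0 t) ^ Suc (Suc n)) has_real_derivative real (Suc (Suc n)) * (max 0 t) ^ Suc n) (at t)"
proof -
  consider "t < 0" | "t = 0" | "0 < t" by linarith
  then show ?thesis
  proof cases
    case 1
    have "((\<lambda>_. 0) has_real_derivative 0) (at t)" by simp
    then have "((\<lambda>t::real. (max 0 t) ^ Suc (Suc n)) has_real_derivative 0) (at t)"
      by (rule has_field_derivative_transform_within_open[of _ _ _ "{..<0}"]) (use 1 in \<open>simp_all add: max_def\<close>)
    then show ?thesis using 1 by simp
  next
    case 2
    have "((\<lambda>y::real. \<bar>y\<bar>) \<longlongrightarrow> 0) (at 0)" by (rule tendsto_rabs_zero) (rule tendsto_ident_at)
    moreover have "\<forall>\<^sub>F y::real in at 0. norm (((max 0 y) ^ Suc (Suc n) - (max 0 0) ^ Suc (Suc n)) / (y - 0)) \<le> \<bar>y\<bar>"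
    proof -
      have "\<forall>\<^sub>F y::real in at 0. y \<in> {-1<..<1}"
        by (intro eventually_at_in_open'[of "{-1<..<1}" 0]) auto
      then show ?thesis
      proof eventually_elim
        fix y :: real assume y: "y \<in> {-1<..<1}"
        show "norm (((max 0 y) ^ Suc (Suc n) - (max 0 0) ^ Suc (Suc n)) / (y - 0)) \<le> \<bar>y\<bar>"
        proof (cases "0 < y")
          case True
          then have m: "max 0 y = y" "y \<noteq> 0" by simp_all
          have "y * y ^ n \<le> y * 1" using True y by (intro mult_left_mono power_le_one) auto
          moreover have "0 \<le> y * y ^ n" using True by simp
          moreover have "((max 0 y) ^ Suc (Suc n) - (max 0 0) ^ Suc (Suc n)) / (y - 0) = y * y ^ n"
            unfolding m(1) power_Suc using m(2) by simp
          ultimately show ?thesis using True by simp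
        next
          case False
          then have m: "max 0 y = 0" by simp
          show ?thesis unfolding m by simp
        qed
      qed
    qed
    ultimately have "((\<lambda>y::real. ((max 0 y) ^ Suc (Suc n) - (max 0 0) ^ Suc (Suc n)) / (y - 0)) \<longlongrightarrow> 0) (at 0)"
      by (rule Lim_null_comparison[rotated])
    then show ?thesis using 2 by (simp add: has_field_derivative_iff)
  next
    case 3
    have "((\<lambda>t::real. t ^ Suc (Suc n)) has_real_derivative real (Suc (Suc n)) * t ^ Suc n) (at t)"
      using DERIV_pow[of "Suc (Suc n)" t] by (simp only: diff_Suc_Suc diff_zero)
    then have "((\<lambda>t::real. (max 0 t) ^ Suc (Suc n)) has_real_derivative real (Suc (Suc n)) * t ^ Suc n) (at t)"
    proof (rule has_field_derivative_transform_within_open[of _ _ _ "{0<..}"])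
      fix s :: real assume "s \<in> {0<..}"
      then have "max 0 s = s" by simp
      then show "s ^ Suc (Suc n) = (max 0 s) ^ Suc (Suc n)" by (simp only:)
    qed (use 3 in simp_all)
    then show ?thesis using 3 by simp
  qed
qed

lemma max0_cube_derivatives [derivative_intros]:
  "((\<lambda>t::real. (max 0 t) ^ 3) has_real_derivative 3 * (max 0 t) ^ 2) (at t)"
  "((\<lambda>t::real. (max 0 t) ^ 2) has_real_derivative 2 * max 0 t) (at t)"
proof -
  have n: "Suc (Suc 1) = 3" "Suc 1 = 2" "Suc (Suc 0) = 2" by simp_all
  have n': "Suc 2 = 3" by simp
  show "((\<lambda>t::real. (max 0 t) ^ 3) has_real_derivative 3 * (max 0 t) ^ 2) (at t)"
    using max0_power_has_derivative[of 1 t] unfolding n n' of_nat_numeral .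
  show "((\<lambda>t::real. (max 0 t) ^ 2) has_real_derivative 2 * max 0 t) (at t)"
    using max0_power_has_derivative[of 0 t] unfolding n of_nat_numeral power_Suc power_0 mult_1_right .
qed

text \<open>The cube is the lowest power of a positive part with two continuous derivatives, and
  these stay explicit. The argument will be a squared distance, so that the kernel is C2 at its
  centre as well.\<close>

definition profile :: "real \<Rightarrow> real" where "profile y = (max 0 (1 - y)) ^ 3"
definition profile' :: "real \<Rightarrow> real" where "profile' y = - 3 * (max 0 (1 - y)) ^ 2"
definition profile'' :: "real \<Rightarrow> real" where "profile'' y = 6 * max 0 (1 - y)"

lemma profile_derivatives:
  "(profile has_real_derivative profile' y) (at y)" "(profile' has_real_derivative profile'' y) (at y)"
proof -
  have d: "((\<lambda>y::real. 1 - y) has_real_derivative -1) (at y)" by (auto intro!: derivative_eq_intros)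
  show "(profile has_real_derivative profile' y) (at y)"
    using DERIV_chain2[OF max0_cube_derivatives(1) d] unfolding profile_def[abs_def] profile'_def by simp
  show "(profile' has_real_derivative profile'' y) (at y)"
    using DERIV_cmult[OF DERIV_chain2[OF max0_cube_derivatives(2) d], of "- 3"]
    unfolding profile'_def[abs_def] profile''_def by simp
qed

lemma profile_eq_0: "1 \<le> y \<Longrightarrow> profile y = 0" "1 \<le> y \<Longrightarrow> profile' y = 0" "1 \<le> y \<Longrightarrow> profile'' y = 0"
  by (simp_all add: profile_def profile'_def profile''_def max_def)

lemma profile_bounds: "0 \<le> profile y" "0 \<le> y \<Longrightarrow> profile y \<le> 1"
  by (auto simp: profile_def power_le_one)

lemma profile_antimono: "x \<le> y \<Longrightarrow> profile y \<le> profile x"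
  unfolding profile_def by (intro power_mono) auto

lemma continuous_on_profile:
  "continuous_on S profile" "continuous_on S profile'" "continuous_on S profile''"
  unfolding profile_def[abs_def] profile'_def[abs_def] profile''_def[abs_def] by (intro continuous_intros)+

text \<open>The transition function is u^3 / (u^3 + w^3) with u and w the positive parts of
  \<open>a - 1\<close> and \<open>exp 2 - a\<close>. It is applied to squared norms, so the
  transition takes place for 1 \<le> |x| \<le> e, one unit of ln |x|.\<close>

definition step_up :: "real \<Rightarrow> real" where "step_up a = max 0 (a - 1)"
definition step_down :: "real \<Rightarrow> real" where "step_down a = max 0 (exp 2 - a)"
definition step_den :: "real \<Rightarrow> real" where "step_den a = step_up a ^ 3 + step_down a ^ 3"
definition step_den' :: "real \<Rightarrow> real" where "step_den' a = 3 * (step_up a)\<^sup>2 - 3 * (step_down a)\<^sup>2"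
definition step_num :: "real \<Rightarrow> real" where
  "step_num a = 3 * (step_up a)\<^sup>2 * step_down a ^ 3 + step_up a ^ 3 * (3 * (step_down a)\<^sup>2)"
definition step_num' :: "real \<Rightarrow> real" where
  "step_num' a = 6 * step_up a * step_down a ^ 3 - step_up a ^ 3 * (6 * step_down a)"

definition step :: "real \<Rightarrow> real" where "step a = step_up a ^ 3 / step_den a"
definition step' :: "real \<Rightarrow> real" where "step' a = step_num a / (step_den a * step_den a)"
definition step'' :: "real \<Rightarrow> real" where
  "step'' a = (step_num' a * (step_den a * step_den a) - step_num a * (step_den' a * step_den a + step_den' a * step_den a))
     / ((step_den a * step_den a) * (step_den a * step_den a))"

lemma exp2_gt_1: "1 < exp (2::real)" by simp

lemma step_den_pos: "0 < step_den a"
proof (cases "1 < a")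
  case True
  then have "0 < step_up a ^ 3" by (simp add: step_up_def)
  then show ?thesis by (simp add: add_pos_nonneg step_den_def step_down_def)
next
  case False
  then have "0 < exp 2 - a" using exp2_gt_1 by linarith
  then have "0 < step_down a" by (simp add: step_down_def)
  then have "0 < step_down a ^ 3" by simp
  then show ?thesis by (simp add: add_nonneg_pos step_den_def step_up_def)
qed

lemma step_derivatives:
  "(step has_real_derivative step' a) (at a)" "(step' has_real_derivative step'' a) (at a)"
proof -
  have d1: "((\<lambda>a::real. a - 1) has_real_derivative 1) (at a)" by (auto intro!: derivative_eq_intros)
  have d2: "((\<lambda>a::real. exp 2 - a) has_real_derivative -1) (at a)" by (auto intro!: derivative_eq_intros)
  have U3: "((\<lambda>a. step_up a ^ 3) has_real_derivative 3 * (step_up a)\<^sup>2) (at a)"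
    using DERIV_chain2[OF max0_cube_derivatives(1) d1] by (simp add: step_up_def)
  have U2: "((\<lambda>a. (step_up a)\<^sup>2) has_real_derivative 2 * step_up a) (at a)"
    using DERIV_chain2[OF max0_cube_derivatives(2) d1] by (simp add: step_up_def)
  have W3: "((\<lambda>a. step_down a ^ 3) has_real_derivative - 3 * (step_down a)\<^sup>2) (at a)"
    using DERIV_chain2[OF max0_cube_derivatives(1) d2] by (simp add: step_down_def)
  have W2: "((\<lambda>a. (step_down a)\<^sup>2) has_real_derivative - 2 * step_down a) (at a)"
    using DERIV_chain2[OF max0_cube_derivatives(2) d2] by (simp add: step_down_def)
  have D: "(step_den has_real_derivative step_den' a) (at a)"
    unfolding step_den_def[abs_def] by (rule DERIV_cong[OF DERIV_add[OF U3 W3]]) (simp add: step_den'_def)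
  have N: "(step_num has_real_derivative step_num' a) (at a)"
    unfolding step_num_def[abs_def]
    by (rule DERIV_cong[OF DERIV_add[OF DERIV_mult[OF DERIV_cmult[OF U2, of 3] W3] DERIV_mult[OF U3 DERIV_cmult[OF W2, of 3]]]])
       (simp add: step_num'_def)
  have nz: "step_den a \<noteq> 0" using step_den_pos[of a] by simp
  show "(step has_real_derivative step' a) (at a)"
    unfolding step_def[abs_def]
    by (rule DERIV_cong[OF DERIV_divide[OF U3 D nz]])
       (simp add: step'_def step_num_def step_den_def step_den'_def algebra_simps)
  show "(step' has_real_derivative step'' a) (at a)"
    unfolding step'_def[abs_def]
    by (rule DERIV_cong[OF DERIV_divide[OF N DERIV_mult[OF D D]]])
       (simp_all add: nz step''_def)
qed

lemma continuous_on_step: "continuous_on S step" "continuous_on S step'" "continuous_on S step''"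
proof -
  have nz: "step_den a \<noteq> 0" for a using step_den_pos[of a] by simp
  have c: "continuous_on S step_up" "continuous_on S step_down"
    unfolding step_up_def[abs_def] step_down_def[abs_def] by (intro continuous_intros)+
  have c': "continuous_on S step_den" "continuous_on S step_den'" "continuous_on S step_num" "continuous_on S step_num'"
    unfolding step_den_def[abs_def] step_den'_def[abs_def] step_num_def[abs_def] step_num'_def[abs_def]
    by (intro continuous_intros c)+
  show "continuous_on S step" "continuous_on S step'" "continuous_on S step''"
    unfolding step_def[abs_def] step'_def[abs_def] step''_def[abs_def]
    by (intro continuous_intros c c'; simp add: nz)+
qed

lemma step_simps:
  "a \<le> 1 \<Longrightarrow> step a = 0" "a \<le> 1 \<Longrightarrow> step' a = 0" "a \<le> 1 \<Longrightarrow> step'' a = 0"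
  "exp 2 \<le> a \<Longrightarrow> step a = 1" "exp 2 \<le> a \<Longrightarrow> step' a = 0" "exp 2 \<le> a \<Longrightarrow> step'' a = 0"
proof -
  have nz: "step_den a \<noteq> 0" using step_den_pos[of a] by simp
  show "step a = 0" "step' a = 0" "step'' a = 0" if "a \<le> 1"
  proof -
    have "step_up a = 0" using that by (simp add: step_up_def)
    then show "step a = 0" "step' a = 0" "step'' a = 0" by (simp_all add: step_def step'_def step''_def step_num_def step_num'_def)
  qed
  show "step a = 1" "step' a = 0" "step'' a = 0" if "exp 2 \<le> a"
  proof -
    have "step_down a = 0" using that by (simp add: step_down_def)
    moreover from this have "step_den a = step_up a ^ 3" by (simp add: step_den_def)
    ultimately show "step a = 1" "step' a = 0" "step'' a = 0"
      using nz by (simp_all add: step_def step'_def step''_def step_num_def step_num'_def)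
  qed
qed

lemma step_bounds: "0 \<le> step a" "step a \<le> 1"
proof -
  have "0 \<le> step_up a ^ 3" "0 \<le> step_down a ^ 3" by (simp_all add: step_up_def step_down_def)
  then show "0 \<le> step a" "step a \<le> 1"
    using step_den_pos[of a] by (simp_all add: step_def pos_divide_le_eq) (simp add: step_den_def)
qed

lemma step_mono_bound: "step (b * exp (- 2)) \<le> step b" if "0 \<le> b"
proof -
  have "mono step"
  proof (rule monoI)
    fix x y :: real assume "x \<le> y"
    then show "step x \<le> step y"
    proof (rule DERIV_nonneg_imp_nondecreasing)
      fix a :: real
      have "0 \<le> step_num a" by (simp add: step_num_def step_up_def step_down_def)
      then have "0 \<le> step' a" using step_den_pos[of a] by (simp add: step'_def)
      then show "\<exists>y. (step has_real_derivative y) (at a) \<and> 0 \<le> y" using step_derivatives(1) by blast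
    qed
  qed
  moreover have "b * exp (- 2) \<le> b" using that by (simp add: mult_left_le)
  ultimately show ?thesis by (rule monoD)
qed

section \<open>The homogeneous kernel and the duality of its Laplacians\<close>

definition profile_mass :: "'a::euclidean_space itself \<Rightarrow> real" where
  "profile_mass _ = (LINT y::'a|lborel. profile ((norm y)\<^sup>2))"

lemma profile_integrable: "integrable lborel (\<lambda>y::'a::euclidean_space. profile ((norm y)\<^sup>2))"
proof (rule integrable_bounded_on_cball[where a = 0 and R = 1 and B = 1])
  show "(\<lambda>y::'a. profile ((norm y)\<^sup>2)) \<in> borel_measurable borel"
    by (intro borel_measurable_continuous_onI continuous_on_compose2[OF continuous_on_profile(1)] continuous_intros) auto
  show "\<bar>profile ((norm y)\<^sup>2)\<bar> \<le> 1" for y :: 'a using profile_bounds[of "(norm y)\<^sup>2"] by simp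
  show "profile ((norm y)\<^sup>2) = 0" if "y \<notin> cball 0 1" for y :: 'a
    using that by (intro profile_eq_0 one_le_power) simp
qed

lemma profile_mass_pos: "0 < profile_mass TYPE('a::euclidean_space)"
proof -
  have p: "profile ((norm y)\<^sup>2) \<noteq> 0" if "y \<in> ball (0::'a) 1" for y
  proof -
    have "(norm y)\<^sup>2 < 1" using that power_strict_mono[of "norm y" 1 2] by simp
    then show ?thesis by (simp add: profile_def)
  qed
  have "0 \<le> profile_mass TYPE('a)" unfolding profile_mass_def
    by (rule integral_nonneg_AE) (simp add: profile_bounds)
  moreover have "profile_mass TYPE('a) \<noteq> 0"
  proof
    assume "profile_mass TYPE('a) = 0"
    then have "AE y in lborel. profile ((norm (y::'a))\<^sup>2) = 0"
      using integral_nonneg_eq_0_iff_AE[OF profile_integrable[where 'a='a]] by (simp add: profile_bounds profile_mass_def)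
    then have "AE y in lborel. y \<notin> ball (0::'a) 1" by eventually_elim (use p in blast)
    then have "ball (0::'a) 1 \<in> null_sets lborel" by (rule AE_iff_null_sets[THEN iffD2, rotated]) simp
    then have "negligible (ball (0::'a) 1)" by (simp add: negligible_iff_null_sets null_sets_completionI)
    then show False using open_not_negligible[OF open_ball, of "0::'a" 1] by simp
  qed
  ultimately show ?thesis by linarith
qed

text \<open>For fixed \<open>z\<close> the kernel is a bump of radius \<open>\<mu>|z|\<close> about \<open>z\<close> of total mass 1.  The radius
  proportional to \<open>|z|\<close> makes the smoothing commute with all similarities fixing the origin.\<close>

definition ker :: "real \<Rightarrow> 'a::euclidean_space \<Rightarrow> 'a \<Rightarrow> real" where
  "ker \<mu> x z = inverse (profile_mass TYPE('a)) * inverse (\<mu> * norm z) ^ DIM('a)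
     * profile ((inverse (\<mu> * norm z))\<^sup>2 * (norm (x - z))\<^sup>2)"

definition ker_grad :: "real \<Rightarrow> 'a::euclidean_space \<Rightarrow> 'a \<Rightarrow> 'a" where
  "ker_grad \<mu> x z = (inverse (profile_mass TYPE('a)) * inverse (\<mu> * norm z) ^ DIM('a)
     * (profile' ((inverse (\<mu> * norm z))\<^sup>2 * (norm (x - z))\<^sup>2) * (2 * (inverse (\<mu> * norm z))\<^sup>2))) *\<^sub>R (x - z)"

definition ker_lap :: "real \<Rightarrow> 'a::euclidean_space \<Rightarrow> 'a \<Rightarrow> real" where
  "ker_lap \<mu> x z = inverse (profile_mass TYPE('a)) * inverse (\<mu> * norm z) ^ DIM('a)
     * (profile' ((inverse (\<mu> * norm z))\<^sup>2 * (norm (x - z))\<^sup>2) * ((inverse (\<mu> * norm z))\<^sup>2 * (2 * real DIM('a)))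
      + profile'' ((inverse (\<mu> * norm z))\<^sup>2 * (norm (x - z))\<^sup>2)
        * (((inverse (\<mu> * norm z))\<^sup>2)\<^sup>2 * (4 * (norm (x - z))\<^sup>2)))"

lemma C2_on_ker: "C2_on UNIV (\<lambda>x. ker \<mu> x z) (\<lambda>x. ker_grad \<mu> x z) (\<lambda>x. ker_lap \<mu> x (z :: 'a::euclidean_space))"
proof -
  let ?s = "(inverse (\<mu> * norm z))\<^sup>2"
  have 1: "C2_on UNIV (\<lambda>x. ?s * (norm (x - z))\<^sup>2) (\<lambda>x. ?s *\<^sub>R 2 *\<^sub>R (x - z)) (\<lambda>x. ?s * (2 * real DIM('a)))"
    by (rule C2_on_cmult[OF C2_on_dist_sq]) simp
  have 2: "C2_on UNIV (\<lambda>x. profile (?s * (norm (x - z))\<^sup>2)) (\<lambda>x. profile' (?s * (norm (x - z))\<^sup>2) *\<^sub>R (?s *\<^sub>R 2 *\<^sub>R (x - z)))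
    (\<lambda>x. profile' (?s * (norm (x - z))\<^sup>2) * (?s * (2 * real DIM('a))) + profile'' (?s * (norm (x - z))\<^sup>2) * ((?s *\<^sub>R 2 *\<^sub>R (x - z)) \<bullet> (?s *\<^sub>R 2 *\<^sub>R (x - z))))"
    by (rule C2_on_compose[OF 1]) (auto intro: profile_derivatives continuous_on_profile)
  show ?thesis
    by (rule C2_on_cong[OF C2_on_cmult[OF 2, of "inverse (profile_mass TYPE('a)) * inverse (\<mu> * norm z) ^ DIM('a)"]])
       (simp_all add: ker_def ker_grad_def ker_lap_def dot_square_norm power2_eq_square mult_ac)
qed

lemma ker_nonneg: "0 < \<mu> \<Longrightarrow> 0 \<le> ker \<mu> x z"
  unfolding ker_def using profile_mass_pos[where 'a='a] profile_bounds(1) by (intro mult_nonneg_nonneg) auto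

lemma ker_eq_0:
  fixes x z :: "'a::euclidean_space"
  assumes l: "0 < \<mu>" and d: "\<mu> * norm z \<le> norm (x - z)"
  shows "ker \<mu> x z = 0" "ker_grad \<mu> x z = 0" "ker_lap \<mu> x z = 0"
proof -
  have "ker \<mu> x z = 0 \<and> ker_grad \<mu> x z = 0 \<and> ker_lap \<mu> x z = 0"
  \<comment> \<open>At \<open>z = 0\<close> the convention \<open>inverse 0 = 0\<close> makes the
    kernel and its derivatives vanish.\<close>
  proof (cases "z = 0")
    case False
    then have p: "0 < \<mu> * norm z" using l by simp
    then have "1 \<le> inverse (\<mu> * norm z) * norm (x - z)" using d by (simp add: field_simps)
    then have "1 \<le> (inverse (\<mu> * norm z) * norm (x - z))\<^sup>2" by (rule one_le_power)
    then have "1 \<le> (inverse (\<mu> * norm z))\<^sup>2 * (norm (x - z))\<^sup>2" by (simp only: power_mult_distrib)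
    from profile_eq_0[OF this] show ?thesis unfolding ker_def ker_grad_def ker_lap_def by simp
  qed (simp add: ker_def ker_grad_def ker_lap_def)
  then show "ker \<mu> x z = 0" "ker_grad \<mu> x z = 0" "ker_lap \<mu> x z = 0" by auto
qed

text \<open>For \<open>\<mu> \<le> 1/2\<close> the norms of x and z differ on the support by a
  factor of at most 2; the later support bounds and uniform estimates rest on this.\<close>

lemma ker_support:
  fixes x z :: "'a::euclidean_space"
  assumes l: "0 < \<mu>" "\<mu> \<le> 1/2" and nz: "ker \<mu> x z \<noteq> 0 \<or> ker_grad \<mu> x z \<noteq> 0 \<or> ker_lap \<mu> x z \<noteq> 0"
  shows "norm (x - z) < \<mu> * norm z" "norm z \<le> 2 * norm x" "norm x \<le> 2 * norm z" "z \<noteq> 0" "x \<noteq> 0"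
proof -
  show d: "norm (x - z) < \<mu> * norm z" using ker_eq_0[OF l(1), of z x] nz by (meson not_le)
  have "\<mu> * norm z \<le> 1/2 * norm z" using l by (intro mult_right_mono) auto
  then show 1: "norm z \<le> 2 * norm x" "norm x \<le> 2 * norm z"
    using d norm_triangle_ineq4[of x "x - z"] norm_triangle_ineq[of z "x - z"] by auto
  show "z \<noteq> 0" using d by auto
  with 1(1) show "x \<noteq> 0" by auto
qed

text \<open>Rotation invariance together with homogeneity of degrees -m, -m-1 and -m-2, where m is
  the dimension.\<close>

lemma ker_similarity:
  fixes g :: "'a::euclidean_space \<Rightarrow> 'a"
  assumes g: "orthogonal_transformation g" and c: "0 < c"
  shows "ker \<mu> (c *\<^sub>R g x) (c *\<^sub>R g z) = ker \<mu> x z / c ^ DIM('a)"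
    and "ker_grad \<mu> (c *\<^sub>R g x) (c *\<^sub>R g z) = (1 / (c * c ^ DIM('a))) *\<^sub>R g (ker_grad \<mu> x z)"
    and "ker_lap \<mu> (c *\<^sub>R g x) (c *\<^sub>R g z) = ker_lap \<mu> x z / (c\<^sup>2 * c ^ DIM('a))"
proof -
  have lg: "linear g" and ng: "norm (g y) = norm y" for y
    using g by (auto simp: orthogonal_transformation_linear orthogonal_transformation_norm)
  have d: "c *\<^sub>R g x - c *\<^sub>R g z = c *\<^sub>R g (x - z)" by (simp add: linear_diff[OF lg] scaleR_diff_right)
  have n: "norm (c *\<^sub>R g x - c *\<^sub>R g z) = c * norm (x - z)" unfolding d using c by (simp add: ng)
  have i: "inverse (\<mu> * norm (c *\<^sub>R g z)) = inverse (\<mu> * norm z) / c" using c by (simp add: ng field_simps)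
  have s: "(inverse (\<mu> * norm z) / c)\<^sup>2 * (c * norm (x - z))\<^sup>2 = (inverse (\<mu> * norm z))\<^sup>2 * (norm (x - z))\<^sup>2"
    using c by (simp add: power_mult_distrib power_divide)
  show "ker \<mu> (c *\<^sub>R g x) (c *\<^sub>R g z) = ker \<mu> x z / c ^ DIM('a)"
    unfolding ker_def n i s by (simp add: power_divide)
  show "ker_grad \<mu> (c *\<^sub>R g x) (c *\<^sub>R g z) = (1 / (c * c ^ DIM('a))) *\<^sub>R g (ker_grad \<mu> x z)"
    unfolding ker_grad_def n i s unfolding d linear_cmul[OF lg] scaleR_scaleR
    by (rule arg_cong2[where f = scaleR]) (use c in \<open>simp_all add: power_divide power2_eq_square field_simps\<close>)
  show "ker_lap \<mu> (c *\<^sub>R g x) (c *\<^sub>R g z) = ker_lap \<mu> x z / (c\<^sup>2 * c ^ DIM('a))"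
  proof -
    define I where "I = inverse (\<mu> * norm z)"
    define n1 where "n1 = norm (x - z)"
    define p1 where "p1 = profile' (I\<^sup>2 * n1\<^sup>2)"
    define p2 where "p2 = profile'' (I\<^sup>2 * n1\<^sup>2)"
    show ?thesis
      unfolding ker_lap_def n i s unfolding I_def[symmetric] n1_def[symmetric] unfolding p1_def[symmetric] p2_def[symmetric]
      using c by (simp add: power_divide power_mult_distrib power2_eq_square field_simps)
  qed
qed

lemma inner_linear_combination:
  fixes y z :: "'a::real_inner"
  shows "(s *\<^sub>R (p *\<^sub>R z + q *\<^sub>R y)) \<bullet> (s *\<^sub>R (p *\<^sub>R z + q *\<^sub>R y)) =
    s\<^sup>2 * (p\<^sup>2 * (z \<bullet> z) + 2 * p * q * (z \<bullet> y) + q\<^sup>2 * (y \<bullet> y))"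
  by (simp add: inner_add_left inner_add_right inner_commute[of y z] power2_eq_square algebra_simps)

text \<open>Up to the factor \<open>|z|\<^sup>2/|x|\<^sup>2\<close> the Laplacian of the kernel in \<open>x\<close> is its Laplacian in \<open>z\<close>, as for every
  rotation-invariant kernel that is homogeneous of degree \<open>-DIM('a)\<close>.\<close>

lemma ker_lap_dual:
  fixes x :: "'a::euclidean_space"
  assumes l: "0 < \<mu>" "\<mu> \<le> 1/2" and x: "x \<noteq> 0"
  shows "weak_laplacian (\<lambda>z. (norm z)\<^sup>2 / (norm x)\<^sup>2 * ker \<mu> x z) (\<lambda>z. ker_lap \<mu> x z)"
proof -
  define m where "m = real DIM('a)"
  \<comment> \<open>\<open>b z powr \<beta>\<close> is |z|^(2-m). It combines the factor |z|^2 with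
    the normalisation |z|^(-m) of the kernel and, being harmonic off 0, leaves no undifferentiated
    profile in the Laplacian.\<close>
  define \<beta> where "\<beta> = 1 - m / 2"
  let ?S = "- {0::'a}"
  have oS: "open ?S" by (intro open_Compl closed_singleton)
  define b where "b z = (norm (z::'a))\<^sup>2" for z
  define a where "a = (norm x)\<^sup>2"
  define Q where "Q z = (norm (z - x))\<^sup>2 * inverse (b z)" for z
  define K where "K = inverse (profile_mass TYPE('a)) * inverse \<mu> ^ DIM('a)"
  have a: "0 < a" using x by (simp add: a_def)
  have b: "0 < b z" if "z \<in> ?S" for z using that by (simp add: b_def)
  have Cb: "C2_on ?S b (\<lambda>z. 2 *\<^sub>R z) (\<lambda>z. 2 * m)"
    using C2_on_dist_sq[OF oS, of 0] by (simp add: b_def[abs_def] m_def)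
  have Cf: "C2_on ?S (\<lambda>z. (norm (z - x))\<^sup>2) (\<lambda>z. 2 *\<^sub>R (z - x)) (\<lambda>z. 2 * m)"
    using C2_on_dist_sq[OF oS, of x] by (simp add: m_def)
  have Ci: "C2_on ?S (\<lambda>z. inverse (b z)) (\<lambda>z. (- (inverse (b z) * inverse (b z))) *\<^sub>R 2 *\<^sub>R z)
     (\<lambda>z. (- (inverse (b z) * inverse (b z))) * (2 * m) + (2 * inverse (b z) ^ 3) * ((2 *\<^sub>R z) \<bullet> (2 *\<^sub>R z)))"
  proof (rule C2_on_compose[OF Cb, of inverse "\<lambda>t. - (inverse t * inverse t)" "\<lambda>t. 2 * inverse t ^ 3"])
    fix z assume "z \<in> ?S"
    from b[OF this] have nz: "b z \<noteq> 0" by simp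
    show "(inverse has_real_derivative - (inverse (b z) * inverse (b z))) (at (b z))"
      using nz by (auto intro!: derivative_eq_intros)
    show "((\<lambda>t. - (inverse t * inverse t)) has_real_derivative 2 * inverse (b z) ^ 3) (at (b z))"
      using nz by (auto intro!: derivative_eq_intros simp: power3_eq_cube algebra_simps)
  next
    show "continuous_on (b ` ?S) (\<lambda>t. 2 * inverse t ^ 3)" using b by (intro continuous_intros) fastforce
  qed
  have Cp: "C2_on ?S (\<lambda>z. b z powr \<beta>) (\<lambda>z. (\<beta> * b z powr (\<beta> - 1)) *\<^sub>R 2 *\<^sub>R z)
     (\<lambda>z. (\<beta> * b z powr (\<beta> - 1)) * (2 * m) + (\<beta> * ((\<beta> - 1) * b z powr (\<beta> - 1 - 1))) * ((2 *\<^sub>R z) \<bullet> (2 *\<^sub>R z)))"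
  proof (rule C2_on_compose[OF Cb, of "\<lambda>t. t powr \<beta>" "\<lambda>t. \<beta> * t powr (\<beta> - 1)" "\<lambda>t. \<beta> * ((\<beta> - 1) * t powr (\<beta> - 1 - 1))"])
    fix z assume "z \<in> ?S"
    from b[OF this] have p: "0 < b z" .
    show "((\<lambda>t. t powr \<beta>) has_real_derivative \<beta> * b z powr (\<beta> - 1)) (at (b z))"
      by (rule has_real_derivative_powr[OF p])
    show "((\<lambda>t. \<beta> * t powr (\<beta> - 1)) has_real_derivative \<beta> * ((\<beta> - 1) * b z powr (\<beta> - 1 - 1))) (at (b z))"
      by (rule DERIV_cmult[OF has_real_derivative_powr[OF p]])
  next
    show "continuous_on (b ` ?S) (\<lambda>t. \<beta> * ((\<beta> - 1) * t powr (\<beta> - 1 - 1)))" using b by (intro continuous_intros) fastforce+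
  qed
  note CQ = C2_on_mult[OF Cf Ci]
  define s where "s = (inverse \<mu>)\<^sup>2"
  let ?E = "\<lambda>f B z. f *\<^sub>R (- (inverse B * inverse B)) *\<^sub>R 2 *\<^sub>R z + inverse B *\<^sub>R 2 *\<^sub>R (z - x)"
  have CP: "C2_on ?S (\<lambda>z. profile (s * Q z))
    (\<lambda>z. profile' (s * Q z) *\<^sub>R s *\<^sub>R ?E ((norm (z - x))\<^sup>2) (b z) z)
    (\<lambda>z. profile' (s * Q z) * (s * ((norm (z - x))\<^sup>2 * ((- (inverse (b z) * inverse (b z))) * (2 * m) + (2 * inverse (b z) ^ 3) * ((2 *\<^sub>R z) \<bullet> (2 *\<^sub>R z)))
        + inverse (b z) * (2 * m) + 2 * ((2 *\<^sub>R (z - x)) \<bullet> ((- (inverse (b z) * inverse (b z))) *\<^sub>R 2 *\<^sub>R z))))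
      + profile'' (s * Q z) * ((s *\<^sub>R ?E ((norm (z - x))\<^sup>2) (b z) z)
         \<bullet> (s *\<^sub>R ?E ((norm (z - x))\<^sup>2) (b z) z)))"
    unfolding Q_def
    by (rule C2_on_compose[OF C2_on_cmult[OF CQ]]) (auto intro: profile_derivatives continuous_on_profile)
  note CF = C2_on_cmult[OF C2_on_mult[OF Cp CP], of "K / a"]
  have "\<exists>D. C2_on ?S (\<lambda>z. (norm z)\<^sup>2 / (norm x)\<^sup>2 * ker \<mu> x z) D (\<lambda>z. ker_lap \<mu> x z)"
  proof (rule exI, rule C2_on_cong[OF CF])
    fix z assume z: "z \<in> ?S"
    define B where "B = b z"
    have B: "0 < B" using b[OF z] by (simp add: B_def)
    have nz: "norm z = sqrt B" by (simp add: B_def b_def)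
    have iB: "(inverse (\<mu> * norm z))\<^sup>2 = s * inverse B"
      by (simp add: s_def B_def b_def power_mult_distrib power_inverse)
    have w: "inverse (norm z) ^ DIM('a) = B powr (\<beta> - 1)"
    proof -
      have "0 < norm z" using z by simp
      then have "inverse (norm z) ^ DIM('a) = norm z powr (- m)"
        by (simp add: m_def powr_minus powr_realpow power_inverse)
      also have "\<dots> = B powr (\<beta> - 1)"
      proof -
        have "(norm z)\<^sup>2 = norm z powr 2" using \<open>0 < norm z\<close> by simp
        then show ?thesis by (simp only: B_def b_def \<beta>_def powr_powr) simp
      qed
      finally show ?thesis .
    qed
    define W where "W = B powr (\<beta> - 1)"
    have pB: "B powr \<beta> = W * B" using B powr_add[of B "\<beta> - 1" 1] by (simp add: W_def)
    have pB2: "B powr (\<beta> - 1 - 1) = W / B" using B powr_diff[of B "\<beta> - 1" 1] by (simp add: W_def)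
    define f where "f = (norm (z - x))\<^sup>2"
    have fx: "(norm (x - z))\<^sup>2 = f" by (simp add: f_def norm_minus_commute)
    have zz: "z \<bullet> z = B" by (simp add: B_def b_def power2_norm_eq_inner)
    define c where "c = x \<bullet> z"
    have fc: "f = a + B - 2 * c"
      by (simp add: f_def a_def c_def zz[symmetric] power2_norm_eq_inner inner_diff_left inner_diff_right inner_commute)
    have zx: "z \<bullet> (z - x) = B - c" "(z - x) \<bullet> z = B - c" "(z - x) \<bullet> (z - x) = f"
      by (simp_all add: inner_diff_left inner_diff_right zz c_def inner_commute f_def power2_norm_eq_inner)
    have kA: "inverse (profile_mass TYPE('a)) * inverse (\<mu> * norm z) ^ DIM('a) = K * W"
      unfolding K_def W_def w[symmetric] by (simp add: power_mult_distrib)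
    have Qz: "s * Q z = s * inverse B * f" by (simp add: Q_def f_def B_def mult_ac)
    show "K / a * (b z powr \<beta> * profile (s * Q z)) = (norm z)\<^sup>2 / (norm x)\<^sup>2 * ker \<mu> x z"
    proof -
      have nB: "(norm z)\<^sup>2 = B" and na: "(norm x)\<^sup>2 = a" by (simp_all add: B_def b_def a_def)
      show ?thesis unfolding ker_def kA iB fx Qz B_def[symmetric] pB nB na by simp
    qed
    define p1 where "p1 = profile' (s * inverse B * f)"
    define p2 where "p2 = profile'' (s * inverse B * f)"
    define p0 where "p0 = profile (s * inverse B * f)"
    have L: "ker_lap \<mu> x z = K * W * (p1 * (s * inverse B * (2 * m)) + p2 * ((s * inverse B)\<^sup>2 * (4 * f)))"
      unfolding ker_lap_def kA iB fx m_def p1_def p2_def ..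
    have i1: "(s *\<^sub>R ?E f B z)
         \<bullet> (s *\<^sub>R ?E f B z) = s\<^sup>2 * (4 * f * a * inverse B ^ 3)"
    proof -
      have "(s *\<^sub>R ?E f B z)
         \<bullet> (s *\<^sub>R ?E f B z)
         = s\<^sup>2 * (4 * f\<^sup>2 * inverse B ^ 4 * B - 8 * f * inverse B ^ 3 * (B - c) + 4 * inverse B ^ 2 * f)"
      proof -
        define y where "y = z - x"
        have "f *\<^sub>R (- (inverse B * inverse B)) *\<^sub>R 2 *\<^sub>R z + inverse B *\<^sub>R 2 *\<^sub>R y
            = (- 2 * f * (inverse B)\<^sup>2) *\<^sub>R z + (2 * inverse B) *\<^sub>R y" by (simp add: power2_eq_square mult_ac)
        then show ?thesis
          unfolding y_def[symmetric] using zz zx[folded y_def]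
          by (simp only: inner_linear_combination) (simp add: power2_eq_square eval_nat_numeral algebra_simps)
      qed
      also have "\<dots> = s\<^sup>2 * (4 * f * a * inverse B ^ 3)"
        using B unfolding fc by (simp add: field_simps eval_nat_numeral)
      finally show ?thesis .
    qed
    have i2: "(2 *\<^sub>R (z - x)) \<bullet> ((- (inverse B * inverse B)) *\<^sub>R 2 *\<^sub>R z) = - 4 * (inverse B)\<^sup>2 * (B - c)"
      by (simp add: zx power2_eq_square)
    have i3: "((\<beta> * W) *\<^sub>R 2 *\<^sub>R z) \<bullet> (p1 *\<^sub>R s *\<^sub>R ?E f B z)
       = \<beta> * W * p1 * s * (4 * inverse B * (B - c) - 4 * f * inverse B)"
    proof -
      define y where "y = z - x"
      have "f *\<^sub>R (- (inverse B * inverse B)) *\<^sub>R 2 *\<^sub>R z + inverse B *\<^sub>R 2 *\<^sub>R y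
            = (- 2 * f * (inverse B)\<^sup>2) *\<^sub>R z + (2 * inverse B) *\<^sub>R y" by (simp add: power2_eq_square mult_ac)
      then show ?thesis
        unfolding y_def[symmetric] using zz zx(1)[folded y_def] B
        by (simp only: inner_add_right inner_scaleR_left inner_scaleR_right) (simp add: power2_eq_square field_simps)
    qed
    have i4: "(2 *\<^sub>R z) \<bullet> (2 *\<^sub>R z) = 4 * B" by (simp add: zz)
    have m\<beta>: "m = 2 - 2 * \<beta>" by (simp add: \<beta>_def)
    show "K / a * (b z powr \<beta> * (profile' (s * Q z) * (s * ((norm (z - x))\<^sup>2 * ((- (inverse (b z) * inverse (b z))) * (2 * m) + (2 * inverse (b z) ^ 3) * ((2 *\<^sub>R z) \<bullet> (2 *\<^sub>R z)))
        + inverse (b z) * (2 * m) + 2 * ((2 *\<^sub>R (z - x)) \<bullet> ((- (inverse (b z) * inverse (b z))) *\<^sub>R 2 *\<^sub>R z))))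
      + profile'' (s * Q z) * ((s *\<^sub>R ?E ((norm (z - x))\<^sup>2) (b z) z)
         \<bullet> (s *\<^sub>R ?E ((norm (z - x))\<^sup>2) (b z) z)))
       + profile (s * Q z) * ((\<beta> * b z powr (\<beta> - 1)) * (2 * m) + (\<beta> * ((\<beta> - 1) * b z powr (\<beta> - 1 - 1))) * ((2 *\<^sub>R z) \<bullet> (2 *\<^sub>R z)))
       + 2 * (((\<beta> * b z powr (\<beta> - 1)) *\<^sub>R 2 *\<^sub>R z) \<bullet> (profile' (s * Q z) *\<^sub>R s *\<^sub>R ?E ((norm (z - x))\<^sup>2) (b z) z)))
       = ker_lap \<mu> x z"
    proof -
      \<comment> \<open>All inner products are now expressed through B, a and c, so a rational
        identity remains; with \<open>m = 2 - 2 * \<beta>\<close> the coefficient of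
        \<open>p0\<close> is 0.\<close>
      have "K / a * (W * B * (p1 * (s * (f * ((- (inverse B * inverse B)) * (2 * m) + (2 * inverse B ^ 3) * (4 * B))
        + inverse B * (2 * m) + 2 * (- 4 * (inverse B)\<^sup>2 * (B - c))))
          + p2 * (s\<^sup>2 * (4 * f * a * inverse B ^ 3)))
         + p0 * ((\<beta> * W) * (2 * m) + (\<beta> * ((\<beta> - 1) * (W / B))) * (4 * B))
         + 2 * (\<beta> * W * p1 * s * (4 * inverse B * (B - c) - 4 * f * inverse B)))
        = K * W * (p1 * (s * inverse B * (2 * m)) + p2 * ((s * inverse B)\<^sup>2 * (4 * f)))"
        using B a unfolding m\<beta> fc by (simp add: field_simps eval_nat_numeral)
      then show ?thesis
        unfolding L Qz B_def[symmetric] f_def[symmetric] p0_def[symmetric] p1_def[symmetric] p2_def[symmetric] pB pB2 W_def[symmetric] i1 i2 i3 i4 .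
    qed
  qed simp_all
  then obtain D where D: "C2_on ?S (\<lambda>z. (norm z)\<^sup>2 / (norm x)\<^sup>2 * ker \<mu> x z) D (\<lambda>z. ker_lap \<mu> x z)" ..
  \<comment> \<open>The kernel vanishes for |z| < |x|/2, so the identity extends across the singular
    point \<open>z = 0\<close>.\<close>
  let ?T = "{z::'a. 2 * norm z < norm x}"
  have oT: "open ?T" by (intro open_Collect_less continuous_intros)
  have T0: "ker \<mu> x z = 0" "ker_lap \<mu> x z = 0" if "z \<in> ?T" for z
    using ker_support(3)[OF l, of x z] that by force+
  obtain D' where "C2_on (?S \<union> ?T) (\<lambda>z. (norm z)\<^sup>2 / (norm x)\<^sup>2 * ker \<mu> x z) D' (\<lambda>z. ker_lap \<mu> x z)"
    by (rule C2_on_extend_zero[OF D oT]) (auto simp: T0)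
  moreover have "?S \<union> ?T = UNIV" using x by auto
  ultimately show ?thesis using C2_on_imp_weak_laplacian by metis
qed

lemma continuous_on_open_cover2:
  fixes f :: "'a::t2_space \<Rightarrow> 'b::topological_space"
  assumes "continuous_on (S \<inter> A) f" "continuous_on (S \<inter> B) f" "open A" "open B" "S \<subseteq> A \<union> B"
  shows "continuous_on S f"
  unfolding continuous_on_eq_continuous_within
proof
  fix x assume x: "x \<in> S"
  have *: "continuous (at x within S) f" if C: "continuous_on (S \<inter> C) f" "open C" "x \<in> C" for C
  proof -
    have "at x within S = at x within (S \<inter> C)" by (rule at_within_nhd[OF C(3,2)]) auto
    then show ?thesis using C x by (simp add: continuous_on_eq_continuous_within)
  qed
  then show "continuous (at x within S) f" using assms x by blast
qed

text \<open>The integral is the Laplacian at x of the smoothed function. By duality its integrand is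
  w times the weak Laplacian, in z, of a nonnegative function of bounded support, and w is
  subharmonic.\<close>

lemma sh_integral_ker_lap_nonneg:
  fixes w :: "real^'m \<Rightarrow> ereal" and x :: "real^'m"
  assumes w: "w \<in> sh_functions" and l: "0 < \<mu>" "\<mu> \<le> 1/2" and x: "x \<noteq> 0"
  shows "0 \<le> (LINT z|lborel. real_of_ereal (w z) * ker_lap \<mu> x z)"
proof (rule sh_integral_weak_laplacian_nonneg[OF w ker_lap_dual[OF l x], where S = "2 * norm x"])
  show "0 \<le> (norm z)\<^sup>2 / (norm x)\<^sup>2 * ker \<mu> x z" for z
    using ker_nonneg[OF l(1), of x z] by simp
  fix z :: "real^'m" assume "z \<notin> cball 0 (2 * norm x)"
  then have "ker \<mu> x z = 0 \<and> ker_lap \<mu> x z = 0" using ker_support(2)[OF l, of x z] by fastforce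
  then show "(norm z)\<^sup>2 / (norm x)\<^sup>2 * ker \<mu> x z = 0" "ker_lap \<mu> x z = 0" by simp_all
qed

lemma continuous_on_ker:
  fixes f h :: "'b::topological_space \<Rightarrow> 'a::euclidean_space"
  assumes "continuous_on S l" "continuous_on S f" "continuous_on S h"
    and "\<And>p. p \<in> S \<Longrightarrow> l p \<noteq> 0" "\<And>p. p \<in> S \<Longrightarrow> h p \<noteq> 0"
  shows "continuous_on S (\<lambda>p. ker (l p) (f p) (h p))" "continuous_on S (\<lambda>p. ker_grad (l p) (f p) (h p))"
    "continuous_on S (\<lambda>p. ker_lap (l p) (f p) (h p))"
  unfolding ker_def ker_grad_def ker_lap_def
  by (intro continuous_intros assms continuous_on_compose2[OF continuous_on_profile(1)[of UNIV]]
     continuous_on_compose2[OF continuous_on_profile(2)[of UNIV]] continuous_on_compose2[OF continuous_on_profile(3)[of UNIV]];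
     use assms(4,5) in auto)+

section \<open>Cutting the kernel off to an annulus\<close>

definition cutoff :: "'a::euclidean_space \<Rightarrow> real" where "cutoff x = step ((norm x)\<^sup>2)"
definition cutoff_grad :: "'a::euclidean_space \<Rightarrow> 'a" where "cutoff_grad x = (2 * step' ((norm x)\<^sup>2)) *\<^sub>R x"
definition cutoff_lap :: "'a::euclidean_space \<Rightarrow> real" where
  "cutoff_lap x = step' ((norm x)\<^sup>2) * (2 * real DIM('a)) + step'' ((norm x)\<^sup>2) * (4 * (norm x)\<^sup>2)"

lemma C2_on_cutoff: "C2_on UNIV cutoff cutoff_grad (cutoff_lap :: 'a::euclidean_space \<Rightarrow> real)"
proof -
  have 1: "C2_on UNIV (\<lambda>x::'a. (norm (x - 0))\<^sup>2) (\<lambda>x. 2 *\<^sub>R (x - 0)) (\<lambda>x. 2 * real DIM('a))" by (rule C2_on_dist_sq) simp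
  show ?thesis
    by (rule C2_on_cong[OF C2_on_compose[OF 1, of step step' step'']])
       (auto intro: step_derivatives continuous_on_step simp: cutoff_def cutoff_grad_def cutoff_lap_def dot_square_norm)
qed

lemma cutoff_eq:
  "norm x \<le> 1 \<Longrightarrow> cutoff x = 0" "norm x \<le> 1 \<Longrightarrow> cutoff_grad x = 0" "norm x \<le> 1 \<Longrightarrow> cutoff_lap x = 0"
  "exp 1 \<le> norm x \<Longrightarrow> cutoff x = 1" "exp 1 \<le> norm x \<Longrightarrow> cutoff_grad x = 0" "exp 1 \<le> norm x \<Longrightarrow> cutoff_lap x = 0"
proof -
  show "cutoff x = 0" "cutoff_grad x = 0" "cutoff_lap x = 0" if "norm x \<le> 1"
  proof -
    have "(norm x)\<^sup>2 \<le> 1" using that by (simp add: power_le_one)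
    from step_simps(1-3)[OF this] show "cutoff x = 0" "cutoff_grad x = 0" "cutoff_lap x = 0"
      by (simp_all add: cutoff_def cutoff_grad_def cutoff_lap_def)
  qed
  show "cutoff x = 1" "cutoff_grad x = 0" "cutoff_lap x = 0" if "exp 1 \<le> norm x"
  proof -
    have "(exp 1)\<^sup>2 \<le> (norm x)\<^sup>2" using that by (intro power_mono) auto
    then have "exp 2 \<le> (norm x)\<^sup>2" by (simp add: exp_double[of 1, simplified, symmetric])
    from step_simps(4-6)[OF this] show "cutoff x = 1" "cutoff_grad x = 0" "cutoff_lap x = 0"
      by (simp_all add: cutoff_def cutoff_grad_def cutoff_lap_def)
  qed
qed

lemma cutoff_bounds: "0 \<le> cutoff x" "cutoff x \<le> 1"
  by (simp_all add: cutoff_def step_bounds)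

lemma cutoff_orthogonal:
  fixes g :: "'a::euclidean_space \<Rightarrow> 'a"
  assumes g: "orthogonal_transformation g"
  shows "cutoff (g x) = cutoff x" "cutoff_grad (g x) = g (cutoff_grad x)" "cutoff_lap (g x) = cutoff_lap x"
  using orthogonal_transformation_norm[OF g] linear_cmul[OF orthogonal_transformation_linear[OF g]]
  by (simp_all add: cutoff_def cutoff_grad_def cutoff_lap_def)

text \<open>The Leibniz terms in the Laplacian of cutoff times kernel with at least one derivative
  on the cutoff. Integrated against a subharmonic function, these are the terms without a
  sign.\<close>

definition trans_ker :: "real \<Rightarrow> 'a::euclidean_space \<Rightarrow> 'a \<Rightarrow> real" where
  "trans_ker \<mu> x z = cutoff_lap x * ker \<mu> x z + 2 * (cutoff_grad x \<bullet> ker_grad \<mu> x z)"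

text \<open>The difference of a cutoff and its dilate: over consecutive scales such differences
  telescope, and each of them lives in 1 \<le> |x| \<le> e^2.\<close>

definition annulus_cut :: "'a::euclidean_space \<Rightarrow> real" where
  "annulus_cut x = cutoff x - cutoff (exp (- 1) *\<^sub>R x)"

definition cut_ker :: "real \<Rightarrow> 'a::euclidean_space \<Rightarrow> 'a \<Rightarrow> real" where
  "cut_ker \<mu> x z = annulus_cut x * ker \<mu> x z"

text \<open>The outer transition term is the inner one at the points divided by e: e^(-2) comes from
  the two derivatives, e^(-m) from the homogeneity of the kernel. Thus both edges of a patch are
  measured by the same expression on the same shell.\<close>

definition cut_ker_lap :: "real \<Rightarrow> 'a::euclidean_space \<Rightarrow> 'a \<Rightarrow> real" where
  "cut_ker_lap \<mu> x z = annulus_cut x * ker_lap \<mu> x z + trans_ker \<mu> x z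
     - (exp (- 1))\<^sup>2 * exp (- 1) ^ DIM('a) * trans_ker \<mu> (exp (- 1) *\<^sub>R x) (exp (- 1) *\<^sub>R z)"

lemma C2_on_cut_ker:
  obtains D where "C2_on UNIV (\<lambda>x. cut_ker \<mu> x z) D (\<lambda>x. cut_ker_lap \<mu> x (z :: 'a::euclidean_space))"
proof -
  let ?c = "exp (- 1) :: real"
  obtain G where G: "\<And>x::'a. (cutoff_grad has_derivative G x) (at x)" "\<And>h. continuous_on UNIV (\<lambda>x. G x h)"
    "\<And>x. (\<Sum>i\<in>Basis. G x i \<bullet> i) = cutoff_lap x" and dc: "\<And>x::'a. (cutoff has_derivative (\<lambda>h. cutoff_grad x \<bullet> h)) (at x)"
    using C2_on_cutoff unfolding C2_on_def by blast
  have sc: "C2_on UNIV (\<lambda>x::'a. cutoff (?c *\<^sub>R x)) (\<lambda>x. ?c *\<^sub>R cutoff_grad (?c *\<^sub>R x)) (\<lambda>x. ?c\<^sup>2 * cutoff_lap (?c *\<^sub>R x))"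
    unfolding C2_on_def
  proof (intro conjI ballI exI[of _ "\<lambda>x h. ?c *\<^sub>R G (?c *\<^sub>R x) (?c *\<^sub>R h)"] allI open_UNIV)
    fix x h :: 'a
    have d: "((\<lambda>x::'a. ?c *\<^sub>R x) has_derivative (\<lambda>h. ?c *\<^sub>R h)) (at x)" by (auto intro!: derivative_eq_intros)
    show "((\<lambda>x. cutoff (?c *\<^sub>R x)) has_derivative (\<lambda>h. (?c *\<^sub>R cutoff_grad (?c *\<^sub>R x)) \<bullet> h)) (at x)"
      using has_derivative_compose[OF d dc] by (rule has_derivative_eq_rhs) (simp add: fun_eq_iff)
    show "((\<lambda>x. ?c *\<^sub>R cutoff_grad (?c *\<^sub>R x)) has_derivative (\<lambda>h. ?c *\<^sub>R G (?c *\<^sub>R x) (?c *\<^sub>R h))) (at x)"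
      by (intro has_derivative_scaleR_right has_derivative_compose[OF d G(1)])
    show "continuous_on UNIV (\<lambda>x. ?c *\<^sub>R G (?c *\<^sub>R x) (?c *\<^sub>R h))"
      by (intro continuous_intros continuous_on_compose2[OF G(2)]) auto
    have "linear (G y)" for y using has_derivative_linear[OF G(1)] .
    then show "(\<Sum>i\<in>Basis. (?c *\<^sub>R G (?c *\<^sub>R x) (?c *\<^sub>R i)) \<bullet> i) = ?c\<^sup>2 * cutoff_lap (?c *\<^sub>R x)"
      by (simp add: linear_cmul G(3)[symmetric] sum_distrib_left power2_eq_square mult.assoc)
  qed
  have ks: "ker \<mu> x z = ?c ^ DIM('a) * ker \<mu> (?c *\<^sub>R x) (?c *\<^sub>R z)"
    "ker_grad \<mu> x z = (?c * ?c ^ DIM('a)) *\<^sub>R ker_grad \<mu> (?c *\<^sub>R x) (?c *\<^sub>R z)" for x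
    using ker_similarity(1,2)[OF orthogonal_transformation_id, of ?c \<mu> x z] by simp_all
  have cut: "C2_on UNIV annulus_cut (\<lambda>x::'a. cutoff_grad x + (- 1) *\<^sub>R ?c *\<^sub>R cutoff_grad (?c *\<^sub>R x)) (\<lambda>x. cutoff_lap x + (- 1) * (?c\<^sup>2 * cutoff_lap (?c *\<^sub>R x)))"
    by (rule C2_on_cong[OF C2_on_add[OF C2_on_cutoff C2_on_cmult[OF sc, of "- 1"]]]) (simp_all add: annulus_cut_def)
  have "C2_on UNIV (\<lambda>x. cut_ker \<mu> x z) (\<lambda>x. annulus_cut x *\<^sub>R ker_grad \<mu> x z + ker \<mu> x z *\<^sub>R (cutoff_grad x + (- 1) *\<^sub>R ?c *\<^sub>R cutoff_grad (?c *\<^sub>R x)))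
     (\<lambda>x. cut_ker_lap \<mu> x z)"
  proof (rule C2_on_cong[OF C2_on_mult[OF cut C2_on_ker]])
    fix x :: 'a
    let ?y = "?c *\<^sub>R x" let ?w = "?c *\<^sub>R z"
    have "?c\<^sup>2 * cutoff_lap ?y * ker \<mu> x z + 2 * ((?c *\<^sub>R cutoff_grad ?y) \<bullet> ker_grad \<mu> x z)
        = ?c\<^sup>2 * ?c ^ DIM('a) * trans_ker \<mu> ?y ?w"
      unfolding ks[of x] trans_ker_def by (simp add: power2_eq_square algebra_simps)
    then show "annulus_cut x * ker_lap \<mu> x z + ker \<mu> x z * (cutoff_lap x + (- 1) * (?c\<^sup>2 * cutoff_lap ?y)) +
         2 * ((cutoff_grad x + (- 1) *\<^sub>R ?c *\<^sub>R cutoff_grad ?y) \<bullet> ker_grad \<mu> x z) = cut_ker_lap \<mu> x z"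
      unfolding cut_ker_lap_def trans_ker_def[of \<mu> x z] by (simp add: inner_diff_left algebra_simps)
  qed (simp_all add: cut_ker_def)
  then show ?thesis using that by blast
qed

lemma exp_minus1_scale: "norm x \<le> 1 \<Longrightarrow> norm (exp (- 1 :: real) *\<^sub>R (x :: 'a::real_normed_vector)) \<le> 1"
proof -
  assume "norm x \<le> 1"
  then have "exp (- 1) * norm x \<le> (1::real) * 1" by (intro mult_mono) auto
  then show ?thesis by simp
qed

lemma annulus_cut_eq_0: "norm x \<le> 1 \<Longrightarrow> annulus_cut x = 0" "exp 2 \<le> norm x \<Longrightarrow> annulus_cut x = 0"
proof -
  show "annulus_cut x = 0" if "norm x \<le> 1"
    using cutoff_eq(1)[OF that] cutoff_eq(1)[OF exp_minus1_scale[OF that]] by (simp add: annulus_cut_def)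
  assume x: "exp 2 \<le> norm x"
  have "exp 1 \<le> exp (2::real)" by simp
  then have 1: "exp 1 \<le> norm x" using x by linarith
  have "exp (- 1) * exp 2 \<le> exp (- 1) * norm x" using x by (intro mult_left_mono) auto
  then have "exp 1 \<le> norm (exp (- 1 :: real) *\<^sub>R x)" by (simp add: mult_exp_exp)
  then show "annulus_cut x = 0" using 1 by (simp add: annulus_cut_def cutoff_eq(4))
qed

lemma annulus_cut_bounds: "0 \<le> annulus_cut x" "annulus_cut x \<le> 1"
proof -
  have "(norm (exp (- 1 :: real) *\<^sub>R x))\<^sup>2 = (norm x)\<^sup>2 * exp (- 2)"
    by (simp add: power_mult_distrib exp_double[of "-1", simplified, symmetric] mult.commute)
  then show "0 \<le> annulus_cut x" using step_mono_bound[of "(norm x)\<^sup>2"] by (simp add: annulus_cut_def cutoff_def)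
  show "annulus_cut x \<le> 1" using cutoff_bounds[of x] cutoff_bounds[of "exp (- 1) *\<^sub>R x"] unfolding annulus_cut_def by linarith
qed

lemma continuous_on_cutoff:
  "continuous_on S cutoff" "continuous_on S cutoff_grad" "continuous_on S (cutoff_lap :: 'a::euclidean_space \<Rightarrow> real)"
  using C2_on_imp[OF C2_on_cutoff[where 'a='a]] continuous_on_subset by blast+

lemma continuous_on_annulus_cut: "continuous_on S annulus_cut"
  unfolding annulus_cut_def[abs_def]
  by (intro continuous_intros continuous_on_cutoff continuous_on_compose2[OF continuous_on_cutoff(1)[of UNIV]]) auto

text \<open>The kernel is singular only where z, and with it x, tends to 0, and there the
  derivatives of the cutoff vanish; hence continuity holds also at \<open>z = 0\<close>. The radius
  is a variable too, because the gluing errors are estimated by compactness.\<close>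

lemma continuous_on_trans_ker:
  fixes K :: "(real \<times> 'a::euclidean_space) set"
  assumes K: "\<And>p. p \<in> K \<Longrightarrow> 0 < fst p \<and> fst p \<le> 1/2"
  shows "continuous_on (K \<times> UNIV) (\<lambda>q. trans_ker (fst (fst q)) (snd (fst q)) (snd q))"
proof (rule continuous_on_open_cover2[where A = "{q. snd q \<noteq> 0}" and B = "{q. norm (snd (fst q)) < 1} \<union> {q. 2 * norm (snd q) < norm (snd (fst q))}"])
  show "continuous_on (K \<times> UNIV \<inter> {q. snd q \<noteq> 0}) (\<lambda>q. trans_ker (fst (fst q)) (snd (fst q)) (snd q))"
    unfolding trans_ker_def
    by (intro continuous_intros continuous_on_ker continuous_on_compose2[OF continuous_on_cutoff(2)[of UNIV]] continuous_on_compose2[OF continuous_on_cutoff(3)[of UNIV]])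
       (use K in force)+
  have "trans_ker (fst (fst q)) (snd (fst q)) (snd q) = 0"
    if "q \<in> K \<times> UNIV \<inter> ({q. norm (snd (fst q)) < 1} \<union> {q. 2 * norm (snd q) < norm (snd (fst q))})" for q
  proof (cases "norm (snd (fst q)) < 1")
    case True
    then show ?thesis by (simp add: trans_ker_def cutoff_eq)
  next
    case False
    then have "2 * norm (snd q) < norm (snd (fst q))" "0 < fst (fst q)" "fst (fst q) \<le> 1/2" using that K[of "fst q"] by auto
    then have "ker (fst (fst q)) (snd (fst q)) (snd q) = 0 \<and> ker_grad (fst (fst q)) (snd (fst q)) (snd q) = 0"
      using ker_support(3)[of "fst (fst q)" "snd (fst q)" "snd q"] by force
    then show ?thesis by (simp add: trans_ker_def)
  qed
  then show "continuous_on (K \<times> UNIV \<inter> ({q. norm (snd (fst q)) < 1} \<union> {q. 2 * norm (snd q) < norm (snd (fst q))}))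
     (\<lambda>q. trans_ker (fst (fst q)) (snd (fst q)) (snd q))"
    by (rule continuous_on_eq[OF continuous_on_const[of _ 0], OF sym])
qed (auto intro!: open_Un open_Collect_less open_Collect_neq continuous_intros simp: not_less)

lemma trans_ker_eq_0:
  assumes "0 < \<mu>" "\<mu> \<le> 1/2"
  shows "norm x \<le> 1 \<Longrightarrow> trans_ker \<mu> x z = 0" "exp 1 \<le> norm x \<Longrightarrow> trans_ker \<mu> x z = 0"
    "2 * norm x < norm z \<Longrightarrow> trans_ker \<mu> x z = 0"
proof -
  show "norm x \<le> 1 \<Longrightarrow> trans_ker \<mu> x z = 0" "exp 1 \<le> norm x \<Longrightarrow> trans_ker \<mu> x z = 0"
    by (simp_all add: trans_ker_def cutoff_eq)
  assume "2 * norm x < norm z"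
  then have "ker \<mu> x z = 0 \<and> ker_grad \<mu> x z = 0" using ker_support(2)[OF assms, of x z] by force
  then show "trans_ker \<mu> x z = 0" by (simp add: trans_ker_def)
qed

lemma trans_ker_orthogonal:
  fixes g :: "'a::euclidean_space \<Rightarrow> 'a"
  assumes g: "orthogonal_transformation g"
  shows "trans_ker \<mu> (g x) (g z) = trans_ker \<mu> x z"
  using ker_similarity(1,2)[OF g, of 1 \<mu> x z] g
  by (simp add: trans_ker_def cutoff_orthogonal[OF g] orthogonal_transformation_def)

lemma cut_ker_support:
  assumes l: "0 < \<mu>" "\<mu> \<le> 1/2" and z: "z \<notin> cball 0 (2 * exp 2)"
  shows "cut_ker \<mu> x z = 0" "cut_ker_lap \<mu> x z = 0"
proof -
  have z2: "2 * exp 2 < norm z" using z by simp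
  have "cut_ker \<mu> x z = 0 \<and> cut_ker_lap \<mu> x z = 0"
  proof (cases "exp 2 \<le> norm x")
    case True
    have "exp 1 \<le> exp (2::real)" by simp
    then have 1: "exp 1 \<le> norm x" using True by linarith
    have "exp (- 1) * exp 2 \<le> exp (- 1) * norm x" using True by (intro mult_left_mono) auto
    then have 2: "exp 1 \<le> norm (exp (- 1 :: real) *\<^sub>R x)" by (simp add: mult_exp_exp)
    show ?thesis using annulus_cut_eq_0(2)[OF True] trans_ker_eq_0(2)[OF l 1, of z] trans_ker_eq_0(2)[OF l 2, of "exp (- 1) *\<^sub>R z"]
      by (simp add: cut_ker_def cut_ker_lap_def)
  next
    case False
    then have 1: "2 * norm x < norm z" using z2 by linarith
    then have 2: "2 * norm (exp (- 1 :: real) *\<^sub>R x) < norm (exp (- 1 :: real) *\<^sub>R z)"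
      by (simp add: mult.left_commute[of 2])
    have "ker \<mu> x z = 0 \<and> ker_lap \<mu> x z = 0" using ker_support(2)[OF l, of x z] 1 by force
    then show ?thesis using trans_ker_eq_0(3)[OF l 1] trans_ker_eq_0(3)[OF l 2] by (simp add: cut_ker_def cut_ker_lap_def)
  qed
  then show "cut_ker \<mu> x z = 0" "cut_ker_lap \<mu> x z = 0" by auto
qed

lemma continuous_on_cut_ker:
  fixes \<mu> :: real
  assumes l: "0 < \<mu>" "\<mu> \<le> 1/2"
  shows "continuous_on UNIV (\<lambda>p. cut_ker \<mu> (fst p) (snd p :: 'a::euclidean_space))"
    and "continuous_on UNIV (\<lambda>p. cut_ker_lap \<mu> (fst p) (snd p :: 'a))"
proof -
  let ?A = "{p :: 'a \<times> 'a. snd p \<noteq> 0}"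
  let ?B = "{p :: 'a \<times> 'a. norm (fst p) < 1} \<union> {p. 2 * norm (snd p) < norm (fst p)}"
  have oA: "open ?A" and oB: "open ?B" and AB: "UNIV \<subseteq> ?A \<union> ?B"
    by (auto intro!: open_Un open_Collect_less open_Collect_neq continuous_intros simp: not_less)
  have tk: "continuous_on S (\<lambda>p. trans_ker \<mu> (f p) (h p))" if "continuous_on S f" "continuous_on S h"
    for S :: "('a \<times> 'a) set" and f h :: "'a \<times> 'a \<Rightarrow> 'a"
    by (rule continuous_on_compose2[OF continuous_on_trans_ker[of "{\<mu>} \<times> UNIV"], of _ "\<lambda>p. ((\<mu>, f p), h p)", simplified])
       (use l that in \<open>auto intro!: continuous_intros\<close>)
  have B0: "annulus_cut (fst p) * ker \<mu> (fst p) (snd p) = 0 \<and> annulus_cut (fst p) * ker_lap \<mu> (fst p) (snd p) = 0"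
    if "p \<in> ?B" for p
  proof (cases "norm (fst p) < 1")
    case True
    then show ?thesis by (simp add: annulus_cut_eq_0)
  next
    case False
    then have "2 * norm (snd p) < norm (fst p)" using that by auto
    then have "ker \<mu> (fst p) (snd p) = 0 \<and> ker_lap \<mu> (fst p) (snd p) = 0"
      using ker_support(3)[OF l, of "fst p" "snd p"] by force
    then show ?thesis by simp
  qed
  have cA: "continuous_on S (\<lambda>p. annulus_cut (fst p :: 'a))" for S :: "('a \<times> 'a) set"
    by (rule continuous_on_compose2[OF continuous_on_annulus_cut[of UNIV]]) (auto intro!: continuous_intros)
  have c1: "continuous_on UNIV (\<lambda>p::'a \<times> 'a. annulus_cut (fst p) * ker \<mu> (fst p) (snd p))"
  proof (rule continuous_on_open_cover2[OF _ _ oA oB AB])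
    show "continuous_on (UNIV \<inter> ?A) (\<lambda>p. annulus_cut (fst p) * ker \<mu> (fst p) (snd p))"
      by (intro continuous_on_mult cA continuous_on_ker) (use l in \<open>auto intro!: continuous_intros\<close>)
    show "continuous_on (UNIV \<inter> ?B) (\<lambda>p. annulus_cut (fst p) * ker \<mu> (fst p) (snd p))"
      by (rule continuous_on_eq[OF continuous_on_const[of _ 0]]) (use B0 in auto)
  qed
  have c2: "continuous_on UNIV (\<lambda>p::'a \<times> 'a. annulus_cut (fst p) * ker_lap \<mu> (fst p) (snd p))"
  proof (rule continuous_on_open_cover2[OF _ _ oA oB AB])
    show "continuous_on (UNIV \<inter> ?A) (\<lambda>p. annulus_cut (fst p) * ker_lap \<mu> (fst p) (snd p))"
      by (intro continuous_on_mult cA continuous_on_ker) (use l in \<open>auto intro!: continuous_intros\<close>)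
    show "continuous_on (UNIV \<inter> ?B) (\<lambda>p. annulus_cut (fst p) * ker_lap \<mu> (fst p) (snd p))"
      by (rule continuous_on_eq[OF continuous_on_const[of _ 0]]) (use B0 in auto)
  qed
  show "continuous_on UNIV (\<lambda>p. cut_ker \<mu> (fst p) (snd p :: 'a))" unfolding cut_ker_def by (rule c1)
  show "continuous_on UNIV (\<lambda>p. cut_ker_lap \<mu> (fst p) (snd p :: 'a))"
    unfolding cut_ker_lap_def by (intro continuous_intros c2 tk)
qed

section \<open>The kernel as an averaging operator\<close>

lemma ker_mass:
  fixes z :: "'a::euclidean_space"
  assumes l: "0 < \<mu>" and z: "z \<noteq> 0"
  shows "integrable lborel (\<lambda>x. ker \<mu> x z)" "(LINT x|lborel. ker \<mu> x z) = 1"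
proof -
  define r where "r = inverse (\<mu> * norm z)"
  have r: "0 < r" using l z by (simp add: r_def)
  have m [measurable]: "(\<lambda>y::'a. profile ((norm y)\<^sup>2)) \<in> borel_measurable borel"
    by (intro borel_measurable_continuous_onI continuous_on_compose2[OF continuous_on_profile(1)[of UNIV]] continuous_intros) auto
  let ?p = "\<lambda>y::'a. profile ((norm y)\<^sup>2)"
  have eq: "ker \<mu> x z = (inverse (profile_mass TYPE('a)) * r ^ DIM('a)) * ?p (r *\<^sub>R (x + (- z)))" for x
    unfolding ker_def r_def[symmetric] using r by (simp add: power_mult_distrib)
  have mr: "(\<lambda>x::'a. ?p (r *\<^sub>R x)) \<in> borel_measurable borel"
    by (intro borel_measurable_continuous_onI continuous_on_compose2[OF continuous_on_profile(1)[of UNIV]] continuous_intros) (auto intro!: continuous_intros)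
  note T = integral_lborel_translate[OF mr, of "- z"]
  note S = integral_lborel_similarity[OF orthogonal_transformation_id r m]
  have i: "integrable lborel (\<lambda>x. ?p (r *\<^sub>R (x + (- z))))"
    unfolding T(2) S(2) by (rule profile_integrable)
  show "integrable lborel (\<lambda>x. ker \<mu> x z)" unfolding eq by (rule integrable_mult_right[OF i])
  have "(LINT x|lborel. ker \<mu> x z) = (inverse (profile_mass TYPE('a)) * r ^ DIM('a)) * (profile_mass TYPE('a) / r ^ DIM('a))"
    unfolding eq integral_mult_right_zero T(1) S(1) profile_mass_def ..
  also have "\<dots> = 1" using r profile_mass_pos[where 'a='a] by simp
  finally show "(LINT x|lborel. ker \<mu> x z) = 1" .
qed

lemma ker_measurable: "(\<lambda>x. ker \<mu> x z) \<in> borel_measurable borel"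
  by (rule borel_measurable_continuous_onI) (rule C2_on_imp(1)[OF C2_on_ker])

text \<open>The radius \<mu>|z| is not uniformly small, but for z far out \<psi> is 0 on the whole
  support of the kernel. At \<open>z = 0\<close> the kernel is 0 by convention, and
  \<open>\<psi> 0 = 0\<close> covers this case.\<close>

lemma ker_approximate_identity:
  fixes \<psi> :: "'a::euclidean_space \<Rightarrow> real"
  assumes \<psi>: "continuous_on UNIV \<psi>" and supp: "\<And>x. x \<notin> cball 0 R \<Longrightarrow> \<psi> x = 0" and z0: "\<psi> 0 = 0"
    and \<mu>: "\<And>n. 0 < \<mu> n" "\<And>n. \<mu> n \<le> 1/2" "\<mu> \<longlonglongrightarrow> 0" and e: "0 < e"
  shows "\<forall>\<^sub>F n in sequentially. \<forall>z. \<bar>(LINT x|lborel. ker (\<mu> n) x z * \<psi> x) - \<psi> z\<bar> \<le> e"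
proof -
  \<comment> \<open>If two points have norms within a factor of 2 and one norm exceeds 3|R| + 1,
    then both exceed |R|.\<close>
  define S where "S = 3 * \<bar>R\<bar> + 1"
  have S: "0 < S" by (simp add: S_def)
  have "uniformly_continuous_on (cball 0 S) \<psi>"
    by (rule compact_uniformly_continuous[OF continuous_on_subset[OF \<psi> subset_UNIV]]) simp
  then obtain \<delta> where \<delta>: "0 < \<delta>" "\<And>x y. x \<in> cball 0 S \<Longrightarrow> y \<in> cball 0 S \<Longrightarrow> dist y x < \<delta> \<Longrightarrow> dist (\<psi> y) (\<psi> x) < e"
    using e unfolding uniformly_continuous_on_def by blast
  have "\<forall>\<^sub>F n in sequentially. \<mu> n < \<delta> / S"
    using order_tendstoD(2)[OF \<mu>(3), of "\<delta> / S"] \<delta>(1) S by simp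
  then show ?thesis
  proof eventually_elim
    fix n assume n: "\<mu> n < \<delta> / S"
    show "\<forall>z. \<bar>(LINT x|lborel. ker (\<mu> n) x z * \<psi> x) - \<psi> z\<bar> \<le> e"
    proof
      fix z :: 'a
      show "\<bar>(LINT x|lborel. ker (\<mu> n) x z * \<psi> x) - \<psi> z\<bar> \<le> e"
      proof (cases "z = 0")
        case True
        then have "ker (\<mu> n) x z = 0" for x by (simp add: ker_def)
        then show ?thesis using True z0 e by simp
      next
        case False
        have close: "\<bar>ker (\<mu> n) x z * \<psi> x - ker (\<mu> n) x z * \<psi> z\<bar> \<le> e * ker (\<mu> n) x z" for x
        proof (cases "ker (\<mu> n) x z = 0")
          case nz: False
          have d: "norm (x - z) < \<mu> n * norm z" "norm z \<le> 2 * norm x" "norm x \<le> 2 * norm z"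
            using ker_support[OF \<mu>(1,2), of n x z] nz by auto
          have "\<bar>\<psi> x - \<psi> z\<bar> \<le> e"
          proof (cases "norm x \<le> S \<and> norm z \<le> S")
            case True
            have "\<mu> n * norm z \<le> \<mu> n * S" using True \<mu>(1)[of n] by (intro mult_left_mono) auto
            also have "\<dots> < \<delta>" using n S by (simp add: pos_less_divide_eq)
            finally have "dist x z < \<delta>" using d(1) by (simp add: dist_norm)
            then show ?thesis using \<delta>(2)[of z x] True by (simp add: dist_real_def)
          next
            case False
            then have "\<bar>R\<bar> < norm x" "\<bar>R\<bar> < norm z" using d by (auto simp: S_def)
            then have "\<psi> x = 0" "\<psi> z = 0" by (auto intro!: supp)
            then show ?thesis using e by simp
          qed
          then have "ker (\<mu> n) x z * \<bar>\<psi> x - \<psi> z\<bar> \<le> ker (\<mu> n) x z * e"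
            using ker_nonneg[OF \<mu>(1)] by (intro mult_left_mono)
          moreover have "\<bar>ker (\<mu> n) x z * \<psi> x - ker (\<mu> n) x z * \<psi> z\<bar> = ker (\<mu> n) x z * \<bar>\<psi> x - \<psi> z\<bar>"
            using ker_nonneg[OF \<mu>(1), of n x z] by (simp only: right_diff_distrib[symmetric] abs_mult abs_of_nonneg)
          ultimately show ?thesis by (simp add: mult.commute)
        qed simp
        note km = ker_mass[OF \<mu>(1)[of n] False]
        obtain M where M: "0 \<le> M" "\<And>y. y \<in> cball 0 R \<Longrightarrow> \<bar>\<psi> y\<bar> \<le> M"
          using continuous_bounded_on_cball[OF continuous_on_subset[OF \<psi> subset_UNIV]] by metis
        have M': "\<bar>\<psi> y\<bar> \<le> M" for y using M supp[of y] by (cases "y \<in> cball 0 R") auto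
        have i1: "integrable lborel (\<lambda>x. ker (\<mu> n) x z * \<psi> x)"
        proof (rule Bochner_Integration.integrable_bound[OF integrable_mult_right[OF km(1), of M]])
          show "(\<lambda>x. ker (\<mu> n) x z * \<psi> x) \<in> borel_measurable lborel"
            using borel_measurable_times[OF ker_measurable borel_measurable_continuous_onI[OF \<psi>]] by simp
          show "AE x in lborel. norm (ker (\<mu> n) x z * \<psi> x) \<le> norm (M * ker (\<mu> n) x z)"
          proof (rule AE_I2)
            fix x
            have "\<bar>ker (\<mu> n) x z\<bar> * \<bar>\<psi> x\<bar> \<le> \<bar>ker (\<mu> n) x z\<bar> * M" by (intro mult_left_mono M') simp
            then show "norm (ker (\<mu> n) x z * \<psi> x) \<le> norm (M * ker (\<mu> n) x z)" using M(1) by (simp add: abs_mult mult.commute)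
          qed
        qed
        have i2: "integrable lborel (\<lambda>x. ker (\<mu> n) x z * \<psi> z)" using km(1) by simp
        have "(LINT x|lborel. ker (\<mu> n) x z * \<psi> x) - \<psi> z = (LINT x|lborel. ker (\<mu> n) x z * \<psi> x - ker (\<mu> n) x z * \<psi> z)"
          using Bochner_Integration.integral_diff[OF i1 i2] km by simp
        also have "\<bar>\<dots>\<bar> \<le> (LINT x|lborel. e * ker (\<mu> n) x z)"
          by (rule order_trans[OF integral_abs_bound integral_mono])
             (use i1 i2 km(1) close in auto)
        also have "\<dots> = e" using km by simp
        finally show ?thesis .
      qed
    qed
  qed
qed

text \<open>As a function of z the kernel does not have mass 1. On its support |z| lies between
  |x|/2 and 2|x|, so it is dominated by a bump of radius \<open>2 * \<mu> * norm x\<close> about x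
  whose mass is 4^m, independently of \<mu>.\<close>

lemma ker_integral_bound:
  fixes x :: "'a::euclidean_space"
  assumes l: "0 < \<mu>" "\<mu> \<le> 1/2" and x: "x \<noteq> 0" and w: "\<And>z. norm z \<le> 2 * norm x \<Longrightarrow> w z \<le> B" and B: "0 \<le> B"
  shows "(LINT z|lborel. w z * ker \<mu> x z) \<le> 4 ^ DIM('a) * B"
proof -
  define r where "r = inverse (2 * \<mu> * norm x)"
  have r: "0 < r" using l x by (simp add: r_def)
  let ?p = "\<lambda>y::'a. profile ((norm y)\<^sup>2)"
  define K where "K = inverse (profile_mass TYPE('a)) * (4 * r) ^ DIM('a)"
  have K: "0 \<le> K" using profile_mass_pos[where 'a='a] r by (simp add: K_def)
  have kb: "ker \<mu> x z \<le> K * ?p (r *\<^sub>R (z + (- x)))" for z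
  proof (cases "ker \<mu> x z = 0")
    case False
    have d: "norm z \<le> 2 * norm x" "norm x \<le> 2 * norm z" "z \<noteq> 0"
      using ker_support[OF l, of x z] False by auto
    have "\<mu> * norm z \<le> 2 * \<mu> * norm x" using mult_left_mono[OF d(1), of \<mu>] l(1) by simp
    then have 1: "r \<le> inverse (\<mu> * norm z)" unfolding r_def using d(3) l(1) by (intro le_imp_inverse_le) auto
    have "2 * \<mu> * norm x \<le> 4 * (\<mu> * norm z)" using mult_left_mono[OF d(2), of "2 * \<mu>"] l(1) by simp
    then have 2: "inverse (\<mu> * norm z) \<le> 4 * r" unfolding r_def using d(3) l(1) x by (simp add: field_simps)
    have "(r * norm (x - z))\<^sup>2 \<le> (inverse (\<mu> * norm z) * norm (x - z))\<^sup>2"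
      using 1 r by (intro power_mono mult_right_mono) auto
    then have "profile ((inverse (\<mu> * norm z))\<^sup>2 * (norm (x - z))\<^sup>2) \<le> profile ((r * norm (x - z))\<^sup>2)"
      unfolding power_mult_distrib by (rule profile_antimono)
    moreover have "inverse (\<mu> * norm z) ^ DIM('a) \<le> (4 * r) ^ DIM('a)"
      using 2 l(1) by (intro power_mono) auto
    ultimately have "inverse (\<mu> * norm z) ^ DIM('a) * profile ((inverse (\<mu> * norm z))\<^sup>2 * (norm (x - z))\<^sup>2)
        \<le> (4 * r) ^ DIM('a) * profile ((r * norm (x - z))\<^sup>2)"
      using profile_bounds(1) r by (intro mult_mono) auto
    then have "inverse (profile_mass TYPE('a)) * (inverse (\<mu> * norm z) ^ DIM('a) * profile ((inverse (\<mu> * norm z))\<^sup>2 * (norm (x - z))\<^sup>2))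
        \<le> inverse (profile_mass TYPE('a)) * ((4 * r) ^ DIM('a) * profile ((r * norm (x - z))\<^sup>2))"
      using profile_mass_pos[where 'a='a] by (intro mult_left_mono) auto
    then show ?thesis using r by (simp add: ker_def K_def mult.assoc norm_minus_commute power_mult_distrib)
  next
    case True
    then show ?thesis using K profile_bounds(1) by simp
  qed
  have m [measurable]: "?p \<in> borel_measurable borel"
    by (intro borel_measurable_continuous_onI continuous_on_compose2[OF continuous_on_profile(1)[of UNIV]] continuous_intros) auto
  have mr: "(\<lambda>x::'a. ?p (r *\<^sub>R x)) \<in> borel_measurable borel"
    by (intro borel_measurable_continuous_onI continuous_on_compose2[OF continuous_on_profile(1)[of UNIV]] continuous_intros) (auto intro!: continuous_intros)
  note T = integral_lborel_translate[OF mr, of "- x"]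
  note S = integral_lborel_similarity[OF orthogonal_transformation_id r m]
  have i: "integrable lborel (\<lambda>z. B * (K * ?p (r *\<^sub>R (z + (- x)))))"
  proof -
    have "integrable lborel (\<lambda>z. ?p (r *\<^sub>R (z + (- x))))" unfolding T(2) S(2) by (rule profile_integrable)
    then show ?thesis by (intro integrable_mult_right)
  qed
  have v: "(LINT z|lborel. B * (K * ?p (r *\<^sub>R (z + (- x))))) = 4 ^ DIM('a) * B"
  proof -
    have "(LINT z|lborel. B * (K * ?p (r *\<^sub>R (z + (- x))))) = B * (K * (profile_mass TYPE('a) / r ^ DIM('a)))"
      unfolding integral_mult_right_zero T(1) S(1) profile_mass_def ..
    also have "\<dots> = 4 ^ DIM('a) * B" using r profile_mass_pos[where 'a='a] by (simp add: K_def power_mult_distrib)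
    finally show ?thesis .
  qed
  have le: "w z * ker \<mu> x z \<le> B * (K * ?p (r *\<^sub>R (z + (- x))))" for z
  proof (cases "ker \<mu> x z = 0")
    case False
    have "w z * ker \<mu> x z \<le> B * ker \<mu> x z"
      using ker_support(2)[OF l, of x z] False by (intro mult_right_mono w ker_nonneg l) auto
    also have "\<dots> \<le> B * (K * ?p (r *\<^sub>R (z + (- x))))" using kb B by (intro mult_left_mono)
    finally show ?thesis .
  next
    case True
    then show ?thesis using K B profile_bounds(1) by simp
  qed
  show ?thesis
  \<comment> \<open>A product that is not integrable has integral 0 by convention, and then
    \<open>0 \<le> B\<close> is enough.\<close>
  proof (cases "integrable lborel (\<lambda>z. w z * ker \<mu> x z)")
    case True
    show ?thesis using integral_mono[OF True i le] unfolding v .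
  next
    case False
    then show ?thesis using B by (simp add: not_integrable_integral_eq)
  qed
qed

section \<open>The regular growth given by a proximate order\<close>

text \<open>In the variable s = ln r the function ln H is s p(e^s), and its derivative h is p + r ln
  r p' at r = e^s; the two limits in the definition of a proximate order say that h tends to \<rho>.
  The increments over bounded intervals are then estimated by the mean value theorem.\<close>

lemma proximate_order_growth:
  assumes p: "proximate_order \<rho> p" and \<rho>: "0 < \<rho>"
  obtains H h s0 where "\<And>s. H s = exp s powr p (exp s)" "\<And>s. 0 < H s"
    "\<And>s. (H has_real_derivative H s * h s) (at s)" "(h \<longlongrightarrow> \<rho>) at_top"
    "\<And>s. s0 \<le> s \<Longrightarrow> \<rho> / 2 \<le> h s" "continuous_on UNIV H" "filterlim H at_top at_top"
    "\<And>s t. s0 \<le> s \<Longrightarrow> s \<le> t \<Longrightarrow> H s \<le> H t"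
    "\<And>e L. 0 < e \<Longrightarrow> \<forall>\<^sub>F s in at_top. \<forall>t. \<bar>t\<bar> \<le> L \<longrightarrow> \<bar>ln (H (s + t)) - ln (H s) - \<rho> * t\<bar> \<le> e * L"
proof -
  obtain p' where p': "\<And>r. 0 < r \<Longrightarrow> (p has_real_derivative p' r) (at r)"
    and lim': "((\<lambda>r. r * ln r * p' r) \<longlongrightarrow> 0) at_top" and lim: "(p \<longlongrightarrow> \<rho>) at_top"
    using p unfolding proximate_order_def by blast
  define H where "H s = exp s powr p (exp s)" for s
  define h where "h s = p (exp s) + exp s * ln (exp s) * p' (exp s)" for s
  have He: "H s = exp (s * p (exp s))" for s by (simp add: H_def powr_def mult.commute)
  have dp: "((\<lambda>s. p (exp s)) has_real_derivative p' (exp s) * exp s) (at s)" for s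
    by (rule DERIV_chain2[OF p' DERIV_exp]) simp
  have dl: "((\<lambda>s. s * p (exp s)) has_real_derivative h s) (at s)" for s
    using DERIV_mult[OF DERIV_ident dp] by (rule DERIV_cong) (simp add: h_def algebra_simps)
  have dH: "(H has_real_derivative H s * h s) (at s)" for s
    unfolding He[abs_def] by (rule DERIV_chain2[OF DERIV_exp dl])
  have hlim: "(h \<longlongrightarrow> \<rho>) at_top"
    using tendsto_add[OF filterlim_compose[OF lim exp_at_top] filterlim_compose[OF lim' exp_at_top]]
    unfolding h_def by simp
  have "\<forall>\<^sub>F s in at_top. \<rho> / 2 < h s" using order_tendstoD(1)[OF hlim, of "\<rho> / 2"] \<rho> by simp
  then obtain s0 where s0: "\<And>s. s0 \<le> s \<Longrightarrow> \<rho> / 2 \<le> h s"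
    unfolding eventually_at_top_linorder by (meson less_imp_le)
  have lnH: "ln (H s) = s * p (exp s)" for s by (simp add: He)
  have dlnH: "((\<lambda>s. ln (H s)) has_real_derivative h s) (at s)" for s using dl[of s] by (simp add: lnH)
  have mvt: "\<exists>z. a < z \<and> z < b \<and> ln (H b) - ln (H a) = (b - a) * h z" if "a < b" for a b
    using MVT2[OF that, of "\<lambda>s. ln (H s)" h] dlnH by blast
  have Hpos: "0 < H s" for s by (simp add: He)
  have mono: "H s \<le> H t" if st: "s0 \<le> s" "s \<le> t" for s t
  proof (cases "s = t")
    case False
    then obtain z where z: "s < z" "z < t" "ln (H t) - ln (H s) = (t - s) * h z" using mvt[of s t] st by auto
    have "0 \<le> (t - s) * h z" using s0[of z] z st \<rho> by (intro mult_nonneg_nonneg) auto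
    then have "ln (H s) \<le> ln (H t)" using z(3) by linarith
    then show ?thesis using Hpos by simp
  qed simp
  have Htop: "filterlim H at_top at_top"
  proof -
    have "filterlim (\<lambda>s. s * p (exp s)) at_top at_top"
      using filterlim_tendsto_pos_mult_at_top[OF filterlim_compose[OF lim exp_at_top] \<rho> filterlim_ident]
      by (simp add: mult.commute)
    then show ?thesis unfolding He[abs_def] by (rule filterlim_compose[OF exp_at_top])
  qed
  have cH: "continuous_on UNIV H" using dH DERIV_continuous_on[of UNIV H "\<lambda>s. H s * h s"] by (simp add: has_field_derivative_at_within)
  have slow: "\<forall>\<^sub>F s in at_top. \<forall>t. \<bar>t\<bar> \<le> L \<longrightarrow> \<bar>ln (H (s + t)) - ln (H s) - \<rho> * t\<bar> \<le> e * L" if e: "0 < e" for e L :: real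
  proof -
    have "\<forall>\<^sub>F s in at_top. dist (h s) \<rho> < e" using tendstoD[OF hlim e] .
    then obtain N where N: "\<And>s. N \<le> s \<Longrightarrow> \<bar>h s - \<rho>\<bar> \<le> e"
      unfolding eventually_at_top_linorder dist_real_def by (meson less_imp_le)
    have "\<bar>ln (H (s + t)) - ln (H s) - \<rho> * t\<bar> \<le> e * L" if s: "N + \<bar>L\<bar> \<le> s" and t: "\<bar>t\<bar> \<le> L" for s t
    proof -
      have "\<exists>z\<ge>N. ln (H (s + t)) - ln (H s) = t * h z"
      proof (cases t "0::real" rule: linorder_cases)
        case less
        then obtain z where "s + t < z" "ln (H s) - ln (H (s + t)) = (s - (s + t)) * h z" using mvt[of "s + t" s] by auto
        then show ?thesis using s t by (intro exI[of _ z]) auto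
      next
        case equal
        then show ?thesis using s by (intro exI[of _ s]) auto
      next
        case greater
        then obtain z where "s < z" "ln (H (s + t)) - ln (H s) = (s + t - s) * h z" using mvt[of s "s + t"] by auto
        then show ?thesis using s t by (intro exI[of _ z]) auto
      qed
      then obtain z where z: "N \<le> z" "ln (H (s + t)) - ln (H s) = t * h z" by blast
      have "\<bar>ln (H (s + t)) - ln (H s) - \<rho> * t\<bar> = \<bar>t\<bar> * \<bar>h z - \<rho>\<bar>"
        unfolding z(2) by (simp add: abs_mult[symmetric] algebra_simps)
      also have "\<dots> \<le> L * e" using N[OF z(1)] t by (intro mult_mono) auto
      finally show ?thesis by (simp add: mult.commute)
    qed
    then show ?thesis unfolding eventually_at_top_linorder by blast
  qed
  show ?thesis by (rule that[OF H_def Hpos dH hlim s0 cH Htop mono slow])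
qed

lemma rotation_matrix_orthogonal_transformation:
  fixes A :: "real^'n^'n"
  assumes "rotation_matrix A"
  shows "orthogonal_transformation (\<lambda>x. A *v x)"
proof -
  have tA: "transpose A ** A = mat 1" using assms by (simp add: rotation_matrix_def orthogonal_matrix)
  have "(A *v v) \<bullet> (A *v w) = v \<bullet> w" for v w
  proof -
    have "(A *v v) \<bullet> (A *v w) = ((A *v v) v* A) \<bullet> w" by (simp add: dot_lmul_matrix)
    also have "(A *v v) v* A = (transpose A ** A) *v v" by (simp add: matrix_vector_mul_assoc[symmetric] transpose_matrix_vector)
    finally show ?thesis by (simp add: tA)
  qed
  then show ?thesis unfolding orthogonal_transformation_def by (simp add: matrix_vector_mul_linear)
qed

section \<open>The flow on the compact invariant set\<close>

locale limit_system =
  fixes \<rho> \<sigma> :: real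
    and V :: "real \<Rightarrow> real^'m^'m"
    and U :: "(real^'m \<Rightarrow> ereal) set"
    and d :: "(real^'m \<Rightarrow> ereal) \<Rightarrow> (real^'m \<Rightarrow> ereal) \<Rightarrow> real"
  assumes dim: "CARD('m) \<ge> 2"
    and rho_pos: "0 < \<rho>" and sigma_pos: "0 < \<sigma>"
    and rot: "rotation_group V"
    and U_nonempty: "U \<noteq> {}"
    and U_subset: "U \<subseteq> U_class \<rho> \<sigma>"
    and U_compact: "compactin distr_topology U"
    and U_connected: "connectedin distr_topology U"
    and U_invariant: "T_invariant (T_map \<rho> V) U"
    and d_metric: "Metric_space U d"
    and d_topology: "Metric_space.mtopology U d = subtopology distr_topology U"
    and d_chain: "chain_recurrent d (T_map \<rho> V) U"
begin

abbreviation P where "P \<equiv> P_map V"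
abbreviation T where "T \<equiv> T_map \<rho> V"

lemma orth: "0 < t \<Longrightarrow> orthogonal_transformation (\<lambda>x. V t *v x)"
  using rot unfolding rotation_group_def by (intro rotation_matrix_orthogonal_transformation) blast

lemma P_eq: "P t x = t *\<^sub>R (V t *v x)" by (simp add: P_map_def)

lemma norm_P: "0 < t \<Longrightarrow> norm (P t x) = t * norm x"
  using orthogonal_transformation_norm[OF orth] by (simp add: P_eq)

lemma P_P: "0 < s \<Longrightarrow> 0 < t \<Longrightarrow> P s (P t x) = P (s * t) x"
proof -
  assume s: "0 < s" and t: "0 < t"
  have "V s ** V t = V (s * t)" using rot s t unfolding rotation_group_def by blast
  then show ?thesis
    using linear_cmul[OF orthogonal_transformation_linear[OF orth[OF s]]]
    by (simp add: P_eq matrix_vector_mul_assoc)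
qed

lemma P_1 [simp]: "P 1 x = x"
  using rot by (simp add: P_eq rotation_group_def)

lemma P_inv: "P (exp (- s)) (P (exp s) x) = x" "P (exp s) (P (exp (- s)) x) = x"
  by (simp_all add: P_P mult_exp_exp)

lemma P_0 [simp]: "P t 0 = 0" by (simp add: P_eq)

lemma continuous_on_P: "continuous_on ({0<..} \<times> UNIV) (\<lambda>q. P (fst q) (snd q))"
proof -
  have cV: "continuous_on {0<..} V" using rot unfolding rotation_group_def by blast
  have c: "continuous_on ({0<..} \<times> UNIV) (\<lambda>q::real \<times> (real^'m). V (fst q))"
    by (rule continuous_on_compose2[OF cV]) (auto intro!: continuous_intros)
  show ?thesis unfolding P_eq matrix_vector_mult_def
    by (intro continuous_intros continuous_on_vec_lambda continuous_on_sum continuous_on_mult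
          continuous_on_component c)
qed

lemma continuous_on_P_fixed: "0 < t \<Longrightarrow> continuous_on S (P t)"
  by (rule continuous_on_compose2[OF continuous_on_P, of S "\<lambda>x. (t, x)", simplified]) (auto intro!: continuous_intros)

lemma integral_P:
  assumes "0 < t" "f \<in> borel_measurable borel"
  shows "(LINT x|lborel. f (P t x)) = (LINT x|lborel. f x) / t ^ CARD('m)"
    and "integrable lborel (\<lambda>x. f (P t x)) \<longleftrightarrow> integrable lborel f"
  using integral_lborel_similarity[OF orth[OF assms(1)] assms] by (simp_all add: P_eq)

lemma T_real: "real_of_ereal (T s w x) = exp (- \<rho> * s) * real_of_ereal (w (P (exp s) x))"
  by (simp add: T_map_def)

lemma T_T: "T s (T t w) = T (s + t) w"
proof
  fix x
  have "ereal (exp (- \<rho> * s)) * (ereal (exp (- \<rho> * t)) * w (P (exp t) (P (exp s) x)))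
      = (ereal (exp (- \<rho> * s)) * ereal (exp (- \<rho> * t))) * w (P (exp t) (P (exp s) x))"
    by (simp only: mult.assoc)
  also have "\<dots> = ereal (exp (- \<rho> * (s + t))) * w (P (exp (s + t)) x)"
    by (simp add: P_P mult_exp_exp algebra_simps)
  finally show "T s (T t w) x = T (s + t) w x" by (simp only: T_map_def)
qed

lemma T_0 [simp]: "T 0 w = w"
  by (simp add: T_map_def fun_eq_iff one_ereal_def[symmetric])

lemma T_U: "w \<in> U \<Longrightarrow> T s w \<in> U"
  using U_invariant unfolding T_invariant_def by blast

lemma U_class: "w \<in> U \<Longrightarrow> subharmonic w \<and> w 0 = 0 \<and> (\<forall>r\<ge>0. max_on_sphere w r \<le> ereal (\<sigma> * r powr \<rho>))"
  using U_subset unfolding U_class_def by blast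

lemma U_sh: "w \<in> U \<Longrightarrow> w \<in> sh_functions"
  using U_class[of w] unfolding sh_functions_def by (auto intro!: exI[of _ 0])

lemma U_upper: "w \<in> U \<Longrightarrow> real_of_ereal (w x) \<le> \<sigma> * norm x powr \<rho>"
proof -
  assume w: "w \<in> U"
  have "w x \<le> max_on_sphere w (norm x)" unfolding max_on_sphere_def by (rule SUP_upper) simp
  also have "\<dots> \<le> ereal (\<sigma> * norm x powr \<rho>)" using U_class[OF w] by simp
  finally have "w x \<le> ereal (\<sigma> * norm x powr \<rho>)" .
  then show ?thesis using sigma_pos by (cases "w x") auto
qed

lemma U_L1_bound: "\<exists>C. \<forall>w\<in>U. (LINT z|lborel. indicator (cball 0 R) z * \<bar>real_of_ereal (w z)\<bar>) \<le> C"
proof -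
  define r where "r = \<bar>R\<bar> + 1"
  have r: "0 < r" "cball (0::real^'m) R \<subseteq> ball 0 r" by (auto simp: r_def)
  define B where "B = \<sigma> * r powr \<rho>"
  have B: "0 \<le> B" using sigma_pos by (simp add: B_def)
  have "(LINT z|lborel. indicator (cball 0 R) z * \<bar>real_of_ereal (w z)\<bar>) \<le> 2 * B * measure lborel (ball (0::real^'m) r)"
    if w: "w \<in> U" for w
  proof -
    define f where "f z = real_of_ereal (w z)" for z
    have i: "integrable lborel (\<lambda>z. indicator (cball 0 R) z * f z)" "integrable lborel (\<lambda>z. indicator (ball 0 r) z * f z)"
      unfolding f_def by (rule sh_integrable_cball[OF U_sh[OF w]], rule sh_integrable_ball[OF U_sh[OF w]])
    have i': "integrable lborel (\<lambda>z. indicator (cball 0 R) z * \<bar>f z\<bar>)" "integrable lborel (\<lambda>z. indicator (ball 0 r) z * \<bar>f z\<bar>)"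
      using integrable_abs[OF i(1)] integrable_abs[OF i(2)] by (simp_all add: abs_mult)
    have "(LINT z|lborel. indicator (cball 0 R) z * \<bar>f z\<bar>) \<le> (LINT z|lborel. indicator (ball 0 r) z * \<bar>f z\<bar>)"
      by (rule integral_mono[OF i']) (use r(2) in \<open>auto simp: indicator_def\<close>)
    also have "\<dots> \<le> 2 * B * measure lborel (ball (0::real^'m) r)"
      unfolding f_def
    proof (rule sh_L1_bound[OF U_sh[OF w] _ r(1) B])
      show "w 0 = 0" using U_class[OF w] by blast
      fix y :: "real^'m" assume "y \<in> ball 0 r"
      then have "norm y powr \<rho> \<le> r powr \<rho>" using rho_pos by (intro powr_mono2) auto
      then have "\<sigma> * norm y powr \<rho> \<le> B" unfolding B_def using sigma_pos by (intro mult_left_mono) auto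
      then show "real_of_ereal (w y) \<le> B" using U_upper[OF w, of y] by linarith
    qed
    finally show ?thesis unfolding f_def .
  qed
  then show ?thesis by blast
qed

text \<open>On \<open>U\<close> the topology comes from the metric \<open>d\<close>, so sequences
  suffice there, and convergence of all pairings describes it without reference to the choice of
  \<open>d\<close>.\<close>

definition conv :: "(nat \<Rightarrow> real^'m \<Rightarrow> ereal) \<Rightarrow> (real^'m \<Rightarrow> ereal) \<Rightarrow> bool" where
  "conv w v \<longleftrightarrow> (\<forall>\<phi>\<in>test_functions. (\<lambda>n. pairing (w n) \<phi>) \<longlonglongrightarrow> pairing v \<phi>)"

lemma U_pairing_limit:
  assumes w: "\<And>n. w n \<in> U" and v: "v \<in> U" and c: "conv w v"
    and \<Psi>: "\<And>n. \<Psi> n \<in> borel_measurable borel" "\<And>n z. z \<notin> cball 0 S \<Longrightarrow> \<Psi> n z = 0"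
    and \<Psi>': "continuous_on UNIV \<Psi>'" "\<And>z. z \<notin> cball 0 S \<Longrightarrow> \<Psi>' z = 0" and S: "0 < S"
    and unif: "\<And>e. 0 < e \<Longrightarrow> \<forall>\<^sub>F n in sequentially. \<forall>z. \<bar>\<Psi> n z - \<Psi>' z\<bar> \<le> e"
  shows "(\<lambda>n. LINT z|lborel. real_of_ereal (w n z) * \<Psi> n z) \<longlonglongrightarrow> (LINT z|lborel. real_of_ereal (v z) * \<Psi>' z)"
proof (rule pairing_limit[OF _ _ _ _ _ _ \<Psi> \<Psi>' S unif])
  show "(\<lambda>z. real_of_ereal (w n z)) \<in> borel_measurable borel" for n by (rule sh_real_measurable[OF U_sh[OF w]])
  show "integrable lborel (\<lambda>z. indicator (cball 0 R) z * real_of_ereal (w n z))" for n R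
    by (rule sh_integrable_cball[OF U_sh[OF w]])
  show "(\<lambda>z. real_of_ereal (v z)) \<in> borel_measurable borel" by (rule sh_real_measurable[OF U_sh[OF v]])
  show "integrable lborel (\<lambda>z. indicator (cball 0 R) z * real_of_ereal (v z))" for R
    by (rule sh_integrable_cball[OF U_sh[OF v]])
  show "\<exists>C. \<forall>n. (LINT z|lborel. indicator (cball 0 R) z * \<bar>real_of_ereal (w n z)\<bar>) \<le> C" for R
    using U_L1_bound[of R] w by blast
  show "(\<lambda>n. LINT z|lborel. real_of_ereal (w n z) * \<phi> z) \<longlonglongrightarrow> (LINT z|lborel. real_of_ereal (v z) * \<phi> z)"
    if "\<phi> \<in> test_functions" for \<phi>
    using c that unfolding conv_def pairing_def by blast
qed assumption+

lemma limitin_U: "(\<And>n. w n \<in> U) \<Longrightarrow> v \<in> U \<Longrightarrow> limitin (Metric_space.mtopology U d) w v sequentially \<longleftrightarrow> conv w v"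
  unfolding d_topology limitin_subtopology limitin_distr_topology conv_def
  using U_sh by auto

lemma conv_iff_d: 
  assumes "\<And>n. w n \<in> U" "v \<in> U"
  shows "conv w v \<longleftrightarrow> (\<lambda>n. d (w n) v) \<longlonglongrightarrow> 0"
  using limitin_U[OF assms] Metric_space.limitin_metric_dist_null[OF d_metric, of w v sequentially] assms by simp

lemma U_seq_compact:
  assumes "\<And>n. w n \<in> U"
  obtains v r where "v \<in> U" "strict_mono (r :: nat \<Rightarrow> nat)" "conv (\<lambda>n. w (r n)) v"
proof -
  have "compactin (Metric_space.mtopology U d) U"
    unfolding d_topology compactin_subtopology using U_compact by simp
  then obtain v r where vr: "v \<in> U" "strict_mono (r :: nat \<Rightarrow> nat)" "limitin (Metric_space.mtopology U d) (w \<circ> r) v sequentially"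
  proof -
    have "range w \<subseteq> U" using assms by auto
    with \<open>compactin (Metric_space.mtopology U d) U\<close> show ?thesis
      unfolding Metric_space.compactin_sequentially[OF d_metric] using that by blast
  qed
  have "conv (\<lambda>n. w (r n)) v" using limitin_U[of "w \<circ> r" v] vr assms by (simp add: o_def)
  then show ?thesis using that vr by blast
qed

lemma conv_subseq: "conv w v \<Longrightarrow> strict_mono r \<Longrightarrow> conv (\<lambda>n. w (r n)) v"
  unfolding conv_def using LIMSEQ_subseq_LIMSEQ[unfolded o_def] by blast

lemma U_seq_compact_param:
  fixes k :: "nat \<Rightarrow> 'k::metric_space"
  assumes w: "\<And>n. w n \<in> U" and K: "compact K" "\<And>n. k n \<in> K"
  obtains v l r where "v \<in> U" "l \<in> K" "strict_mono (r :: nat \<Rightarrow> nat)" "conv (\<lambda>n. w (r n)) v" "(\<lambda>n. k (r n)) \<longlonglongrightarrow> l"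
proof -
  obtain v r where r: "v \<in> U" "strict_mono (r :: nat \<Rightarrow> nat)" "conv (\<lambda>n. w (r n)) v"
    by (rule U_seq_compact[OF w])
  obtain l q where q: "l \<in> K" "strict_mono (q :: nat \<Rightarrow> nat)" "((\<lambda>n. k (r n)) \<circ> q) \<longlonglongrightarrow> l"
    by (rule seq_compactE[OF compact_imp_seq_compact[OF K(1)], of "\<lambda>n. k (r n)"]) (use K(2) in auto)
  show ?thesis
    by (rule that[OF r(1) q(1) strict_mono_o[OF r(2) q(2), unfolded o_def]])
       (use conv_subseq[OF r(3) q(2)] q(3) in \<open>simp_all add: o_def\<close>)
qed

lemma T_integral:
  assumes "w \<in> U" and \<psi>: "\<psi> \<in> borel_measurable borel"
  shows "(LINT x|lborel. real_of_ereal (T s w x) * \<psi> x)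
     = exp (- \<rho> * s) / exp s ^ CARD('m) * (LINT z|lborel. real_of_ereal (w z) * \<psi> (P (exp (- s)) z))"
proof -
  have mP: "P (exp (- s)) \<in> borel_measurable borel"
    by (rule borel_measurable_continuous_onI[OF continuous_on_P_fixed]) simp
  have m: "(\<lambda>z. real_of_ereal (w z) * \<psi> (P (exp (- s)) z)) \<in> borel_measurable borel"
    by (intro borel_measurable_times sh_real_measurable U_sh assms(1) measurable_compose[OF mP \<psi>])
  have "(LINT x|lborel. real_of_ereal (T s w x) * \<psi> x)
      = exp (- \<rho> * s) * (LINT x|lborel. real_of_ereal (w (P (exp s) x)) * \<psi> (P (exp (- s)) (P (exp s) x)))"
    unfolding T_real P_inv by (simp add: mult.assoc)
  also have "(LINT x|lborel. real_of_ereal (w (P (exp s) x)) * \<psi> (P (exp (- s)) (P (exp s) x)))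
     = (LINT z|lborel. real_of_ereal (w z) * \<psi> (P (exp (- s)) z)) / exp s ^ CARD('m)"
    using integral_P(1)[OF _ m, of "exp s"] by simp
  finally show ?thesis by simp
qed

text \<open>A convergent sequence of times keeps the scale factors in a compact set of positive
  reals, which gives a common support and uniform convergence.\<close>

lemma P_uniform_limit:
  fixes \<phi> :: "real^'m \<Rightarrow> real"
  assumes \<phi>: "continuous_on UNIV \<phi>" "\<And>x. x \<notin> cball 0 R \<Longrightarrow> \<phi> x = 0" and t: "t \<longlonglongrightarrow> t'"
  shows "\<exists>S>0. (\<forall>n z. z \<notin> cball 0 S \<longrightarrow> \<phi> (P (exp (t n)) z) = 0) \<and> (\<forall>z. z \<notin> cball 0 S \<longrightarrow> \<phi> (P (exp t') z) = 0) \<and>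
    (\<forall>e>0. \<forall>\<^sub>F n in sequentially. \<forall>z. \<bar>\<phi> (P (exp (t n)) z) - \<phi> (P (exp t') z)\<bar> \<le> e)"
proof -
  obtain B where B: "\<And>n. \<bar>t n\<bar> \<le> B" using convergent_imp_Bseq[of t] t unfolding Bseq_def convergent_def by auto
  define K where "K = {exp (- B)..exp B}"
  have K: "compact K" "\<And>k. k \<in> K \<Longrightarrow> 0 < k" by (auto simp: K_def intro: less_le_trans[OF exp_gt_zero])
  have tK: "exp (t n) \<in> K" for n using B[of n] by (auto simp: K_def abs_le_iff)
  have lim: "(\<lambda>n. exp (t n)) \<longlonglongrightarrow> exp t'" using t by (rule tendsto_exp)
  have t'K: "exp t' \<in> K" using closed_sequentially[OF compact_imp_closed[OF K(1)] tK lim] .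
  define S where "S = (\<bar>R\<bar> + 1) * exp B"
  have S: "0 < S" by (simp add: S_def add_nonneg_pos)
  have z0: "\<phi> (P k z) = 0" if "k \<in> K" "z \<notin> cball 0 S" for k z
  proof (rule \<phi>(2))
    have "(\<bar>R\<bar> + 1) * exp B < norm z" using that(2) by (simp add: S_def)
    then have "exp (- B) * ((\<bar>R\<bar> + 1) * exp B) < exp (- B) * norm z" by (intro mult_strict_left_mono) auto
    also have "exp (- B) * norm z \<le> k * norm z" using that(1) by (intro mult_right_mono) (auto simp: K_def)
    finally have "exp (- B) * ((\<bar>R\<bar> + 1) * exp B) < k * norm z" .
    moreover have "exp (- B) * ((\<bar>R\<bar> + 1) * exp B) = \<bar>R\<bar> + 1" by (simp add: exp_minus)
    ultimately have "\<bar>R\<bar> + 1 < k * norm z" by simp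
    then show "P k z \<notin> cball 0 R" using norm_P[OF K(2)[OF that(1)], of z] by simp
  qed
  have cF: "continuous_on (K \<times> UNIV) (\<lambda>p. \<phi> (P (fst p) (snd p)))"
    by (rule continuous_on_compose2[OF \<phi>(1)]) (use K(2) in \<open>auto intro!: continuous_on_subset[OF continuous_on_P]\<close>)
  have "\<forall>\<^sub>F n in sequentially. \<forall>z. \<bar>\<phi> (P (exp (t n)) z) - \<phi> (P (exp t') z)\<bar> \<le> e" if "0 < e" for e
    by (rule uniform_limit_compact_param[OF K(1), of "\<lambda>k z. \<phi> (P k z)", OF cF z0 tK lim that])
  then show ?thesis using S z0 tK t'K by blast
qed

lemma continuous_P_compose:
  "continuous_on UNIV \<phi> \<Longrightarrow> 0 < t \<Longrightarrow> continuous_on UNIV (\<lambda>z. \<phi> (P t z))"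
  by (rule continuous_on_compose2[OF _ continuous_on_P_fixed]) auto

lemma test_function_props:
  assumes "\<phi> \<in> (test_functions :: (real^'m \<Rightarrow> real) set)"
  obtains R where "0 < R" "continuous_on UNIV \<phi>" "\<And>x. x \<notin> cball 0 R \<Longrightarrow> \<phi> x = 0"
proof -
  have c: "continuous_on UNIV \<phi>" using assms unfolding test_functions_def by (auto dest: spec[of _ 0])
  have "bounded (closure {x. \<phi> x \<noteq> 0})" using assms unfolding test_functions_def by (auto intro: compact_imp_bounded)
  then have "bounded {x. \<phi> x \<noteq> 0}" by (meson bounded_subset closure_subset)
  then obtain R where R: "0 < R" "\<And>x. x \<in> {x. \<phi> x \<noteq> 0} \<Longrightarrow> norm x \<le> R" unfolding bounded_pos by blast
  have "\<phi> x = 0" if "x \<notin> cball 0 R" for x using R(2)[of x] that by force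
  then show ?thesis using that R(1) c by blast
qed

text \<open>Joint continuity of the flow. A change of variables moves the time onto the test
  function, and the transported test functions converge uniformly, as \<open>U_pairing_limit\<close>
  allows.\<close>

lemma T_conv:
  assumes w: "\<And>n. w n \<in> U" and v: "v \<in> U" and c: "conv w v" and t: "t \<longlonglongrightarrow> t'"
  shows "conv (\<lambda>n. T (t n) (w n)) (T t' v)"
  unfolding conv_def
proof
  fix \<phi> :: "real^'m \<Rightarrow> real" assume "\<phi> \<in> test_functions"
  then obtain R where R: "continuous_on UNIV \<phi>" "\<And>x. x \<notin> cball 0 R \<Longrightarrow> \<phi> x = 0" using test_function_props by blast
  have m: "\<phi> \<in> borel_measurable borel" by (rule borel_measurable_continuous_onI[OF R(1)])
  have lim: "(\<lambda>n. - t n) \<longlonglongrightarrow> - t'" using t by (rule tendsto_minus)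
  obtain S where S: "0 < S" "\<And>n z. z \<notin> cball 0 S \<Longrightarrow> \<phi> (P (exp (- t n)) z) = 0" "\<And>z. z \<notin> cball 0 S \<Longrightarrow> \<phi> (P (exp (- t')) z) = 0"
    "\<And>e. 0 < e \<Longrightarrow> \<forall>\<^sub>F n in sequentially. \<forall>z. \<bar>\<phi> (P (exp (- t n)) z) - \<phi> (P (exp (- t')) z)\<bar> \<le> e"
    using P_uniform_limit[OF R lim] by blast
  have mc: "(\<lambda>z. \<phi> (P (exp s) z)) \<in> borel_measurable borel" for s
    by (rule borel_measurable_continuous_onI[OF continuous_P_compose[OF R(1)]]) simp
  have "(\<lambda>n. LINT z|lborel. real_of_ereal (w n z) * \<phi> (P (exp (- t n)) z)) \<longlonglongrightarrow> (LINT z|lborel. real_of_ereal (v z) * \<phi> (P (exp (- t')) z))"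
    by (rule U_pairing_limit[OF w v c mc S(2) continuous_P_compose[OF R(1) exp_gt_zero] S(3,1,4)])
  then have "(\<lambda>n. exp (- \<rho> * t n) / exp (t n) ^ CARD('m) * (LINT z|lborel. real_of_ereal (w n z) * \<phi> (P (exp (- t n)) z)))
     \<longlonglongrightarrow> exp (- \<rho> * t') / exp t' ^ CARD('m) * (LINT z|lborel. real_of_ereal (v z) * \<phi> (P (exp (- t')) z))"
    by (intro tendsto_intros t) auto
  then show "(\<lambda>n. pairing (T (t n) (w n)) \<phi>) \<longlonglongrightarrow> pairing (T t' v) \<phi>"
    unfolding pairing_def T_integral[OF w m] T_integral[OF v m] .
qed

lemma d_nonneg: "0 \<le> d x y" and d_sym: "d x y = d y x"
  and d_triangle: "x \<in> U \<Longrightarrow> y \<in> U \<Longrightarrow> z \<in> U \<Longrightarrow> d x z \<le> d x y + d y z"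
  and d_zero: "x \<in> U \<Longrightarrow> d x x = 0"
  using Metric_space.nonneg[OF d_metric] Metric_space.commute[OF d_metric] Metric_space.triangle[OF d_metric]
    Metric_space.zero[OF d_metric] by auto

lemma d_conv_other:
  assumes "\<And>n. w n \<in> U" "\<And>n. u n \<in> U" "v \<in> U" "conv w v" "(\<lambda>n. d (w n) (u n)) \<longlonglongrightarrow> 0"
  shows "conv u v"
proof -
  have "(\<lambda>n. d (w n) v) \<longlonglongrightarrow> 0" using conv_iff_d[of w v] assms by blast
  from tendsto_add[OF assms(5) this] have "(\<lambda>n. d (w n) (u n) + d (w n) v) \<longlonglongrightarrow> 0" by simp
  then have "(\<lambda>n. d (u n) v) \<longlonglongrightarrow> 0"
    by (rule Lim_null_comparison[rotated])
       (use d_triangle[OF assms(2,1,3)] d_nonneg d_sym in \<open>simp add: always_eventually\<close>)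
  then show ?thesis using conv_iff_d[of u v] assms by blast
qed

lemma conv_imp_d:
  assumes "\<And>n. w n \<in> U" "\<And>n. u n \<in> U" "v \<in> U" "conv w v" "conv u v"
  shows "(\<lambda>n. d (w n) (u n)) \<longlonglongrightarrow> 0"
proof -
  have "(\<lambda>n. d (w n) v + d (u n) v) \<longlonglongrightarrow> 0"
    using tendsto_add[of "\<lambda>n. d (w n) v" 0 sequentially "\<lambda>n. d (u n) v" 0] conv_iff_d[of w v] conv_iff_d[of u v] assms by simp
  then show ?thesis
    by (rule Lim_null_comparison[rotated])
       (use d_triangle[OF assms(1,3,2)] d_nonneg d_sym in \<open>simp add: always_eventually\<close>)
qed

text \<open>Equicontinuity of the flow over bounded times, from the compactness of \<open>U\<close>
  and of the time interval.\<close>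

lemma T_uniform:
  assumes e: "0 < e"
  shows "\<exists>\<delta>>0. \<forall>a\<in>U. \<forall>b\<in>U. \<forall>s. d a b < \<delta> \<longrightarrow> \<bar>s\<bar> \<le> L \<longrightarrow> d (T s a) (T s b) < e"
proof (rule ccontr)
  assume neg: "\<not> ?thesis"
  have "\<exists>a b s. a \<in> U \<and> b \<in> U \<and> d a b < 1 / real (Suc n) \<and> \<bar>s\<bar> \<le> L \<and> \<not> d (T s a) (T s b) < e" for n
  proof -
    have "0 < 1 / real (Suc n)" by simp
    with neg show ?thesis by blast
  qed
  then obtain a b s where abs: "\<And>n. a n \<in> U" "\<And>n. b n \<in> U" "\<And>n. d (a n) (b n) < 1 / real (Suc n)" "\<And>n. \<bar>s n\<bar> \<le> L"
    "\<And>n. \<not> d (T (s n) (a n)) (T (s n) (b n)) < e" by metis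
  have sK: "s n \<in> {-L..L}" for n using abs(4)[of n] by (auto simp: abs_le_iff)
  obtain v l r where r: "v \<in> U" "l \<in> {-L..L}" "strict_mono (r :: nat \<Rightarrow> nat)" "conv (\<lambda>n. a (r n)) v" "(\<lambda>n. s (r n)) \<longlonglongrightarrow> l"
    by (rule U_seq_compact_param[of a "{-L..L}" s, OF abs(1) compact_Icc sK])
  have "(\<lambda>n. d (a n) (b n)) \<longlonglongrightarrow> 0"
    by (rule Lim_null_comparison[OF always_eventually LIMSEQ_inverse_real_of_nat])
       (use abs(3) d_nonneg in \<open>auto simp: inverse_eq_divide less_imp_le\<close>)
  from LIMSEQ_subseq_LIMSEQ[OF this r(3)] have "(\<lambda>n. d (a (r n)) (b (r n))) \<longlonglongrightarrow> 0" by (simp add: o_def)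
  then have "conv (\<lambda>n. b (r n)) v" by (rule d_conv_other[OF abs(1) abs(2) r(1,4)])
  from conv_imp_d[OF T_U[OF abs(1)] T_U[OF abs(2)] T_U[OF r(1)] T_conv[OF abs(1) r(1,4,5)] T_conv[OF abs(2) r(1) this r(5)]]
  have "(\<lambda>n. d (T (s (r n)) (a (r n))) (T (s (r n)) (b (r n)))) \<longlonglongrightarrow> 0" .
  from order_tendstoD(2)[OF this e] abs(5) show False by (auto simp: eventually_sequentially)
qed

end

section \<open>Concatenation of pseudo-orbits\<close>

text \<open>Each chain ends where the next one begins, so the last step of a stage still obeys the
  relation of that stage. \<open>st k\<close> is the stage containing k.\<close>

lemma concatenate_stages:
  fixes R :: "nat \<Rightarrow> 'a \<Rightarrow> 'a \<Rightarrow> bool" and N :: "nat \<Rightarrow> nat"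
  assumes step: "\<And>n. (R n ^^ N n) (X n) (X (Suc n))" and pos: "\<And>n. 1 \<le> N n"
  obtains Y S where "strict_mono S" "S 0 = 0" "\<And>n. S (Suc n) = S n + N n" "\<And>n. Y (S n) = X n"
    "\<And>n k. S n \<le> k \<Longrightarrow> k < S (Suc n) \<Longrightarrow> R n (Y k) (Y (Suc k))"
proof -
  obtain f where f: "\<And>n. f n 0 = X n" "\<And>n. f n (N n) = X (Suc n)" "\<And>n i. i < N n \<Longrightarrow> R n (f n i) (f n (Suc i))"
    using step unfolding relpowp_fun_conv by metis
  define S where "S n = sum N {..<n}" for n
  have S: "S 0 = 0" "S (Suc n) = S n + N n" for n by (simp_all add: S_def)
  have sm: "strict_mono S" unfolding strict_mono_Suc_iff using pos S(2) by (simp add: less_eq_Suc_le)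
  define st where "st k = (LEAST n. k < S (Suc n))" for k
  have ex: "\<exists>n. k < S (Suc n)" for k
    using strict_mono_imp_increasing[OF sm, of "Suc k"] by (intro exI[of _ k]) auto
  have st_eq: "st k = n" if "S n \<le> k" "k < S (Suc n)" for n k
    unfolding st_def
  proof (rule Least_equality)
    fix m assume "k < S (Suc m)"
    then have "S n < S (Suc m)" using that(1) by simp
    then show "n \<le> m" using strict_mono_less[OF sm] by (simp add: less_Suc_eq_le)
  qed (rule that(2))
  define Y where "Y k = f (st k) (k - S (st k))" for k
  have Yf: "Y (S n + i) = f n i" if "i < N n" for n i
    using st_eq[of n "S n + i"] that S(2) by (simp add: Y_def)
  have YS: "Y (S n) = X n" for n using Yf[of 0 n] pos[of n] f(1) by simp
  have Yf': "Y (S n + i) = f n i" if "i \<le> N n" for n i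
  proof (cases "i = N n")
    case True
    then show ?thesis using YS[of "Suc n"] f(2) S(2) by simp
  qed (use Yf that in simp)
  have YR: "R n (Y k) (Y (Suc k))" if "S n \<le> k" "k < S (Suc n)" for n k
  proof -
    define i where "i = k - S n"
    have i: "k = S n + i" "i < N n" using that S(2) by (auto simp: i_def)
    have "Y (Suc k) = f n (Suc i)" using Yf'[of "Suc i" n] i by simp
    then show ?thesis using Yf'[of i n] f(3)[OF i(2)] i by simp
  qed
  show ?thesis by (rule that[OF sm S YS YR])
qed

lemma strict_mono_stage:
  fixes S :: "nat \<Rightarrow> nat"
  assumes S: "strict_mono S" and m: "S m \<le> k"
  shows "\<exists>n\<ge>m. S n \<le> k \<and> k < S (Suc n)"
proof -
  have bd: "n \<le> k" if "S n \<le> k" for n using strict_mono_imp_increasing[OF S, of n] that by simp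
  define n where "n = (GREATEST n. S n \<le> k)"
  have 1: "S n \<le> k" unfolding n_def by (rule GreatestI_nat[of "\<lambda>n. S n \<le> k" m k]) (use m bd in auto)
  have 2: "m \<le> n" unfolding n_def by (rule Greatest_le_nat[of "\<lambda>n. S n \<le> k" m k]) (use m bd in auto)
  have "\<not> S (Suc n) \<le> k"
  proof
    assume "S (Suc n) \<le> k"
    then have "Suc n \<le> n" unfolding n_def by (intro Greatest_le_nat[of "\<lambda>n. S n \<le> k" _ k]) (use bd in auto)
    then show False by simp
  qed
  then show ?thesis using 1 2 by auto
qed

lemma chain_imp_tranclp:
  assumes "\<And>j. j < n \<Longrightarrow> R (c j) (c (Suc j))" "1 \<le> n"
  shows "R\<^sup>+\<^sup>+ (c 0) (c n)"
proof -
  have "(R ^^ n) (c 0) (c n)" unfolding relpowp_fun_conv using assms(1) by blast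
  then show ?thesis unfolding tranclp_power using assms(2) by (intro exI[of _ n]) auto
qed

section \<open>Chain transitivity by unit time steps\<close>

context limit_system
begin

definition flow_step :: "real \<Rightarrow> (real^'m \<Rightarrow> ereal) \<Rightarrow> (real^'m \<Rightarrow> ereal) \<Rightarrow> bool" where
  "flow_step e a b \<longleftrightarrow> a \<in> U \<and> b \<in> U \<and> (\<exists>t\<ge>1. d (T t a) b < e)"

definition unit_step :: "real \<Rightarrow> (real^'m \<Rightarrow> ereal) \<Rightarrow> (real^'m \<Rightarrow> ereal) \<Rightarrow> bool" where
  "unit_step e a b \<longleftrightarrow> a \<in> U \<and> b \<in> U \<and> d (T 1 a) b < e"

lemma flow_recurrent:
  assumes "a \<in> U" "0 < e"
  shows "(flow_step e)\<^sup>+\<^sup>+ a a"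
proof -
  obtain n c where c: "1 \<le> (n::nat)" "c 0 = a" "c n = a" "\<And>j. j \<le> n \<Longrightarrow> c j \<in> U"
    "\<And>j. j < n \<Longrightarrow> \<exists>t\<ge>1. d (T t (c j)) (c (Suc j)) < e"
    using d_chain[unfolded chain_recurrent_def, rule_format, OF assms zero_less_one] by blast
  have "(flow_step e)\<^sup>+\<^sup>+ (c 0) (c n)"
    by (rule chain_imp_tranclp) (use c in \<open>auto simp: flow_step_def\<close>)
  then show ?thesis using c by simp
qed

text \<open>The set of points reachable from \<open>a\<close> is open by definition and closed by chain recurrence.\<close>

lemma flow_transitive:
  assumes a: "a \<in> U" and b: "b \<in> U" and e: "0 < e"
  shows "(flow_step e)\<^sup>+\<^sup>+ a b"
proof -
  interpret M: Metric_space U d by (rule d_metric)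
  define R where "R = {y \<in> U. (flow_step e)\<^sup>+\<^sup>+ a y}"
  have RU: "R \<subseteq> U" by (auto simp: R_def)
  have "openin M.mtopology R"
    unfolding M.openin_mtopology
  proof (intro conjI RU allI impI)
    fix y assume "y \<in> R"
    then have y: "y \<in> U" "(flow_step e)\<^sup>+\<^sup>+ a y" by (auto simp: R_def)
    obtain x where x: "(flow_step e)\<^sup>*\<^sup>* a x" "flow_step e x y" using y(2) by cases (auto dest: tranclp_into_rtranclp)
    obtain t where t: "1 \<le> t" "d (T t x) y < e" and xU: "x \<in> U" using x(2) unfolding flow_step_def by blast
    \<comment> \<open>The last step of the chain has the slack \<open>e - d (T t x) y\<close>, by
      which its end may be moved.\<close>
    have "M.mball y (e - d (T t x) y) \<subseteq> R"
    proof
      fix z assume "z \<in> M.mball y (e - d (T t x) y)"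
      then have z: "z \<in> U" "d y z < e - d (T t x) y" by (auto simp: M.mball_def)
      then have "d (T t x) z < e" using d_triangle[OF T_U[OF xU] y(1) z(1), of t] by linarith
      then have "flow_step e x z" unfolding flow_step_def using xU z t by blast
      then show "z \<in> R" unfolding R_def using x(1) z by (simp add: rtranclp_into_tranclp1)
    qed
    then show "\<exists>r>0. M.mball y r \<subseteq> R" using t by (intro exI[of _ "e - d (T t x) y"]) simp
  qed
  moreover have "closedin M.mtopology R"
    unfolding closedin_def M.topspace_mtopology
  proof (intro conjI RU)
    show "openin M.mtopology (U - R)"
      unfolding M.openin_mtopology
    proof (intro conjI allI impI)
      fix y assume y: "y \<in> U - R"
      \<comment> \<open>A chain from y back to y can be entered from any z near y, since its first
        step has slack and \<open>T t\<close> is continuous. So a reachable z would make y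
        reachable.\<close>
      then have "(flow_step e)\<^sup>+\<^sup>+ y y" using e by (intro flow_recurrent) auto
      then obtain x where x: "flow_step e y x" "(flow_step e)\<^sup>*\<^sup>* x y" using tranclpD by fast
      obtain t where t: "1 \<le> t" "d (T t y) x < e" and xU: "x \<in> U" using x(1) unfolding flow_step_def by blast
      define e' where "e' = e - d (T t y) x"
      have e': "0 < e'" using t by (simp add: e'_def)
      obtain \<delta> where \<delta>: "0 < \<delta>" "\<And>a b s. a \<in> U \<Longrightarrow> b \<in> U \<Longrightarrow> d a b < \<delta> \<Longrightarrow> \<bar>s\<bar> \<le> t \<Longrightarrow> d (T s a) (T s b) < e'"
        using T_uniform[where L = t, OF e'] by blast
      have "z \<notin> R" if z: "z \<in> U" "d y z < \<delta>" for z
      proof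
        assume "z \<in> R"
        have "d (T t z) (T t y) < e'" using \<delta>(2)[of z y t] z y t(1) d_sym by auto
        then have "d (T t z) x < e" using d_triangle[OF T_U[OF z(1)] T_U xU, of y t t] y unfolding e'_def by auto
        then have "flow_step e z x" unfolding flow_step_def using z xU t by blast
        then have "(flow_step e)\<^sup>+\<^sup>+ z y" using x(2) by (rule rtranclp_into_tranclp2)
        moreover have "(flow_step e)\<^sup>+\<^sup>+ a z" using \<open>z \<in> R\<close> by (simp add: R_def)
        ultimately have "(flow_step e)\<^sup>+\<^sup>+ a y" by (rule tranclp_trans[rotated])
        then show False using y by (simp add: R_def)
      qed
      then show "\<exists>r>0. M.mball y r \<subseteq> U - R" using \<delta>(1) by (intro exI[of _ \<delta>]) (auto simp: M.mball_def)
    qed auto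
  qed
  moreover have "connected_space M.mtopology"
    unfolding d_topology using U_connected unfolding connectedin_def by blast
  ultimately have "R = {} \<or> R = U" unfolding connected_space_clopen_in M.topspace_mtopology by blast
  moreover have "a \<in> R" using flow_recurrent[OF a e] a by (simp add: R_def)
  ultimately show ?thesis using b by (auto simp: R_def)
qed

text \<open>The chains use arbitrary real times, unit steps only integral ones. The difference is
  carried along as a phase in [0, 1), so the target is reached up to a shift along its
  orbit.\<close>

lemma unit_transitive:
  assumes a: "a \<in> U" and b: "b \<in> U" and e: "0 < e"
  obtains \<theta> where "0 \<le> \<theta>" "\<theta> < 1" "(unit_step e)\<^sup>+\<^sup>+ a (T \<theta> b)"
proof -
  obtain \<delta> where \<delta>: "0 < \<delta>" "\<And>a b s. a \<in> U \<Longrightarrow> b \<in> U \<Longrightarrow> d a b < \<delta> \<Longrightarrow> \<bar>s\<bar> \<le> 1 \<Longrightarrow> d (T s a) (T s b) < e"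
    using T_uniform[where L = 1, OF e] by blast
  have one: "\<exists>\<theta>'. 0 \<le> \<theta>' \<and> \<theta>' < 1 \<and> (unit_step e)\<^sup>+\<^sup>+ (T \<theta> x) (T \<theta>' y)"
    if xy: "flow_step \<delta> x y" and \<theta>: "0 \<le> \<theta>" "\<theta> < 1" for x y \<theta>
  proof -
    obtain t where t: "1 \<le> t" "d (T t x) y < \<delta>" and U: "x \<in> U" "y \<in> U" using xy unfolding flow_step_def by blast
    \<comment> \<open>N is the least integer with \<open>t \<le> \<theta> + N\<close>, and the
      overshoot is the new phase. All steps but the last follow the orbit of x exactly; the last one
      makes the given jump, transported by \<open>T \<theta>'\<close>, whence \<delta> from the
      uniform continuity over times up to 1.\<close>
    define N where "N = nat \<lceil>t - \<theta>\<rceil>"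
    have N: "t \<le> \<theta> + real N" "\<theta> + real N < t + 1" "1 \<le> N"
      using t(1) \<theta> unfolding N_def by linarith+
    define \<theta>' where "\<theta>' = \<theta> + real N - t"
    have \<theta>': "0 \<le> \<theta>'" "\<theta>' < 1" using N by (auto simp: \<theta>'_def)
    define c where "c i = (if i < N then T (\<theta> + real i) x else T \<theta>' y)" for i
    have "(unit_step e)\<^sup>+\<^sup>+ (c 0) (c N)"
    proof (rule chain_imp_tranclp[OF _ N(3)])
      fix j assume j: "j < N"
      show "unit_step e (c j) (c (Suc j))"
      proof (cases "Suc j < N")
        case True
        have "T 1 (T (\<theta> + real j) x) = T (\<theta> + real (Suc j)) x" unfolding T_T by (simp add: add_ac)
        then show ?thesis using True j e T_U[OF U(1)] by (simp add: unit_step_def c_def d_zero)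
      next
        case False
        then have "N = Suc j" using j by simp
        then have "T 1 (T (\<theta> + real j) x) = T \<theta>' (T t x)" unfolding T_T by (simp add: \<theta>'_def add_ac)
        moreover have "d (T \<theta>' (T t x)) (T \<theta>' y) < e" using \<delta>(2)[OF T_U[OF U(1)] U(2) t(2)] \<theta>' by simp
        ultimately show ?thesis using False j T_U[OF U(1)] T_U[OF U(2)] by (simp add: unit_step_def c_def)
      qed
    qed
    then show ?thesis using \<theta>' N(3) by (intro exI[of _ \<theta>']) (simp add: c_def)
  qed
  have "(flow_step \<delta>)\<^sup>+\<^sup>+ a b" by (rule flow_transitive[OF a b \<delta>(1)])
  then have "\<exists>\<theta>. 0 \<le> \<theta> \<and> \<theta> < 1 \<and> (unit_step e)\<^sup>+\<^sup>+ (T 0 a) (T \<theta> b)"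
  proof induction
    case (base y)
    show ?case by (rule one[OF base]) auto
  next
    case (step y z)
    then obtain \<theta> where \<theta>: "0 \<le> \<theta>" "\<theta> < 1" "(unit_step e)\<^sup>+\<^sup>+ (T 0 a) (T \<theta> y)" by blast
    obtain \<theta>' where "0 \<le> \<theta>'" "\<theta>' < 1" "(unit_step e)\<^sup>+\<^sup>+ (T \<theta> y) (T \<theta>' z)" using one[OF step(2) \<theta>(1,2)] by blast
    then show ?case using \<theta>(3) by (intro exI[of _ \<theta>']) (auto intro: tranclp_trans)
  qed
  then show ?thesis using that by auto
qed

text \<open>The second component will be the smoothing radius. The bounds c and c' keep it away from
  0 during a stage.\<close>

definition pair_step :: "real \<Rightarrow> real \<Rightarrow> real \<Rightarrow> (real^'m \<Rightarrow> ereal) \<times> real \<Rightarrow> (real^'m \<Rightarrow> ereal) \<times> real \<Rightarrow> bool" where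
  "pair_step e c c' p q \<longleftrightarrow> unit_step e (fst p) (fst q) \<and> \<bar>snd p - snd q\<bar> < e \<and> c \<le> snd p \<and> snd p \<le> c' \<and> c \<le> snd q \<and> snd q \<le> c'"

text \<open>Following the true orbit of a costs nothing, so it is followed long enough to bring the
  radius from l to l' in steps below e and to make at least L steps; the radius then stays at l' on
  the way to the orbit of b.\<close>

lemma pair_transitive:
  assumes a: "a \<in> U" and b: "b \<in> U" and e: "0 < e" and l: "c \<le> l" "l \<le> c'" "c \<le> l'" "l' \<le> c'"
  obtains \<theta> n where "0 \<le> \<theta>" "\<theta> < 1" "L \<le> n" "1 \<le> n" "(pair_step e c c' ^^ n) (a, l) (T \<theta> b, l')"
proof -
  obtain N0 :: nat where N0: "\<bar>l' - l\<bar> / e < real N0" using reals_Archimedean2 by blast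
  define N where "N = max (max N0 L) 1"
  have N: "L \<le> N" "1 \<le> N" "N0 \<le> N" by (auto simp: N_def)
  have "\<bar>l' - l\<bar> < e * real N0" using N0 e by (simp add: pos_divide_less_eq mult.commute)
  also have "\<dots> \<le> e * real N" using N(3) e by (intro mult_left_mono) auto
  finally have small: "\<bar>l' - l\<bar> / real N < e" using N(2) by (simp add: pos_divide_less_eq)
  define f where "f i = (T (real i) a, l + real i / real N * (l' - l))" for i
  have between: "c \<le> l + s * (l' - l) \<and> l + s * (l' - l) \<le> c'" if s: "0 \<le> s" "s \<le> 1" for s
  proof -
    have eq: "l + s * (l' - l) = (1 - s) * l + s * l'" by (simp add: algebra_simps)
    have "(1 - s) * c + s * c \<le> (1 - s) * l + s * l'" using s l by (intro add_mono mult_left_mono) auto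
    moreover have "(1 - s) * l + s * l' \<le> (1 - s) * c' + s * c'" using s l by (intro add_mono mult_left_mono) auto
    ultimately show ?thesis unfolding eq by (simp add: algebra_simps)
  qed
  have "(pair_step e c c' ^^ N) (f 0) (f N)"
    unfolding relpowp_fun_conv
  proof (intro exI[of _ f] conjI refl allI impI)
    fix i assume i: "i < N"
    have "T 1 (T (real i) a) = T (real (Suc i)) a" unfolding T_T by simp
    then have "unit_step e (fst (f i)) (fst (f (Suc i)))" using T_U[OF a] e by (simp add: f_def unit_step_def d_zero)
    moreover have "snd (f i) - snd (f (Suc i)) = - ((l' - l) / real N)" using N(2) by (simp add: f_def field_simps)
    then have "\<bar>snd (f i) - snd (f (Suc i))\<bar> < e" using small by simp
    ultimately show "pair_step e c c' (f i) (f (Suc i))"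
      using between[of "real i / real N"] between[of "real (Suc i) / real N"] i
      by (simp add: pair_step_def f_def)
  qed
  moreover have "f 0 = (a, l)" "f N = (T (real N) a, l')" using N(2) by (simp_all add: f_def)
  ultimately have 1: "(pair_step e c c' ^^ N) (a, l) (T (real N) a, l')" by simp
  obtain \<theta> where \<theta>: "0 \<le> \<theta>" "\<theta> < 1" "(unit_step e)\<^sup>+\<^sup>+ (T (real N) a) (T \<theta> b)"
    using unit_transitive[OF T_U[OF a] b e] by metis
  obtain k where k: "(unit_step e ^^ k) (T (real N) a) (T \<theta> b)" using \<theta>(3) by (auto simp: tranclp_power)
  have 2: "(pair_step e c c' ^^ k) (T (real N) a, l') (T \<theta> b, l')"
  proof -
    obtain g where g: "g 0 = T (real N) a" "g k = T \<theta> b" "\<And>i. i < k \<Longrightarrow> unit_step e (g i) (g (Suc i))"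
      using k unfolding relpowp_fun_conv by blast
    show ?thesis unfolding relpowp_fun_conv
      by (rule exI[of _ "\<lambda>i. (g i, l')"]) (use g e l in \<open>auto simp: pair_step_def\<close>)
  qed
  have "(pair_step e c c' ^^ (N + k)) (a, l) (T \<theta> b, l')"
    unfolding relpowp_add using 1 2 by blast
  then show ?thesis using that[OF \<theta>(1,2), of "N + k"] N by simp
qed

text \<open>Density is not enough: every v must be approached along increasing indices, so that it
  shows up in the tail of the pseudo-orbit.\<close>

lemma U_dense_sequence:
  obtains z where "\<And>n. z n \<in> U" "\<And>v. v \<in> U \<Longrightarrow> \<exists>r. strict_mono (r :: nat \<Rightarrow> nat) \<and> (\<lambda>n. d (z (r n)) v) \<longlonglongrightarrow> 0"
proof -
  interpret M: Metric_space U d by (rule d_metric)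
  have "compactin M.mtopology U" unfolding d_topology compactin_subtopology using U_compact by simp
  then have "M.mtotally_bounded U" by (rule M.compactin_imp_mtotally_bounded)
  from this have fin: "\<exists>K. finite K \<and> K \<subseteq> U \<and> U \<subseteq> (\<Union>x\<in>K. M.mball x (1 / real (Suc n)))" for n
  proof -
    have "0 < 1 / real (Suc n)" by simp
    with \<open>M.mtotally_bounded U\<close> show ?thesis unfolding M.mtotally_bounded_def by blast
  qed
  define K where "K n = (SOME K. finite K \<and> K \<subseteq> U \<and> U \<subseteq> (\<Union>x\<in>K. M.mball x (1 / real (Suc n))))" for n
  have K: "finite (K n)" "K n \<subseteq> U" "U \<subseteq> (\<Union>x\<in>K n. M.mball x (1 / real (Suc n)))" for n
    using someI_ex[OF fin[of n]] unfolding K_def by blast+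
  have Kne: "K n \<noteq> {}" for n using K(3)[of n] U_nonempty by auto
  define W where "W = (\<Union>n. K n \<times> {n})"
  have "countable W" unfolding W_def by (intro countable_UN countableI_type countable_finite finite_cartesian_product K(1)) simp
  moreover have "W \<noteq> {}" using Kne[of 0] by (auto simp: W_def)
  ultimately have g: "range (from_nat_into W) = W" by (rule range_from_nat_into[rotated])
  define g where "g = from_nat_into W"
  note g = g[folded g_def]
  define z where "z n = fst (g n)" for n
  have zU: "z n \<in> U" for n
  proof -
    have "g n \<in> W" using g by auto
    then show ?thesis using K(2)[THEN subsetD] by (auto simp: W_def z_def)
  qed
  have "\<exists>r. strict_mono (r :: nat \<Rightarrow> nat) \<and> (\<lambda>n. d (z (r n)) v) \<longlonglongrightarrow> 0" if v: "v \<in> U" for v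
  proof -
    have "\<exists>i>m. d (z i) v < 1 / real (Suc n)" for m n
    proof -
      \<comment> \<open>The level M1 is above all levels among the entries up to m, so an entry of
        this level has an index greater than m.\<close>
      define M1 where "M1 = Max (insert n ((\<lambda>i. snd (g i)) ` {..m})) + 1"
      obtain x where x: "x \<in> K M1" "v \<in> M.mball x (1 / real (Suc M1))" using K(3)[of M1] v by blast
      have "(x, M1) \<in> range g" using x(1) g by (auto simp: W_def)
      then obtain i where i: "g i = (x, M1)" by (metis rangeE)
      have "m < i"
      proof (rule ccontr)
        assume "\<not> m < i"
        then have "snd (g i) \<le> Max (insert n ((\<lambda>i. snd (g i)) ` {..m}))" by (intro Max_ge) auto
        then show False using i by (simp add: M1_def)
      qed
      have "n \<le> Max (insert n ((\<lambda>i. snd (g i)) ` {..m}))" by (intro Max_ge) auto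
      then have nM: "n \<le> M1" by (simp add: M1_def)
      have "d (z i) v < 1 / real (Suc M1)" using x(2) i by (simp add: z_def M.mball_def)
      also have "\<dots> \<le> 1 / real (Suc n)" using nM by (simp add: frac_le)
      finally show ?thesis using \<open>m < i\<close> by blast
    qed
    then obtain F where F: "\<And>m n. m < F m n" "\<And>m n. d (z (F m n)) v < 1 / real (Suc n)" by metis
    define r where "r = rec_nat (F 0 0) (\<lambda>n q. F q (Suc n))"
    have r: "r 0 = F 0 0" "r (Suc n) = F (r n) (Suc n)" for n by (simp_all add: r_def)
    have "strict_mono r" unfolding strict_mono_Suc_iff by (simp add: r F)
    moreover have "d (z (r n)) v < 1 / real (Suc n)" for n
    proof (cases n)
      case 0
      show ?thesis unfolding 0 r(1) by (rule F(2))
    next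
      case (Suc m)
      show ?thesis unfolding Suc r(2) by (rule F(2))
    qed
    then have "(\<lambda>n. d (z (r n)) v) \<longlonglongrightarrow> 0"
      by (intro Lim_null_comparison[OF always_eventually LIMSEQ_inverse_real_of_nat])
         (use d_nonneg in \<open>auto simp: inverse_eq_divide less_imp_le\<close>)
    ultimately show ?thesis by blast
  qed
  with zU show ?thesis using that by blast
qed

text \<open>In stage n the radius moves from 1/(n+2) to 1/(n+3), starting with 1/2.
  \<open>L n\<close> prescribes a least length for stage n and thereby delays the start of stage n +
  1.\<close>

lemma pseudo_orbit:
  fixes \<eta> :: "nat \<Rightarrow> real" and L :: "nat \<Rightarrow> nat"
  assumes \<eta>: "\<And>n. 0 < \<eta> n"
  obtains y \<mu> S \<theta> z where "\<And>k. y k \<in> U" "\<And>k. 0 < \<mu> k" "\<And>k. \<mu> k \<le> 1/2" "\<mu> \<longlonglongrightarrow> 0"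
    "strict_mono S" "S 0 = (0::nat)" "\<And>n. L n \<le> S (Suc n)"
    "\<And>n k. S n \<le> k \<Longrightarrow> k < S (Suc n) \<Longrightarrow> pair_step (\<eta> n) (1 / real (n + 3)) (1 / real (n + 2)) (y k, \<mu> k) (y (Suc k), \<mu> (Suc k))"
    "\<And>n. y (S n) = T (\<theta> n) (z n)" "\<And>n. 0 \<le> \<theta> n" "\<And>n. \<theta> n \<le> 1" "\<And>n. z n \<in> U"
    "\<And>v. v \<in> U \<Longrightarrow> \<exists>r. strict_mono (r :: nat \<Rightarrow> nat) \<and> (\<lambda>n. d (z (r n)) v) \<longlonglongrightarrow> 0"
proof -
  obtain z where z: "\<And>n. z n \<in> U" "\<And>v. v \<in> U \<Longrightarrow> \<exists>r. strict_mono (r :: nat \<Rightarrow> nat) \<and> (\<lambda>n. d (z (r n)) v) \<longlonglongrightarrow> 0"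
    using U_dense_sequence by blast
  define X where "X \<theta> n = (T \<theta> (z n), 1 / real (n + 2))" for \<theta> n
  have "\<exists>\<theta>'. 0 \<le> \<theta>' \<and> \<theta>' \<le> 1 \<and> (\<exists>N. L n \<le> N \<and> 1 \<le> N \<and> (pair_step (\<eta> n) (1 / real (n + 3)) (1 / real (n + 2)) ^^ N) (X \<theta> n) (X \<theta>' (Suc n)))" for \<theta> n
  proof -
    have q: "1 / real (n + 3) \<le> 1 / real (n + 2)" "1 / real (n + 2) \<le> 1 / real (n + 2)"
      "1 / real (n + 3) \<le> 1 / real (Suc n + 2)" "1 / real (Suc n + 2) \<le> 1 / real (n + 2)"
      by (auto simp: frac_le)
    obtain \<theta>' N where "0 \<le> \<theta>'" "\<theta>' < 1" "L n \<le> N" "1 \<le> N" "(pair_step (\<eta> n) (1 / real (n + 3)) (1 / real (n + 2)) ^^ N) (T \<theta> (z n), 1 / real (n + 2)) (T \<theta>' (z (Suc n)), 1 / real (Suc n + 2))"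
      by (rule pair_transitive[OF T_U[OF z(1), of \<theta> n] z(1)[of "Suc n"] \<eta> q])
    then show ?thesis unfolding X_def by (intro exI[of _ \<theta>'] conjI exI[of _ N]) auto
  qed
  note ex = this
  \<comment> \<open>The phase in which a stage ends is the one in which the next stage starts, so
    the phases are chosen recursively.\<close>
  define \<Theta> where "\<Theta> \<theta> n = (SOME \<theta>'. 0 \<le> \<theta>' \<and> \<theta>' \<le> 1 \<and> (\<exists>N. L n \<le> N \<and> 1 \<le> N \<and>
     (pair_step (\<eta> n) (1 / real (n + 3)) (1 / real (n + 2)) ^^ N) (X \<theta> n) (X \<theta>' (Suc n))))" for \<theta> n
  have \<Theta>: "0 \<le> \<Theta> \<theta> n \<and> \<Theta> \<theta> n \<le> 1 \<and> (\<exists>N. L n \<le> N \<and> 1 \<le> N \<and>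
     (pair_step (\<eta> n) (1 / real (n + 3)) (1 / real (n + 2)) ^^ N) (X \<theta> n) (X (\<Theta> \<theta> n) (Suc n)))" for \<theta> n
    unfolding \<Theta>_def by (rule someI_ex[OF ex])
  define \<theta> where "\<theta> = rec_nat (0::real) (\<lambda>n q. \<Theta> q n)"
  have \<theta>: "\<theta> 0 = 0" "\<theta> (Suc n) = \<Theta> (\<theta> n) n" for n by (simp_all add: \<theta>_def)
  have \<theta>b: "0 \<le> \<theta> n" "\<theta> n \<le> 1" for n using \<Theta> by (cases n; simp add: \<theta>)+
  have "\<exists>N. \<forall>n. L n \<le> N n \<and> 1 \<le> N n \<and>
     (pair_step (\<eta> n) (1 / real (n + 3)) (1 / real (n + 2)) ^^ N n) (X (\<theta> n) n) (X (\<theta> (Suc n)) (Suc n))"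
    using \<Theta> unfolding \<theta>(2) by (intro choice) blast
  then obtain N where N: "\<And>n. L n \<le> N n" "\<And>n. 1 \<le> N n" "\<And>n. (pair_step (\<eta> n) (1 / real (n + 3)) (1 / real (n + 2)) ^^ N n) (X (\<theta> n) n) (X (\<theta> (Suc n)) (Suc n))"
    by blast
  obtain Y S where Y: "strict_mono S" "S 0 = 0" "\<And>n. S (Suc n) = S n + N n" "\<And>n. Y (S n) = X (\<theta> n) n"
    "\<And>n k. S n \<le> k \<Longrightarrow> k < S (Suc n) \<Longrightarrow> pair_step (\<eta> n) (1 / real (n + 3)) (1 / real (n + 2)) (Y k) (Y (Suc k))"
    by (rule concatenate_stages[where R = "\<lambda>n. pair_step (\<eta> n) (1 / real (n + 3)) (1 / real (n + 2))" and N = N and X = "\<lambda>n. X (\<theta> n) n", OF N(3,2)]) blast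
  have stage: "\<exists>n. S n \<le> k \<and> k < S (Suc n) \<and> m \<le> n" if "S m \<le> k" for k m
    using strict_mono_stage[OF Y(1) that] by blast
  define y where "y k = fst (Y k)" for k
  define \<mu> where "\<mu> k = snd (Y k)" for k
  have st: "pair_step (\<eta> n) (1 / real (n + 3)) (1 / real (n + 2)) (y k, \<mu> k) (y (Suc k), \<mu> (Suc k))" if "S n \<le> k" "k < S (Suc n)" for n k
    using Y(5)[OF that] by (simp add: y_def \<mu>_def)
  have gen: "y k \<in> U \<and> 0 < \<mu> k \<and> \<mu> k \<le> 1/2" for k
  proof -
    obtain n where "S n \<le> k" "k < S (Suc n)" using stage[of 0 k] Y(2) by auto
    from st[OF this] have 1: "y k \<in> U" "1 / real (n + 3) \<le> \<mu> k" "\<mu> k \<le> 1 / real (n + 2)"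
      unfolding pair_step_def unit_step_def by auto
    have "0 < 1 / real (n + 3)" "1 / real (n + 2) \<le> 1/2" by (simp_all add: frac_le)
    then show ?thesis using 1 by linarith
  qed
  have lim: "\<mu> \<longlonglongrightarrow> 0"
  proof (rule LIMSEQ_I)
    fix e :: real assume "0 < e"
    then obtain m where m: "1 / real (Suc m) < e" using reals_Archimedean[of e] by (auto simp: inverse_eq_divide)
    have "norm (\<mu> k - 0) < e" if "S m \<le> k" for k
    proof -
      obtain n where n: "S n \<le> k" "k < S (Suc n)" "m \<le> n" using stage[OF \<open>S m \<le> k\<close>] by blast
      from st[OF n(1,2)] have "\<mu> k \<le> 1 / real (n + 2)" unfolding pair_step_def by auto
      also have "\<dots> \<le> 1 / real (Suc m)" using n(3) by (simp add: frac_le)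
      finally show ?thesis using m gen[of k] by simp
    qed
    then show "\<exists>no. \<forall>n\<ge>no. norm (\<mu> n - 0) < e" by blast
  qed
  have yS: "y (S n) = T (\<theta> n) (z n)" for n using Y(4) by (simp add: y_def X_def)
  have LS: "L n \<le> S (Suc n)" for n using N(1)[of n] Y(3)[of n] by simp
  show ?thesis
    by (rule that[of y \<mu> S \<theta> z]) (use gen lim Y(1,2) LS st yS \<theta>b z in blast)+
qed

end

section \<open>Gluing errors on the shell\<close>

definition shell :: "'a::real_normed_vector set" where "shell = {x. 1 \<le> norm x \<and> norm x \<le> exp 1}"

lemma compact_shell: "compact (shell :: 'a::euclidean_space set)"
proof -
  have "shell = (cball 0 (exp 1) \<inter> {x::'a. 1 \<le> norm x})" by (auto simp: shell_def)
  moreover have "closed {x::'a. 1 \<le> norm x}" by (intro closed_Collect_le continuous_intros)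
  ultimately show ?thesis by (metis compact_Int_closed compact_cball)
qed

lemma shell_nonempty: "shell \<noteq> ({} :: 'a::euclidean_space set)"
proof -
  obtain b :: 'a where "b \<in> Basis" using nonempty_Basis by blast
  then have "b \<in> shell" by (simp add: shell_def)
  then show ?thesis by blast
qed

context limit_system
begin

text \<open>The part without a sign of the Laplacian, at \<xi>, of the cutoff times the smoothed
  w.\<close>

definition trans_int :: "(real^'m \<Rightarrow> ereal) \<Rightarrow> real \<Rightarrow> real^'m \<Rightarrow> real" where
  "trans_int w \<mu> \<xi> = (LINT z|lborel. real_of_ereal (w z) * trans_ker \<mu> \<xi> z)"

text \<open>The bound c confines the radii to a compact interval away from 0, where the transition
  kernel is jointly continuous with bounded support in z.\<close>

lemma trans_int_limit:
  assumes w: "\<And>n. w n \<in> U" "v \<in> U" "conv w v" and c: "0 < c"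
    and \<mu>: "\<And>n. \<mu> n \<in> {c..1/2}" "\<mu> \<longlonglongrightarrow> \<mu>'" and \<xi>: "\<And>n. \<xi> n \<in> shell" "\<xi> \<longlonglongrightarrow> \<xi>'"
  shows "(\<lambda>n. trans_int (w n) (\<mu> n) (\<xi> n)) \<longlonglongrightarrow> trans_int v \<mu>' \<xi>'"
proof -
  let ?K = "{c..1/2} \<times> (shell :: (real^'m) set)"
  define F where "F k z = trans_ker (fst k) (snd k) z" for k :: "real \<times> (real^'m)" and z :: "real^'m"
  define S :: real where "S = 2 * exp 1"
  have S: "0 < S" by (simp add: S_def)
  have K: "compact ?K" by (intro compact_Times compact_shell compact_Icc)
  have Kp: "0 < fst k \<and> fst k \<le> 1/2" if "k \<in> ?K" for k using that c by (auto simp: mem_Times_iff)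
  have cF: "continuous_on (?K \<times> UNIV) (\<lambda>p. F (fst p) (snd p))"
    unfolding F_def by (rule continuous_on_trans_ker) (use Kp in blast)
  have F0: "F k z = 0" if "k \<in> ?K" "z \<notin> cball 0 S" for k z
  proof -
    have "norm (snd k) \<le> exp 1" using that(1) by (auto simp: shell_def mem_Times_iff)
    then have "2 * norm (snd k) < norm z" using that(2) by (simp add: S_def)
    then show ?thesis unfolding F_def using Kp[OF that(1)] by (intro trans_ker_eq_0(3)) auto
  qed
  have kK: "(\<mu> n, \<xi> n) \<in> ?K" for n using \<mu>(1) \<xi>(1) by blast
  have lim: "(\<lambda>n. (\<mu> n, \<xi> n)) \<longlonglongrightarrow> (\<mu>', \<xi>')" by (intro tendsto_Pair \<mu> \<xi>)
  have k'K: "(\<mu>', \<xi>') \<in> ?K" by (rule closed_sequentially[OF compact_imp_closed[OF K] kK lim])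
  have cFk: "continuous_on UNIV (F k)" if "k \<in> ?K" for k
    by (rule continuous_on_compose2[OF cF, of UNIV "\<lambda>z. (k, z)", simplified]) (use that in \<open>auto intro!: continuous_intros\<close>)
  have mF: "F k \<in> borel_measurable borel" if "k \<in> ?K" for k
    by (rule borel_measurable_continuous_onI[OF cFk[OF that]])
  have "(\<lambda>n. LINT z|lborel. real_of_ereal (w n z) * F (\<mu> n, \<xi> n) z) \<longlonglongrightarrow> (LINT z|lborel. real_of_ereal (v z) * F (\<mu>', \<xi>') z)"
  proof (rule U_pairing_limit[OF w mF[OF kK] F0[OF kK] cFk[OF k'K] F0[OF k'K] S])
    fix e :: real assume e: "0 < e"
    show "\<forall>\<^sub>F n in sequentially. \<forall>z. \<bar>F (\<mu> n, \<xi> n) z - F (\<mu>', \<xi>') z\<bar> \<le> e"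
      by (rule uniform_limit_compact_param[OF K, of F, OF cF F0 kK lim e])
  qed
  then show ?thesis by (simp add: F_def trans_int_def)
qed

lemma trans_int_bounded:
  assumes "w \<in> U" "0 < \<mu>" "\<mu> \<le> 1/2"
  shows "\<exists>B. \<forall>\<xi>\<in>shell. \<bar>trans_int w \<mu> \<xi>\<bar> \<le> B"
proof -
  have "continuous_on shell (trans_int w \<mu>)"
    unfolding continuous_on_sequentially
  proof (intro allI ballI impI, elim conjE)
    fix x :: "nat \<Rightarrow> real^'m" and a assume x: "\<forall>n. x n \<in> shell" "x \<longlonglongrightarrow> a"
    show "(trans_int w \<mu> \<circ> x) \<longlonglongrightarrow> trans_int w \<mu> a"
      unfolding o_def
      by (rule trans_int_limit[of "\<lambda>n. w" w \<mu> "\<lambda>n. \<mu>" \<mu> x a]) (use assms x in \<open>auto simp: conv_def\<close>)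
  qed
  then have "bounded (trans_int w \<mu> ` shell)" by (intro compact_imp_bounded compact_continuous_image compact_shell)
  then show ?thesis unfolding bounded_iff by auto
qed

text \<open>Along a sequence of counterexamples both transition integrals would tend to that of
  \<open>T 1 v\<close> for some v. The tolerance depends on c and e alone. The factor r stands for
  the ratio of the weights of consecutive patches, divided by its expected value.\<close>

lemma transition_error_small:
  assumes c: "0 < c" and e: "0 < e"
  shows "\<exists>\<eta>>0. \<forall>a\<in>U. \<forall>b\<in>U. \<forall>l\<in>{c..1/2}. \<forall>l'\<in>{c..1/2}. \<forall>r. \<forall>\<xi>\<in>shell.
    d (T 1 a) b < \<eta> \<longrightarrow> \<bar>l - l'\<bar> < \<eta> \<longrightarrow> \<bar>r - 1\<bar> < \<eta> \<longrightarrow> \<bar>trans_int b l' \<xi> - r * trans_int (T 1 a) l \<xi>\<bar> < e"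
proof (rule ccontr)
  assume neg: "\<not> ?thesis"
  define bad where "bad \<eta> a b l l' r \<xi> \<longleftrightarrow> a \<in> U \<and> b \<in> U \<and> l \<in> {c..1/2} \<and> l' \<in> {c..1/2} \<and> \<xi> \<in> shell \<and>
    d (T 1 a) b < \<eta> \<and> \<bar>l - l'\<bar> < \<eta> \<and> \<bar>r - 1\<bar> < \<eta> \<and> \<not> \<bar>trans_int b l' \<xi> - r * trans_int (T 1 a) l \<xi>\<bar> < e"
    for \<eta> a b l l' r \<xi>
  have "\<exists>a b l l' r \<xi>. bad (1 / real (Suc n)) a b l l' r \<xi>" for n
  proof -
    have "0 < 1 / real (Suc n)" by simp
    with neg show ?thesis unfolding bad_def by blast
  qed
  then obtain a b l l' r \<xi> where bad: "\<And>n. bad (1 / real (Suc n)) (a n) (b n) (l n) (l' n) (r n) (\<xi> n)" by metis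
  have abl: "a n \<in> U" "b n \<in> U" "l n \<in> {c..1/2}" "l' n \<in> {c..1/2}" "\<xi> n \<in> shell"
    "d (T 1 (a n)) (b n) < 1 / real (Suc n)" "\<bar>l n - l' n\<bar> < 1 / real (Suc n)" "\<bar>r n - 1\<bar> < 1 / real (Suc n)"
    "\<not> \<bar>trans_int (b n) (l' n) (\<xi> n) - r n * trans_int (T 1 (a n)) (l n) (\<xi> n)\<bar> < e" for n
    using bad[of n] unfolding bad_def by blast+
  have null: "f \<longlonglongrightarrow> 0" if "\<And>n. \<bar>f n\<bar> < 1 / real (Suc n)" for f
    by (rule Lim_null_comparison[OF always_eventually LIMSEQ_inverse_real_of_nat])
       (use that in \<open>auto simp: inverse_eq_divide less_imp_le\<close>)
  let ?K = "{c..1/2} \<times> (shell :: (real^'m) set)"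
  have K: "compact ?K" by (intro compact_Times compact_shell compact_Icc)
  have kK: "(l n, \<xi> n) \<in> ?K" for n using abl(3,5) by blast
  obtain v k s where s: "v \<in> U" "k \<in> ?K" "strict_mono (s :: nat \<Rightarrow> nat)" "conv (\<lambda>n. a (s n)) v" "(\<lambda>n. (l (s n), \<xi> (s n))) \<longlonglongrightarrow> k"
    by (rule U_seq_compact_param[of a ?K "\<lambda>n. (l n, \<xi> n)", OF abl(1) K kK])
  have l: "(\<lambda>n. l (s n)) \<longlonglongrightarrow> fst k" and x: "(\<lambda>n. \<xi> (s n)) \<longlonglongrightarrow> snd k"
    using tendsto_fst[OF s(5)] tendsto_snd[OF s(5)] by simp_all
  have sub: "(\<lambda>n. f (s n)) \<longlonglongrightarrow> 0" if "f \<longlonglongrightarrow> 0" for f :: "nat \<Rightarrow> real"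
    using LIMSEQ_subseq_LIMSEQ[OF that s(3)] by (simp add: o_def)
  have "(\<lambda>n. l n - l' n) \<longlonglongrightarrow> 0" "(\<lambda>n. r n - 1) \<longlonglongrightarrow> 0" "(\<lambda>n. d (T 1 (a n)) (b n)) \<longlonglongrightarrow> 0"
    by (rule null, use abl d_nonneg in simp)+
  note nl = this[THEN sub]
  have l': "(\<lambda>n. l' (s n)) \<longlonglongrightarrow> fst k" using tendsto_diff[OF l nl(1)] by simp
  have r1: "(\<lambda>n. r (s n)) \<longlonglongrightarrow> 1" using tendsto_add[OF nl(2) tendsto_const[of 1]] by simp
  have ca: "conv (\<lambda>n. T 1 (a (s n))) (T 1 v)" by (rule T_conv[OF abl(1) s(1,4) tendsto_const])
  have cb: "conv (\<lambda>n. b (s n)) (T 1 v)" by (rule d_conv_other[OF T_U[OF abl(1)] abl(2) T_U[OF s(1)] ca nl(3)])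
  have "(\<lambda>n. trans_int (b (s n)) (l' (s n)) (\<xi> (s n)) - r (s n) * trans_int (T 1 (a (s n))) (l (s n)) (\<xi> (s n)))
     \<longlonglongrightarrow> trans_int (T 1 v) (fst k) (snd k) - 1 * trans_int (T 1 v) (fst k) (snd k)"
    by (intro tendsto_diff tendsto_mult r1 trans_int_limit[OF abl(2) T_U[OF s(1)] cb c abl(4) l' abl(5) x]
        trans_int_limit[OF T_U[OF abl(1)] T_U[OF s(1)] ca c abl(3) l abl(5) x])
  then have "(\<lambda>n. \<bar>trans_int (b (s n)) (l' (s n)) (\<xi> (s n)) - r (s n) * trans_int (T 1 (a (s n))) (l (s n)) (\<xi> (s n))\<bar>) \<longlonglongrightarrow> 0"
    by (intro tendsto_rabs_zero) simp
  from order_tendstoD(2)[OF this e] abl(9) show False by (auto simp: eventually_sequentially)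
qed

text \<open>The radii of a stage determine its tolerance, the tolerance determines from which index
  on the ratios of A are accurate enough, and these indices determine the lengths of the preceding
  stages. The pseudo-orbit itself has to be chosen last.\<close>

lemma pseudo_orbit_errors:
  fixes A :: "nat \<Rightarrow> real"
  assumes A: "\<And>k. 0 < A k" "(\<lambda>k. A k * exp \<rho> / A (Suc k)) \<longlonglongrightarrow> 1"
  shows "\<exists>y \<mu> \<epsilon>. (\<forall>k. y k \<in> U) \<and> (\<forall>k. 0 < \<mu> k \<and> \<mu> k \<le> 1/2) \<and> \<mu> \<longlonglongrightarrow> 0 \<and>
    (\<lambda>k. d (T 1 (y k)) (y (Suc k))) \<longlonglongrightarrow> 0 \<and> (\<forall>k. 0 \<le> \<epsilon> k) \<and> \<epsilon> \<longlonglongrightarrow> 0 \<and>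
    (\<forall>\<xi>\<in>shell. - \<epsilon> 0 * A 0 \<le> A 0 * trans_int (y 0) (\<mu> 0) \<xi>) \<and>
    (\<forall>k. \<forall>\<xi>\<in>shell. - \<epsilon> (Suc k) * A (Suc k) \<le>
        A (Suc k) * trans_int (y (Suc k)) (\<mu> (Suc k)) \<xi> - A k * exp \<rho> * trans_int (T 1 (y k)) (\<mu> k) \<xi>) \<and>
    (\<forall>v\<in>U. \<exists>k \<theta>. filterlim k at_top sequentially \<and> conv (\<lambda>n. y (k n)) (T \<theta> v))"
proof -
  define r where "r k = A k * exp \<rho> / A (Suc k)" for k
  define good where "good n \<eta> \<longleftrightarrow> 0 < \<eta> \<and> (\<forall>a\<in>U. \<forall>b\<in>U. \<forall>l\<in>{1 / real (n + 3)..1/2}. \<forall>l'\<in>{1 / real (n + 3)..1/2}. \<forall>r. \<forall>\<xi>\<in>shell.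
    d (T 1 a) b < \<eta> \<longrightarrow> \<bar>l - l'\<bar> < \<eta> \<longrightarrow> \<bar>r - 1\<bar> < \<eta> \<longrightarrow> \<bar>trans_int b l' \<xi> - r * trans_int (T 1 a) l \<xi>\<bar> < 1 / real (Suc n))" for n \<eta>
  have "\<exists>\<eta>. good n \<eta>" for n
    using transition_error_small[of "1 / real (n + 3)" "1 / real (Suc n)"] unfolding good_def by simp
  then obtain \<eta>0 where \<eta>0: "\<And>n. good n (\<eta>0 n)" by metis
  define \<eta> where "\<eta> n = min (\<eta>0 n) (1 / real (Suc n))" for n
  have \<eta>: "0 < \<eta> n" "\<eta> n \<le> \<eta>0 n" "\<eta> n \<le> 1 / real (Suc n)" for n using \<eta>0[of n] by (simp_all add: \<eta>_def good_def)
  have "\<exists>L. \<forall>k\<ge>L. \<bar>r k - 1\<bar> < \<eta> (Suc n)" for n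
  proof -
    have "(\<lambda>k. \<bar>r k - 1\<bar>) \<longlonglongrightarrow> 0"
      using tendsto_rabs[OF tendsto_diff[OF A(2) tendsto_const[of 1]]] by (simp add: r_def)
    from order_tendstoD(2)[OF this \<eta>(1)[of "Suc n"]] show ?thesis by (simp add: eventually_sequentially)
  qed
  \<comment> \<open>\<open>L n\<close> bounds the start of stage n + 1 from below, hence the shift
    of the index. During stage 0 the ratios are not controlled and the errors are merely
    finite.\<close>
  then obtain L where L: "\<And>n k. L n \<le> k \<Longrightarrow> \<bar>r k - 1\<bar> < \<eta> (Suc n)" by metis
  obtain y \<mu> S \<theta> z where y: "\<And>k. y k \<in> U" and \<mu>: "\<And>k. 0 < \<mu> k" "\<And>k. \<mu> k \<le> 1/2" "\<mu> \<longlonglongrightarrow> 0"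
    and S: "strict_mono S" "S 0 = (0::nat)" "\<And>n. L n \<le> S (Suc n)"
    and st: "\<And>n k. S n \<le> k \<Longrightarrow> k < S (Suc n) \<Longrightarrow> pair_step (\<eta> n) (1 / real (n + 3)) (1 / real (n + 2)) (y k, \<mu> k) (y (Suc k), \<mu> (Suc k))"
    and z: "\<And>n. y (S n) = T (\<theta> n) (z n)" "\<And>n. 0 \<le> \<theta> n" "\<And>n. \<theta> n \<le> 1" "\<And>n. z n \<in> U"
    "\<And>v. v \<in> U \<Longrightarrow> \<exists>r. strict_mono (r :: nat \<Rightarrow> nat) \<and> (\<lambda>n. d (z (r n)) v) \<longlonglongrightarrow> 0"
    by (rule pseudo_orbit[of \<eta> L, OF \<eta>(1)]) blast
  define E where "E k \<xi> = trans_int (y (Suc k)) (\<mu> (Suc k)) \<xi> - r k * trans_int (T 1 (y k)) (\<mu> k) \<xi>" for k \<xi>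
  have Esmall: "\<bar>E k \<xi>\<bar> < 1 / real (Suc m) \<and> d (T 1 (y k)) (y (Suc k)) < 1 / real (Suc m)" if k: "S (Suc m) \<le> k" and \<xi>: "\<xi> \<in> shell" for m k \<xi>
  proof -
    obtain n where n: "Suc m \<le> n" "S n \<le> k" "k < S (Suc n)" using strict_mono_stage[OF S(1) k] by blast
    have p: "d (T 1 (y k)) (y (Suc k)) < \<eta> n" "\<bar>\<mu> k - \<mu> (Suc k)\<bar> < \<eta> n" "1 / real (n + 3) \<le> \<mu> k" "1 / real (n + 3) \<le> \<mu> (Suc k)"
      using st[OF n(2,3)] by (auto simp: pair_step_def unit_step_def)
    obtain n' where n': "n = Suc n'" using n(1) by (cases n) auto
    have "L n' \<le> k" using S(3)[of n'] n(2) n' by simp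
    from L[OF this] have r1: "\<bar>r k - 1\<bar> < \<eta> n" by (simp add: n')
    have lm: "\<mu> k \<in> {1 / real (n + 3)..1/2}" "\<mu> (Suc k) \<in> {1 / real (n + 3)..1/2}" using p(3,4) \<mu>(2) by auto
    have "\<bar>E k \<xi>\<bar> < 1 / real (Suc n)"
    proof -
      have "d (T 1 (y k)) (y (Suc k)) < \<eta>0 n" "\<bar>\<mu> k - \<mu> (Suc k)\<bar> < \<eta>0 n" "\<bar>r k - 1\<bar> < \<eta>0 n"
        using p(1,2) r1 \<eta>(2)[of n] by linarith+
      then show ?thesis using \<eta>0[of n] y lm \<xi> unfolding good_def E_def by blast
    qed
    moreover have "1 / real (Suc n) \<le> 1 / real (Suc m)" using n(1) by (simp add: frac_le)
    ultimately show ?thesis using p(1) \<eta>(3)[of n] by linarith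
  qed
  have shell0: "\<exists>x::real^'m. x \<in> shell" using shell_nonempty by blast
  have "\<exists>B. \<forall>\<xi>\<in>shell. \<bar>E k \<xi>\<bar> \<le> B" for k
  proof -
    obtain B1 where B1: "\<And>\<xi>. \<xi> \<in> shell \<Longrightarrow> \<bar>trans_int (y (Suc k)) (\<mu> (Suc k)) \<xi>\<bar> \<le> B1"
      using trans_int_bounded[OF y \<mu>(1,2)] by blast
    obtain B2 where B2: "\<And>\<xi>. \<xi> \<in> shell \<Longrightarrow> \<bar>trans_int (T 1 (y k)) (\<mu> k) \<xi>\<bar> \<le> B2"
      using trans_int_bounded[OF T_U[OF y] \<mu>(1,2)] by blast
    have "\<bar>E k \<xi>\<bar> \<le> B1 + \<bar>r k\<bar> * B2" if "\<xi> \<in> shell" for \<xi>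
    proof -
      have "\<bar>E k \<xi>\<bar> \<le> \<bar>trans_int (y (Suc k)) (\<mu> (Suc k)) \<xi>\<bar> + \<bar>r k\<bar> * \<bar>trans_int (T 1 (y k)) (\<mu> k) \<xi>\<bar>"
        unfolding E_def by (metis abs_mult abs_triangle_ineq4)
      also have "\<dots> \<le> B1 + \<bar>r k\<bar> * B2" using B1[OF that] B2[OF that] by (intro add_mono mult_left_mono) auto
      finally show ?thesis .
    qed
    then show ?thesis by blast
  qed
  then obtain B where B: "\<And>k \<xi>. \<xi> \<in> shell \<Longrightarrow> \<bar>E k \<xi>\<bar> \<le> B k" by metis
  obtain B0 where B0: "\<And>\<xi>. \<xi> \<in> shell \<Longrightarrow> \<bar>trans_int (y 0) (\<mu> 0) \<xi>\<bar> \<le> B0"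
    using trans_int_bounded[OF y \<mu>(1,2)] by blast
  have bdd: "bdd_above ((\<lambda>\<xi>. \<bar>E k \<xi>\<bar>) ` shell)" for k using B by (intro bdd_aboveI2)
  \<comment> \<open>The first patch has no predecessor, so at index 0 the whole transition term
    counts as an error.\<close>
  define \<epsilon> where "\<epsilon> k = (case k of 0 \<Rightarrow> B0 | Suc k \<Rightarrow> (SUP \<xi>\<in>shell. \<bar>E k \<xi>\<bar>))" for k
  have up: "\<bar>E k \<xi>\<bar> \<le> \<epsilon> (Suc k)" if "\<xi> \<in> shell" for k \<xi>
    unfolding \<epsilon>_def using cSUP_upper[OF that bdd[of k]] by simp
  have \<epsilon>0: "0 \<le> \<epsilon> k" for k
  proof (cases k)
    case 0
    then show ?thesis using B0 shell0 by (auto simp: \<epsilon>_def intro: order_trans[OF abs_ge_zero])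
  next
    case (Suc j)
    then show ?thesis using up[of _ j] shell0 by (auto intro: order_trans[OF abs_ge_zero])
  qed
  have small: "\<epsilon> (Suc k) \<le> 1 / real (Suc m) \<and> d (T 1 (y k)) (y (Suc k)) \<le> 1 / real (Suc m)" if "S (Suc m) \<le> k" for m k
  proof -
    have "(SUP \<xi>\<in>shell. \<bar>E k \<xi>\<bar>) \<le> 1 / real (Suc m)"
      by (rule cSUP_least[OF shell_nonempty]) (use Esmall[OF that] in \<open>simp add: less_imp_le\<close>)
    then show ?thesis using Esmall[OF that] shell0 by (auto simp: \<epsilon>_def intro: less_imp_le)
  qed
  have null: "f \<longlonglongrightarrow> 0" if "\<And>k. 0 \<le> f k" "\<And>m k. S (Suc m) \<le> k \<Longrightarrow> f k \<le> 1 / real (Suc m)" for f :: "nat \<Rightarrow> real"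
  proof (rule LIMSEQ_I)
    fix e :: real assume "0 < e"
    then obtain m where m: "1 / real (Suc m) < e" using reals_Archimedean[of e] by (auto simp: inverse_eq_divide)
    have "norm (f k - 0) < e" if "S (Suc m) \<le> k" for k using \<open>\<And>k. 0 \<le> f k\<close>[of k] \<open>\<And>m k. S (Suc m) \<le> k \<Longrightarrow> f k \<le> 1 / real (Suc m)\<close>[OF that] m by simp
    then show "\<exists>no. \<forall>n\<ge>no. norm (f n - 0) < e" by blast
  qed
  have dlim: "(\<lambda>k. d (T 1 (y k)) (y (Suc k))) \<longlonglongrightarrow> 0" by (rule null) (use d_nonneg small in blast)+
  have "(\<lambda>k. \<epsilon> (Suc k)) \<longlonglongrightarrow> 0" by (rule null) (use \<epsilon>0 small in blast)+
  then have \<epsilon>lim: "\<epsilon> \<longlonglongrightarrow> 0" by (rule LIMSEQ_imp_Suc)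
  have e0: "- \<epsilon> 0 * A 0 \<le> A 0 * trans_int (y 0) (\<mu> 0) \<xi>" if "\<xi> \<in> shell" for \<xi>
  proof -
    have "- \<epsilon> 0 \<le> trans_int (y 0) (\<mu> 0) \<xi>" using B0[OF that] by (simp add: \<epsilon>_def)
    from mult_left_mono[OF this less_imp_le[OF A(1)[of 0]]] show ?thesis by (simp add: mult.commute)
  qed
  have eS: "- \<epsilon> (Suc k) * A (Suc k) \<le>
        A (Suc k) * trans_int (y (Suc k)) (\<mu> (Suc k)) \<xi> - A k * exp \<rho> * trans_int (T 1 (y k)) (\<mu> k) \<xi>" if "\<xi> \<in> shell" for k \<xi>
  proof -
    have "- \<epsilon> (Suc k) \<le> E k \<xi>" using up[OF that, of k] by simp
    from mult_left_mono[OF this less_imp_le[OF A(1)[of "Suc k"]]]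
    have "- \<epsilon> (Suc k) * A (Suc k) \<le> A (Suc k) * E k \<xi>" by (simp add: mult.commute)
    also have "A (Suc k) * E k \<xi> = A (Suc k) * trans_int (y (Suc k)) (\<mu> (Suc k)) \<xi> - A k * exp \<rho> * trans_int (T 1 (y k)) (\<mu> k) \<xi>"
      using A(1)[of "Suc k"] by (simp add: E_def r_def right_diff_distrib)
    finally show ?thesis .
  qed
  \<comment> \<open>Stages begin at points of the form \<open>T (\<theta> n) (z n)\<close>. The
    phases lie in [0, 1] and converge along a further subsequence, which yields a point on the orbit
    of v.\<close>
  have rec: "\<exists>k \<theta>. filterlim k at_top sequentially \<and> conv (\<lambda>n. y (k n)) (T \<theta> v)" if v: "v \<in> U" for v
  proof -
    obtain q where q: "strict_mono (q :: nat \<Rightarrow> nat)" "(\<lambda>n. d (z (q n)) v) \<longlonglongrightarrow> 0" using z(5)[OF v] by blast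
    have cz: "conv (\<lambda>n. z (q n)) v" using conv_iff_d[of "\<lambda>n. z (q n)" v] q(2) v z(4) by blast
    have \<theta>01: "\<theta> n \<in> {0..1}" for n using z(2,3) by simp
    obtain l s where s: "l \<in> {0..1}" "strict_mono (s :: nat \<Rightarrow> nat)" "((\<lambda>n. \<theta> (q n)) \<circ> s) \<longlonglongrightarrow> l"
      by (rule seq_compactE[OF compact_imp_seq_compact[OF compact_Icc[of 0 "1::real"]], of "\<lambda>n. \<theta> (q n)"]) (use \<theta>01 in auto)
    have "conv (\<lambda>n. T (\<theta> (q (s n))) (z (q (s n)))) (T l v)"
      by (rule T_conv[OF z(4) v conv_subseq[OF cz s(2)]]) (use s(3) in \<open>simp add: o_def\<close>)
    moreover have "filterlim (\<lambda>n. S (q (s n))) at_top sequentially"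
      using filterlim_subseq[OF strict_mono_o[OF S(1) strict_mono_o[OF q(1) s(2)]]] by (simp add: o_def)
    ultimately show ?thesis using z(1) by (intro exI[of _ "\<lambda>n. S (q (s n))"] exI[of _ l]) simp
  qed
  show ?thesis
    by (rule exI[of _ y], rule exI[of _ \<mu>], rule exI[of _ \<epsilon>])
       (intro conjI allI ballI y \<mu> dlim \<epsilon>0 \<epsilon>lim e0 eS rec; assumption)
qed

end

section \<open>Construction of the function\<close>

text \<open>The value at the origin is set explicitly: \<open>ln 0 = 0\<close> would give a positive
  value for \<open>a = - 1\<close>, the threshold of the summand with index 0. The third power makes
  the function C2 across |x| = e^a.\<close>

definition radial_cube :: "real \<Rightarrow> 'a::euclidean_space \<Rightarrow> real" where
  "radial_cube a x = (if x = 0 then 0 else (max 0 (ln (norm x) - a)) ^ 3)"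

definition radial_cube_lap :: "real \<Rightarrow> 'a::euclidean_space \<Rightarrow> real" where
  "radial_cube_lap a x = (if x = 0 then 0 else
     (6 * max 0 (ln (norm x) - a) + 3 * (real DIM('a) - 2) * (max 0 (ln (norm x) - a))\<^sup>2) / (norm x)\<^sup>2)"

lemma ln_norm_le: "x \<noteq> 0 \<Longrightarrow> norm x \<le> exp a \<Longrightarrow> ln (norm x) \<le> a"
  by (metis ln_exp ln_le_cancel_iff zero_less_norm_iff exp_gt_zero)

lemma radial_cube_eq_0:
  assumes "norm x \<le> exp a"
  shows "radial_cube a x = 0" "radial_cube_lap a x = 0"
  using ln_norm_le[of x a] assms by (auto simp: radial_cube_def radial_cube_lap_def max_def)

text \<open>Computed in t = |x|^2, where ln |x| = ln t / 2. The function vanishes on a ball about 0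
  and so extends across the origin.\<close>

lemma C2_on_radial_cube:
  obtains D where "C2_on UNIV (radial_cube a) D (radial_cube_lap a :: 'a::euclidean_space \<Rightarrow> real)"
proof -
  define M where "M t = max 0 (ln t / 2 - a)" for t
  define h where "h t = M t ^ 3" for t
  define h' where "h' t = 3 * (M t)\<^sup>2 * (1 / (2 * t))" for t
  define h'' where "h'' t = 6 * M t * (1 / (2 * t)) * (1 / (2 * t)) + 3 * (M t)\<^sup>2 * (- 1 / (2 * t\<^sup>2))" for t
  have lnd: "((\<lambda>t. ln t / 2 - a) has_real_derivative 1 / (2 * t)) (at t)" if "0 < t" for t
    using that by (auto intro!: derivative_eq_intros)
  have dh: "(h has_real_derivative h' t) (at t)" if "0 < t" for t
    using DERIV_chain2[OF max0_cube_derivatives(1) lnd[OF that]] unfolding h_def[abs_def] h'_def M_def .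
  have dM2: "((\<lambda>t. (M t)\<^sup>2) has_real_derivative 2 * M t * (1 / (2 * t))) (at t)" if "0 < t" for t
    using DERIV_chain2[OF max0_cube_derivatives(2) lnd[OF that]] unfolding M_def .
  have dinv: "((\<lambda>t. 1 / (2 * t)) has_real_derivative - 1 / (2 * t\<^sup>2)) (at t)" if "0 < t" for t :: real
    using that by (auto intro!: derivative_eq_intros simp: power2_eq_square field_simps)
  have dh': "(h' has_real_derivative h'' t) (at t)" if "0 < t" for t
  proof -
    have "((\<lambda>t. 3 * ((M t)\<^sup>2 * (1 / (2 * t)))) has_real_derivative 3 * (2 * M t * (1 / (2 * t)) * (1 / (2 * t)) + (- 1 / (2 * t\<^sup>2)) * (M t)\<^sup>2)) (at t)"
      by (rule DERIV_cmult[OF DERIV_mult[OF dM2[OF that] dinv[OF that]]])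
    then show ?thesis unfolding h'_def[abs_def] h''_def by (simp add: algebra_simps)
  qed
  have base: "C2_on (- {0}) (\<lambda>x::'a. (norm (x - 0))\<^sup>2) (\<lambda>x. 2 *\<^sub>R (x - 0)) (\<lambda>x. 2 * real DIM('a))"
    by (rule C2_on_dist_sq) (simp add: open_Compl)
  have ch: "continuous_on ((\<lambda>x::'a. (norm (x - 0))\<^sup>2) ` (- {0})) h''"
    unfolding h''_def[abs_def] M_def by (intro continuous_intros) auto
  have C: "C2_on (- {0}) (\<lambda>x::'a. h ((norm (x - 0))\<^sup>2)) (\<lambda>x. h' ((norm (x - 0))\<^sup>2) *\<^sub>R (2 *\<^sub>R (x - 0)))
     (\<lambda>x. h' ((norm (x - 0))\<^sup>2) * (2 * real DIM('a)) + h'' ((norm (x - 0))\<^sup>2) * ((2 *\<^sub>R (x - 0)) \<bullet> (2 *\<^sub>R (x - 0))))"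
    by (rule C2_on_compose[OF base dh dh' ch]) auto
  have C': "C2_on (- {0}) (radial_cube a) (\<lambda>x. h' ((norm (x - 0))\<^sup>2) *\<^sub>R (2 *\<^sub>R (x - 0))) (radial_cube_lap a :: 'a \<Rightarrow> real)"
  proof (rule C2_on_cong[OF C])
    fix x :: 'a assume "x \<in> - {0}"
    then have x: "x \<noteq> 0" "0 < norm x" by auto
    have Mx: "M ((norm x)\<^sup>2) = max 0 (ln (norm x) - a)" using x by (simp add: M_def ln_realpow)
    show "h ((norm (x - 0))\<^sup>2) = radial_cube a x" using x Mx by (simp add: h_def radial_cube_def)
    define n where "n = norm x"
    define q where "q = max 0 (ln (norm x) - a)"
    have n: "0 < n" using x by (simp add: n_def)
    have "3 * q\<^sup>2 * (1 / (2 * n\<^sup>2)) * (2 * real DIM('a)) + (6 * q * (1 / (2 * n\<^sup>2)) * (1 / (2 * n\<^sup>2)) + 3 * q\<^sup>2 * (- 1 / (2 * (n\<^sup>2)\<^sup>2))) * (4 * n\<^sup>2)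
       = (6 * q + 3 * (real DIM('a) - 2) * q\<^sup>2) / n\<^sup>2"
      using n by (simp add: field_simps power2_eq_square)
    then show "h' ((norm (x - 0))\<^sup>2) * (2 * real DIM('a)) + h'' ((norm (x - 0))\<^sup>2) * ((2 *\<^sub>R (x - 0)) \<bullet> (2 *\<^sub>R (x - 0))) = radial_cube_lap a x"
      using x Mx by (simp add: h'_def h''_def radial_cube_lap_def n_def q_def dot_square_norm)
  qed simp
  obtain D' where "C2_on (- {0} \<union> ball 0 (exp a)) (radial_cube a) D' (radial_cube_lap a :: 'a \<Rightarrow> real)"
    by (rule C2_on_extend_zero[OF C' open_ball[of 0 "exp a"]]) (auto intro: radial_cube_eq_0)
  moreover have "- {0} \<union> ball 0 (exp a) = (UNIV :: 'a set)" by auto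
  ultimately show ?thesis using that by simp
qed

section \<open>The glued function and its Laplacian\<close>

locale azarin_construction = limit_system \<rho> \<sigma> V U d
  for \<rho> \<sigma> :: real and V :: "real \<Rightarrow> real^'m^'m" and U :: "(real^'m \<Rightarrow> ereal) set"
    and d :: "(real^'m \<Rightarrow> ereal) \<Rightarrow> (real^'m \<Rightarrow> ereal) \<Rightarrow> real" +
  fixes p H :: "real \<Rightarrow> real" and y :: "nat \<Rightarrow> real^'m \<Rightarrow> ereal" and \<mu> \<epsilon> :: "nat \<Rightarrow> real"
  assumes H_eq: "\<And>s. H s = exp s powr p (exp s)"
    and H_pos: "\<And>s. 0 < H s" and H_top: "filterlim H at_top at_top"
    and H_mono: "\<forall>\<^sub>F s in at_top. \<forall>t\<ge>s. H s \<le> H t"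
    and H_slow: "\<And>e L. 0 < e \<Longrightarrow> \<forall>\<^sub>F s in at_top. \<forall>t. \<bar>t\<bar> \<le> L \<longrightarrow> \<bar>ln (H (s + t)) - ln (H s) - \<rho> * t\<bar> \<le> e * L"
    and y_U: "\<And>k. y k \<in> U" and \<mu>_pos: "\<And>k. 0 < \<mu> k" and \<mu>_half: "\<And>k. \<mu> k \<le> 1/2" and \<mu>_lim: "\<mu> \<longlonglongrightarrow> 0"
    and y_step: "(\<lambda>k. d (T 1 (y k)) (y (Suc k))) \<longlonglongrightarrow> 0"
    and \<epsilon>_nonneg: "\<And>k. 0 \<le> \<epsilon> k" and \<epsilon>_lim: "\<epsilon> \<longlonglongrightarrow> 0"
    and error_0: "\<And>\<xi>. \<xi> \<in> shell \<Longrightarrow> - \<epsilon> 0 * H (real 0) \<le> H (real 0) * trans_int (y 0) (\<mu> 0) \<xi>"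
    and error_Suc: "\<And>k \<xi>. \<xi> \<in> shell \<Longrightarrow> - \<epsilon> (Suc k) * H (real (Suc k)) \<le>
        H (real (Suc k)) * trans_int (y (Suc k)) (\<mu> (Suc k)) \<xi> - H (real k) * exp \<rho> * trans_int (T 1 (y k)) (\<mu> k) \<xi>"
begin

definition patch_int :: "nat \<Rightarrow> real^'m \<Rightarrow> real" where
  "patch_int j x = (LINT z|lborel. real_of_ereal (y j z) * cut_ker (\<mu> j) x z)"

definition patch_int_lap :: "nat \<Rightarrow> real^'m \<Rightarrow> real" where
  "patch_int_lap j x = (LINT z|lborel. real_of_ereal (y j z) * cut_ker_lap (\<mu> j) x z)"

text \<open>The annulus 1 \<le> |x| \<le> e^2 is moved to e^j \<le> |x| \<le> e^(j+2), so at most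
  two patches are nonzero at any point.\<close>

definition patch :: "nat \<Rightarrow> real^'m \<Rightarrow> real" where
  "patch j x = H (real j) * patch_int j (P (exp (- real j)) x)"

definition patch_lap :: "nat \<Rightarrow> real^'m \<Rightarrow> real" where
  "patch_lap j x = H (real j) * ((exp (- real j))\<^sup>2 * patch_int_lap j (P (exp (- real j)) x))"

text \<open>The radial summand compensates the negative part of the Laplacian in the shell where the
  \<open>j\<close>-th and the preceding patch are glued.\<close>

definition corr_coeff :: "nat \<Rightarrow> real" where "corr_coeff j = exp 2 * (\<epsilon> j * H (real j))"

definition summand :: "nat \<Rightarrow> real^'m \<Rightarrow> real" where
  "summand j x = patch j x + corr_coeff j * radial_cube (real j - 1) x"

definition summand_lap :: "nat \<Rightarrow> real^'m \<Rightarrow> real" where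
  "summand_lap j x = patch_lap j x + corr_coeff j * radial_cube_lap (real j - 1) x"

text \<open>An infinite sum written as a finite one: since j \<le> e^(j-1), the summand j vanishes
  for |x| \<le> j.\<close>

definition glued :: "real^'m \<Rightarrow> real" where "glued x = (\<Sum>j<nat \<lceil>norm x\<rceil>. summand j x)"

definition glued_lap :: "real^'m \<Rightarrow> real" where "glued_lap x = (\<Sum>j<nat \<lceil>norm x\<rceil>. summand_lap j x)"

lemma corr_coeff_nonneg: "0 \<le> corr_coeff j"
  using \<epsilon>_nonneg H_pos by (simp add: corr_coeff_def less_imp_le)

lemma patch_eq_0_inner:
  assumes "norm x \<le> exp (real j)"
  shows "patch j x = 0" "patch_lap j x = 0"
proof -
  have "norm (P (exp (- real j)) x) = exp (- real j) * norm x" by (simp add: norm_P)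
  also have "\<dots> \<le> exp (- real j) * exp (real j)" using assms by (intro mult_left_mono) auto
  finally have n: "norm (P (exp (- real j)) x) \<le> 1" by (simp add: exp_minus)
  have "cut_ker (\<mu> j) (P (exp (- real j)) x) z = 0 \<and> cut_ker_lap (\<mu> j) (P (exp (- real j)) x) z = 0" for z
    unfolding cut_ker_def cut_ker_lap_def
    using annulus_cut_eq_0(1)[OF n] trans_ker_eq_0(1)[OF \<mu>_pos \<mu>_half n] trans_ker_eq_0(1)[OF \<mu>_pos \<mu>_half exp_minus1_scale[OF n]]
    by simp
  then show "patch j x = 0" "patch_lap j x = 0" by (simp_all add: patch_def patch_lap_def patch_int_def patch_int_lap_def)
qed

lemma patch_eq_0_outer:
  assumes "exp (real j + 2) \<le> norm x"
  shows "patch j x = 0" "patch_lap j x = 0"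
proof -
  have "exp 2 = exp (- real j) * exp (real j + 2)" by (simp add: mult_exp_exp)
  also have "\<dots> \<le> exp (- real j) * norm x" using assms by (intro mult_left_mono) auto
  also have "\<dots> = norm (P (exp (- real j)) x)" by (simp add: norm_P)
  finally have n: "exp 2 \<le> norm (P (exp (- real j)) x)" .
  have "exp (-1) * exp 2 \<le> exp (-1) * norm (P (exp (- real j)) x)" using n by (intro mult_left_mono) auto
  then have n1: "exp 1 \<le> norm (exp (- 1 :: real) *\<^sub>R P (exp (- real j)) x)" by (simp add: mult_exp_exp)
  have "exp 1 \<le> exp (2::real)" by simp
  then have n2: "exp 1 \<le> norm (P (exp (- real j)) x)" using n by linarith
  have "cut_ker (\<mu> j) (P (exp (- real j)) x) z = 0 \<and> cut_ker_lap (\<mu> j) (P (exp (- real j)) x) z = 0" for z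
    unfolding cut_ker_def cut_ker_lap_def
    using annulus_cut_eq_0(2)[OF n] trans_ker_eq_0(2)[OF \<mu>_pos \<mu>_half n2] trans_ker_eq_0(2)[OF \<mu>_pos \<mu>_half n1]
    by simp
  then show "patch j x = 0" "patch_lap j x = 0" by (simp_all add: patch_def patch_lap_def patch_int_def patch_int_lap_def)
qed

lemma summand_eq_0:
  assumes "norm x \<le> real j"
  shows "summand j x = 0" "summand_lap j x = 0"
proof -
  have "1 + (real j - 1) \<le> exp (real j - 1)" by (rule exp_ge_add_one_self)
  then have 1: "norm x \<le> exp (real j - 1)" using assms by linarith
  have "exp (real j - 1) \<le> exp (real j)" by simp
  then have 2: "norm x \<le> exp (real j)" using 1 by linarith
  show "summand j x = 0" "summand_lap j x = 0"
    by (simp_all add: summand_def summand_lap_def patch_eq_0_inner[OF 2] radial_cube_eq_0[OF 1])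
qed

lemma glued_eq:
  assumes "norm x \<le> real n"
  shows "glued x = (\<Sum>j<n. summand j x)" "glued_lap x = (\<Sum>j<n. summand_lap j x)"
proof -
  have le: "nat \<lceil>norm x\<rceil> \<le> n" using assms by (simp add: ceiling_le_iff nat_le_iff)
  have z: "norm x \<le> real j" if "j \<in> {..<n} - {..<nat \<lceil>norm x\<rceil>}" for j
  proof -
    have "nat \<lceil>norm x\<rceil> \<le> j" using that by auto
    then show ?thesis by (simp add: nat_le_iff ceiling_le_iff)
  qed
  show "glued x = (\<Sum>j<n. summand j x)" "glued_lap x = (\<Sum>j<n. summand_lap j x)"
    unfolding glued_def glued_lap_def
    by (rule sum.mono_neutral_left; use le z summand_eq_0 in auto)+
qed

lemma y_props:
  "(\<lambda>z. real_of_ereal (y j z)) \<in> borel_measurable borel"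
  "integrable lborel (\<lambda>z. indicator (cball 0 S) z * real_of_ereal (y j z))"
  by (rule sh_real_measurable[OF U_sh[OF y_U]], rule sh_integrable_cball[OF U_sh[OF y_U]])

text \<open>The similarity is applied to the C2 kernels, before they are integrated against
  \<open>y j\<close>. The form with arbitrary \<open>t > 0\<close> serves for the subharmonicity of
  all rescalings.\<close>

lemma weak_laplacian_summand:
  assumes t: "0 < t"
  shows "weak_laplacian (\<lambda>x. summand j (P t x)) (\<lambda>x. t\<^sup>2 * summand_lap j (P t x))"
proof -
  define s where "s = exp (- real j) * t"
  have s: "0 < s" using t by (simp add: s_def)
  have Ps: "P (exp (- real j)) (P t x) = P s x" for x using t by (simp add: P_P s_def)
  have w0: "weak_laplacian (\<lambda>x. LINT z|lborel. real_of_ereal (y j z) * cut_ker (\<mu> j) (P s x) z)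
     (\<lambda>x. LINT z|lborel. real_of_ereal (y j z) * (s\<^sup>2 * cut_ker_lap (\<mu> j) (P s x) z))"
  proof (rule weak_laplacian_superposition[where S = "2 * exp 2", OF _ _ _ _ y_props])
    have cP: "continuous_on UNIV (\<lambda>p::(real^'m) \<times> (real^'m). (P s (fst p), snd p))"
      by (intro continuous_on_Pair continuous_on_compose2[OF continuous_on_P_fixed[OF s, of UNIV]] continuous_intros) auto
    show "continuous_on UNIV (\<lambda>p. cut_ker (\<mu> j) (P s (fst p)) (snd p))"
      using continuous_on_compose2[OF continuous_on_cut_ker(1)[OF \<mu>_pos \<mu>_half] cP] by simp
    show "continuous_on UNIV (\<lambda>p. s\<^sup>2 * cut_ker_lap (\<mu> j) (P s (fst p)) (snd p))"
      using continuous_on_compose2[OF continuous_on_cut_ker(2)[OF \<mu>_pos \<mu>_half] cP] by (intro continuous_on_mult_left) simp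
    show "cut_ker (\<mu> j) (P s x) z = 0" "s\<^sup>2 * cut_ker_lap (\<mu> j) (P s x) z = 0" if "z \<notin> cball 0 (2 * exp 2)" for x z :: "real^'m"
      using cut_ker_support[OF \<mu>_pos \<mu>_half that] by simp_all
    fix z :: "real^'m"
    obtain D where D: "C2_on UNIV (\<lambda>x. cut_ker (\<mu> j) x z) D (\<lambda>x. cut_ker_lap (\<mu> j) x z)" by (rule C2_on_cut_ker)
    obtain D' where "C2_on UNIV (\<lambda>x. cut_ker (\<mu> j) (s *\<^sub>R (V s *v x)) z) D' (\<lambda>x. s\<^sup>2 * cut_ker_lap (\<mu> j) (s *\<^sub>R (V s *v x)) z)"
      by (rule C2_on_similarity[OF D orth[OF s]])
    then show "weak_laplacian (\<lambda>x. cut_ker (\<mu> j) (P s x) z) (\<lambda>x. s\<^sup>2 * cut_ker_lap (\<mu> j) (P s x) z)"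
      unfolding P_eq by (rule C2_on_imp_weak_laplacian)
  qed
  have eq: "(LINT z|lborel. real_of_ereal (y j z) * (s\<^sup>2 * cut_ker_lap (\<mu> j) (P s x) z)) = t\<^sup>2 * ((exp (- real j))\<^sup>2 * patch_int_lap j (P s x))" for x
  proof -
    have "(LINT z|lborel. real_of_ereal (y j z) * (s\<^sup>2 * cut_ker_lap (\<mu> j) (P s x) z)) = (LINT z|lborel. s\<^sup>2 * (real_of_ereal (y j z) * cut_ker_lap (\<mu> j) (P s x) z))"
      by (intro Bochner_Integration.integral_cong) auto
    then show ?thesis by (simp add: patch_int_lap_def s_def power_mult_distrib)
  qed
  have w1: "weak_laplacian (\<lambda>x. patch j (P t x)) (\<lambda>x. H (real j) * (t\<^sup>2 * ((exp (- real j))\<^sup>2 * patch_int_lap j (P s x))))"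
    using weak_laplacian_cmult[OF w0, of "H (real j)"] unfolding eq patch_def Ps patch_int_def .
  obtain D where D: "C2_on UNIV (radial_cube (real j - 1)) D (radial_cube_lap (real j - 1) :: real^'m \<Rightarrow> real)" by (rule C2_on_radial_cube)
  obtain D' where "C2_on UNIV (\<lambda>x. radial_cube (real j - 1) (t *\<^sub>R (V t *v x))) D' (\<lambda>x. t\<^sup>2 * radial_cube_lap (real j - 1) (t *\<^sub>R (V t *v x)))"
    by (rule C2_on_similarity[OF D orth[OF t]])
  then have "weak_laplacian (\<lambda>x. radial_cube (real j - 1) (P t x)) (\<lambda>x. t\<^sup>2 * radial_cube_lap (real j - 1) (P t x))"
    unfolding P_eq by (rule C2_on_imp_weak_laplacian)
  from weak_laplacian_add[OF w1 weak_laplacian_cmult[OF this, of "corr_coeff j"]]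
  show ?thesis
    by (simp add: summand_def summand_lap_def patch_lap_def Ps distrib_left mult.left_commute mult.assoc)
qed

lemma weak_laplacian_glued:
  assumes t: "0 < t"
  shows "weak_laplacian (\<lambda>x. glued (P t x)) (\<lambda>x. t\<^sup>2 * glued_lap (P t x))"
proof (rule weak_laplacian_local)
  fix R :: real
  obtain n :: nat where n: "t * \<bar>R\<bar> \<le> real n" using real_arch_simple by blast
  have b: "norm (P t x) \<le> real n" if "x \<in> ball 0 R" for x
  proof -
    have "t * norm x \<le> t * \<bar>R\<bar>" using that t by (intro mult_left_mono) auto
    then show ?thesis using n by (simp add: norm_P[OF t])
  qed
  have w: "weak_laplacian (\<lambda>x. \<Sum>j<n. summand j (P t x)) (\<lambda>x. \<Sum>j<n. t\<^sup>2 * summand_lap j (P t x))"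
    by (rule weak_laplacian_sum) (rule weak_laplacian_summand[OF t])
  show "\<exists>f' l'. weak_laplacian f' l' \<and> (\<forall>x\<in>ball 0 R. glued (P t x) = f' x \<and> t\<^sup>2 * glued_lap (P t x) = l' x)"
    by (intro exI conjI ballI, rule w) (simp_all add: glued_eq[OF b] sum_distrib_left)
qed

lemma radial_cube_nonneg: "0 \<le> radial_cube a x"
  by (simp add: radial_cube_def)

text \<open>The sign uses that the dimension is at least 2: the quadratic term has the factor m -
  2.\<close>

lemma radial_cube_lap_nonneg: "0 \<le> radial_cube_lap a (x :: real^'m)"
  using dim by (auto simp: radial_cube_lap_def intro!: divide_nonneg_nonneg add_nonneg_nonneg mult_nonneg_nonneg)

text \<open>On the inner shell only the inner cutoff varies, on the outer shell only the outer one.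
  In both cases the term with \<open>ker_lap\<close> is nonnegative because \<open>y j\<close> is
  subharmonic, and the transition term remains. On the outer shell a change of variables brings it
  back to \<xi> and turns \<open>y j\<close> into \<open>T 1 (y j)\<close>.\<close>

lemma patch_int_lap_shell:
  assumes \<xi>: "\<xi> \<in> shell"
  shows "trans_int (y j) (\<mu> j) \<xi> \<le> patch_int_lap j \<xi>"
    and "- (exp (- 1))\<^sup>2 * exp \<rho> * trans_int (T 1 (y j)) (\<mu> j) \<xi> \<le> patch_int_lap j (P (exp 1) \<xi>)"
proof -
  have n: "1 \<le> norm \<xi>" "norm \<xi> \<le> exp 1" using \<xi> by (auto simp: shell_def)
  have \<xi>0: "\<xi> \<noteq> 0" using n by auto
  define Y where "Y z = real_of_ereal (y j z)" for z
  have mY: "Y \<in> borel_measurable borel" unfolding Y_def[abs_def] by (rule y_props)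
  have int: "integrable lborel (\<lambda>z. Y z * K z)" if K: "continuous_on UNIV K" and K0: "\<And>z. z \<notin> cball 0 S \<Longrightarrow> K z = 0" for K S
  proof -
    obtain M where M: "0 \<le> M" "\<And>z. z \<in> cball 0 S \<Longrightarrow> \<bar>K z\<bar> \<le> M"
      using continuous_bounded_on_cball[OF continuous_on_subset[OF K subset_UNIV]] by metis
    have "\<bar>K z\<bar> \<le> M" for z using M K0[of z] by (cases "z \<in> cball 0 S") auto
    then show ?thesis unfolding Y_def
      by (intro sh_integrable_times[OF U_sh[OF y_U] borel_measurable_continuous_onI[OF K] _ K0])
  qed
  have ctk: "continuous_on UNIV (trans_ker (\<mu> j) x)" for x :: "real^'m"
    by (rule continuous_on_compose2[OF continuous_on_trans_ker[of "{\<mu> j} \<times> UNIV"], of UNIV "\<lambda>z. ((\<mu> j, x), z)", simplified])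
       (use \<mu>_pos \<mu>_half in \<open>auto intro!: continuous_intros\<close>)
  have tk0: "trans_ker (\<mu> j) x z = 0" if "z \<notin> cball 0 (2 * norm x)" for x z :: "real^'m"
    using that by (intro trans_ker_eq_0(3)[OF \<mu>_pos \<mu>_half]) simp
  have itk: "integrable lborel (\<lambda>z. Y z * trans_ker (\<mu> j) x z)" for x by (rule int[OF ctk tk0])
  have cckl: "continuous_on UNIV (cut_ker_lap (\<mu> j) x)" for x :: "real^'m"
    by (rule continuous_on_compose2[OF continuous_on_cut_ker(2)[OF \<mu>_pos \<mu>_half], of UNIV "\<lambda>z. (x, z)", simplified])
       (auto intro!: continuous_intros)
  have ickl: "integrable lborel (\<lambda>z. Y z * cut_ker_lap (\<mu> j) x z)" for x
    by (rule int[OF cckl cut_ker_support(2)[OF \<mu>_pos \<mu>_half]])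
  have nn: "0 \<le> (LINT z|lborel. Y z * ker_lap (\<mu> j) x z)" if "x \<noteq> 0" for x
    unfolding Y_def by (rule sh_integral_ker_lap_nonneg[OF U_sh[OF y_U] \<mu>_pos \<mu>_half that])
  have n1: "norm (exp (- 1 :: real) *\<^sub>R \<xi>) \<le> 1"
  proof -
    have "exp (-1) * norm \<xi> \<le> exp (-1) * exp (1::real)" using n by (intro mult_left_mono) auto
    then show ?thesis by (simp add: mult_exp_exp)
  qed
  have e1: "cut_ker_lap (\<mu> j) \<xi> z = annulus_cut \<xi> * ker_lap (\<mu> j) \<xi> z + trans_ker (\<mu> j) \<xi> z" for z
    using trans_ker_eq_0(1)[OF \<mu>_pos \<mu>_half n1] by (simp add: cut_ker_lap_def)
  have "patch_int_lap j \<xi> - trans_int (y j) (\<mu> j) \<xi> = (LINT z|lborel. Y z * cut_ker_lap (\<mu> j) \<xi> z - Y z * trans_ker (\<mu> j) \<xi> z)"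
    unfolding patch_int_lap_def trans_int_def Y_def[symmetric] by (rule Bochner_Integration.integral_diff[OF ickl itk, symmetric])
  also have "\<dots> = (LINT z|lborel. annulus_cut \<xi> * (Y z * ker_lap (\<mu> j) \<xi> z))"
    by (intro Bochner_Integration.integral_cong) (simp_all add: e1 algebra_simps)
  also have "\<dots> = annulus_cut \<xi> * (LINT z|lborel. Y z * ker_lap (\<mu> j) \<xi> z)" by simp
  also have "0 \<le> \<dots>" using annulus_cut_bounds(1) nn[OF \<xi>0] by (rule mult_nonneg_nonneg)
  finally show "trans_int (y j) (\<mu> j) \<xi> \<le> patch_int_lap j \<xi>" by simp
  define \<xi>' where "\<xi>' = P (exp 1) \<xi>"
  have n': "norm \<xi>' = exp 1 * norm \<xi>" by (simp add: \<xi>'_def norm_P)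
  have n'1: "exp 1 \<le> norm \<xi>'" unfolding n' using mult_left_mono[OF n(1), of "exp 1"] by simp
  have "0 < norm \<xi>'" by (rule less_le_trans[OF exp_gt_zero n'1])
  then have \<xi>'0: "\<xi>' \<noteq> 0" by auto
  define X where "X z = exp (- 1 :: real) *\<^sub>R z" for z :: "real^'m"
  let ?I = "LINT z|lborel. Y z * trans_ker (\<mu> j) (X \<xi>') (X z)"
  have X\<xi>': "X \<xi>' = V (exp 1) *v \<xi>" by (simp add: X_def \<xi>'_def P_eq mult_exp_exp)
  have cX: "continuous_on UNIV X" unfolding X_def by (intro continuous_intros)
  have mX: "(\<lambda>z. Y z * trans_ker (\<mu> j) (X \<xi>') (X z)) \<in> borel_measurable borel"
    by (intro borel_measurable_times mY borel_measurable_continuous_onI continuous_on_compose2[OF ctk cX]) auto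
  have cX0: "continuous_on UNIV (\<lambda>z. trans_ker (\<mu> j) (X \<xi>') (X z))" by (rule continuous_on_compose2[OF ctk cX]) auto
  have iX: "integrable lborel (\<lambda>z. Y z * trans_ker (\<mu> j) (X \<xi>') (X z))"
  proof (rule int[OF cX0, of "2 * norm \<xi>'"])
    fix z :: "real^'m" assume "z \<notin> cball 0 (2 * norm \<xi>')"
    then have "exp (-1) * (2 * norm \<xi>') < exp (-1) * norm z" by (intro mult_strict_left_mono) auto
    then have "X z \<notin> cball 0 (2 * norm (X \<xi>'))" by (simp add: X_def)
    then show "trans_ker (\<mu> j) (X \<xi>') (X z) = 0" by (rule tk0)
  qed
  define c where "c = (exp (- 1))\<^sup>2 * exp (- 1 :: real) ^ DIM(real^'m)"
  have e2: "cut_ker_lap (\<mu> j) \<xi>' z = annulus_cut \<xi>' * ker_lap (\<mu> j) \<xi>' z - c * trans_ker (\<mu> j) (X \<xi>') (X z)" for z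
    using trans_ker_eq_0(2)[OF \<mu>_pos \<mu>_half n'1] by (simp add: cut_ker_lap_def X_def c_def)
  have "patch_int_lap j \<xi>' + c * ?I
     = (LINT z|lborel. Y z * cut_ker_lap (\<mu> j) \<xi>' z) + (LINT z|lborel. c * (Y z * trans_ker (\<mu> j) (X \<xi>') (X z)))"
    by (simp add: patch_int_lap_def Y_def)
  also have "\<dots> = (LINT z|lborel. Y z * cut_ker_lap (\<mu> j) \<xi>' z + c * (Y z * trans_ker (\<mu> j) (X \<xi>') (X z)))"
    by (rule Bochner_Integration.integral_add[OF ickl integrable_mult_right[OF iX], symmetric])
  also have "\<dots> = (LINT z|lborel. annulus_cut \<xi>' * (Y z * ker_lap (\<mu> j) \<xi>' z))"
    by (intro Bochner_Integration.integral_cong) (simp_all add: e2 algebra_simps)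
  also have "\<dots> = annulus_cut \<xi>' * (LINT z|lborel. Y z * ker_lap (\<mu> j) \<xi>' z)" by simp
  also have "0 \<le> \<dots>" using annulus_cut_bounds(1) nn[OF \<xi>'0] by (rule mult_nonneg_nonneg)
  finally have 1: "- (c * ?I) \<le> patch_int_lap j \<xi>'" by simp
  have XP: "X (P (exp 1) z) = V (exp 1) *v z" for z by (simp add: X_def P_eq mult_exp_exp)
  have "trans_int (T 1 (y j)) (\<mu> j) \<xi> = (LINT z|lborel. exp (- \<rho>) * (Y (P (exp 1) z) * trans_ker (\<mu> j) (X \<xi>') (X (P (exp 1) z))))"
    unfolding trans_int_def T_real XP X\<xi>' trans_ker_orthogonal[OF orth[OF exp_gt_zero]] by (simp add: Y_def mult.assoc)
  also have "\<dots> = exp (- \<rho>) * (LINT z|lborel. Y (P (exp 1) z) * trans_ker (\<mu> j) (X \<xi>') (X (P (exp 1) z)))" by simp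
  also have "(LINT z|lborel. Y (P (exp 1) z) * trans_ker (\<mu> j) (X \<xi>') (X (P (exp 1) z))) = ?I / exp 1 ^ CARD('m)"
    by (rule integral_P(1)[OF exp_gt_zero mX])
  finally have 2: "trans_int (T 1 (y j)) (\<mu> j) \<xi> = exp (- \<rho>) * (?I / exp 1 ^ CARD('m))" .
  \<comment> \<open>The Jacobian of the change of variables equals the homogeneity factor in
    \<open>c\<close>; there remain e^(-2) from the Laplacian and e^\<rho>, which undoes the
    normalisation in \<open>T 1\<close>.\<close>
  have "c * I = (exp (- 1))\<^sup>2 * exp \<rho> * (exp (- \<rho>) * (I / exp 1 ^ CARD('m)))" for I :: real
    by (simp add: c_def exp_minus field_simps)
  then show "- (exp (- 1))\<^sup>2 * exp \<rho> * trans_int (T 1 (y j)) (\<mu> j) \<xi> \<le> patch_int_lap j (P (exp 1) \<xi>)"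
    using 1 unfolding \<xi>'_def[symmetric] 2 by simp
qed

end

section \<open>Size of the corrector and growth of the glued function\<close>

lemma contraction_tendsto_0:
  fixes x :: "nat \<Rightarrow> real"
  assumes x: "\<And>n. 0 \<le> x n" and \<theta>: "0 \<le> \<theta>" "\<theta> < 1"
    and step: "\<forall>\<^sub>F n in sequentially. x (Suc n) \<le> \<theta> * x n + \<delta> n" and \<delta>: "\<delta> \<longlonglongrightarrow> 0"
  shows "x \<longlonglongrightarrow> 0"
proof (rule LIMSEQ_I)
  fix r :: real assume r: "0 < r"
  define e where "e = r / 2"
  have e: "0 < e" using r by (simp add: e_def)
  then have "0 < (1 - \<theta>) * e" using \<theta> by simp
  from eventually_conj[OF step order_tendstoD(2)[OF \<delta> this]]
  obtain K where K: "\<And>n. K \<le> n \<Longrightarrow> x (Suc n) \<le> \<theta> * x n + \<delta> n \<and> \<delta> n < (1 - \<theta>) * e"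
    by (auto simp: eventually_sequentially)
  have b: "x (K + i) \<le> e + \<theta> ^ i * x K" for i
  proof (induction i)
    case 0
    then show ?case using e by simp
  next
    case (Suc i)
    have "x (K + Suc i) \<le> \<theta> * x (K + i) + (1 - \<theta>) * e" using K[of "K + i"] by simp
    also have "\<dots> \<le> \<theta> * (e + \<theta> ^ i * x K) + (1 - \<theta>) * e" using Suc \<theta>(1) by (intro add_right_mono mult_left_mono) auto
    finally show ?case by (simp add: algebra_simps)
  qed
  have "(\<lambda>i. \<theta> ^ i * x K) \<longlonglongrightarrow> 0 * x K" using \<theta> by (intro tendsto_mult LIMSEQ_power_zero tendsto_const) auto
  then have "\<forall>\<^sub>F i in sequentially. \<theta> ^ i * x K < e" using order_tendstoD(2)[of "\<lambda>i. \<theta> ^ i * x K" 0] e by simp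
  then obtain I where I: "\<And>i. I \<le> i \<Longrightarrow> \<theta> ^ i * x K < e" by (auto simp: eventually_sequentially)
  have "norm (x n - 0) < r" if "K + I \<le> n" for n
  proof -
    define i where "i = n - K"
    have i: "n = K + i" "I \<le> i" using that by (simp_all add: i_def)
    have "x n < r" using b[of i] I[OF i(2)] i(1) by (simp add: e_def)
    then show ?thesis using x[of n] by simp
  qed
  then show "\<exists>no. \<forall>n\<ge>no. norm (x n - 0) < r" by blast
qed

lemma cube_le_exp: "0 \<le> t \<Longrightarrow> t ^ 3 \<le> 27 * exp (t :: real)"
proof -
  assume t: "0 \<le> t"
  have "t / 3 \<le> exp (t / 3)" using exp_ge_add_one_self[of "t / 3"] by linarith
  then have "(t / 3) ^ 3 \<le> exp (t / 3) ^ 3" using t by (intro power_mono) auto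
  also have "exp (t / 3) ^ 3 = exp t" by (simp add: exp_of_nat_mult[symmetric])
  finally show ?thesis by (simp add: power_divide)
qed

context azarin_construction
begin

text \<open>On the shell \<open>e\<^sup>k \<le> |x| \<le> e\<^sup>k\<^sup>+\<^sup>1\<close> only the patches \<open>k\<close> and \<open>k - 1\<close> are present, and the negative part of
  the Laplacian comes from their transition terms alone.\<close>

lemma glued_lap_nonneg: "0 \<le> glued_lap x"
proof -
  have cn: "0 \<le> corr_coeff j * radial_cube_lap (real j - 1) x" for j
    by (intro mult_nonneg_nonneg corr_coeff_nonneg radial_cube_lap_nonneg)
  show ?thesis
  proof (cases "norm x < 1")
    case True
    have "norm x \<le> exp (real j)" for j
    proof -
      have "1 \<le> exp (real j)" by simp
      then show ?thesis using True by linarith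
    qed
    then have "patch_lap j x = 0" for j by (rule patch_eq_0_inner(2))
    then show ?thesis unfolding glued_lap_def summand_lap_def using cn by (intro sum_nonneg) simp
  next
    case False
    then have x1: "1 \<le> norm x" by simp
    define l where "l = ln (norm x)"
    have l: "0 \<le> l" "exp l = norm x" using x1 less_le_trans[OF zero_less_one x1] by (simp_all add: l_def)
    define k where "k = nat \<lfloor>l\<rfloor>"
    have k: "real k \<le> l" "l < real k + 1" using l(1) by (simp_all add: k_def)
    have xk: "exp (real k) \<le> norm x" "norm x \<le> exp (real k + 1)" using k l(2)[symmetric] by simp_all
    define \<xi> where "\<xi> = P (exp (- real k)) x"
    have n\<xi>: "norm \<xi> = exp (- real k) * norm x" by (simp add: \<xi>_def norm_P)
    have \<xi>: "\<xi> \<in> shell"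
    proof -
      have "exp (- real k) * exp (real k) \<le> exp (- real k) * norm x" "exp (- real k) * norm x \<le> exp (- real k) * exp (real k + 1)"
        using xk by (auto intro: mult_left_mono)
      then show ?thesis by (simp add: shell_def n\<xi> mult_exp_exp)
    qed
    obtain n0 :: nat where n0: "norm x \<le> real n0" using real_arch_simple by blast
    define n where "n = max n0 (Suc k)"
    have n: "norm x \<le> real n" "k < n" using n0 by (auto simp: n_def)
    have pz: "patch_lap j x = 0" if "j \<noteq> k" "Suc j \<noteq> k" for j
    proof (cases "j < k")
      case True
      then have "real j + 2 \<le> real k" using that by linarith
      then have "exp (real j + 2) \<le> exp (real k)" by simp
      then show ?thesis using xk(1) by (intro patch_eq_0_outer(2)) linarith
    next
      case False
      then have "real k + 1 \<le> real j" using that by linarith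
      then have "exp (real k + 1) \<le> exp (real j)" by simp
      then show ?thesis using xk(2) by (intro patch_eq_0_inner(2)) linarith
    qed
    \<comment> \<open>After extraction of e^(-2k) the two transition terms are exactly those
      compared in \<open>error_Suc\<close>; for k = 0 there is only one, and \<open>error_0\<close>
      applies.\<close>
    have main: "- (exp (- real k))\<^sup>2 * (\<epsilon> k * H (real k)) \<le> (\<Sum>j<n. patch_lap j x)"
    proof (cases k)
      case 0
      have "(\<Sum>j<n. patch_lap j x) = (\<Sum>j\<in>{0}. patch_lap j x)"
        by (rule sum.mono_neutral_right) (use n pz 0 in auto)
      also have "\<dots> = H (real 0) * patch_int_lap 0 \<xi>" by (simp add: patch_lap_def \<xi>_def 0)
      also have "\<dots> \<ge> H (real 0) * trans_int (y 0) (\<mu> 0) \<xi>" using patch_int_lap_shell(1)[OF \<xi>, of 0] H_pos[of "real 0"] by (intro mult_left_mono) auto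
      finally show ?thesis using error_0[OF \<xi>] unfolding 0 by simp
    next
      case (Suc i)
      have "(\<Sum>j<n. patch_lap j x) = (\<Sum>j\<in>{i, k}. patch_lap j x)"
        by (rule sum.mono_neutral_right) (use n pz Suc in auto)
      also have "\<dots> = patch_lap i x + patch_lap k x" using Suc by simp
      finally have s: "(\<Sum>j<n. patch_lap j x) = patch_lap i x + patch_lap k x" .
      define E where "E = (exp (- real k))\<^sup>2"
      have E: "0 < E" by (simp add: E_def)
      have Ei: "(exp (- real i))\<^sup>2 * (exp (- 1))\<^sup>2 = E"
        unfolding E_def power_mult_distrib[symmetric] by (simp add: mult_exp_exp Suc)
      have Pi: "P (exp (- real i)) x = P (exp 1) \<xi>" by (simp add: \<xi>_def P_P mult_exp_exp Suc)
      have "H (real i) * ((exp (- real i))\<^sup>2 * (- (exp (- 1))\<^sup>2 * exp \<rho> * trans_int (T 1 (y i)) (\<mu> i) \<xi>)) \<le> patch_lap i x"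
        unfolding patch_lap_def Pi using patch_int_lap_shell(2)[OF \<xi>, of i] H_pos[of "real i"] by (intro mult_left_mono) auto
      moreover have "H (real i) * ((exp (- real i))\<^sup>2 * (- (exp (- 1))\<^sup>2 * exp \<rho> * trans_int (T 1 (y i)) (\<mu> i) \<xi>))
         = - (((exp (- real i))\<^sup>2 * (exp (- 1))\<^sup>2) * (H (real i) * exp \<rho> * trans_int (T 1 (y i)) (\<mu> i) \<xi>))" by simp
      ultimately have 1: "- (E * (H (real i) * exp \<rho> * trans_int (T 1 (y i)) (\<mu> i) \<xi>)) \<le> patch_lap i x" unfolding Ei by (rule ord_eq_le_trans[OF sym, rotated])
      have "H (real k) * (E * trans_int (y k) (\<mu> k) \<xi>) \<le> patch_lap k x"
        unfolding patch_lap_def \<xi>_def[symmetric] E_def[symmetric] using patch_int_lap_shell(1)[OF \<xi>, of k] H_pos[of "real k"] E by (intro mult_left_mono) auto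
      then have 2: "E * (H (real k) * trans_int (y k) (\<mu> k) \<xi>) \<le> patch_lap k x" by (simp add: mult.left_commute)
      have "E * (- \<epsilon> k * H (real k)) \<le> E * (H (real k) * trans_int (y k) (\<mu> k) \<xi> - H (real i) * exp \<rho> * trans_int (T 1 (y i)) (\<mu> i) \<xi>)"
        using error_Suc[OF \<xi>, of i] E unfolding Suc by (intro mult_left_mono) auto
      then have "- E * (\<epsilon> k * H (real k)) \<le> E * (H (real k) * trans_int (y k) (\<mu> k) \<xi>) - E * (H (real i) * exp \<rho> * trans_int (T 1 (y i)) (\<mu> i) \<xi>)"
        by (simp add: right_diff_distrib)
      then show ?thesis unfolding s E_def[symmetric] using 1 2 by linarith
    qed
    \<comment> \<open>The threshold of the k-th radial term lies one unit below the shell. On the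
      shell ln |x| therefore exceeds it by at least 1, and the Laplacian of the term is at least
      1/|x|^2, hence at least e^(-2k-2); this is the origin of the constant \<open>exp 2\<close> in
      \<open>corr_coeff\<close>.\<close>
    have "(exp (- real k))\<^sup>2 * (\<epsilon> k * H (real k)) \<le> corr_coeff k * radial_cube_lap (real k - 1) x"
    proof -
      have x0: "x \<noteq> 0" using x1 by auto
      have M: "1 \<le> max 0 (l - (real k - 1))" using k(1) by linarith
      have "1 \<le> 6 * max 0 (l - (real k - 1)) + 3 * (real DIM(real^'m) - 2) * (max 0 (l - (real k - 1)))\<^sup>2"
        using M dim by (intro add_increasing2 mult_nonneg_nonneg) auto
      then have r: "1 / (norm x)\<^sup>2 \<le> radial_cube_lap (real k - 1) x"
        using x0 by (simp add: radial_cube_lap_def l_def[symmetric] divide_right_mono)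
      have "(norm x)\<^sup>2 \<le> (exp (real k + 1))\<^sup>2" using xk(2) by (intro power_mono) auto
      also have "\<dots> = exp 2 / (exp (- real k))\<^sup>2"
        unfolding power2_eq_square exp_minus by (simp add: mult_exp_exp field_simps)
      finally have "(exp (- real k))\<^sup>2 * (norm x)\<^sup>2 \<le> exp 2" by (simp add: field_simps)
      then have "(exp (- real k))\<^sup>2 \<le> exp 2 * (1 / (norm x)\<^sup>2)" using x0 by (simp add: field_simps)
      also have "\<dots> \<le> exp 2 * radial_cube_lap (real k - 1) x" using r by (intro mult_left_mono) auto
      finally have "(exp (- real k))\<^sup>2 * (\<epsilon> k * H (real k)) \<le> (exp 2 * radial_cube_lap (real k - 1) x) * (\<epsilon> k * H (real k))"
        using \<epsilon>_nonneg[of k] H_pos[of "real k"] by (intro mult_right_mono mult_nonneg_nonneg) auto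
      then show ?thesis by (simp add: corr_coeff_def mult_ac)
    qed
    also have "\<dots> \<le> (\<Sum>j<n. corr_coeff j * radial_cube_lap (real j - 1) x)"
      by (rule member_le_sum[of k "{..<n}" "\<lambda>j. corr_coeff j * radial_cube_lap (real j - 1) x"]) (use n(2) cn in auto)
    finally have "(exp (- real k))\<^sup>2 * (\<epsilon> k * H (real k)) \<le> (\<Sum>j<n. corr_coeff j * radial_cube_lap (real j - 1) x)" .
    then show ?thesis unfolding glued_eq(2)[OF n(1)] summand_lap_def sum.distrib using main by simp
  qed
qed

text \<open>Slow variation is uniform over bounded increments, so the increments may vary with
  n.\<close>

lemma H_ratio_limit:
  assumes s: "filterlim s at_top sequentially" and t: "t \<longlonglongrightarrow> t'"
  shows "(\<lambda>n. H (s n + t n) / H (s n)) \<longlonglongrightarrow> exp (\<rho> * t')"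
proof -
  obtain L where L: "0 < L" "\<And>n. \<bar>t n\<bar> \<le> L" using convergent_imp_Bseq[of t] t unfolding Bseq_def convergent_def by auto
  have "(\<lambda>n. ln (H (s n + t n)) - ln (H (s n)) - \<rho> * t n) \<longlonglongrightarrow> 0"
    unfolding tendsto_iff
  proof (intro allI impI)
    fix e :: real assume e: "0 < e"
    have "\<forall>\<^sub>F n in sequentially. \<forall>t. \<bar>t\<bar> \<le> L \<longrightarrow> \<bar>ln (H (s n + t)) - ln (H (s n)) - \<rho> * t\<bar> \<le> (e / 2 / L) * L"
      by (rule eventually_compose_filterlim[OF H_slow[of "e / 2 / L" L] s]) (use e L(1) in simp)
    then show "\<forall>\<^sub>F n in sequentially. dist (ln (H (s n + t n)) - ln (H (s n)) - \<rho> * t n) 0 < e"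
    proof eventually_elim
      case (elim n)
      then have "\<bar>ln (H (s n + t n)) - ln (H (s n)) - \<rho> * t n\<bar> \<le> e / 2" using L by simp
      then show ?case using e by (simp add: dist_real_def)
    qed
  qed
  from tendsto_add[OF this tendsto_mult[OF tendsto_const[of \<rho>] t]]
  have "(\<lambda>n. ln (H (s n + t n)) - ln (H (s n))) \<longlonglongrightarrow> \<rho> * t'" by simp
  then have "(\<lambda>n. exp (ln (H (s n + t n)) - ln (H (s n)))) \<longlonglongrightarrow> exp (\<rho> * t')" by (rule tendsto_exp)
  then show ?thesis by (simp add: exp_diff H_pos)
qed

text \<open>A bound for the corrector where |x| \<le> e^N: there ln |x| exceeds the threshold j - 1
  by at most N - j + 1.\<close>

definition corr_sum :: "nat \<Rightarrow> real" where
  "corr_sum N = (\<Sum>j\<le>N. corr_coeff j * (real (N - j) + 1) ^ 3)"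

text \<open>The cubes are enlarged to exponentials of rate \<alpha> = \<rho>/2, for which the sum
  satisfies a one-step recursion with factor e^\<alpha>. As \<open>H\<close> eventually grows by
  more than e^(3\<alpha>/2) per step, the quotient contracts by e^(-\<alpha>/2) up to an error
  \<open>exp 2 * \<epsilon> (Suc N)\<close>, which tends to 0.\<close>

lemma corr_sum_small: "(\<lambda>N. corr_sum N / H (real N)) \<longlonglongrightarrow> 0"
proof -
  define \<alpha> where "\<alpha> = \<rho> / 2"
  have \<alpha>: "0 < \<alpha>" using rho_pos by (simp add: \<alpha>_def)
  define X where "X N = (\<Sum>j\<le>N. corr_coeff j * exp (\<alpha> * real (N - j)))" for N
  have X0: "0 \<le> X N" for N unfolding X_def by (intro sum_nonneg mult_nonneg_nonneg corr_coeff_nonneg) simp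
  have XS: "X (Suc N) = exp \<alpha> * X N + corr_coeff (Suc N)" for N
  proof -
    have "(\<Sum>j\<le>N. corr_coeff j * exp (\<alpha> * real (Suc N - j))) = (\<Sum>j\<le>N. exp \<alpha> * (corr_coeff j * exp (\<alpha> * real (N - j))))"
      by (intro sum.cong refl) (simp add: Suc_diff_le distrib_left exp_add)
    then show ?thesis by (simp add: X_def sum_distrib_left)
  qed
  define x where "x N = X N / H (real N)" for N
  have "x \<longlonglongrightarrow> 0"
  proof (rule contraction_tendsto_0[of x "exp (- \<alpha> / 2)" "\<lambda>N. exp 2 * \<epsilon> (Suc N)"])
    show "0 \<le> x N" for N using X0[of N] H_pos[of "real N"] by (simp add: x_def)
    show "0 \<le> exp (- \<alpha> / 2)" "exp (- \<alpha> / 2) < 1" using \<alpha> by simp_all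
    have "(\<lambda>N. exp 2 * \<epsilon> (Suc N)) \<longlonglongrightarrow> exp 2 * 0" by (intro tendsto_mult tendsto_const LIMSEQ_Suc \<epsilon>_lim)
    then show "(\<lambda>N. exp 2 * \<epsilon> (Suc N)) \<longlonglongrightarrow> 0" by simp
    have "(\<lambda>n. H (real n + 1) / H (real n)) \<longlonglongrightarrow> exp (\<rho> * 1)"
      by (rule H_ratio_limit[OF filterlim_real_sequentially tendsto_const])
    moreover have "exp (3 / 2 * \<alpha>) < exp (\<rho> * 1)" using \<alpha> by (simp add: \<alpha>_def)
    ultimately have "\<forall>\<^sub>F n in sequentially. exp (3 / 2 * \<alpha>) < H (real n + 1) / H (real n)" by (rule order_tendstoD(1))
    then show "\<forall>\<^sub>F N in sequentially. x (Suc N) \<le> exp (- \<alpha> / 2) * x N + exp 2 * \<epsilon> (Suc N)"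
    proof eventually_elim
      case (elim N)
      have h: "exp (3 / 2 * \<alpha>) * H (real N) \<le> H (real (Suc N))"
        using elim H_pos[of "real N"] by (simp add: field_simps add.commute)
      have hs: "0 < H (real (Suc N))" and hn: "0 < H (real N)" by (rule H_pos)+
      have "exp \<alpha> / H (real (Suc N)) \<le> exp \<alpha> / (exp (3 / 2 * \<alpha>) * H (real N))"
        using h hs hn by (intro divide_left_mono) auto
      also have "\<dots> = exp (\<alpha> - 3 / 2 * \<alpha>) / H (real N)" unfolding exp_diff by (simp add: field_simps)
      also have "\<alpha> - 3 / 2 * \<alpha> = - \<alpha> / 2" by simp
      finally have "exp \<alpha> / H (real (Suc N)) * X N \<le> exp (- \<alpha> / 2) / H (real N) * X N" using X0 by (intro mult_right_mono) auto
      then have "exp \<alpha> * X N / H (real (Suc N)) \<le> exp (- \<alpha> / 2) * x N" by (simp add: x_def)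
      moreover have "corr_coeff (Suc N) / H (real (Suc N)) = exp 2 * \<epsilon> (Suc N)"
      proof -
        have "H (real (Suc N)) \<noteq> 0" using hs by linarith
        then show ?thesis by (simp add: corr_coeff_def)
      qed
      moreover have "x (Suc N) = exp \<alpha> * X N / H (real (Suc N)) + corr_coeff (Suc N) / H (real (Suc N))"
        unfolding x_def XS by (rule add_divide_distrib)
      ultimately show ?case by simp
    qed
  qed
  define C where "C = 27 * exp \<alpha> / \<alpha> ^ 3"
  have cube: "(real i + 1) ^ 3 \<le> C * exp (\<alpha> * real i)" for i
  proof -
    have "(\<alpha> * (real i + 1)) ^ 3 \<le> 27 * exp (\<alpha> * (real i + 1))" using \<alpha> by (intro cube_le_exp) auto
    also have "\<dots> = 27 * exp \<alpha> * exp (\<alpha> * real i)" by (simp add: distrib_left exp_add)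
    finally have "\<alpha> ^ 3 * (real i + 1) ^ 3 \<le> 27 * exp \<alpha> * exp (\<alpha> * real i)" unfolding power_mult_distrib .
    then have "\<alpha> ^ 3 * (real i + 1) ^ 3 / \<alpha> ^ 3 \<le> 27 * exp \<alpha> * exp (\<alpha> * real i) / \<alpha> ^ 3"
      using \<alpha> by (intro divide_right_mono) auto
    moreover have "\<alpha> ^ 3 \<noteq> 0" using \<alpha> by simp
    ultimately show ?thesis unfolding C_def by simp
  qed
  have "corr_sum N \<le> C * X N" for N
    unfolding corr_sum_def X_def sum_distrib_left
  proof (intro sum_mono)
    fix j assume "j \<in> {..N}"
    have "corr_coeff j * (real (N - j) + 1) ^ 3 \<le> corr_coeff j * (C * exp (\<alpha> * real (N - j)))"
      by (intro mult_left_mono cube corr_coeff_nonneg)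
    then show "corr_coeff j * (real (N - j) + 1) ^ 3 \<le> C * (corr_coeff j * exp (\<alpha> * real (N - j)))" by (simp add: mult_ac)
  qed
  then have up: "corr_sum N / H (real N) \<le> C * x N" for N
    unfolding x_def times_divide_eq_right using H_pos[of "real N"] by (intro divide_right_mono) auto
  have lo: "0 \<le> corr_sum N / H (real N)" for N
    unfolding corr_sum_def using H_pos[of "real N"] by (intro divide_nonneg_pos sum_nonneg mult_nonneg_nonneg corr_coeff_nonneg) auto
  have "(\<lambda>N. C * x N) \<longlonglongrightarrow> C * 0" by (intro tendsto_mult tendsto_const \<open>x \<longlonglongrightarrow> 0\<close>)
  then have "(\<lambda>N. C * x N) \<longlonglongrightarrow> 0" by simp
  then show ?thesis by (rule tendsto_sandwich[OF always_eventually always_eventually tendsto_const, rotated 2]) (use up lo in auto)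
qed

text \<open>Radial terms with index above N have not yet started at |x| \<le> e^N, so the number n
  of summands does not matter.\<close>

lemma corr_le_corr_sum:
  assumes x: "norm x \<le> exp (real N)"
  shows "(\<Sum>j<n. corr_coeff j * radial_cube (real j - 1) x) \<le> corr_sum N"
proof -
  have z: "radial_cube (real j - 1) x = 0" if "N < j" for j
  proof -
    have "exp (real N) \<le> exp (real j - 1)" using that by simp
    then show ?thesis using x by (intro radial_cube_eq_0(1)) linarith
  qed
  have "(\<Sum>j<n. corr_coeff j * radial_cube (real j - 1) x) \<le> (\<Sum>j\<in>{..<n} \<union> {..N}. corr_coeff j * radial_cube (real j - 1) x)"
    by (rule sum_mono2) (auto intro: mult_nonneg_nonneg corr_coeff_nonneg radial_cube_nonneg)
  also have "\<dots> = (\<Sum>j\<le>N. corr_coeff j * radial_cube (real j - 1) x)"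
    by (rule sum.mono_neutral_right) (use z in auto)
  also have "\<dots> \<le> corr_sum N"
    unfolding corr_sum_def
  proof (intro sum_mono mult_left_mono corr_coeff_nonneg)
    fix j assume j: "j \<in> {..N}"
    show "radial_cube (real j - 1) x \<le> (real (N - j) + 1) ^ 3"
    proof (cases "x = 0")
      case False
      have "ln (norm x) \<le> real N" by (rule ln_norm_le[OF False x])
      then show ?thesis using False j by (auto simp: radial_cube_def of_nat_diff intro!: power_mono)
    qed (simp add: radial_cube_def)
  qed
  finally show ?thesis .
qed

text \<open>The kernel averages the bound \<open>\<sigma> * norm z powr \<rho>\<close> over points
  with |z| \<le> 2 e^2, and its mass is bounded independently of the radius.\<close>

lemma patch_int_le: "\<exists>B\<ge>0. \<forall>j x. patch_int j x \<le> B"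
proof (intro exI conjI allI)
  define b where "b = \<sigma> * (2 * exp 2) powr \<rho>"
  define B where "B = 4 ^ DIM(real^'m) * b"
  have b: "0 \<le> b" using sigma_pos by (simp add: b_def)
  then show B: "0 \<le> B" by (simp add: B_def)
  fix j and x :: "real^'m"
  have eq: "patch_int j x = annulus_cut x * (LINT z|lborel. real_of_ereal (y j z) * ker (\<mu> j) x z)"
    unfolding patch_int_def cut_ker_def by (simp add: mult.left_commute)
  show "patch_int j x \<le> B"
  proof (cases "x = 0 \<or> exp 2 \<le> norm x")
    case True
    then have "annulus_cut x = 0" using annulus_cut_eq_0[of x] by auto
    then show ?thesis using B by (simp add: eq)
  next
    case False
    have "(LINT z|lborel. real_of_ereal (y j z) * ker (\<mu> j) x z) \<le> B"
      unfolding B_def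
    proof (rule ker_integral_bound[OF \<mu>_pos \<mu>_half _ _ b])
      show "x \<noteq> 0" using False by simp
      fix z :: "real^'m" assume "norm z \<le> 2 * norm x"
      then have "norm z \<le> 2 * exp 2" using False by linarith
      then have "norm z powr \<rho> \<le> (2 * exp 2) powr \<rho>" using rho_pos by (intro powr_mono2) auto
      then have "\<sigma> * norm z powr \<rho> \<le> b" unfolding b_def using sigma_pos by (intro mult_left_mono) auto
      then show "real_of_ereal (y j z) \<le> b" using U_upper[OF y_U, of j z] by linarith
    qed
    then have "annulus_cut x * (LINT z|lborel. real_of_ereal (y j z) * ker (\<mu> j) x z) \<le> annulus_cut x * B"
      using annulus_cut_bounds(1) by (intro mult_left_mono) auto
    also have "\<dots> \<le> B" using annulus_cut_bounds[of x] B by (intro mult_left_le_one_le) auto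
    finally show ?thesis by (simp add: eq)
  qed
qed

text \<open>\<open>H\<close> is monotone only from some point on; the finitely many earlier values
  are dominated because \<open>H\<close> tends to infinity.\<close>

lemma H_nat_le: "\<exists>s1. \<forall>s\<ge>s1. \<forall>j. real j \<le> s \<longrightarrow> H (real j) \<le> H s"
proof -
  obtain s0 where s0: "\<And>s t. s0 \<le> s \<Longrightarrow> s \<le> t \<Longrightarrow> H s \<le> H t" using H_mono unfolding eventually_at_top_linorder by blast
  have "\<forall>\<^sub>F s in at_top. (\<Sum>j<nat \<lceil>s0\<rceil>. H (real j)) \<le> H s" using H_top unfolding filterlim_at_top by blast
  then obtain s1 where s1: "\<And>s. s1 \<le> s \<Longrightarrow> (\<Sum>j<nat \<lceil>s0\<rceil>. H (real j)) \<le> H s" unfolding eventually_at_top_linorder by blast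
  have "H (real j) \<le> H s" if "s1 \<le> s" "real j \<le> s" for s j
  proof (cases "s0 \<le> real j")
    case False
    then have "int j < \<lceil>s0\<rceil>" by (simp add: less_ceiling_iff)
    then have "j \<in> {..<nat \<lceil>s0\<rceil>}" by simp
    then have "H (real j) \<le> (\<Sum>j<nat \<lceil>s0\<rceil>. H (real j))"
      by (rule member_le_sum) (use H_pos in \<open>auto intro: less_imp_le\<close>)
    then show ?thesis using s1[OF that(1)] by linarith
  qed (use s0 that in blast)
  then show ?thesis by blast
qed

text \<open>At most two patches contribute at a point, each at most \<open>B * H s\<close>. The
  corrector is at most \<open>corr_sum N\<close>, hence at most \<open>H N\<close>, where N is s
  rounded up; going back from N to s costs the factor \<open>exp (\<rho> + 1)\<close>.\<close>

lemma glued_upper: "\<exists>C\<ge>0. \<forall>\<^sub>F s in at_top. \<forall>x. norm x \<le> exp s \<longrightarrow> glued x \<le> C * H s"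
proof -
  obtain B where B: "0 \<le> B" "\<And>j x. patch_int j x \<le> B" using patch_int_le by blast
  obtain s1 where s1: "\<And>s j. s1 \<le> s \<Longrightarrow> real j \<le> s \<Longrightarrow> H (real j) \<le> H s" using H_nat_le by blast
  have "\<forall>\<^sub>F N in sequentially. corr_sum N / H (real N) < 1" by (rule order_tendstoD(2)[OF corr_sum_small]) simp
  then obtain N1 where N1: "\<And>N. N1 \<le> N \<Longrightarrow> corr_sum N / H (real N) < 1" by (auto simp: eventually_sequentially)
  define C where "C = 2 * B + exp (\<rho> + 1)"
  have ev: "\<forall>\<^sub>F s in at_top. \<forall>t. \<bar>t\<bar> \<le> 1 \<longrightarrow> \<bar>ln (H (s + t)) - ln (H s) - \<rho> * t\<bar> \<le> 1 * 1" by (rule H_slow) simp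
  have "\<forall>\<^sub>F s in at_top. \<forall>x. norm x \<le> exp s \<longrightarrow> glued x \<le> C * H s"
    using ev eventually_ge_at_top[of s1] eventually_ge_at_top[of "real N1"]
  proof eventually_elim
    case (elim s)
    show ?case
    proof (intro allI impI)
      fix x :: "real^'m" assume x: "norm x \<le> exp s"
      define n where "n = nat \<lceil>norm x\<rceil>"
      \<comment> \<open>Outside J the patches vanish at x, and the integer part k of ln |x| confines
        J to k - 1 and k.\<close>
      define J where "J = {j. exp (real j) < norm x \<and> norm x < exp (real j + 2)}"
      define l where "l = ln (norm x)"
      define k where "k = nat \<lfloor>l\<rfloor>"
      have J: "J \<subseteq> {k - 1..k}"
      proof
        fix j assume j: "j \<in> J"
        then have "exp (real j) < norm x" by (simp add: J_def)
        then have "0 < norm x" by (rule less_trans[OF exp_gt_zero])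
        then have "exp l = norm x" by (simp add: l_def)
        then have "exp (real j) < exp l" "exp l < exp (real j + 2)" using j by (simp_all add: J_def)
        then have "real j < l" "l < real j + 2" unfolding exp_less_cancel_iff by simp_all
        then have "int j \<le> \<lfloor>l\<rfloor>" "\<lfloor>l\<rfloor> < int j + 2" by linarith+
        then have "j \<le> k" "k < j + 2" unfolding k_def by linarith+
        then show "j \<in> {k - 1..k}" by simp
      qed
      have "card J \<le> card {k - 1..k}" by (rule card_mono[OF _ J]) simp
      also have "\<dots> \<le> 2" by simp
      finally have cJ: "card J \<le> 2" .
      have fJ: "finite J" by (rule finite_subset[OF J]) simp
      have Hs: "0 < H s" by (rule H_pos)
      have "(\<Sum>j<n. patch j x) = (\<Sum>j\<in>{..<n} \<inter> J. patch j x)"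
      proof (rule sum.mono_neutral_right)
        show "\<forall>j\<in>{..<n} - {..<n} \<inter> J. patch j x = 0"
        proof
          fix j assume "j \<in> {..<n} - {..<n} \<inter> J"
          then have "norm x \<le> exp (real j) \<or> exp (real j + 2) \<le> norm x" by (auto simp: J_def not_less)
          then show "patch j x = 0" by (elim disjE) (erule patch_eq_0_inner(1), erule patch_eq_0_outer(1))
        qed
      qed simp_all
      also have "\<dots> \<le> (\<Sum>j\<in>{..<n} \<inter> J. B * H s)"
      proof (rule sum_mono)
        fix j assume "j \<in> {..<n} \<inter> J"
        then have "exp (real j) < norm x" by (simp add: J_def)
        then have "exp (real j) < exp s" using x by linarith
        then have "real j \<le> s" by simp
        then have h: "H (real j) \<le> H s" by (rule s1[OF elim(2)])
        have "patch j x \<le> H (real j) * B" unfolding patch_def using B(2) H_pos[of "real j"] by (intro mult_left_mono) auto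
        also have "\<dots> \<le> H s * B" using h B(1) by (intro mult_right_mono)
        finally show "patch j x \<le> B * H s" by (simp add: mult.commute)
      qed
      also have "\<dots> = real (card ({..<n} \<inter> J)) * (B * H s)" by simp
      also have "\<dots> \<le> 2 * (B * H s)"
      proof (intro mult_right_mono)
        have "card ({..<n} \<inter> J) \<le> card J" by (rule card_mono[OF fJ]) simp
        then show "real (card ({..<n} \<inter> J)) \<le> 2" using cJ by linarith
      qed (use B(1) Hs in simp)
      finally have 1: "(\<Sum>j<n. patch j x) \<le> 2 * (B * H s)" .
      define N where "N = nat \<lceil>s\<rceil>"
      have N: "s \<le> real N" "real N \<le> s + 1" "N1 \<le> N"
      proof -
        have s0: "0 \<le> s" using elim(3) by (rule order_trans[OF of_nat_0_le_iff])
        then have "real N = real_of_int \<lceil>s\<rceil>" by (simp add: N_def)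
        then show "s \<le> real N" "real N \<le> s + 1" by linarith+
        then show "N1 \<le> N" using elim(3) by linarith
      qed
      have "exp s \<le> exp (real N)" using N(1) by simp
      then have "(\<Sum>j<n. corr_coeff j * radial_cube (real j - 1) x) \<le> corr_sum N" using x by (intro corr_le_corr_sum) linarith
      also have "corr_sum N \<le> H (real N)" using N1[OF N(3)] H_pos[of "real N"] by (simp add: divide_less_eq)
      also have "H (real N) \<le> exp (\<rho> + 1) * H s"
      proof -
        have "\<bar>ln (H (s + (real N - s))) - ln (H s) - \<rho> * (real N - s)\<bar> \<le> 1 * 1"
          by (rule elim(1)[rule_format]) (use N in \<open>simp add: abs_le_iff\<close>)
        moreover have "\<rho> * (real N - s) \<le> \<rho> * 1" using N rho_pos by (intro mult_left_mono) auto
        ultimately have "ln (H (real N)) \<le> (\<rho> + 1) + ln (H s)" by (simp add: abs_le_iff)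
        then have "exp (ln (H (real N))) \<le> exp ((\<rho> + 1) + ln (H s))" by simp
        then show ?thesis unfolding exp_add[of "\<rho> + 1"] by (simp add: H_pos)
      qed
      finally have 2: "(\<Sum>j<n. corr_coeff j * radial_cube (real j - 1) x) \<le> exp (\<rho> + 1) * H s" .
      have "glued x = (\<Sum>j<n. patch j x) + (\<Sum>j<n. corr_coeff j * radial_cube (real j - 1) x)"
        unfolding glued_def summand_def n_def[symmetric] sum.distrib ..
      then show "glued x \<le> C * H s" using 1 2 unfolding C_def distrib_right by linarith
    qed
  qed
  moreover have "0 \<le> C" using B(1) by (simp add: C_def add_nonneg_nonneg)
  ultimately show ?thesis by blast
qed

section \<open>Limits of the rescalings\<close>

lemma y_Suc_conv:
  assumes "filterlim k at_top sequentially" "w \<in> U" "conv (\<lambda>n. y (k n)) w"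
  shows "conv (\<lambda>n. y (Suc (k n))) (T 1 w)"
proof (rule d_conv_other[OF T_U[OF y_U] y_U T_U[OF assms(2)] T_conv[OF y_U assms(2,3) tendsto_const[of 1]]])
  show "(\<lambda>n. d (T 1 (y (k n))) (y (Suc (k n)))) \<longlonglongrightarrow> 0" by (rule filterlim_compose[OF y_step assms(1)])
qed

text \<open>The map \<open>T (- 1)\<close> is uniformly continuous on \<open>U\<close>, so closeness
  of \<open>T 1 (y j)\<close> to \<open>y (Suc j)\<close> becomes closeness of \<open>y j\<close> to
  \<open>T (- 1) (y (Suc j))\<close>. The truncated subtraction is harmless because
  \<open>k n\<close> tends to infinity.\<close>

lemma y_pred_conv:
  assumes k: "filterlim k at_top sequentially" and w: "w \<in> U" "conv (\<lambda>n. y (k n)) w"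
  shows "conv (\<lambda>n. y (k n - 1)) (T (- 1) w)"
proof (rule d_conv_other[OF T_U[OF y_U] y_U T_U[OF w(1)] T_conv[OF y_U w tendsto_const[of "-1"]]])
  have "(\<lambda>j. d (T (- 1) (y (Suc j))) (y j)) \<longlonglongrightarrow> 0"
    unfolding tendsto_iff
  proof (intro allI impI)
    fix e :: real assume e: "0 < e"
    obtain \<delta> where \<delta>: "0 < \<delta>" "\<And>a b s. a \<in> U \<Longrightarrow> b \<in> U \<Longrightarrow> d a b < \<delta> \<Longrightarrow> \<bar>s\<bar> \<le> 1 \<Longrightarrow> d (T s a) (T s b) < e"
      using T_uniform[OF e, of 1] by blast
    from order_tendstoD(2)[OF y_step \<delta>(1)]
    show "\<forall>\<^sub>F j in sequentially. dist (d (T (- 1) (y (Suc j))) (y j)) 0 < e"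
    proof eventually_elim
      case (elim j)
      have "d (T (- 1) (y (Suc j))) (T (- 1) (T 1 (y j))) < e"
        by (rule \<delta>(2)[OF y_U T_U[OF y_U]]) (use elim d_sym in simp_all)
      then show ?case using d_nonneg by (simp add: T_T)
    qed
  qed
  moreover have "filterlim (\<lambda>n. k n - 1) at_top sequentially"
    unfolding filterlim_at_top
  proof
    fix Z
    show "\<forall>\<^sub>F n in sequentially. Z \<le> k n - 1" 
      using k unfolding filterlim_at_top by (auto elim!: eventually_mono dest!: spec[of _ "Suc Z"])
  qed
  ultimately have "(\<lambda>n. d (T (- 1) (y (Suc (k n - 1)))) (y (k n - 1))) \<longlonglongrightarrow> 0" by (rule filterlim_compose)
  moreover have "\<forall>\<^sub>F n in sequentially. d (T (- 1) (y (Suc (k n - 1)))) (y (k n - 1)) = d (T (- 1) (y (k n))) (y (k n - 1))"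
  proof -
    have "\<forall>\<^sub>F n in sequentially. 1 \<le> k n" using k unfolding filterlim_at_top by blast
    then show ?thesis by eventually_elim simp
  qed
  ultimately show "(\<lambda>n. d (T (- 1) (y (k n))) (y (k n - 1))) \<longlonglongrightarrow> 0" by (rule Lim_transform_eventually)
qed

lemma filterlim_diff_nat: "filterlim k at_top sequentially \<Longrightarrow> filterlim (\<lambda>n. k n - L :: nat) at_top sequentially"
  unfolding filterlim_at_top
proof
  fix Z assume "\<forall>Z. \<forall>\<^sub>F n in sequentially. Z \<le> k n"
  then have "\<forall>\<^sub>F n in sequentially. Z + L \<le> k n" by blast
  then show "\<forall>\<^sub>F n in sequentially. Z \<le> k n - L" by eventually_elim simp
qed

lemma filterlim_add_nat: "filterlim k at_top sequentially \<Longrightarrow> filterlim (\<lambda>n. k n + i :: nat) at_top sequentially"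
  by (rule filterlim_at_top_mono[where f = k]) (auto intro: always_eventually)

text \<open>All patches at a bounded distance from the index \<open>k n\<close> thus follow one
  orbit, that of w.\<close>

lemma y_shift_conv:
  assumes k: "filterlim k at_top sequentially" and w: "w \<in> U" "conv (\<lambda>n. y (k n)) w"
  shows "conv (\<lambda>n. y (k n - L + i)) (T (real i - real L) w)"
proof -
  have "conv (\<lambda>n. y (k n - L)) (T (- real L) w)"
  proof (induction L)
    case 0
    then show ?case using w(2) by simp
  next
    case (Suc L)
    have "conv (\<lambda>n. y (k n - L - 1)) (T (- 1) (T (- real L) w))"
      by (rule y_pred_conv[OF filterlim_diff_nat[OF k] T_U[OF w(1)] Suc])
    moreover have "- 1 + - real L = - real (Suc L)" by simp
    ultimately show ?case by (simp add: T_T)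
  qed
  note 0 = this
  show ?thesis
  proof (induction i)
    case 0
    then show ?case using \<open>conv (\<lambda>n. y (k n - L)) (T (- real L) w)\<close> by simp
  next
    case (Suc i)
    have "conv (\<lambda>n. y (Suc (k n - L + i))) (T 1 (T (real i - real L) w))"
      by (rule y_Suc_conv[OF filterlim_add_nat[OF filterlim_diff_nat[OF k]] T_U[OF w(1)] Suc])
    moreover have "1 + (real i - real L) = real (Suc i) - real L" by simp
    ultimately show ?case by (simp add: T_T)
  qed
qed

lemma continuous_patch_int: "continuous_on UNIV (patch_int j)"
  unfolding patch_int_def[abs_def]
  by (rule continuous_kernel_integral[OF continuous_on_cut_ker(1)[OF \<mu>_pos \<mu>_half] cut_ker_support(1)[OF \<mu>_pos \<mu>_half] y_props])

text \<open>Fubini moves the smoothing from \<open>y (j n)\<close> onto \<kappa>. As the radii tend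
  to 0, the result tends uniformly to \<kappa> times \<open>annulus_cut\<close>, so convergence of
  the y's as distributions is enough.\<close>

lemma patch_int_limit:
  fixes \<kappa> :: "real^'m \<Rightarrow> real"
  assumes j: "filterlim j at_top sequentially" and v: "v \<in> U" "conv (\<lambda>n. y (j n)) v"
    and \<kappa>: "continuous_on UNIV \<kappa>" "\<And>x. x \<notin> cball 0 R \<Longrightarrow> \<kappa> x = 0"
  shows "(\<lambda>n. LINT x|lborel. \<kappa> x * patch_int (j n) x) \<longlonglongrightarrow> (LINT z|lborel. real_of_ereal (v z) * (annulus_cut z * \<kappa> z))"
proof -
  define \<Psi> where "\<Psi> n z = (LINT x|lborel. \<kappa> x * cut_ker (\<mu> (j n)) x z)" for n z
  have m\<kappa>: "\<kappa> \<in> borel_measurable borel" by (rule borel_measurable_continuous_onI[OF \<kappa>(1)])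
  obtain B where B: "0 \<le> B" "\<And>x. x \<in> cball 0 R \<Longrightarrow> \<bar>\<kappa> x\<bar> \<le> B"
    using continuous_bounded_on_cball[OF continuous_on_subset[OF \<kappa>(1) subset_UNIV]] by metis
  have B': "\<bar>\<kappa> x\<bar> \<le> B" for x using B \<kappa>(2)[of x] by (cases "x \<in> cball 0 R") auto
  have fub: "(LINT x|lborel. \<kappa> x * patch_int (j n) x) = (LINT z|lborel. real_of_ereal (y (j n) z) * \<Psi> n z)" for n
    unfolding patch_int_def \<Psi>_def
    by (rule Fubini_kernel[where v = "\<lambda>x. x", OF m\<kappa> B' \<kappa>(2) continuous_on_id continuous_on_cut_ker(1)[OF \<mu>_pos \<mu>_half] cut_ker_support(1)[OF \<mu>_pos \<mu>_half] y_props])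
  have sw: "continuous_on UNIV (\<lambda>p::(real^'m) \<times> (real^'m). (snd p, fst p))" by (intro continuous_intros)
  have c\<Psi>: "continuous_on UNIV (\<Psi> n)" for n
    unfolding \<Psi>_def[abs_def]
  proof (rule continuous_kernel_integral[where S = "exp 2", OF _ _ m\<kappa>])
    show "continuous_on UNIV (\<lambda>p. cut_ker (\<mu> (j n)) (snd p) (fst p :: real^'m))"
      using continuous_on_compose2[OF continuous_on_cut_ker(1)[OF \<mu>_pos \<mu>_half] sw] by simp
    show "cut_ker (\<mu> (j n)) x z = 0" if "x \<notin> cball 0 (exp 2)" for z x :: "real^'m"
      using annulus_cut_eq_0(2)[of x] that by (simp add: cut_ker_def)
    show "integrable lborel (\<lambda>z. indicator (cball 0 (exp 2)) z * \<kappa> z)"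
      by (rule integrable_bounded_on_cball[of _ 0 R B]) (use m\<kappa> B' B \<kappa>(2) in \<open>auto simp: indicator_def\<close>)
  qed
  have c': "continuous_on UNIV (\<lambda>z. annulus_cut z * \<kappa> z)" by (intro continuous_intros continuous_on_annulus_cut \<kappa>)
  have \<Psi>eq: "\<Psi> n z = (LINT x|lborel. ker (\<mu> (j n)) x z * (annulus_cut x * \<kappa> x))" for n z
    unfolding \<Psi>_def cut_ker_def by (intro Bochner_Integration.integral_cong) (simp_all add: mult_ac)
  have S: "(0::real) < 2 * exp 2" by simp
  have "(\<lambda>n. LINT z|lborel. real_of_ereal (y (j n) z) * \<Psi> n z) \<longlonglongrightarrow> (LINT z|lborel. real_of_ereal (v z) * (annulus_cut z * \<kappa> z))"
  proof (rule U_pairing_limit[where S = "2 * exp 2", OF y_U v borel_measurable_continuous_onI[OF c\<Psi>] _ c' _ S])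
    show "\<Psi> n z = 0" if "z \<notin> cball 0 (2 * exp 2)" for n z
      unfolding \<Psi>_def by (simp add: cut_ker_support(1)[OF \<mu>_pos \<mu>_half that])
    show "annulus_cut z * \<kappa> z = 0" if "z \<notin> cball 0 (2 * exp 2)" for z
    proof -
      have "exp 2 \<le> (2::real) * exp 2" "2 * exp 2 < norm z" using that by simp_all
      then have "exp 2 \<le> norm z" by linarith
      then show ?thesis by (simp add: annulus_cut_eq_0(2))
    qed
    fix e :: real assume e: "0 < e"
    have z0: "annulus_cut x * \<kappa> x = 0" if "x \<notin> cball 0 R" for x using \<kappa>(2)[OF that] by simp
    have zz: "annulus_cut (0::real^'m) * \<kappa> 0 = 0" by (simp add: annulus_cut_eq_0(1))
    have lim: "(\<lambda>n. \<mu> (j n)) \<longlonglongrightarrow> 0" by (rule filterlim_compose[OF \<mu>_lim j])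
    show "\<forall>\<^sub>F n in sequentially. \<forall>z. \<bar>\<Psi> n z - annulus_cut z * \<kappa> z\<bar> \<le> e"
      unfolding \<Psi>eq by (rule ker_approximate_identity[OF c' z0 zz \<mu>_pos \<mu>_half lim e])
  qed
  then show ?thesis unfolding fub .
qed

lemma patch_location:
  assumes "patch j x \<noteq> 0"
  shows "exp (real j) < norm x" "norm x < exp (real j + 2)" "j < nat \<lceil>norm x\<rceil>"
proof -
  show 1: "exp (real j) < norm x" "norm x < exp (real j + 2)"
    using assms patch_eq_0_inner(1)[of x j] patch_eq_0_outer(1)[of j x] not_le by blast+
  have "1 + real j \<le> exp (real j)" by (rule exp_ge_add_one_self)
  then have "real j < norm x" using 1(1) by linarith
  then show "j < nat \<lceil>norm x\<rceil>" by (simp add: zless_nat_eq_int_zless less_ceiling_iff)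
qed

text \<open>Each term is a difference of consecutive values of \<open>c\<close>, and
  \<open>c\<close> falls from 1 to 0 over the range. The range starts at L + 2 rather than L because
  a patch extends over two scales.\<close>

lemma annulus_cut_sum:
  fixes z :: "real^'m"
  assumes z: "exp (- real L) \<le> norm z" "norm z \<le> exp (real M)"
  shows "(\<Sum>i<L + M + 3. annulus_cut (P (exp (real (L + 2) - real i)) z)) = 1"
proof -
  define c where "c i = cutoff (P (exp (real (L + 2) - real i)) z)" for i
  have cn: "cutoff a = cutoff b" if "norm a = norm b" for a b :: "real^'m" using that by (simp add: cutoff_def)
  have ac: "annulus_cut (P (exp (real (L + 2) - real i)) z) = c i - c (Suc i)" for i
  proof -
    have "norm (exp (- 1 :: real) *\<^sub>R P (exp (real (L + 2) - real i)) z) = norm (P (exp (real (L + 2) - real (Suc i))) z)"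
      by (simp add: norm_P mult.assoc[symmetric] mult_exp_exp)
    from cn[OF this] show ?thesis unfolding annulus_cut_def c_def by simp
  qed
  have "exp 1 \<le> norm (P (exp (real (L + 2) - real 0)) z)"
  proof -
    have "exp (real L + 2) * exp (- real L) \<le> exp (real L + 2) * norm z" using z(1) by (intro mult_left_mono) auto
    then have "exp 2 \<le> exp (real L + 2) * norm z" by (simp add: mult_exp_exp)
    moreover have "exp (1::real) \<le> exp 2" by simp
    ultimately have "exp 1 \<le> exp (real L + 2) * norm z" by linarith
    then show ?thesis by (simp add: norm_P add.commute)
  qed
  then have c0: "c 0 = 1" unfolding c_def by (rule cutoff_eq(4))
  have "norm (P (exp (real (L + 2) - real (L + M + 3))) z) \<le> 1"
  proof -
    have "exp (- real M - 1) * norm z \<le> exp (- real M - 1) * exp (real M)" using z(2) by (intro mult_left_mono) auto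
    moreover have "exp (- real M - 1) * exp (real M) \<le> 1" by (simp add: mult_exp_exp)
    moreover have "real (L + 2) - real (L + M + 3) = - real M - 1" by simp
    ultimately show ?thesis by (simp only: norm_P exp_gt_zero)
  qed
  then have cN: "c (L + M + 3) = 0" unfolding c_def by (rule cutoff_eq(1))
  show ?thesis unfolding ac sum_lessThan_telescope' c0 cN by simp
qed

lemma glued_P_continuous: "0 < t \<Longrightarrow> continuous_on UNIV (\<lambda>x. glued (P t x))"
  using weak_laplacian_glued[of t] unfolding weak_laplacian_def by blast

text \<open>Away from 0 and infinity a fixed number of patches is involved. Each tends to the part
  of w selected by a rescaled \<open>annulus_cut\<close>, these parts add up to w on the support of
  \<psi>, and the corrector is o(H).\<close>

lemma glued_limit_annulus:
  fixes \<psi> :: "real^'m \<Rightarrow> real"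
  assumes k: "filterlim k at_top sequentially" and w: "w \<in> U" "conv (\<lambda>n. y (k n)) w"
    and \<psi>: "continuous_on UNIV \<psi>" "\<And>x. exp (real M) < norm x \<Longrightarrow> \<psi> x = 0" "\<And>x. norm x < exp (- real L) \<Longrightarrow> \<psi> x = 0"
  shows "(\<lambda>n. LINT x|lborel. glued (P (exp (real (k n))) x) / H (real (k n)) * \<psi> x) \<longlonglongrightarrow> (LINT z|lborel. real_of_ereal (w z) * \<psi> z)"
proof -
  define N where "N = L + M + 3"
  \<comment> \<open>The first index of a range containing all patches that reach the annulus at
    scale e^(k n). The truncated subtraction is exact as soon as
    \<open>L + 2 \<le> k n\<close>.\<close>
  define m where "m n = k n - (L + 2)" for n
  define \<tau> where "\<tau> i = real (L + 2) - real i" for i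
  define t where "t n i x = patch (m n + i) (P (exp (real (k n))) x) / H (real (k n))" for n i x
  \<comment> \<open>What is left besides the N patches. For large n it is, on the support of \<psi>,
    just the corrector divided by \<open>H (real (k n))\<close>.\<close>
  define g where "g n x = glued (P (exp (real (k n))) x) / H (real (k n)) - (\<Sum>i<N. t n i x)" for n x
  let ?ac = "\<lambda>i z. annulus_cut (P (exp (\<tau> i)) z) * \<psi> z"
  let ?I = "\<lambda>i. LINT z|lborel. real_of_ereal (w z) * ?ac i z"
  have \<psi>0: "\<psi> x = 0" if "x \<notin> cball 0 (exp (real M))" for x using \<psi>(2)[of x] that by simp
  have iprod: "integrable lborel (\<lambda>x. F x * \<psi> x)" if F: "continuous_on UNIV F" for F
  proof -
    have c: "continuous_on UNIV (\<lambda>x. F x * \<psi> x)" by (intro continuous_intros F \<psi>(1))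
    obtain B where B: "\<And>x. x \<in> cball 0 (exp (real M)) \<Longrightarrow> \<bar>F x * \<psi> x\<bar> \<le> B"
      using continuous_bounded_on_cball[OF continuous_on_subset[OF c subset_UNIV]] by metis
    show ?thesis by (rule integrable_bounded_on_cball[of "\<lambda>x. F x * \<psi> x" 0 "exp (real M)" B, OF borel_measurable_continuous_onI[OF c] B])
         (simp_all add: \<psi>0)
  qed
  have ev: "\<forall>\<^sub>F n in sequentially. L + 2 \<le> k n" using k unfolding filterlim_at_top by blast
  have Pm: "P (exp (- real (m n + i))) (P (exp (real (k n))) x) = P (exp (\<tau> i)) x" if "L + 2 \<le> k n" for n i x
  proof -
    have "- real (m n + i) + real (k n) = \<tau> i" using that by (simp add: m_def \<tau>_def of_nat_diff)
    then show ?thesis by (simp add: P_P mult_exp_exp)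
  qed
  have t_eq: "t n i x = H (real (m n + i)) / H (real (k n)) * patch_int (m n + i) (P (exp (\<tau> i)) x)" if "L + 2 \<le> k n" for n i x
    using Pm[OF that] by (simp add: t_def patch_def)
  have ct: "continuous_on UNIV (t n i)" for n i
  proof -
    have "continuous_on UNIV (\<lambda>x. P (exp (- real (m n + i))) (P (exp (real (k n))) x))"
      by (rule continuous_on_compose2[OF continuous_on_P_fixed[of _ UNIV] continuous_on_P_fixed]) auto
    then have "continuous_on UNIV (\<lambda>x. patch_int (m n + i) (P (exp (- real (m n + i))) (P (exp (real (k n))) x)))"
      by (rule continuous_on_compose2[OF continuous_patch_int]) simp
    moreover have "H (real (k n)) \<noteq> 0" using H_pos[of "real (k n)"] by simp
    ultimately show ?thesis unfolding t_def[abs_def] patch_def by (intro continuous_intros) auto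
  qed
  have cg: "continuous_on UNIV (g n)" for n
  proof -
    have "H (real (k n)) \<noteq> 0" using H_pos[of "real (k n)"] by simp
    then show ?thesis unfolding g_def[abs_def]
      by (intro continuous_on_diff continuous_on_divide glued_P_continuous continuous_on_const continuous_on_sum ct) simp_all
  qed
  have split: "(LINT x|lborel. glued (P (exp (real (k n))) x) / H (real (k n)) * \<psi> x) = (\<Sum>i<N. LINT x|lborel. t n i x * \<psi> x) + (LINT x|lborel. g n x * \<psi> x)" for n
  proof -
    have "(\<Sum>i<N. LINT x|lborel. t n i x * \<psi> x) + (LINT x|lborel. g n x * \<psi> x) = (LINT x|lborel. (\<Sum>i<N. t n i x * \<psi> x) + g n x * \<psi> x)"
    proof -
      have "(\<Sum>i<N. LINT x|lborel. t n i x * \<psi> x) = (LINT x|lborel. (\<Sum>i<N. t n i x * \<psi> x))"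
        by (rule Bochner_Integration.integral_sum[symmetric]) (rule iprod[OF ct])
      moreover have "integrable lborel (\<lambda>x. \<Sum>i<N. t n i x * \<psi> x)"
        by (rule Bochner_Integration.integrable_sum) (rule iprod[OF ct])
      ultimately show ?thesis by (simp only: Bochner_Integration.integral_add[OF _ iprod[OF cg[of n]]])
    qed
    also have "\<dots> = (LINT x|lborel. glued (P (exp (real (k n))) x) / H (real (k n)) * \<psi> x)"
      by (intro Bochner_Integration.integral_cong) (simp_all add: g_def sum_distrib_right left_diff_distrib)
    finally show ?thesis by simp
  qed
  have gb: "\<bar>g n x * \<psi> x\<bar> \<le> corr_sum (k n + M) / H (real (k n)) * \<bar>\<psi> x\<bar>" if kn: "L + 2 \<le> k n" for n x
  proof (cases "\<psi> x = 0")
    case False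
    then have nx: "exp (- real L) \<le> norm x" "norm x \<le> exp (real M)" using \<psi>(2)[of x] \<psi>(3)[of x] not_le by blast+
    define X where "X = P (exp (real (k n))) x"
    have nX: "norm X = exp (real (k n)) * norm x" by (simp add: X_def norm_P)
    have X1: "exp (real (k n) - real L) \<le> norm X" and X2: "norm X \<le> exp (real (k n + M))"
      unfolding nX using mult_left_mono[OF nx(1), of "exp (real (k n))"] mult_left_mono[OF nx(2), of "exp (real (k n))"]
      by (simp_all add: mult_exp_exp)
    define A where "A = {..<nat \<lceil>norm X\<rceil>}"
    let ?C = "\<Sum>j\<in>A. corr_coeff j * radial_cube (real j - 1) X"
    have "(\<Sum>j\<in>A. patch j X) = (\<Sum>j\<in>A \<union> {m n..<m n + N}. patch j X)"
      by (rule sum.mono_neutral_left) (use patch_location(3) in \<open>auto simp: A_def\<close>)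
    also have "\<dots> = (\<Sum>j\<in>{m n..<m n + N}. patch j X)"
    proof (rule sum.mono_neutral_right)
      show "\<forall>j\<in>A \<union> {m n..<m n + N} - {m n..<m n + N}. patch j X = 0"
      proof (rule ballI, rule ccontr)
        fix j assume j: "j \<in> A \<union> {m n..<m n + N} - {m n..<m n + N}" and nz: "patch j X \<noteq> 0"
        have "exp (real j) < exp (real (k n + M))" "exp (real (k n) - real L) < exp (real j + 2)"
          using patch_location(1,2)[OF nz] X1 X2 by linarith+
        then have "real j < real (k n + M)" "real (k n) - real L < real j + 2" unfolding exp_less_cancel_iff by simp_all
        then have "j < k n + M" "k n < j + 2 + L" by linarith+
        then have "m n \<le> j" "j < m n + N" using kn unfolding m_def N_def by linarith+
        then show False using j by simp
      qed
    qed (simp_all add: A_def)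
    also have "\<dots> = (\<Sum>i<N. patch (m n + i) X)"
      using sum.shift_bounds_nat_ivl[of "\<lambda>j. patch j X" 0 "m n" N] by (simp add: lessThan_atLeast0 add.commute)
    finally have "glued X = (\<Sum>i<N. patch (m n + i) X) + ?C"
      unfolding glued_def A_def summand_def sum.distrib by simp
    then have g: "g n x = ?C / H (real (k n))"
      unfolding g_def t_def X_def[symmetric] by (simp add: sum_divide_distrib[symmetric] add_divide_distrib)
    have h: "0 < H (real (k n))" by (rule H_pos)
    have "0 \<le> ?C"
      by (intro sum_nonneg mult_nonneg_nonneg corr_coeff_nonneg radial_cube_nonneg)
    moreover have "?C \<le> corr_sum (k n + M)"
      unfolding A_def by (rule corr_le_corr_sum[OF X2])
    ultimately have "\<bar>g n x\<bar> \<le> corr_sum (k n + M) / H (real (k n))" unfolding g using h by (simp add: divide_right_mono)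
    then show ?thesis unfolding abs_mult by (intro mult_right_mono) auto
  qed simp
  have g0: "(\<lambda>n. LINT x|lborel. g n x * \<psi> x) \<longlonglongrightarrow> 0"
  proof -
    have kr: "filterlim (\<lambda>n. real (k n)) at_top sequentially" by (rule filterlim_compose[OF filterlim_real_sequentially k])
    have "(\<lambda>n. corr_sum (k n + M) / H (real (k n + M))) \<longlonglongrightarrow> 0" by (rule filterlim_compose[OF corr_sum_small filterlim_add_nat[OF k]])
    moreover have "(\<lambda>n. H (real (k n) + real M) / H (real (k n))) \<longlonglongrightarrow> exp (\<rho> * real M)" by (rule H_ratio_limit[OF kr tendsto_const])
    ultimately have "(\<lambda>n. corr_sum (k n + M) / H (real (k n + M)) * (H (real (k n) + real M) / H (real (k n)))) \<longlonglongrightarrow> 0 * exp (\<rho> * real M)" by (rule tendsto_mult)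
    moreover have "corr_sum (k n + M) / H (real (k n + M)) * (H (real (k n) + real M) / H (real (k n))) = corr_sum (k n + M) / H (real (k n))" for n
      using H_pos[of "real (k n) + real M"] by simp
    ultimately have "(\<lambda>n. corr_sum (k n + M) / H (real (k n))) \<longlonglongrightarrow> 0" by (simp only: mult_zero_left)
    from tendsto_mult[OF this tendsto_const[of "LINT x|lborel. \<bar>\<psi> x\<bar>"]]
    have lim: "(\<lambda>n. corr_sum (k n + M) / H (real (k n)) * (LINT x|lborel. \<bar>\<psi> x\<bar>)) \<longlonglongrightarrow> 0" by simp
    have i1: "integrable lborel (\<lambda>x. \<bar>\<psi> x\<bar>)" using integrable_abs[OF iprod[of "\<lambda>x. 1"]] by simp
    have "\<forall>\<^sub>F n in sequentially. norm (LINT x|lborel. g n x * \<psi> x) \<le> corr_sum (k n + M) / H (real (k n)) * (LINT x|lborel. \<bar>\<psi> x\<bar>)"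
      using ev
    proof eventually_elim
      case (elim n)
      have "norm (LINT x|lborel. g n x * \<psi> x) \<le> (LINT x|lborel. \<bar>g n x * \<psi> x\<bar>)" using integral_norm_bound[of lborel "\<lambda>x. g n x * \<psi> x"] by simp
      also have "\<dots> \<le> (LINT x|lborel. corr_sum (k n + M) / H (real (k n)) * \<bar>\<psi> x\<bar>)"
        by (rule integral_mono[OF integrable_abs[OF iprod[OF cg]] integrable_mult_right[OF i1]]) (rule gb[OF elim])
      finally show ?case by simp
    qed
    then show ?thesis by (rule Lim_null_comparison[OF _ lim])
  qed
  have ti: "(\<lambda>n. LINT x|lborel. t n i x * \<psi> x) \<longlonglongrightarrow> ?I i" for i
  proof -
    define \<kappa> where "\<kappa> x = \<psi> (P (exp (- \<tau> i)) x)" for x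
    let ?J = "LINT z|lborel. real_of_ereal (T (- \<tau> i) w z) * (annulus_cut z * \<kappa> z)"
    have c\<kappa>: "continuous_on UNIV \<kappa>" unfolding \<kappa>_def by (rule continuous_P_compose[OF \<psi>(1)]) simp
    have \<kappa>0: "\<kappa> x = 0" if "x \<notin> cball 0 (exp (\<tau> i + real M))" for x
      unfolding \<kappa>_def
    proof (rule \<psi>(2))
      have "exp (- \<tau> i) * exp (\<tau> i + real M) < exp (- \<tau> i) * norm x" using that by (intro mult_strict_left_mono) auto
      then show "exp (real M) < norm (P (exp (- \<tau> i)) x)" by (simp add: norm_P mult_exp_exp)
    qed
    have jlim: "filterlim (\<lambda>n. m n + i) at_top sequentially" unfolding m_def by (rule filterlim_add_nat[OF filterlim_diff_nat[OF k]])
    have yc: "conv (\<lambda>n. y (m n + i)) (T (- \<tau> i) w)"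
      using y_shift_conv[OF k w, of "L + 2" i] by (simp add: m_def \<tau>_def)
    have l1: "(\<lambda>n. LINT x|lborel. \<kappa> x * patch_int (m n + i) x) \<longlonglongrightarrow> ?J"
      by (rule patch_int_limit[OF jlim T_U[OF w(1)] yc c\<kappa> \<kappa>0])
    have kr: "filterlim (\<lambda>n. real (k n)) at_top sequentially" by (rule filterlim_compose[OF filterlim_real_sequentially k])
    have l2: "(\<lambda>n. H (real (k n) + - \<tau> i) / H (real (k n))) \<longlonglongrightarrow> exp (\<rho> * - \<tau> i)" by (rule H_ratio_limit[OF kr tendsto_const])
    have l3: "(\<lambda>n. H (real (k n) + - \<tau> i) / H (real (k n)) * ((LINT x|lborel. \<kappa> x * patch_int (m n + i) x) / exp (\<tau> i) ^ CARD('m)))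
      \<longlonglongrightarrow> exp (\<rho> * - \<tau> i) * (?J / exp (\<tau> i) ^ CARD('m))"
      by (intro tendsto_mult l2 tendsto_divide l1 tendsto_const) simp
    have mac: "(\<lambda>z. annulus_cut z * \<kappa> z) \<in> borel_measurable borel"
      by (intro borel_measurable_continuous_onI continuous_on_mult continuous_on_annulus_cut c\<kappa>)
    have \<kappa>P: "\<kappa> (P (exp (\<tau> i)) z) = \<psi> z" for z by (simp add: \<kappa>_def P_inv)
    \<comment> \<open>The limit of the ratio of \<open>H\<close> undoes the normalisation in
      \<open>T (- \<tau> i)\<close>, and the Jacobians of the two opposite scalings cancel.\<close>
    have e1: "exp (\<rho> * - \<tau> i) * (?J / exp (\<tau> i) ^ CARD('m))
      = ?I i"
    proof -
      have TI: "?J =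
        exp (- \<rho> * - \<tau> i) / exp (- \<tau> i) ^ CARD('m) * ?I i"
        using T_integral[OF w(1) mac, of "- \<tau> i"] by (simp add: \<kappa>P)
      have "exp (\<rho> * - \<tau> i) * ((exp (- \<rho> * - \<tau> i) / exp (- \<tau> i) ^ CARD('m) * I) / exp (\<tau> i) ^ CARD('m)) = I" for I :: real
      proof -
        have "exp (- \<tau> i) ^ CARD('m) * exp (\<tau> i) ^ CARD('m) = 1" by (simp add: power_mult_distrib[symmetric] exp_minus)
        moreover have "exp (\<rho> * - \<tau> i) * exp (- \<rho> * - \<tau> i) = 1" by (simp add: mult_exp_exp)
        ultimately have "(exp (\<rho> * - \<tau> i) * exp (- \<rho> * - \<tau> i)) * I / (exp (- \<tau> i) ^ CARD('m) * exp (\<tau> i) ^ CARD('m)) = I" by simp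
        then show ?thesis by simp
      qed
      then show ?thesis unfolding TI .
    qed
    have e2: "\<forall>\<^sub>F n in sequentially. H (real (k n) + - \<tau> i) / H (real (k n)) * ((LINT x|lborel. \<kappa> x * patch_int (m n + i) x) / exp (\<tau> i) ^ CARD('m)) = (LINT x|lborel. t n i x * \<psi> x)"
      using ev
    proof eventually_elim
      case (elim n)
      have mk: "real (k n) + - \<tau> i = real (m n + i)" using elim by (simp add: m_def \<tau>_def of_nat_diff)
      have mf: "(\<lambda>x. \<kappa> x * patch_int (m n + i) x) \<in> borel_measurable borel"
        by (intro borel_measurable_continuous_onI continuous_on_mult c\<kappa> continuous_patch_int)
      have "(LINT x|lborel. t n i x * \<psi> x) = (LINT x|lborel. H (real (m n + i)) / H (real (k n)) * (\<kappa> (P (exp (\<tau> i)) x) * patch_int (m n + i) (P (exp (\<tau> i)) x)))"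
        unfolding t_eq[OF elim] \<kappa>P by (simp add: mult_ac)
      also have "\<dots> = H (real (m n + i)) / H (real (k n)) * (LINT x|lborel. \<kappa> (P (exp (\<tau> i)) x) * patch_int (m n + i) (P (exp (\<tau> i)) x))" by simp
      also have "(LINT x|lborel. \<kappa> (P (exp (\<tau> i)) x) * patch_int (m n + i) (P (exp (\<tau> i)) x)) = (LINT x|lborel. \<kappa> x * patch_int (m n + i) x) / exp (\<tau> i) ^ CARD('m)"
        by (rule integral_P(1)[OF exp_gt_zero mf])
      finally show ?case unfolding mk by simp
    qed
    show ?thesis using Lim_transform_eventually[OF l3 e2] unfolding e1 .
  qed
  have final: "(\<Sum>i<N. ?I i) = (LINT z|lborel. real_of_ereal (w z) * \<psi> z)"
  proof -
    obtain B where B: "0 \<le> B" "\<And>x. x \<in> cball 0 (exp (real M)) \<Longrightarrow> \<bar>\<psi> x\<bar> \<le> B"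
      using continuous_bounded_on_cball[OF continuous_on_subset[OF \<psi>(1) subset_UNIV]] by metis
    have ii: "integrable lborel (\<lambda>z. real_of_ereal (w z) * ?ac i z)" for i
    proof (rule sh_integrable_times[OF U_sh[OF w(1)], of _ B "exp (real M)"])
      show "(\<lambda>z. annulus_cut (P (exp (\<tau> i)) z) * \<psi> z) \<in> borel_measurable borel"
        by (intro borel_measurable_continuous_onI continuous_on_mult \<psi>(1) continuous_P_compose continuous_on_annulus_cut) simp
      fix z :: "real^'m"
      show "\<bar>annulus_cut (P (exp (\<tau> i)) z) * \<psi> z\<bar> \<le> B"
      proof (cases "z \<in> cball 0 (exp (real M))")
        case True
        have "\<bar>annulus_cut (P (exp (\<tau> i)) z)\<bar> * \<bar>\<psi> z\<bar> \<le> 1 * B"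
          using annulus_cut_bounds[of "P (exp (\<tau> i)) z"] B(2)[OF True] by (intro mult_mono) auto
        then show ?thesis by (simp add: abs_mult)
      qed (use \<psi>0 B(1) in simp)
      show "z \<notin> cball 0 (exp (real M)) \<Longrightarrow> annulus_cut (P (exp (\<tau> i)) z) * \<psi> z = 0" using \<psi>0 by simp
    qed
    have "(\<Sum>i<N. ?I i)
       = (LINT z|lborel. (\<Sum>i<N. real_of_ereal (w z) * ?ac i z))"
      by (rule Bochner_Integration.integral_sum[symmetric]) (rule ii)
    also have "\<dots> = (LINT z|lborel. real_of_ereal (w z) * \<psi> z)"
    proof (intro Bochner_Integration.integral_cong refl)
      fix z :: "real^'m"
      have "(\<Sum>i<N. annulus_cut (P (exp (\<tau> i)) z)) * \<psi> z = \<psi> z"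
      proof (cases "\<psi> z = 0")
        case False
        then have "exp (- real L) \<le> norm z" "norm z \<le> exp (real M)" using \<psi>(2)[of z] \<psi>(3)[of z] not_le by blast+
        then show ?thesis using annulus_cut_sum[of L z M] by (simp add: N_def \<tau>_def)
      qed simp
      moreover have "(\<Sum>i<N. real_of_ereal (w z) * ?ac i z) = real_of_ereal (w z) * ((\<Sum>i<N. annulus_cut (P (exp (\<tau> i)) z)) * \<psi> z)"
        by (simp add: sum_distrib_left sum_distrib_right)
      ultimately show "(\<Sum>i<N. real_of_ereal (w z) * ?ac i z) = real_of_ereal (w z) * \<psi> z" by simp
    qed
    finally show ?thesis .
  qed
  have "(\<lambda>n. (\<Sum>i<N. LINT x|lborel. t n i x * \<psi> x) + (LINT x|lborel. g n x * \<psi> x)) \<longlonglongrightarrow>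
    (\<Sum>i<N. ?I i) + 0"
    by (intro tendsto_add tendsto_sum ti g0)
  then show ?thesis unfolding split final by simp
qed

end

text \<open>By \<open>sh_L1_bound\<close> the L1 norm over a small ball is bounded by its volume,
  uniformly for functions that are 0 at the origin and have a common upper bound; so no mass
  concentrates at the origin. The volume factor (2 r)^m is replaced by 2 r, as 2 r \<le> 1.\<close>

lemma sh_small_ball_bound:
  fixes u :: "real^'m \<Rightarrow> ereal"
  assumes u: "u \<in> sh_functions" "u 0 = 0" and B: "0 \<le> B" "\<And>x. x \<in> ball 0 1 \<Longrightarrow> real_of_ereal (u x) \<le> B"
    and r: "0 < r" "r \<le> 1/2"
    and h: "h \<in> borel_measurable borel" "\<And>x. \<bar>h x\<bar> \<le> M" "\<And>x. x \<notin> cball 0 r \<Longrightarrow> h x = 0"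
  shows "\<bar>LINT x|lborel. real_of_ereal (u x) * h x\<bar> \<le> M * (2 * B * (2 * r * measure lborel (ball (0::real^'m) 1)))"
proof -
  define f where "f x = real_of_ereal (u x)" for x
  have M: "0 \<le> M" using h(2)[of 0] by linarith
  have i: "integrable lborel (\<lambda>z. indicator (cball 0 r) z * f z)" "integrable lborel (\<lambda>z. indicator (ball 0 (2 * r)) z * f z)"
    unfolding f_def by (rule sh_integrable_cball[OF u(1)], rule sh_integrable_ball[OF u(1)])
  have i': "integrable lborel (\<lambda>z. indicator (cball 0 r) z * \<bar>f z\<bar>)" "integrable lborel (\<lambda>z. indicator (ball 0 (2 * r)) z * \<bar>f z\<bar>)"
    using integrable_abs[OF i(1)] integrable_abs[OF i(2)] by (simp_all add: abs_mult)
  have mf: "f \<in> borel_measurable borel" unfolding f_def[abs_def] by (rule sh_real_measurable[OF u(1)])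
  have "\<bar>LINT x|lborel. f x * h x\<bar> \<le> M * (LINT z|lborel. indicator (cball 0 r) z * \<bar>f z\<bar>)"
    by (rule integrable_times_bounded(2)[OF mf i(1) h])
  also have "\<dots> \<le> M * (LINT z|lborel. indicator (ball 0 (2 * r)) z * \<bar>f z\<bar>)"
    by (intro mult_left_mono M integral_mono[OF i']) (use r in \<open>auto simp: indicator_def\<close>)
  also have "\<dots> \<le> M * (2 * B * measure lborel (ball (0::real^'m) (2 * r)))"
    unfolding f_def
  proof (intro mult_left_mono M sh_L1_bound u B(1))
    show "0 < 2 * r" using r by simp
    show "real_of_ereal (u x) \<le> B" if "x \<in> ball 0 (2 * r)" for x using B(2)[of x] that r by simp
  qed
  also have "measure lborel (ball (0::real^'m) (2 * r)) = (2 * r) ^ DIM(real^'m) * measure lborel (ball (0::real^'m) 1)"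
    using r by (intro measure_ball_rescale) simp
  also have "M * (2 * B * ((2 * r) ^ DIM(real^'m) * measure lborel (ball (0::real^'m) 1))) \<le> M * (2 * B * (2 * r * measure lborel (ball (0::real^'m) 1)))"
  proof (intro mult_left_mono mult_right_mono M measure_nonneg)
    show "(2 * r) ^ DIM(real^'m) \<le> 2 * r" using power_decreasing[of 1 "DIM(real^'m)" "2 * r"] r by simp
  qed (use B(1) in simp)
  finally show ?thesis unfolding f_def .
qed

lemma eventually_bounded_imp_bounded:
  fixes a :: "nat \<Rightarrow> real"
  assumes "\<forall>\<^sub>F n in sequentially. a n \<le> C"
  shows "\<exists>C. \<forall>n. a n \<le> C"
proof -
  obtain N where N: "\<And>n. N \<le> n \<Longrightarrow> a n \<le> C" using assms by (auto simp: eventually_sequentially)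
  have "a n \<le> \<bar>C\<bar> + (\<Sum>i<N. \<bar>a i\<bar>)" for n
  proof (cases "N \<le> n")
    case True
    then show ?thesis using N[OF True] sum_nonneg[of "{..<N}" "\<lambda>i. \<bar>a i\<bar>"] by linarith
  next
    case False
    then have "\<bar>a n\<bar> \<le> (\<Sum>i<N. \<bar>a i\<bar>)" by (intro member_le_sum[of n "{..<N}" "\<lambda>i. \<bar>a i\<bar>"]) auto
    then show ?thesis by linarith
  qed
  then show ?thesis by blast
qed

context azarin_construction
begin

lemma glued_0 [simp]: "glued 0 = 0"
  by (simp add: glued_def)

lemma glued_P_sh:
  assumes "0 < t" "0 < c"
  shows "(\<lambda>x. ereal (glued (P t x) / c)) \<in> sh_functions"
proof -
  have "weak_laplacian (\<lambda>x. 1 / c * glued (P t x)) (\<lambda>x. 1 / c * (t\<^sup>2 * glued_lap (P t x)))"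
    by (rule weak_laplacian_cmult[OF weak_laplacian_glued[OF assms(1)]])
  then have "subharmonic (\<lambda>x. ereal (1 / c * glued (P t x)))"
    by (rule weak_laplacian_nonneg_imp_subharmonic) (use assms glued_lap_nonneg in \<open>simp add: mult_nonneg_nonneg\<close>)
  then show ?thesis unfolding sh_functions_def by simp
qed

lemma rescale_glued:
  assumes "0 < t"
  shows "rescale p V (\<lambda>x. ereal (glued x)) t = (\<lambda>x. ereal (glued (P t x) / H (ln t)))"
proof -
  have "t powr (- p t) = 1 / H (ln t)" using assms by (simp add: H_eq powr_minus divide_inverse)
  then show ?thesis by (simp add: rescale_def fun_eq_iff)
qed

lemma glued_SH: "(\<lambda>x. ereal (glued x)) \<in> SH p"
proof -
  obtain C where C: "0 \<le> C" "\<forall>\<^sub>F s in at_top. \<forall>x. norm x \<le> exp s \<longrightarrow> glued x \<le> C * H s" using glued_upper by blast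
  have "\<forall>\<^sub>F r in at_top. \<forall>x. norm x \<le> exp (ln r) \<longrightarrow> glued x \<le> C * H (ln r)"
    using C(2) ln_at_top unfolding filterlim_iff by blast
  then have "\<forall>\<^sub>F r in at_top. ereal (r powr (- p r)) * max_on_sphere (\<lambda>x. ereal (glued x)) r \<le> ereal C"
    using eventually_gt_at_top[of 0]
  proof eventually_elim
    case (elim r)
    have "max_on_sphere (\<lambda>x. ereal (glued x)) r \<le> ereal (C * H (ln r))"
      unfolding max_on_sphere_def by (rule SUP_least) (use elim in simp)
    then have "ereal (r powr (- p r)) * max_on_sphere (\<lambda>x. ereal (glued x)) r \<le> ereal (r powr (- p r)) * ereal (C * H (ln r))"
      by (intro ereal_mult_left_mono) auto
    also have "\<dots> = ereal C"
    proof -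
      have "r powr (- p r) = 1 / H (ln r)" using elim by (simp add: H_eq powr_minus divide_inverse)
      then show ?thesis using H_pos[of "ln r"] by simp
    qed
    finally show ?case .
  qed
  then have "Limsup at_top (\<lambda>r. ereal (r powr (- p r)) * max_on_sphere (\<lambda>x. ereal (glued x)) r) \<le> ereal C"
    by (intro Limsup_bounded) auto
  then have "Limsup at_top (\<lambda>r. ereal (r powr (- p r)) * max_on_sphere (\<lambda>x. ereal (glued x)) r) < \<infinity>"
    by (rule le_less_trans) simp
  then show ?thesis using glued_P_sh[of 1 1] by (simp add: SH_def)
qed

lemma scaled_upper:
  assumes s: "filterlim s at_top sequentially" and R: "0 < R"
  shows "\<exists>B\<ge>0. \<forall>\<^sub>F n in sequentially. \<forall>x\<in>ball 0 R. glued (P (exp (s n)) x) / H (s n) \<le> B"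
proof -
  obtain C where C: "0 \<le> C" "\<forall>\<^sub>F s in at_top. \<forall>x. norm x \<le> exp s \<longrightarrow> glued x \<le> C * H s" using glued_upper by blast
  define B where "B = C * (exp (\<rho> * ln R) + 1)"
  have B: "0 \<le> B" unfolding B_def using C(1) by (intro mult_nonneg_nonneg add_nonneg_nonneg) auto
  have "filterlim (\<lambda>n. ln R + s n) at_top sequentially" by (rule filterlim_tendsto_add_at_top[OF tendsto_const s])
  then have sR: "filterlim (\<lambda>n. s n + ln R) at_top sequentially" by (simp add: add.commute)
  have ev1: "\<forall>\<^sub>F n in sequentially. \<forall>x. norm x \<le> exp (s n + ln R) \<longrightarrow> glued x \<le> C * H (s n + ln R)"
    by (rule eventually_compose_filterlim[OF C(2) sR])
  have "(\<lambda>n. H (s n + ln R) / H (s n)) \<longlonglongrightarrow> exp (\<rho> * ln R)" by (rule H_ratio_limit[OF s tendsto_const])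
  then have "\<forall>\<^sub>F n in sequentially. H (s n + ln R) / H (s n) < exp (\<rho> * ln R) + 1" by (rule order_tendstoD(2)) simp
  then have "\<forall>\<^sub>F n in sequentially. \<forall>x\<in>ball 0 R. glued (P (exp (s n)) x) / H (s n) \<le> B"
    using ev1
  proof eventually_elim
    case (elim n)
    show ?case
    proof
      fix x :: "real^'m" assume x: "x \<in> ball 0 R"
      have "exp (s n) * norm x \<le> exp (s n) * R" using x by (intro mult_left_mono) auto
      then have "norm (P (exp (s n)) x) \<le> exp (s n + ln R)" using R by (simp add: norm_P exp_add)
      then have "glued (P (exp (s n)) x) \<le> C * H (s n + ln R)" using elim(2) by blast
      then have "glued (P (exp (s n)) x) / H (s n) \<le> C * H (s n + ln R) / H (s n)"
        using H_pos[of "s n"] by (intro divide_right_mono) auto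
      also have "\<dots> = C * (H (s n + ln R) / H (s n))" by simp
      also have "\<dots> \<le> B" unfolding B_def using elim(1) C(1) by (intro mult_left_mono) auto
      finally show "glued (P (exp (s n)) x) / H (s n) \<le> B" .
    qed
  qed
  then show ?thesis using B by blast
qed

text \<open>A test function is split by a cutoff at radius e^(1-L). The rescalings and w are
  subharmonic, 0 at the origin and bounded above near it, so the inner part contributes little
  uniformly in n; the outer part is covered by \<open>glued_limit_annulus\<close>.\<close>

lemma glued_limit:
  fixes \<phi> :: "real^'m \<Rightarrow> real"
  assumes k: "filterlim k at_top sequentially" and w: "w \<in> U" "conv (\<lambda>n. y (k n)) w"
    and \<phi>: "continuous_on UNIV \<phi>" "\<And>x. x \<notin> cball 0 R \<Longrightarrow> \<phi> x = 0"
  shows "(\<lambda>n. LINT x|lborel. glued (P (exp (real (k n))) x) / H (real (k n)) * \<phi> x) \<longlonglongrightarrow> (LINT z|lborel. real_of_ereal (w z) * \<phi> z)"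
  unfolding tendsto_iff
proof (intro allI impI)
  fix e :: real assume e: "0 < e"
  define v where "v n x = ereal (glued (P (exp (real (k n))) x) / H (real (k n)))" for n x
  have vsh: "v n \<in> sh_functions" for n unfolding v_def[abs_def] by (rule glued_P_sh) (simp_all add: H_pos)
  have kr: "filterlim (\<lambda>n. real (k n)) at_top sequentially" by (rule filterlim_compose[OF filterlim_real_sequentially k])
  obtain B where B: "0 \<le> B" "\<forall>\<^sub>F n in sequentially. \<forall>x\<in>ball 0 1. glued (P (exp (real (k n))) x) / H (real (k n)) \<le> B"
    using scaled_upper[OF kr, of 1] by auto
  define B1 where "B1 = B + \<sigma>"
  have B1: "0 \<le> B1" "B \<le> B1" "\<sigma> \<le> B1" using B(1) sigma_pos by (auto simp: B1_def)
  obtain M0 where M0: "0 \<le> M0" "\<And>x. x \<in> cball 0 R \<Longrightarrow> \<bar>\<phi> x\<bar> \<le> M0"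
    using continuous_bounded_on_cball[OF continuous_on_subset[OF \<phi>(1) subset_UNIV]] by metis
  have M0': "\<bar>\<phi> x\<bar> \<le> M0" for x using M0 \<phi>(2)[of x] by (cases "x \<in> cball 0 R") auto
  define c1 where "c1 = measure lborel (ball (0::real^'m) 1)"
  have pw: "(\<lambda>L. exp (1 - real L)) \<longlonglongrightarrow> 0"
  proof -
    have "(\<lambda>L. exp 1 * exp (- 1 :: real) ^ L) \<longlonglongrightarrow> exp 1 * 0" by (intro tendsto_mult tendsto_const LIMSEQ_power_zero) simp
    then show ?thesis by (simp add: exp_of_nat_mult[symmetric] mult_exp_exp)
  qed
  have "(\<lambda>L. M0 * (2 * B1 * (2 * exp (1 - real L) * c1))) \<longlonglongrightarrow> M0 * (2 * B1 * (2 * 0 * c1))"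
    by (intro tendsto_mult tendsto_const pw)
  then have "\<forall>\<^sub>F L in sequentially. M0 * (2 * B1 * (2 * exp (1 - real L) * c1)) < e / 3"
    by (rule order_tendstoD(2)) (use e in simp)
  moreover have "\<forall>\<^sub>F L in sequentially. exp (1 - real L) < 1 / 2" by (rule order_tendstoD(2)[OF pw]) simp
  ultimately have "\<forall>\<^sub>F L in sequentially. M0 * (2 * B1 * (2 * exp (1 - real L) * c1)) < e / 3 \<and> exp (1 - real L) < 1 / 2"
    by (rule eventually_conj)
  \<comment> \<open>The inner parts of the rescaling and of w each cost less than e/3, which leaves
    e/3 for the convergence on the annulus. A radius of at most 1/2 is required by
    \<open>sh_small_ball_bound\<close>.\<close>
  then obtain L where L: "M0 * (2 * B1 * (2 * exp (1 - real L) * c1)) < e / 3" "exp (1 - real L) < 1 / 2"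
    unfolding eventually_sequentially by blast
  define r where "r = exp (1 - real L)"
  have r: "0 < r" "r \<le> 1/2" using L(2) by (simp_all add: r_def)
  define cut where "cut x = cutoff (exp (real L) *\<^sub>R x)" for x :: "real^'m"
  have ccut: "continuous_on UNIV cut" unfolding cut_def
    by (rule continuous_on_compose2[OF continuous_on_cutoff(1)[of UNIV]]) (auto intro!: continuous_intros)
  define \<psi> where "\<psi> x = \<phi> x * cut x" for x
  define h where "h x = \<phi> x * (1 - cut x)" for x
  have c\<psi>: "continuous_on UNIV \<psi>" unfolding \<psi>_def by (intro continuous_intros \<phi> ccut)
  have ch: "continuous_on UNIV h" unfolding h_def by (intro continuous_intros \<phi> ccut)
  have mh: "h \<in> borel_measurable borel" and m\<psi>: "\<psi> \<in> borel_measurable borel"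
    by (rule borel_measurable_continuous_onI, fact)+
  have cb: "0 \<le> cut x" "cut x \<le> 1" for x by (simp_all add: cut_def cutoff_bounds)
  have hb: "\<bar>h x\<bar> \<le> M0" for x
  proof -
    have "\<bar>\<phi> x\<bar> * \<bar>1 - cut x\<bar> \<le> M0 * 1" using M0'[of x] cb[of x] M0(1) by (intro mult_mono) auto
    then show ?thesis by (simp add: h_def abs_mult)
  qed
  have \<psi>b: "\<bar>\<psi> x\<bar> \<le> M0" for x
  proof -
    have "\<bar>\<phi> x\<bar> * \<bar>cut x\<bar> \<le> M0 * 1" using M0'[of x] cb[of x] M0(1) by (intro mult_mono) auto
    then show ?thesis by (simp add: \<psi>_def abs_mult)
  qed
  have h0: "h x = 0" if "x \<notin> cball 0 r" for x
  proof -
    have "exp (real L) * r < exp (real L) * norm x" using that by (intro mult_strict_left_mono) auto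
    then have "exp 1 \<le> norm (exp (real L) *\<^sub>R x)" by (simp add: r_def mult_exp_exp)
    then show ?thesis by (simp add: h_def cut_def cutoff_eq(4))
  qed
  have \<psi>0: "\<psi> x = 0" if "x \<notin> cball 0 R" for x using \<phi>(2)[OF that] by (simp add: \<psi>_def)
  have \<psi>in: "\<psi> x = 0" if "norm x < exp (- real L)" for x
  proof -
    have "exp (real L) * norm x \<le> exp (real L) * exp (- real L)" using that by (intro mult_left_mono) auto
    then have "norm (exp (real L) *\<^sub>R x) \<le> 1" by (simp add: mult_exp_exp)
    then show ?thesis by (simp add: \<psi>_def cut_def cutoff_eq(1))
  qed
  obtain M :: nat where M: "\<bar>R\<bar> \<le> real M" using real_arch_simple by blast
  have \<psi>out: "\<psi> x = 0" if "exp (real M) < norm x" for x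
  proof (rule \<psi>0)
    have "1 + real M \<le> exp (real M)" by (rule exp_ge_add_one_self)
    then have "R < norm x" using that M by linarith
    then show "x \<notin> cball 0 R" by simp
  qed
  have lim: "(\<lambda>n. LINT x|lborel. glued (P (exp (real (k n))) x) / H (real (k n)) * \<psi> x) \<longlonglongrightarrow> (LINT z|lborel. real_of_ereal (w z) * \<psi> z)"
    by (rule glued_limit_annulus[OF k w c\<psi> \<psi>out \<psi>in])
  have split: "(LINT x|lborel. real_of_ereal (q x) * \<phi> x) = (LINT x|lborel. real_of_ereal (q x) * \<psi> x) + (LINT x|lborel. real_of_ereal (q x) * h x)"
    if q: "q \<in> sh_functions" for q
  proof -
    have "(LINT x|lborel. real_of_ereal (q x) * \<psi> x) + (LINT x|lborel. real_of_ereal (q x) * h x) = (LINT x|lborel. real_of_ereal (q x) * \<psi> x + real_of_ereal (q x) * h x)"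
      by (rule Bochner_Integration.integral_add[symmetric, OF sh_integrable_times[OF q m\<psi> \<psi>b \<psi>0] sh_integrable_times[OF q mh hb h0]])
    also have "\<dots> = (LINT x|lborel. real_of_ereal (q x) * \<phi> x)"
      by (intro Bochner_Integration.integral_cong refl) (simp add: \<psi>_def h_def algebra_simps)
    finally show ?thesis by simp
  qed
  have wh: "\<bar>LINT x|lborel. real_of_ereal (w x) * h x\<bar> \<le> M0 * (2 * B1 * (2 * r * c1))"
    unfolding c1_def
  proof (rule sh_small_ball_bound[OF U_sh[OF w(1)] _ B1(1) _ r mh hb h0])
    show "w 0 = 0" using U_class[OF w(1)] by blast
    fix x :: "real^'m" assume "x \<in> ball 0 1"
    then have "norm x powr \<rho> \<le> 1 powr \<rho>" using rho_pos by (intro powr_mono2) auto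
    then have "\<sigma> * norm x powr \<rho> \<le> \<sigma> * 1" using sigma_pos by (intro mult_left_mono) auto
    then show "real_of_ereal (w x) \<le> B1" using U_upper[OF w(1), of x] B1(3) by linarith
  qed
  have veq: "real_of_ereal (v n x) = glued (P (exp (real (k n))) x) / H (real (k n))" for n x by (simp add: v_def)
  have e3: "0 < e / 3" using e by simp
  show "\<forall>\<^sub>F n in sequentially. dist (LINT x|lborel. glued (P (exp (real (k n))) x) / H (real (k n)) * \<phi> x) (LINT z|lborel. real_of_ereal (w z) * \<phi> z) < e"
    using B(2) tendstoD[OF lim e3]
  proof eventually_elim
    case (elim n)
    have vh: "\<bar>LINT x|lborel. real_of_ereal (v n x) * h x\<bar> \<le> M0 * (2 * B1 * (2 * r * c1))"
      unfolding c1_def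
    proof (rule sh_small_ball_bound[OF vsh _ B1(1) _ r mh hb h0])
      show "v n 0 = 0" by (simp add: v_def)
      show "real_of_ereal (v n x) \<le> B1" if "x \<in> ball 0 1" for x
        using elim(1) that B1(2) unfolding veq by fastforce
    qed
    show ?case using elim(2) vh wh L(1) split[OF vsh[of n]] split[OF U_sh[OF w(1)]]
      unfolding veq dist_real_def r_def[symmetric] by linarith
  qed
qed

text \<open>The bounded part \<open>\<theta> n\<close> of the time is moved onto the test function,
  as in \<open>T_conv\<close>, and the ratio of \<open>H\<close> at the times k and k + \<theta>
  supplies the normalising factor of \<open>T \<theta>'\<close>.\<close>

lemma rescale_limit:
  assumes k: "filterlim k at_top sequentially" and w: "w \<in> U" "conv (\<lambda>n. y (k n)) w"
    and \<theta>: "\<theta> \<longlonglongrightarrow> \<theta>'" and \<phi>: "\<phi> \<in> test_functions"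
  shows "(\<lambda>n. pairing (rescale p V (\<lambda>x. ereal (glued x)) (exp (real (k n) + \<theta> n))) \<phi>) \<longlonglongrightarrow> pairing (T \<theta>' w) \<phi>"
proof -
  obtain R where R: "continuous_on UNIV \<phi>" "\<And>x. x \<notin> cball 0 R \<Longrightarrow> \<phi> x = 0" using test_function_props[OF \<phi>] by blast
  define v where "v n x = glued (P (exp (real (k n))) x) / H (real (k n))" for n x
  let ?u = "\<lambda>n. rescale p V (\<lambda>x. ereal (glued x)) (exp (real (k n) + \<theta> n))"
  let ?J = "LINT z|lborel. real_of_ereal (w z) * \<phi> (P (exp (- \<theta>')) z)"
  let ?I = "\<lambda>n. LINT z|lborel. v n z * \<phi> (P (exp (- \<theta> n)) z)"
  have vsh: "(\<lambda>x. ereal (v n x)) \<in> sh_functions" for n unfolding v_def by (rule glued_P_sh) (simp_all add: H_pos)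
  have kr: "filterlim (\<lambda>n. real (k n)) at_top sequentially" by (rule filterlim_compose[OF filterlim_real_sequentially k])
  have mv: "v n \<in> borel_measurable borel" for n using sh_real_measurable[OF vsh[of n]] by simp
  have iv: "integrable lborel (\<lambda>z. indicator (cball 0 Q) z * v n z)" for n Q using sh_integrable_cball[OF vsh[of n], of 0 Q] by simp
  \<comment> \<open>\<open>scaled_upper\<close> gives an upper bound for large n, which
    \<open>sh_L1_bound\<close> turns into an L1 bound; the finitely many remaining n only enlarge
    the constant.\<close>
  have bd: "\<exists>C. \<forall>n. (LINT z|lborel. indicator (cball 0 Q) z * \<bar>v n z\<bar>) \<le> C" for Q
  proof -
    define Q' where "Q' = \<bar>Q\<bar> + 1"
    have Q': "0 < Q'" "cball (0::real^'m) Q \<subseteq> ball 0 Q'" by (auto simp: Q'_def)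
    obtain B where B: "0 \<le> B" "\<forall>\<^sub>F n in sequentially. \<forall>x\<in>ball 0 Q'. glued (P (exp (real (k n))) x) / H (real (k n)) \<le> B"
      using scaled_upper[OF kr Q'(1)] by blast
    have "\<forall>\<^sub>F n in sequentially. (LINT z|lborel. indicator (cball 0 Q) z * \<bar>v n z\<bar>) \<le> 2 * B * measure lborel (ball (0::real^'m) Q')"
      using B(2)
    proof eventually_elim
      case (elim n)
      have i1: "integrable lborel (\<lambda>z. indicator (cball 0 Q) z * \<bar>v n z\<bar>)" using integrable_abs[OF iv[of Q n]] by (simp add: abs_mult)
      have i2: "integrable lborel (\<lambda>z. indicator (ball 0 Q') z * \<bar>v n z\<bar>)"
        using integrable_abs[OF sh_integrable_ball[OF vsh[of n], of 0 Q']] by (simp add: abs_mult)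
      have "(LINT z|lborel. indicator (cball 0 Q) z * \<bar>v n z\<bar>) \<le> (LINT z|lborel. indicator (ball 0 Q') z * \<bar>v n z\<bar>)"
        by (rule integral_mono[OF i1 i2]) (use Q'(2) in \<open>auto simp: indicator_def\<close>)
      also have "\<dots> \<le> 2 * B * measure lborel (ball (0::real^'m) Q')"
        using sh_L1_bound[OF vsh[of n] _ Q'(1) B(1)] elim by (simp add: v_def)
      finally show ?case .
    qed
    then show ?thesis by (rule eventually_bounded_imp_bounded)
  qed
  have cv: "(\<lambda>n. LINT z|lborel. v n z * \<psi> z) \<longlonglongrightarrow> (LINT z|lborel. real_of_ereal (w z) * \<psi> z)" if \<psi>: "\<psi> \<in> test_functions" for \<psi>
  proof -
    obtain Q where "continuous_on UNIV \<psi>" "\<And>x. x \<notin> cball 0 Q \<Longrightarrow> \<psi> x = 0" using test_function_props[OF \<psi>] by blast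
    then show ?thesis unfolding v_def by (rule glued_limit[OF k w])
  qed
  have mt: "(\<lambda>n. - \<theta> n) \<longlonglongrightarrow> - \<theta>'" using \<theta> by (rule tendsto_minus)
  obtain S where S: "0 < S" "\<And>n z. z \<notin> cball 0 S \<Longrightarrow> \<phi> (P (exp (- \<theta> n)) z) = 0" "\<And>z. z \<notin> cball 0 S \<Longrightarrow> \<phi> (P (exp (- \<theta>')) z) = 0"
    "\<And>e. 0 < e \<Longrightarrow> \<forall>\<^sub>F n in sequentially. \<forall>z. \<bar>\<phi> (P (exp (- \<theta> n)) z) - \<phi> (P (exp (- \<theta>')) z)\<bar> \<le> e"
    using P_uniform_limit[OF R mt] by blast
  have c\<phi>: "continuous_on UNIV (\<lambda>z. \<phi> (P (exp s) z))" for s by (rule continuous_P_compose[OF R(1)]) simp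
  have m\<phi>: "\<phi> \<in> borel_measurable borel" by (rule borel_measurable_continuous_onI[OF R(1)])
  have l1: "(\<lambda>n. LINT z|lborel. v n z * \<phi> (P (exp (- \<theta> n)) z)) \<longlonglongrightarrow> ?J"
    by (rule pairing_limit[OF mv iv sh_real_measurable[OF U_sh[OF w(1)]] sh_integrable_cball[OF U_sh[OF w(1)]] bd cv
          borel_measurable_continuous_onI[OF c\<phi>] S(2) c\<phi> S(3,1,4)])
  have "(\<lambda>n. inverse (H (real (k n) + \<theta> n) / H (real (k n)))) \<longlonglongrightarrow> inverse (exp (\<rho> * \<theta>'))"
    by (intro tendsto_inverse H_ratio_limit[OF kr \<theta>]) simp
  then have l2: "(\<lambda>n. H (real (k n)) / H (real (k n) + \<theta> n)) \<longlonglongrightarrow> exp (- \<rho> * \<theta>')" by (simp add: exp_minus)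
  have l3: "(\<lambda>n. H (real (k n)) / H (real (k n) + \<theta> n) * (?I n / exp (\<theta> n) ^ CARD('m)))
    \<longlonglongrightarrow> exp (- \<rho> * \<theta>') * (?J / exp \<theta>' ^ CARD('m))"
    by (intro tendsto_mult l2 tendsto_divide l1 tendsto_power tendsto_exp \<theta>) simp
  have eq: "pairing (?u n) \<phi> =
     H (real (k n)) / H (real (k n) + \<theta> n) * (?I n / exp (\<theta> n) ^ CARD('m))" for n
  proof -
    define c where "c = H (real (k n)) / H (real (k n) + \<theta> n)"
    have vP: "glued (P (exp (real (k n) + \<theta> n)) x) / H (real (k n) + \<theta> n) = c * v n (P (exp (\<theta> n)) x)" for x
    proof -
      have "P (exp (real (k n))) (P (exp (\<theta> n)) x) = P (exp (real (k n) + \<theta> n)) x" by (simp add: P_P mult_exp_exp)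
      then show ?thesis using H_pos[of "real (k n)"] by (simp add: v_def c_def)
    qed
    have mvp: "(\<lambda>z. v n z * \<phi> (P (exp (- \<theta> n)) z)) \<in> borel_measurable borel"
      by (intro borel_measurable_times mv borel_measurable_continuous_onI c\<phi>)
    have "pairing (?u n) \<phi>
      = (LINT x|lborel. c * (v n (P (exp (\<theta> n)) x) * \<phi> (P (exp (- \<theta> n)) (P (exp (\<theta> n)) x))))"
      unfolding pairing_def rescale_glued[OF exp_gt_zero] P_inv by (simp add: vP mult.assoc)
    also have "\<dots> = c * (LINT x|lborel. v n (P (exp (\<theta> n)) x) * \<phi> (P (exp (- \<theta> n)) (P (exp (\<theta> n)) x)))" by simp
    also have "(LINT x|lborel. v n (P (exp (\<theta> n)) x) * \<phi> (P (exp (- \<theta> n)) (P (exp (\<theta> n)) x))) = ?I n / exp (\<theta> n) ^ CARD('m)"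
      by (rule integral_P(1)[OF exp_gt_zero mvp])
    finally show ?thesis unfolding c_def .
  qed
  have "pairing (T \<theta>' w) \<phi> = exp (- \<rho> * \<theta>') * (?J / exp \<theta>' ^ CARD('m))"
    unfolding pairing_def T_integral[OF w(1) m\<phi>] by simp
  then show ?thesis using l3 unfolding eq by simp
qed

lemma rescale_sh: "0 < t \<Longrightarrow> rescale p V (\<lambda>x. ereal (glued x)) t \<in> sh_functions"
  unfolding rescale_glued by (rule glued_P_sh) (simp_all add: H_pos)

text \<open>For one inclusion ln t is split into an integer and a phase in [0, 1]; compactness gives
  a subsequence along which the rescalings tend to some \<open>T l w\<close>, which lies in
  \<open>U\<close> and must be the given limit. For the other, if \<open>y (k n)\<close> tends to
  \<open>T \<theta> v\<close>, then the rescalings at \<open>exp (k n - \<theta>)\<close> tend to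
  v.\<close>

lemma Fr_glued:
  assumes recur: "\<And>v. v \<in> U \<Longrightarrow> \<exists>k \<theta>. filterlim k at_top sequentially \<and> conv (\<lambda>n. y (k n)) (T \<theta> v)"
  shows "Fr (\<lambda>x. ereal (glued x)) p V = U"
proof (intro equalityI subsetI)
  fix v assume "v \<in> Fr (\<lambda>x. ereal (glued x)) p V"
  then obtain t :: "nat \<Rightarrow> real" where v: "v \<in> sh_functions" and t: "\<And>n. 0 < t n" "filterlim t at_top sequentially"
    and lim: "\<And>\<phi>. \<phi> \<in> test_functions \<Longrightarrow> (\<lambda>n. pairing (rescale p V (\<lambda>x. ereal (glued x)) (t n)) \<phi>) \<longlonglongrightarrow> pairing v \<phi>"
    unfolding Fr_def limitin_distr_topology by blast
  define s where "s n = ln (t n)" for n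
  have s: "filterlim s at_top sequentially" unfolding s_def by (rule filterlim_compose[OF ln_at_top t(2)])
  have "\<forall>\<^sub>F n in sequentially. 0 \<le> s n" using s unfolding filterlim_at_top by blast
  \<comment> \<open>The shift by n0 makes the logarithms nonnegative, so that \<open>nat\<close>
    does not truncate their integer parts.\<close>
  then obtain n0 where n0: "\<And>n. n0 \<le> n \<Longrightarrow> 0 \<le> s n" by (auto simp: eventually_sequentially)
  define k where "k n = nat \<lfloor>s (n + n0)\<rfloor>" for n
  define \<theta> where "\<theta> n = s (n + n0) - real (k n)" for n
  have kf: "real (k n) = real_of_int \<lfloor>s (n + n0)\<rfloor>" for n using n0[of "n + n0"] by (simp add: k_def)
  have \<theta>01: "\<theta> n \<in> {0..1}" for n unfolding \<theta>_def kf by (simp, linarith)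
  obtain w l r where r: "w \<in> U" "l \<in> {0..1}" "strict_mono (r :: nat \<Rightarrow> nat)" "conv (\<lambda>n. y (k (r n))) w" "(\<lambda>n. \<theta> (r n)) \<longlonglongrightarrow> l"
    by (rule U_seq_compact_param[of "\<lambda>n. y (k n)" "{0..1}" \<theta>, OF y_U compact_Icc \<theta>01])
  have sn0: "filterlim (\<lambda>n. s (n + n0)) at_top sequentially" by (rule filterlim_compose[OF s filterlim_add_const_nat_at_top])
  have k: "filterlim k at_top sequentially"
    unfolding filterlim_at_top
  proof
    fix Z
    have "\<forall>\<^sub>F n in sequentially. real Z \<le> s (n + n0)" using sn0 unfolding filterlim_at_top by blast
    then show "\<forall>\<^sub>F n in sequentially. Z \<le> k n"
    proof eventually_elim
      case (elim n)
      then have "int Z \<le> \<lfloor>s (n + n0)\<rfloor>" by (simp add: le_floor_iff)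
      then show ?case by (simp add: k_def)
    qed
  qed
  have kr: "filterlim (\<lambda>n. k (r n)) at_top sequentially" by (rule filterlim_compose[OF k filterlim_subseq[OF r(3)]])
  have ex: "exp (real (k n) + \<theta> n) = t (n + n0)" for n using t(1)[of "n + n0"] by (simp add: \<theta>_def s_def)
  have "v = T l w"
  proof (rule sh_eq_if_pairing_eq[OF v U_sh[OF T_U[OF r(1)]]])
    fix \<phi> :: "real^'m \<Rightarrow> real" assume \<phi>: "\<phi> \<in> test_functions"
    have 1: "(\<lambda>n. pairing (rescale p V (\<lambda>x. ereal (glued x)) (t (r n + n0))) \<phi>) \<longlonglongrightarrow> pairing (T l w) \<phi>"
      using rescale_limit[OF kr r(1,4,5) \<phi>] unfolding ex .
    have "filterlim (\<lambda>n. r n + n0) sequentially sequentially" by (rule filterlim_add_nat[OF filterlim_subseq[OF r(3)]])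
    from filterlim_compose[OF lim[OF \<phi>] this]
    have 2: "(\<lambda>n. pairing (rescale p V (\<lambda>x. ereal (glued x)) (t (r n + n0))) \<phi>) \<longlonglongrightarrow> pairing v \<phi>" .
    show "pairing v \<phi> = pairing (T l w) \<phi>" by (rule LIMSEQ_unique[OF 2 1])
  qed
  then show "v \<in> U" using T_U[OF r(1)] by simp
next
  fix v assume v: "v \<in> U"
  obtain k \<theta> where k: "filterlim k at_top sequentially" "conv (\<lambda>n. y (k n)) (T \<theta> v)" using recur[OF v] by blast
  define t where "t n = exp (real (k n) + - \<theta>)" for n
  have kr: "filterlim (\<lambda>n. real (k n)) at_top sequentially" by (rule filterlim_compose[OF filterlim_real_sequentially k(1)])
  have "filterlim (\<lambda>n. - \<theta> + real (k n)) at_top sequentially" by (rule filterlim_tendsto_add_at_top[OF tendsto_const kr])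
  then have "filterlim (\<lambda>n. real (k n) + - \<theta>) at_top sequentially" by (simp only: add.commute)
  then have t: "filterlim t at_top sequentially" unfolding t_def by (rule filterlim_compose[OF exp_at_top])
  have tp: "0 < t n" for n by (simp add: t_def)
  have "(\<lambda>n. pairing (rescale p V (\<lambda>x. ereal (glued x)) (t n)) \<phi>) \<longlonglongrightarrow> pairing v \<phi>" if \<phi>: "\<phi> \<in> test_functions" for \<phi>
    using rescale_limit[OF k(1) T_U[OF v] k(2) tendsto_const[of "- \<theta>"] \<phi>] by (simp add: T_T t_def)
  then have "limitin distr_topology (\<lambda>n. rescale p V (\<lambda>x. ereal (glued x)) (t n)) v sequentially"
    unfolding limitin_distr_topology using U_sh[OF v] rescale_sh[OF tp] by (simp add: always_eventually)
  then show "v \<in> Fr (\<lambda>x. ereal (glued x)) p V" unfolding Fr_def using U_sh[OF v] tp t by blast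
qed

end

section \<open>Choice of the data for a given proximate order\<close>

theorem theorem4p2p1p2:
  fixes \<rho> \<sigma> :: real
    and V :: "real \<Rightarrow> real^'m^'m"
    and U :: "(real^'m \<Rightarrow> ereal) set"
    and d :: "(real^'m \<Rightarrow> ereal) \<Rightarrow> (real^'m \<Rightarrow> ereal) \<Rightarrow> real"
  assumes "CARD('m) \<ge> 2"
    and "0 < \<rho>" and "0 < \<sigma>"
    and "rotation_group V"
    and "U \<noteq> {}"
    and "U \<subseteq> U_class \<rho> \<sigma>"
    and "compactin distr_topology U"
    and "connectedin distr_topology U"
    and "T_invariant (T_map \<rho> V) U"
    and "Metric_space U d"
    and "Metric_space.mtopology U d = subtopology distr_topology U"
    and "chain_recurrent d (T_map \<rho> V) U"
  shows "\<forall>p. proximate_order \<rho> p \<longrightarrow> (\<exists>u \<in> SH p. Fr u p V = U)"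
proof (intro allI impI)
  fix p assume p: "proximate_order \<rho> p"
  interpret limit_system \<rho> \<sigma> V U d by (intro limit_system.intro assms)
  obtain H h s0 where H: "\<And>s. H s = exp s powr p (exp s)" "\<And>s. 0 < H s"
    "\<And>s. (H has_real_derivative H s * h s) (at s)" "(h \<longlongrightarrow> \<rho>) at_top"
    "\<And>s. s0 \<le> s \<Longrightarrow> \<rho> / 2 \<le> h s" "continuous_on UNIV H" "filterlim H at_top at_top"
    "\<And>s t. s0 \<le> s \<Longrightarrow> s \<le> t \<Longrightarrow> H s \<le> H t"
    "\<And>e L. 0 < e \<Longrightarrow> \<forall>\<^sub>F s in at_top. \<forall>t. \<bar>t\<bar> \<le> L \<longrightarrow> \<bar>ln (H (s + t)) - ln (H s) - \<rho> * t\<bar> \<le> e * L"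
    by (rule proximate_order_growth[OF p assms(2)]) blast
  \<comment> \<open>Slow variation with the increment 1 yields the limit of the ratios that
    \<open>pseudo_orbit_errors\<close> requires of the weights.\<close>
  have "(\<lambda>k. ln (H (real k + 1)) - ln (H (real k)) - \<rho>) \<longlonglongrightarrow> 0"
    unfolding tendsto_iff
  proof (intro allI impI)
    fix e :: real assume e: "0 < e"
    have "\<forall>\<^sub>F k in sequentially. \<forall>t. \<bar>t\<bar> \<le> 1 \<longrightarrow> \<bar>ln (H (real k + t)) - ln (H (real k)) - \<rho> * t\<bar> \<le> e / 2 * 1"
      by (rule eventually_compose_filterlim[OF H(9)[of "e / 2" 1] filterlim_real_sequentially]) (use e in simp)
    then show "\<forall>\<^sub>F k in sequentially. dist (ln (H (real k + 1)) - ln (H (real k)) - \<rho>) 0 < e"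
    proof eventually_elim
      case (elim k)
      from elim[rule_format, of 1] show ?case using e by (simp add: dist_real_def)
    qed
  qed
  then have "(\<lambda>k. exp (- (ln (H (real k + 1)) - ln (H (real k)) - \<rho>))) \<longlonglongrightarrow> exp (- 0)" by (intro tendsto_intros)
  moreover have "exp (- (ln (H (real k + 1)) - ln (H (real k)) - \<rho>)) = H (real k) * exp \<rho> / H (real (Suc k))" for k
  proof -
    have "exp (- (ln (H (real k + 1)) - ln (H (real k)) - \<rho>)) = exp (ln (H (real k)) + \<rho> - ln (H (real k + 1)))" by (simp add: algebra_simps)
    then show ?thesis using H(2) by (simp add: exp_add exp_diff add.commute)
  qed
  ultimately have ratio: "(\<lambda>k. H (real k) * exp \<rho> / H (real (Suc k))) \<longlonglongrightarrow> 1" by simp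
  obtain y \<mu> \<epsilon> where y: "\<And>k. y k \<in> U" and \<mu>: "\<And>k. 0 < \<mu> k \<and> \<mu> k \<le> 1/2" "\<mu> \<longlonglongrightarrow> 0"
    and step: "(\<lambda>k. d (T 1 (y k)) (y (Suc k))) \<longlonglongrightarrow> 0" and \<epsilon>: "\<And>k. 0 \<le> \<epsilon> k" "\<epsilon> \<longlonglongrightarrow> 0"
    and e0: "\<And>\<xi>. \<xi> \<in> shell \<Longrightarrow> - \<epsilon> 0 * H (real 0) \<le> H (real 0) * trans_int (y 0) (\<mu> 0) \<xi>"
    and eS: "\<And>k \<xi>. \<xi> \<in> shell \<Longrightarrow> - \<epsilon> (Suc k) * H (real (Suc k)) \<le>
        H (real (Suc k)) * trans_int (y (Suc k)) (\<mu> (Suc k)) \<xi> - H (real k) * exp \<rho> * trans_int (T 1 (y k)) (\<mu> k) \<xi>"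
    and recur: "\<And>v. v \<in> U \<Longrightarrow> \<exists>k \<theta>. filterlim k at_top sequentially \<and> conv (\<lambda>n. y (k n)) (T \<theta> v)"
    using pseudo_orbit_errors[of "\<lambda>k. H (real k)", OF H(2) ratio] by blast
  have mono: "\<forall>\<^sub>F s in at_top. \<forall>t\<ge>s. H s \<le> H t"
    unfolding eventually_at_top_linorder using H(8) by blast
  interpret azarin_construction \<rho> \<sigma> V U d p H y \<mu> \<epsilon>
    by unfold_locales (use H(1,2,7,9) mono y \<mu> step \<epsilon> e0 eS in blast)+
  show "\<exists>u \<in> SH p. Fr u p V = U" using glued_SH Fr_glued[OF recur] by blast
qed

end
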